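(* Let $d\ge 2$ and $\lambda=(\lambda_1,\dots,\lambda_d)\in V_d$. Then the number of (distinct) elements of the set $\widehat{\Phi}_d^{-1}(\bar\lambda)$ is $$\#\left(\widehat{\Phi}_d^{-1}(\bar\lambda)\right) = \frac{\sum_{\mathbb{I}\in\mathfrak{I}'(\lambda)}\left(\{-(d-1)\}^{\#\mathbb{I}-1}\cdot\prod_{I\in\mathbb{I}}(\#I-1)!\right)}{\prod_{K\in\mathfrak{K}(\lambda)}(\#K)!}.$$
   Context: $\#X$ denotes the cardinality of a set $X$. For $d\ge 2$ let $V_d := \{(\lambda_1,\dots,\lambda_d)\in\mathbb{C}^d \mid \lambda_i\neq 1 \text{ for all } i,\ \sum_{i=1}^d \frac{1}{1-\lambda_i}=0\}$. $\mathrm{MC}_d$ is the set of monic centered polynomials $f(z)=z^d+\sum_{k=0}^{d-2}a_kz^k$ with $a_k\in\mathbb{C}$. The map $\widehat{\Phi}_d$ sends $f\in\mathrm{MC}_d$ to the unordered collection (multiset) $\{f'(\zeta)\}_\zeta$ in $\mathbb{C}^d/\mathfrak{S}_d$, where $\zeta$ runs over the $d$ fixed points of $f$ counted with multiplicity. $\bar\lambda$ denotes the class of $\lambda$ in $\mathbb{C}^d/\mathfrak{S}_d$, i.e. the multiset $\{\lambda_1,\dots,\lambda_d\}$. The fiber $\widehat{\Phi}_d^{-1}(\bar\lambda)$ is regarded as a set (not counted with multiplicity). For $\lambda\in V_d$, $\mathfrak{I}'(\lambda)$ is the set of all partitions $\mathbb{I}=\{I_1,\dots,I_l\}$ ($l\ge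 1$) of $\{1,\dots,d\}$ into nonempty disjoint subsets such that $\sum_{i\in I_u}\frac{1}{1-\lambda_i}=0$ for every $1\le u\le l$; it always contains the one-block partition $\{\{1,\dots,d\}\}$. For $\lambda\in V_d$, $\mathfrak{K}(\lambda)$ is the partition of $\{1,\dots,d\}$ into the equivalence classes of the relation $i\sim j\iff\lambda_i=\lambda_j$. *)

theory Defs
  imports
    "HOL-Analysis.Analysis"
    "HOL-Computational_Algebra.Computational_Algebra"
    "HOL-Library.Disjoint_Sets"
begin

(* A vector in C^d is a function nat => complex of which only the values on {1..d} matter. *)

definition V :: "nat \<Rightarrow> (nat \<Rightarrow> complex) set" where
  "V d = {lam. (\<forall>i\<in>{1..d}. lam i \<noteq> 1) \<and> (\<Sum>i\<in>{1..d}. 1 / (1 - lam i)) = 0}"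

definition MC :: "nat \<Rightarrow> complex poly set" where
  "MC d = {monom 1 d + (\<Sum>k\<in>{0..d-2}. monom (a k) k) | a. True}"

(* proots counts roots with multiplicity, so this is the multiset of fixed points of f. *)
definition fixed_points :: "complex poly \<Rightarrow> complex multiset" where
  "fixed_points f = proots (f - [:0, 1:])"

definition Phi_hat :: "complex poly \<Rightarrow> complex multiset" where
  "Phi_hat f = image_mset (poly (pderiv f)) (fixed_points f)"

(* The class of lam modulo permutation of the coordinates. *)
definition mset_class :: "nat \<Rightarrow> (nat \<Rightarrow> complex) \<Rightarrow> complex multiset" where
  "mset_class d lam = image_mset lam (mset_set {1..d})"

definition fiber :: "nat \<Rightarrow> complex multiset \<Rightarrow> complex poly set" where
  "fiber d M = {f \<in> MC d. Phi_hat f = M}"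

definition II' :: "nat \<Rightarrow> (nat \<Rightarrow> complex) \<Rightarrow> nat set set set" where
  "II' d lam = {P. partition_on {1..d} P \<and> (\<forall>I\<in>P. (\<Sum>i\<in>I. 1 / (1 - lam i)) = 0)}"

definition KK :: "nat \<Rightarrow> (nat \<Rightarrow> complex) \<Rightarrow> nat set set" where
  "KK d lam = {1..d} // {(i, j). i \<in> {1..d} \<and> j \<in> {1..d} \<and> lam i = lam j}"

end

theory Submission
  imports Defs "HOL-Complex_Analysis.Complex_Analysis" "HOL-Library.Disjoint_Sets"
begin

text \<open>A polynomial f of the family is z plus the product of the (z - w_i) over its d labelled
  fixed points, so f'(w_i) - 1 is the product of the w_i - w_j over j distinct from i
  (\<open>diffprod\<close>). With m_i = 1/(lam_i - 1), the labelled fixed points of the elements of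
  the fiber are, up to a common translation, exactly the centered solutions of m_i * diffprod_i = 1,
  the set \<open>sols\<close>. The derivative at a fixed point differs from 1, so the fixed points
  are simple and every f is labelled compatibly with lam in exactly prod (#K)! ways
  (\<open>card_sols_fiber\<close>). It remains to count \<open>sols S m\<close> for a zero-sum
  vector m without zero entries.

  The count rests on a deformation. Replace m by m + t r with t -> 0+. Solutions stay bounded
  (\<open>seq_bounded\<close>), and they gather in clusters that form a partition P of S into blocks
  B on which m sums to zero. A cluster of s points has size t^(1/(s-1))
  (\<open>cluster_bounded\<close>). After rescaling, each cluster has a shape in
  \<open>sols B m\<close>, and the cluster centers solve a residue problem \<open>glob\<close>: the
  product of the (z - eta_B)^(-#B) must have residue sum_B r at eta_B. Conversely every such limit
  continues to exactly one solution for small t, by an implicit function theorem for strictly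
  differentiable maps. The differential there is injective by \<open>equal_residues\<close>: a
  rational function that decays at infinity and has equal residues has residues zero, hence a
  rational primitive, and a Wronskian degree count leaves no room for a nonzero numerator of low
  degree. Hence, for small t, #sols(m + t r) is the sum over zero-sum partitions P of #glob(P) *
  prod_B #sols(B, m).

  If no proper nonempty subset sums to zero, only the one-block partition occurs, so the count is
  locally constant along nonresonant paths. A path to the explicit vector \<open>star\<close>, whose
  solutions are given by roots of unity, shows that it is (d-1)! (\<open>card_sols_star\<close>,
  \<open>card_sols_nonresonant\<close>). Taking r = \<open>star\<close> for arbitrary m gives the
  relation (d-1)! = sum_P #glob(P) * prod_B #sols(B, m) (\<open>zsp_relation\<close>). The number
  #glob(P) is found by applying this relation to a special m for which all other factors are known:
  d * #glob(P) is the falling factorial of d of length #P (\<open>card_glob_star\<close>).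

  Thus d! = sum_P d(d-1)...(d-#P+1) * prod_B #sols(B, m), which determines #sols by induction on the
  set. The claimed numerator satisfies the same relation. For set functions under subset
  convolution, the right-hand side is a d-th power, and the Abel-Hurwitz identities
  (\<open>hurwitz_identity\<close>, \<open>hurwitz_convolution\<close>) show that powers of the
  numerator are obtained by changing the parameter 1 to c in c * (c - #S)^(#Q - 1). At c = d only
  the one-block partition survives, with value d * (d-1)! (\<open>block_sum_hz_sum\<close>,
  \<open>hz_sum_full\<close>, \<open>card_sols\<close>).\<close>

section \<open>Rational functions with equal residues\<close>

lemma partial_fractions:
  fixes \<eta> :: "'a \<Rightarrow> complex" and X :: "complex poly"
  assumes "finite U" "inj_on \<eta> U" "degree X < (\<Sum>u\<in>U. e u)"
  shows "\<exists>b. X = (\<Sum>u\<in>U. \<Sum>k\<in>{1..e u}. smult (b u k)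
           ((\<Prod>v\<in>U - {u}. [:- \<eta> v, 1:] ^ e v) * [:- \<eta> u, 1:] ^ (e u - k)))"
  using assms(3)
proof (induction "\<Sum>u\<in>U. e u" arbitrary: e X)
  case 0
  then show ?case by simp
next
  case (Suc n)
  have "(\<Sum>u\<in>U. e u) \<noteq> 0" using Suc.hyps(2) by simp
  then obtain u where u: "u \<in> U" "e u \<noteq> 0" by (meson sum.neutral)
  define H where "H = (\<Prod>v\<in>U - {u}. [:- \<eta> v, 1:] ^ e v)"
  have H0: "poly H (\<eta> u) \<noteq> 0"
    using u assms by (auto simp: H_def poly_prod inj_on_def)
  have degH: "degree H = (\<Sum>v\<in>U-{u}. e v)"
    unfolding H_def by (subst degree_prod_eq_sum_degree) (auto simp: degree_power_eq)
  have sumsplit: "(\<Sum>v\<in>U. e v) = e u + (\<Sum>v\<in>U-{u}. e v)"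
    using u assms(1) by (simp add: sum.remove)
  \<comment> \<open>The coefficient of the pole of top order \<open>e u\<close>: after subtracting
    it the numerator vanishes at \<open>\<eta> u\<close> and one linear factor cancels.\<close>
  define b0 where "b0 = poly X (\<eta> u) / poly H (\<eta> u)"
  define e' where "e' = e(u := e u - 1)"
  have e'sum: "n = (\<Sum>v\<in>U. e' v)"
  proof -
    have "(\<Sum>v\<in>U. e' v) = e' u + (\<Sum>v\<in>U-{u}. e' v)"
      using u assms(1) by (simp add: sum.remove)
    also have "(\<Sum>v\<in>U-{u}. e' v) = (\<Sum>v\<in>U-{u}. e v)"
      by (intro sum.cong) (auto simp: e'_def)
    finally show ?thesis using sumsplit Suc.hyps(2) u(2) by (simp add: e'_def)
  qed
  have "poly (X - smult b0 H) (\<eta> u) = 0" using H0 by (simp add: b0_def)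
  then obtain X1 where X1: "X - smult b0 H = [:- \<eta> u, 1:] * X1"
    unfolding poly_eq_0_iff_dvd by (elim dvdE)
  have Xeq: "X = [:- \<eta> u, 1:] * X1 + smult b0 H" using X1 by (simp add: algebra_simps)
  show ?case
  proof (cases "X1 = 0")
    case True
    have "X = (\<Sum>u'\<in>U. \<Sum>k\<in>{1..e u'}. smult (if u' = u \<and> k = e u then b0 else 0)
           ((\<Prod>v\<in>U - {u'}. [:- \<eta> v, 1:] ^ e v) * [:- \<eta> u', 1:] ^ (e u' - k)))"
    proof -
      have "(\<Sum>u'\<in>U. \<Sum>k\<in>{1..e u'}. smult (if u' = u \<and> k = e u then b0 else 0)
           ((\<Prod>v\<in>U - {u'}. [:- \<eta> v, 1:] ^ e v) * [:- \<eta> u', 1:] ^ (e u' - k)))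
        = (\<Sum>u'\<in>U. if u' = u then smult b0 H else 0)"
      proof (intro sum.cong refl)
        fix u' assume "u' \<in> U"
        show "(\<Sum>k\<in>{1..e u'}. smult (if u' = u \<and> k = e u then b0 else 0)
           ((\<Prod>v\<in>U - {u'}. [:- \<eta> v, 1:] ^ e v) * [:- \<eta> u', 1:] ^ (e u' - k)))
           = (if u' = u then smult b0 H else 0)"
        proof (cases "u' = u")
          case True
          have "(\<Sum>k\<in>{1..e u}. smult (if k = e u then b0 else 0) (H * [:- \<eta> u, 1:] ^ (e u - k)))
             = (\<Sum>k\<in>{1..e u}. if k = e u then smult b0 H else 0)"
            by (intro sum.cong) auto
          also have "\<dots> = smult b0 H" using u(2) by simp
          finally show ?thesis using True by (simp add: H_def)
        qed simp
      qed
      also have "\<dots> = smult b0 H" using u(1) assms(1) by simp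
      finally show ?thesis using Xeq True by simp
    qed
    then show ?thesis by (intro exI[of _ "\<lambda>u' k. if u' = u \<and> k = e u then b0 else 0"])
  next
    case False
    have "degree ([:- \<eta> u, 1:] * X1) < (\<Sum>u\<in>U. e u)"
    proof -
      have "degree (X - smult b0 H) \<le> max (degree X) (degree H)"
        by (meson degree_diff_le_max degree_smult_le order.trans max.mono order_refl)
      also have "\<dots> < (\<Sum>u\<in>U. e u)" using Suc.prems degH sumsplit u(2) by auto
      finally show ?thesis using X1 by simp
    qed
    moreover have "degree ([:- \<eta> u, 1:] * X1) = Suc (degree X1)"
      using False by (subst degree_mult_eq) auto
    ultimately have "degree X1 < (\<Sum>u\<in>U. e' u)" using Suc.hyps(2) e'sum by simp
    from Suc.hyps(1)[OF e'sum this] obtain b where b: "X1 = (\<Sum>u\<in>U. \<Sum>k\<in>{1..e' u}. smult (b u k)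
           ((\<Prod>v\<in>U - {u}. [:- \<eta> v, 1:] ^ e' v) * [:- \<eta> u, 1:] ^ (e' u - k)))" by blast
    define b' where "b' = (\<lambda>u' k. if u' = u \<and> k = e u then b0 else b u' k)"
    have rest: "(\<Sum>k\<in>{1..e' u'}. [:- \<eta> u, 1:] * smult (b u' k)
           ((\<Prod>v\<in>U - {u'}. [:- \<eta> v, 1:] ^ e' v) * [:- \<eta> u', 1:] ^ (e' u' - k)))
         = (\<Sum>k\<in>{1..e u'}. smult (b' u' k)
           ((\<Prod>v\<in>U - {u'}. [:- \<eta> v, 1:] ^ e v) * [:- \<eta> u', 1:] ^ (e u' - k)))"
      if "u' \<in> U" "u' \<noteq> u" for u'
    proof (intro sum.cong)
      show "{1..e' u'} = {1..e u'}" using that by (simp add: e'_def)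
      fix k
      have "(\<Prod>v\<in>U - {u'}. [:- \<eta> v, 1:] ^ e v) = [:- \<eta> u, 1:] ^ e u * (\<Prod>v\<in>U - {u'} - {u}. [:- \<eta> v, 1:] ^ e v)"
        using that u assms(1) by (subst prod.remove[of _ u]) auto
      moreover have "(\<Prod>v\<in>U - {u'}. [:- \<eta> v, 1:] ^ e' v) = [:- \<eta> u, 1:] ^ e' u * (\<Prod>v\<in>U - {u'} - {u}. [:- \<eta> v, 1:] ^ e' v)"
        using that u assms(1) by (subst prod.remove[of _ u]) auto
      moreover have "(\<Prod>v\<in>U - {u'} - {u}. [:- \<eta> v, 1:] ^ e' v) = (\<Prod>v\<in>U - {u'} - {u}. [:- \<eta> v, 1:] ^ e v)"
        by (intro prod.cong) (auto simp: e'_def)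
      moreover have "[:- \<eta> u, 1:] ^ e u = [:- \<eta> u, 1:] * [:- \<eta> u, 1:] ^ e' u"
        using u(2) by (cases "e u") (auto simp: e'_def)
      ultimately show "[:- \<eta> u, 1:] * smult (b u' k)
           ((\<Prod>v\<in>U - {u'}. [:- \<eta> v, 1:] ^ e' v) * [:- \<eta> u', 1:] ^ (e' u' - k)) = smult (b' u' k)
           ((\<Prod>v\<in>U - {u'}. [:- \<eta> v, 1:] ^ e v) * [:- \<eta> u', 1:] ^ (e u' - k))"
        using that by (simp add: b'_def e'_def mult.assoc del: mult_pCons_left mult_pCons_right)
    qed
    have main: "(\<Sum>k\<in>{1..e' u}. [:- \<eta> u, 1:] * smult (b u k)
           ((\<Prod>v\<in>U - {u}. [:- \<eta> v, 1:] ^ e' v) * [:- \<eta> u, 1:] ^ (e' u - k))) + smult b0 H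
         = (\<Sum>k\<in>{1..e u}. smult (b' u k)
           ((\<Prod>v\<in>U - {u}. [:- \<eta> v, 1:] ^ e v) * [:- \<eta> u, 1:] ^ (e u - k)))"
    proof -
      have HH: "(\<Prod>v\<in>U - {u}. [:- \<eta> v, 1:] ^ e' v) = H"
        unfolding H_def by (intro prod.cong) (auto simp: e'_def)
      have "{1..e u} = insert (e u) {1..e' u}" using u(2) by (auto simp: e'_def)
      then have "(\<Sum>k\<in>{1..e u}. smult (b' u k) (H * [:- \<eta> u, 1:] ^ (e u - k)))
        = smult (b' u (e u)) (H * [:- \<eta> u, 1:] ^ (e u - e u)) + (\<Sum>k\<in>{1..e' u}. smult (b' u k) (H * [:- \<eta> u, 1:] ^ (e u - k)))"
        using u(2) by (simp add: e'_def)
      also have "(\<Sum>k\<in>{1..e' u}. smult (b' u k) (H * [:- \<eta> u, 1:] ^ (e u - k)))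
        = (\<Sum>k\<in>{1..e' u}. [:- \<eta> u, 1:] * smult (b u k) (H * [:- \<eta> u, 1:] ^ (e' u - k)))"
      proof (intro sum.cong refl)
        fix k assume k: "k \<in> {1..e' u}"
        then have "e u - k = Suc (e' u - k)" "k \<noteq> e u" using u(2) by (auto simp: e'_def)
        then show "smult (b' u k) (H * [:- \<eta> u, 1:] ^ (e u - k)) = [:- \<eta> u, 1:] * smult (b u k) (H * [:- \<eta> u, 1:] ^ (e' u - k))"
          using k u(2) by (simp add: b'_def e'_def mult.left_commute del: mult_pCons_left mult_pCons_right)
      qed
      finally show ?thesis unfolding HH H_def[symmetric] by (simp add: b'_def)
    qed
    have "X = (\<Sum>u'\<in>U. \<Sum>k\<in>{1..e' u'}. [:- \<eta> u, 1:] * smult (b u' k)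
           ((\<Prod>v\<in>U - {u'}. [:- \<eta> v, 1:] ^ e' v) * [:- \<eta> u', 1:] ^ (e' u' - k))) + smult b0 H"
      unfolding Xeq by (subst b) (simp only: sum_distrib_left)
    also have "\<dots> = (\<Sum>u'\<in>U-{u}. \<Sum>k\<in>{1..e' u'}. [:- \<eta> u, 1:] * smult (b u' k)
           ((\<Prod>v\<in>U - {u'}. [:- \<eta> v, 1:] ^ e' v) * [:- \<eta> u', 1:] ^ (e' u' - k))) + 
         ((\<Sum>k\<in>{1..e' u}. [:- \<eta> u, 1:] * smult (b u k)
           ((\<Prod>v\<in>U - {u}. [:- \<eta> v, 1:] ^ e' v) * [:- \<eta> u, 1:] ^ (e' u - k))) + smult b0 H)"
      using u(1) assms(1) by (subst sum.remove[of U u]) (auto simp only: add_ac)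
    also have "\<dots> = (\<Sum>u'\<in>U. \<Sum>k\<in>{1..e u'}. smult (b' u' k)
           ((\<Prod>v\<in>U - {u'}. [:- \<eta> v, 1:] ^ e v) * [:- \<eta> u', 1:] ^ (e u' - k)))"
      unfolding main using rest sum.remove[OF assms(1) u(1), of "\<lambda>u'. \<Sum>k\<in>{1..e u'}. smult (b' u' k)
           ((\<Prod>v\<in>U - {u'}. [:- \<eta> v, 1:] ^ e v) * [:- \<eta> u', 1:] ^ (e u' - k))"]
      by (simp add: add.commute del: mult_pCons_left mult_pCons_right)
    finally show ?thesis by blast
  qed
qed

text \<open>Polynomials of different degrees have a Wronskian of exact degree
  \<open>degree p + degree q - 1\<close>; every degree contradiction below comes from this.\<close>

lemma coeff_wronskian:
  fixes p q :: "complex poly"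
  assumes "p \<noteq> 0" "q \<noteq> 0" "degree p + degree q = Suc n"
  shows "coeff (pderiv p * q - p * pderiv q) n
    = (of_nat (degree p) - of_nat (degree q)) * (lead_coeff p * lead_coeff q)"
proof -
  have *: "coeff (pderiv p * q) n = of_nat (degree p) * (lead_coeff p * lead_coeff q)"
    if "degree p + degree q = Suc n" "q \<noteq> 0" for p q :: "complex poly"
  proof (cases "degree p")
    case 0
    then have "pderiv p = 0" by (simp add: pderiv_eq_0_iff)
    then show ?thesis using 0 by simp
  next
    case (Suc k)
    then have d: "degree (pderiv p) = k" by (simp add: degree_pderiv)
    then have "n = degree (pderiv p) + degree q" using that Suc by simp
    then have "coeff (pderiv p * q) n = coeff (pderiv p) k * lead_coeff q"
      using coeff_mult_degree_sum[of "pderiv p" q] d by simp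
    then show ?thesis using Suc by (simp add: coeff_pderiv)
  qed
  have "coeff (p * pderiv q) n = of_nat (degree q) * (lead_coeff q * lead_coeff p)"
    using *[of q p] assms by (simp add: mult.commute)
  with *[of p q] assms show ?thesis by (simp add: algebra_simps)
qed

lemma residue_sum:
  assumes "finite A" "open s" "z \<in> s" "\<And>a. a \<in> A \<Longrightarrow> f a holomorphic_on s - {z}"
  shows "residue (\<lambda>w. \<Sum>a\<in>A. f a w) z = (\<Sum>a\<in>A. residue (f a) z)"
  using assms(1,4)
proof (induction A rule: finite_induct)
  case empty
  then show ?case by (simp add: residue_const)
next
  case (insert x F)
  have "residue (\<lambda>w. f x w + (\<Sum>a\<in>F. f a w)) z = residue (f x) z + residue (\<lambda>w. \<Sum>a\<in>F. f a w) z"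
    by (rule residue_add[OF assms(2,3)]) (auto intro!: holomorphic_intros insert)
  then show ?case using insert by simp
qed

lemma residue_inverse_power:
  "residue (\<lambda>z. c / (z - a) ^ k) a = (if k = 1 then c else 0)"
proof (cases k)
  case 0
  then show ?thesis by (simp add: residue_const)
next
  case (Suc n)
  have "residue (\<lambda>z. c / (z - a) ^ Suc n) a = (deriv ^^ n) (\<lambda>z. c) a / fact n"
    by (rule residue_holomorphic_over_power[of UNIV]) auto
  then show ?thesis using Suc by (cases n) (auto simp: higher_deriv_const)
qed

text \<open>The degree condition says that the function decays like z^(-2), so its residues sum to
  zero and, being equal, vanish. It then has a rational primitive \<open>B / E1\<close>, and
  comparing degrees in (B' E1 - B E1') rad = E1 X gives the lower bound on \<open>degree X\<close>.
  This is the source of both boundedness of clusters and nondegeneracy of limits.\<close>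

lemma equal_residues:
  fixes \<eta> :: "'a \<Rightarrow> complex" and X :: "complex poly"
  assumes fin: "finite U" and ne: "U \<noteq> {}" and inj: "inj_on \<eta> U"
    and e: "\<And>u. u \<in> U \<Longrightarrow> e u \<ge> 1"
    and deg: "degree X + 2 \<le> (\<Sum>u\<in>U. e u)"
    and res: "\<And>u. u \<in> U \<Longrightarrow> residue (\<lambda>z. poly X z / (\<Prod>v\<in>U. (z - \<eta> v) ^ e v)) (\<eta> u) = a"
  shows "a = 0" "X = 0 \<or> card U \<le> degree X + 1"
proof -
  define q where "q u = [:- \<eta> u, 1:]" for u
  have q0: "q u \<noteq> 0" for u by (simp add: q_def)
  have degq: "degree (q u) = 1" "lead_coeff (q u) = 1" for u by (simp_all add: q_def)
  obtain b where b: "X = (\<Sum>u\<in>U. \<Sum>k\<in>{1..e u}. smult (b u k)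
           ((\<Prod>v\<in>U - {u}. q v ^ e v) * q u ^ (e u - k)))"
    using partial_fractions[OF fin inj, of X e] deg unfolding q_def by auto
  have pq: "poly (q u) z = z - \<eta> u" for u z by (simp add: q_def)
  have frac: "poly X z / (\<Prod>v\<in>U. (z - \<eta> v) ^ e v) = (\<Sum>u\<in>U. \<Sum>k\<in>{1..e u}. b u k / (z - \<eta> u) ^ k)"
    if z: "z \<notin> \<eta> ` U" for z
  proof -
    have "poly X z / (\<Prod>v\<in>U. (z - \<eta> v) ^ e v) = (\<Sum>u\<in>U. \<Sum>k\<in>{1..e u}. b u k *
           ((\<Prod>v\<in>U - {u}. (z - \<eta> v) ^ e v) * (z - \<eta> u) ^ (e u - k)) / (\<Prod>v\<in>U. (z - \<eta> v) ^ e v))"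
      by (subst b) (simp add: poly_sum poly_prod pq sum_divide_distrib)
    also have "\<dots> = (\<Sum>u\<in>U. \<Sum>k\<in>{1..e u}. b u k / (z - \<eta> u) ^ k)"
    proof (intro sum.cong refl)
      fix u k assume u: "u \<in> U" and k: "k \<in> {1..e u}"
      have nz: "(\<Prod>v\<in>U - {u}. (z - \<eta> v) ^ e v) \<noteq> 0" "z - \<eta> u \<noteq> 0"
        using z fin u by auto
      have "(\<Prod>v\<in>U. (z - \<eta> v) ^ e v) = (z - \<eta> u) ^ e u * (\<Prod>v\<in>U - {u}. (z - \<eta> v) ^ e v)"
        using u fin by (simp add: prod.remove)
      also have "(z - \<eta> u) ^ e u = (z - \<eta> u) ^ (e u - k) * (z - \<eta> u) ^ k"
        using k by (simp flip: power_add)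
      finally show "b u k * ((\<Prod>v\<in>U - {u}. (z - \<eta> v) ^ e v) * (z - \<eta> u) ^ (e u - k)) / (\<Prod>v\<in>U. (z - \<eta> v) ^ e v)
         = b u k / (z - \<eta> u) ^ k" using nz by (simp add: field_simps)
    qed
    finally show ?thesis .
  qed
  have b1: "b u 1 = a" if u: "u \<in> U" for u
  proof -
    define s where "s = - (\<eta> ` (U - {u}))"
    have s: "open s" "\<eta> u \<in> s"
      using fin u inj by (auto simp: s_def finite_imp_closed open_Compl inj_on_def)
    have hol: "(\<lambda>z. b v k / (z - \<eta> v) ^ k) holomorphic_on s - {\<eta> u}" if "v \<in> U" for v k
      using that by (intro holomorphic_intros) (auto simp: s_def)
    have "a = residue (\<lambda>z. \<Sum>v\<in>U. \<Sum>k\<in>{1..e v}. b v k / (z - \<eta> v) ^ k) (\<eta> u)"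
      unfolding res[OF u, symmetric]
    proof (rule residue_cong)
      have "eventually (\<lambda>z. z \<in> s - {\<eta> u}) (at (\<eta> u))"
        using s by (auto simp: eventually_at_filter elim!: eventually_mono[OF eventually_nhds_in_open])
      then show "\<forall>\<^sub>F z in at (\<eta> u). poly X z / (\<Prod>v\<in>U. (z - \<eta> v) ^ e v) =
           (\<Sum>v\<in>U. \<Sum>k = 1..e v. b v k / (z - \<eta> v) ^ k)"
        by eventually_elim (rule frac, auto simp: s_def)
    qed simp
    also have "\<dots> = (\<Sum>v\<in>U. \<Sum>k\<in>{1..e v}. residue (\<lambda>z. b v k / (z - \<eta> v) ^ k) (\<eta> u))"
    proof -
      have "residue (\<lambda>z. \<Sum>v\<in>U. \<Sum>k\<in>{1..e v}. b v k / (z - \<eta> v) ^ k) (\<eta> u)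
        = (\<Sum>v\<in>U. residue (\<lambda>z. \<Sum>k\<in>{1..e v}. b v k / (z - \<eta> v) ^ k) (\<eta> u))"
        by (rule residue_sum[OF fin s]) (intro holomorphic_on_sum hol)
      also have "\<dots> = (\<Sum>v\<in>U. \<Sum>k\<in>{1..e v}. residue (\<lambda>z. b v k / (z - \<eta> v) ^ k) (\<eta> u))"
        by (intro sum.cong refl residue_sum[OF _ s] hol) auto
      finally show ?thesis .
    qed
    also have "\<dots> = (\<Sum>v\<in>U. if v = u then b u 1 else 0)"
    proof (intro sum.cong refl)
      fix v assume v: "v \<in> U"
      show "(\<Sum>k\<in>{1..e v}. residue (\<lambda>z. b v k / (z - \<eta> v) ^ k) (\<eta> u)) = (if v = u then b u 1 else 0)"
      proof (cases "v = u")
        case True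
        have "1 \<le> e u" using e u by blast
        then show ?thesis using True by (simp add: residue_inverse_power)
      next
        case False
        have "residue (\<lambda>z. b v k / (z - \<eta> v) ^ k) (\<eta> u) = 0" for k
        proof (rule residue_holo[of "- {\<eta> v}"])
          show "\<eta> u \<in> - {\<eta> v}" using inj u v False by (auto simp: inj_on_def)
        qed (auto intro!: holomorphic_intros)
        then show ?thesis using False by simp
      qed
    qed
    also have "\<dots> = b u 1" using u fin by simp
    finally show ?thesis by simp
  qed
  define N where "N = (\<Sum>u\<in>U. e u)"
  define Ek where "Ek u k = (\<Prod>v\<in>U - {u}. q v ^ e v) * q u ^ (e u - k)" for u k
  have degEk: "degree (Ek u k) = N - k" "lead_coeff (Ek u k) = 1" if "u \<in> U" "k \<in> {1..e u}" for u k
  proof -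
    have "N = e u + (\<Sum>v\<in>U - {u}. e v)" unfolding N_def using that fin by (simp add: sum.remove)
    moreover have "degree (\<Prod>v\<in>U - {u}. q v ^ e v) = (\<Sum>v\<in>U - {u}. e v)"
      by (subst degree_prod_eq_sum_degree) (auto simp: q0 degree_power_eq degq)
    ultimately show "degree (Ek u k) = N - k" unfolding Ek_def using that
      by (subst degree_mult_eq) (auto simp: q0 fin degree_power_eq degq)
    show "lead_coeff (Ek u k) = 1" unfolding Ek_def
      by (simp add: lead_coeff_mult lead_coeff_prod lead_coeff_power degq(2) del: One_nat_def)
  qed
  have bX: "X = (\<Sum>u\<in>U. \<Sum>k\<in>{1..e u}. smult (b u k) (Ek u k))"
    using b by (simp add: Ek_def)
  \<comment> \<open>Only the simple-pole terms reach degree \<open>N - 1\<close>, while X has degree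
    at most \<open>N - 2\<close>; this is the statement that the residues sum to zero.\<close>
  have "coeff X (N - 1) = (\<Sum>u\<in>U. \<Sum>k\<in>{1..e u}. if k = 1 then b u k else 0)"
    unfolding bX coeff_sum
  proof (intro sum.cong refl)
    fix u k assume u: "u \<in> U" and k: "k \<in> {1..e u}"
    show "coeff (smult (b u k) (Ek u k)) (N - 1) = (if k = 1 then b u k else 0)"
    proof (cases "k = 1")
      case True then show ?thesis using degEk[OF u k] by simp
    next
      case False
      have "N - k < N - 1"
        using False k deg unfolding N_def by auto
      then show ?thesis using False degEk[OF u k] by (simp add: coeff_eq_0)
    qed
  qed
  also have "\<dots> = (\<Sum>u\<in>U. a)"
    using e b1 by (intro sum.cong) auto
  finally have "of_nat (card U) * a = 0"
    using deg by (simp add: coeff_eq_0 N_def)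
  then show a0: "a = 0" using fin ne by simp
  define E1 where "E1 = (\<Prod>u\<in>U. q u ^ (e u - 1))"
  define rad where "rad = (\<Prod>u\<in>U. q u)"
  define T where "T u k = (\<Prod>v\<in>U - {u}. q v ^ (e v - 1)) * q u ^ (e u - k)" for u k
  define c where "c u k = - b u k / of_nat (k - 1)" for u k
  \<comment> \<open>Termwise primitive: integrating b/(z - eta)^k for k at least 2 gives -b/(k-1)/(z
    - eta)^(k-1). Multiplying by \<open>E1\<close> turns the terms into the polynomials
    \<open>T u k\<close>.\<close>
  define B where "B = (\<Sum>u\<in>U. \<Sum>k\<in>{2..e u}. smult (c u k) (T u k))"
  have wterm: "(pderiv (T u k) * E1 - T u k * pderiv E1) * rad = smult (- of_nat (k - 1)) (E1 * Ek u k)"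
    if u: "u \<in> U" and k: "k \<in> {2..e u}" for u k
  proof -
    have E1T: "E1 = T u k * q u ^ (k - 1)"
    proof -
      have "E1 = q u ^ (e u - 1) * (\<Prod>v\<in>U - {u}. q v ^ (e v - 1))"
        unfolding E1_def using u fin by (simp add: prod.remove)
      moreover have "q u ^ (e u - 1) = q u ^ (e u - k) * q u ^ (k - 1)"
        using k by (simp flip: power_add)
      ultimately show ?thesis by (simp add: T_def)
    qed
    obtain j where j: "k - 1 = Suc j" using k by (metis Suc_diff_le Suc_1 atLeastAtMost_iff diff_Suc_Suc diff_zero not_less_eq_eq numeral_2_eq_2 One_nat_def)
    have dq: "pderiv (q u) = 1" by (simp add: q_def pderiv_pCons)
    have dp: "pderiv (q u ^ (k - 1)) = smult (of_nat (k - 1)) (q u ^ j)"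
      unfolding j pderiv_power_Suc dq by simp
    have dE1: "pderiv E1 = pderiv (T u k) * q u ^ (k - 1) + T u k * smult (of_nat (k - 1)) (q u ^ j)"
      unfolding E1T pderiv_mult dp by (simp add: algebra_simps)
    have 1: "pderiv (T u k) * E1 - T u k * pderiv E1 = smult (- of_nat (k - 1)) (T u k * T u k * q u ^ j)"
      unfolding dE1 unfolding E1T by (simp add: algebra_simps)
    define H1 R where "H1 = (\<Prod>v\<in>U - {u}. q v ^ (e v - 1))" and "R = (\<Prod>v\<in>U - {u}. q v)"
    have rad: "rad = q u * R" unfolding rad_def R_def using u fin by (simp add: prod.remove)
    have "H1 * R = (\<Prod>v\<in>U - {u}. q v ^ e v)"
      unfolding prod.distrib[symmetric] H1_def R_def
    proof (intro prod.cong refl)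
      fix v assume "v \<in> U - {u}"
      then have "e v \<ge> 1" using e by auto
      then show "q v ^ (e v - 1) * q v = q v ^ e v"
        by (cases "e v") (auto simp: mult.commute)
    qed
    then have Ek: "Ek u k = H1 * R * q u ^ (e u - k)" by (simp add: Ek_def)
    have Tu: "T u k = H1 * q u ^ (e u - k)" by (simp add: T_def H1_def)
    have "T u k * T u k * q u ^ j * rad = (T u k * q u ^ (k - 1)) * Ek u k"
      unfolding Ek rad j power_Suc Tu by (simp only: mult_ac)
    then show ?thesis unfolding 1 E1T[symmetric] by simp
  qed
  have key: "(pderiv B * E1 - B * pderiv E1) * rad = E1 * X"
  proof -
    have "(pderiv B * E1 - B * pderiv E1) * rad
      = (\<Sum>u\<in>U. \<Sum>k\<in>{2..e u}. smult (c u k) ((pderiv (T u k) * E1 - T u k * pderiv E1) * rad))"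
      unfolding B_def
      by (simp add: higher_pderiv_sum[of 1, simplified] pderiv_smult sum_distrib_right sum_subtractf smult_diff_right left_diff_distrib)
    also have "\<dots> = (\<Sum>u\<in>U. \<Sum>k\<in>{2..e u}. smult (b u k) (E1 * Ek u k))"
    proof (intro sum.cong refl)
      fix u k assume uk: "u \<in> U" "k \<in> {2..e u}"
      have gen: "- x / n * - n = x" if "n \<noteq> 0" for x n :: complex using that by simp
      have "(of_nat (k - 1) :: complex) \<noteq> 0" unfolding of_nat_eq_0_iff using uk by auto
      then have "c u k * - of_nat (k - 1) = b u k" unfolding c_def by (rule gen)
      then show "smult (c u k) ((pderiv (T u k) * E1 - T u k * pderiv E1) * rad) = smult (b u k) (E1 * Ek u k)"
        unfolding wterm[OF uk] smult_smult by simp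
    qed
    also have "\<dots> = (\<Sum>u\<in>U. \<Sum>k\<in>{1..e u}. smult (b u k) (E1 * Ek u k))"
    proof (rule sum.cong[OF refl])
      fix u assume "u \<in> U"
      have z0: "\<forall>k\<in>{1..e u} - {2..e u}. smult (b u k) (E1 * Ek u k) = 0"
      proof
        fix k assume "k \<in> {1..e u} - {2..e u}"
        then have "k = 1" by auto
        then show "smult (b u k) (E1 * Ek u k) = 0" using b1[OF \<open>u \<in> U\<close>] a0 by simp
      qed
      show "(\<Sum>k\<in>{2..e u}. smult (b u k) (E1 * Ek u k)) = (\<Sum>k\<in>{1..e u}. smult (b u k) (E1 * Ek u k))"
        by (rule sum.mono_neutral_left[OF _ _ z0]) auto
    qed
    also have "\<dots> = E1 * X" unfolding bX by (simp add: sum_distrib_left)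
    finally show ?thesis .
  qed
  have E10: "E1 \<noteq> 0" "rad \<noteq> 0" using fin by (auto simp: E1_def rad_def q0)
  have degE1: "degree E1 = N - card U"
  proof -
    have "degree E1 = (\<Sum>u\<in>U. e u - 1)" unfolding E1_def
      by (subst degree_prod_eq_sum_degree) (auto simp: q0 degree_power_eq degq)
    also have "\<dots> = N - card U" unfolding N_def using e by (subst sum_subtractf_nat) auto
    finally show ?thesis .
  qed
  have cardN: "card U \<le> N" unfolding N_def using e by (metis sum_mono card_eq_sum)
  have degrad: "degree rad = card U" unfolding rad_def
    by (subst degree_prod_eq_sum_degree) (auto simp: q0 degq)
  show "X = 0 \<or> card U \<le> degree X + 1"
  proof (cases "B = 0 \<or> X = 0")
    case True
    then show ?thesis using key E10 by auto
  next
    case False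
    have T: "degree (T u k) < degree E1" if u: "u \<in> U" and k: "k \<in> {2..e u}" for u k
    proof -
      have "degree E1 = (e u - 1) + (\<Sum>v\<in>U - {u}. e v - 1)" unfolding E1_def
        using u fin by (subst degree_prod_eq_sum_degree) (auto simp: q0 degree_power_eq degq sum.remove)
      moreover have "degree (\<Prod>v\<in>U - {u}. q v ^ (e v - 1)) = (\<Sum>v\<in>U - {u}. e v - 1)"
        by (subst degree_prod_eq_sum_degree) (auto simp: q0 degree_power_eq degq)
      ultimately show ?thesis unfolding T_def using k
        by (subst degree_mult_eq) (auto simp: q0 fin degree_power_eq degq)
    qed
    have "degree B < degree E1"
    proof -
      have "\<exists>u\<in>U. \<exists>k. k \<in> {2..e u}" using False unfolding B_def by (metis (no_types, lifting) sum.neutral)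
      then have "degree E1 > 0" using T by fastforce
      then show ?thesis unfolding B_def
        by (intro degree_sum_less) (use T in \<open>auto intro!: degree_sum_less le_less_trans[OF degree_smult_le]\<close>)
    qed
    \<comment> \<open>\<open>B\<close> has smaller degree than \<open>E1\<close>, so their Wronskian
      has degree exactly n; times \<open>rad\<close> it equals \<open>E1 * X\<close>, which forces
      \<open>degree X\<close> to be at least \<open>card U - 1\<close>.\<close>
    then obtain n where n: "degree B + degree E1 = Suc n" by (cases "degree E1") auto
    have "coeff (pderiv B * E1 - B * pderiv E1) n \<noteq> 0"
      using coeff_wronskian[of B E1 n] False E10 n \<open>degree B < degree E1\<close> by simp
    then have "n \<le> degree (pderiv B * E1 - B * pderiv E1)" "pderiv B * E1 - B * pderiv E1 \<noteq> 0"
      by (auto intro: le_degree)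
    then have "n + card U \<le> degree ((pderiv B * E1 - B * pderiv E1) * rad)"
      using E10 by (simp add: degree_mult_eq degrad)
    also have "\<dots> = degree E1 + degree X" unfolding key using E10 False by (simp add: degree_mult_eq)
    finally show ?thesis using n by simp
  qed
qed

section \<open>Linear algebra over finite index sets\<close>

text \<open>Gaussian elimination by induction on the set of equations: one equation with a nonzero
  coefficient removes one unknown.\<close>

lemma underdetermined_system:
  fixes A :: "'i \<Rightarrow> 'j \<Rightarrow> complex"
  assumes "finite I" "finite J" "card I < card J"
  shows "\<exists>h. (\<forall>i\<in>I. (\<Sum>j\<in>J. A i j * h j) = 0) \<and> (\<exists>j\<in>J. h j \<noteq> 0)"
  using assms
proof (induction I arbitrary: A J rule: finite_induct)
  case empty
  then obtain j where "j \<in> J" by (metis card.empty card_gt_0_iff ex_in_conv)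
  then show ?case by (intro exI[of _ "\<lambda>_. 1"]) auto
next
  case (insert i I)
  show ?case
  proof (cases "\<forall>j\<in>J. A i j = 0")
    case True
    obtain h where "\<forall>i\<in>I. (\<Sum>j\<in>J. A i j * h j) = 0" "\<exists>j\<in>J. h j \<noteq> 0"
      using insert.IH[of J A] insert.prems insert.hyps by auto
    then show ?thesis using True by (intro exI[of _ h]) auto
  next
    case False
    then obtain j0 where j0: "j0 \<in> J" "A i j0 \<noteq> 0" by auto
    \<comment> \<open>The coefficients of the other rows after the unknown \<open>j0\<close> has
      been eliminated with pivot \<open>A i j0\<close>.\<close>
    define A' where "A' i' j = A i' j - A i' j0 * A i j / A i j0" for i' j
    have "card I < card (J - {j0})" using insert.prems insert.hyps j0 by simp
    then obtain h' where h': "\<forall>i\<in>I. (\<Sum>j\<in>J - {j0}. A' i j * h' j) = 0" "\<exists>j\<in>J - {j0}. h' j \<noteq> 0"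
      using insert.IH[of "J - {j0}" A'] insert.prems by auto
    define h where "h = h'(j0 := - (\<Sum>j\<in>J - {j0}. A i j * h' j) / A i j0)"
    have split: "(\<Sum>j\<in>J. A k j * h j) = A k j0 * h j0 + (\<Sum>j\<in>J - {j0}. A k j * h' j)" for k
    proof -
      have "(\<Sum>j\<in>J. A k j * h j) = A k j0 * h j0 + (\<Sum>j\<in>J - {j0}. A k j * h j)"
        using j0 insert.prems by (simp add: sum.remove)
      also have "(\<Sum>j\<in>J - {j0}. A k j * h j) = (\<Sum>j\<in>J - {j0}. A k j * h' j)"
        by (intro sum.cong) (auto simp: h_def)
      finally show ?thesis .
    qed
    have "(\<Sum>j\<in>J. A k j * h j) = 0" if "k \<in> insert i I" for k
    proof (cases "k = i")
      case True
      then show ?thesis using j0 by (simp add: split) (simp add: h_def)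
    next
      case False
      then have "0 = (\<Sum>j\<in>J - {j0}. A' k j * h' j)" using h' that by auto
      also have "\<dots> = (\<Sum>j\<in>J - {j0}. A k j * h' j - A k j0 / A i j0 * (A i j * h' j))"
        by (intro sum.cong refl) (simp add: A'_def algebra_simps)
      also have "\<dots> = (\<Sum>j\<in>J - {j0}. A k j * h' j) - A k j0 / A i j0 * (\<Sum>j\<in>J - {j0}. A i j * h' j)"
        unfolding sum_subtractf sum_distrib_left ..
      also have "\<dots> = (\<Sum>j\<in>J. A k j * h j)" unfolding split by (simp add: h_def)
      finally show ?thesis by simp
    qed
    moreover have "\<exists>j\<in>J. h j \<noteq> 0" using h'(2) by (auto simp: h_def)
    ultimately show ?thesis by blast
  qed
qed

text \<open>The right inverse is built column by column from kernel vectors of an enlarged system;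
  it is also a left inverse because A (B A - 1) = 0 and A is injective.\<close>

lemma injective_system_inverse:
  fixes A :: "'a \<Rightarrow> 'a \<Rightarrow> complex"
  assumes fin: "finite S"
    and inj: "\<And>h. (\<And>i. i \<in> S \<Longrightarrow> (\<Sum>j\<in>S. A i j * h j) = 0) \<Longrightarrow> (\<And>j. j \<in> S \<Longrightarrow> h j = 0)"
  obtains B where "\<And>i k. i \<in> S \<Longrightarrow> k \<in> S \<Longrightarrow> (\<Sum>j\<in>S. A i j * B j k) = (if i = k then 1 else 0)"
    "\<And>i k. i \<in> S \<Longrightarrow> k \<in> S \<Longrightarrow> (\<Sum>j\<in>S. B i j * A j k) = (if i = k then 1 else 0)"
proof -
  have "\<exists>b. \<forall>i\<in>S. (\<Sum>j\<in>S. A i j * b j) = (if i = k then 1 else 0)" if k: "k \<in> S" for k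
  proof -
    \<comment> \<open>The extra unknown \<open>None\<close> carries minus the k-th unit vector as
      its column. Its value in a kernel vector cannot vanish by injectivity, and dividing by it
      solves A b = e_k.\<close>
    define J where "J = insert None (Some ` S)"
    define A' where "A' i j = (case j of None \<Rightarrow> (if i = k then - 1 else 0) | Some j \<Rightarrow> A i j)" for i j
    have "card S < card J" using fin by (simp add: J_def card_image)
    from underdetermined_system[OF fin _ this, of A'] obtain h where
      h: "\<forall>i\<in>S. (\<Sum>j\<in>J. A' i j * h j) = 0" "\<exists>j\<in>J. h j \<noteq> 0" using fin by (auto simp: J_def)
    have eq: "(\<Sum>j\<in>S. A i j * h (Some j)) = (if i = k then h None else 0)" if "i \<in> S" for i
    proof -
      have "0 = (\<Sum>j\<in>J. A' i j * h j)" using h that by simp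
      also have "\<dots> = A' i None * h None + (\<Sum>j\<in>S. A' i (Some j) * h (Some j))"
        unfolding J_def using fin by (subst sum.insert) (auto simp: sum.reindex)
      finally show ?thesis by (simp add: A'_def split: if_splits)
    qed
    have "h None \<noteq> 0"
    proof
      assume "h None = 0"
      then have "h (Some j) = 0" if "j \<in> S" for j
        using inj[of "\<lambda>j. h (Some j)"] eq that by auto
      then show False using h(2) \<open>h None = 0\<close> by (auto simp: J_def)
    qed
    then show ?thesis
      using eq by (intro exI[of _ "\<lambda>j. h (Some j) / h None"]) (simp flip: sum_divide_distrib)
  qed
  then have "\<exists>B. \<forall>k\<in>S. \<forall>i\<in>S. (\<Sum>j\<in>S. A i j * B k j) = (if i = k then 1 else 0)"
    by (intro bchoice) auto
  then obtain B' where B': "\<forall>k\<in>S. \<forall>i\<in>S. (\<Sum>j\<in>S. A i j * B' k j) = (if i = k then 1 else 0)" by blast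
  define B where "B j k = B' k j" for j k
  have AB: "(\<Sum>j\<in>S. A i j * B j k) = (if i = k then 1 else 0)" if "i \<in> S" "k \<in> S" for i k
    using B' that by (simp add: B_def)
  have BA: "(\<Sum>j\<in>S. B i j * A j k) = (if i = k then 1 else 0)" if i: "i \<in> S" and k: "k \<in> S" for i k
  proof -
    have "(\<Sum>l\<in>S. B l' l * A l k) - (if l' = k then 1 else 0) = 0" if "l' \<in> S" for l'
    proof (rule inj[of "\<lambda>l'. (\<Sum>l\<in>S. B l' l * A l k) - (if l' = k then 1 else 0)", OF _ that])
      fix i assume i: "i \<in> S"
      have "(\<Sum>j\<in>S. A i j * ((\<Sum>l\<in>S. B j l * A l k) - (if j = k then 1 else 0)))
          = (\<Sum>j\<in>S. \<Sum>l\<in>S. A i j * B j l * A l k) - (\<Sum>j\<in>S. if j = k then A i j else 0)"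
        unfolding sum_subtractf[symmetric]
        by (intro sum.cong refl) (simp add: right_diff_distrib sum_distrib_left mult.assoc)
      also have "(\<Sum>j\<in>S. \<Sum>l\<in>S. A i j * B j l * A l k) = (\<Sum>l\<in>S. (\<Sum>j\<in>S. A i j * B j l) * A l k)"
        by (subst sum.swap) (simp add: sum_distrib_right)
      also have "\<dots> = (\<Sum>l\<in>S. if i = l then A l k else 0)"
        by (intro sum.cong refl) (simp add: AB i)
      finally show "(\<Sum>j\<in>S. A i j * ((\<Sum>l\<in>S. B j l * A l k) - (if j = k then 1 else 0))) = 0"
        using fin i k by simp
    qed
    from this[OF i] show ?thesis by simp
  qed
  show ?thesis using that AB BA by blast
qed

section \<open>Strict differentiability and an implicit function theorem\<close>

text \<open>Calculus near a base point \<open>v0\<close> for maps depending on a real parameter t ->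
  0+. Only the coordinates in \<open>S\<close> count.\<close>

locale strict_diff =
  fixes S :: "'a set" and v0 :: "'a \<Rightarrow> complex"
  assumes finS: "finite S"
begin

definition nrm :: "('a \<Rightarrow> complex) \<Rightarrow> real" where "nrm h = (\<Sum>i\<in>S. cmod (h i))"

definition near :: "real \<Rightarrow> ('a \<Rightarrow> complex) \<Rightarrow> bool" where
  "near \<delta> v \<longleftrightarrow> (\<forall>i\<in>S. cmod (v i - v0 i) < \<delta>)"

text \<open>Two independent points v and v' tend to \<open>v0\<close> while t -> 0+, as the strict
  derivative compares values at two arbitrary nearby points.\<close>

definition Fl :: "(real \<times> ('a \<Rightarrow> complex) \<times> ('a \<Rightarrow> complex)) filter" where
  "Fl = (INF \<delta>\<in>{0<..}. principal {(t, v, v'). 0 < t \<and> t < \<delta> \<and> near \<delta> v \<and> near \<delta> v'})"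

lemma near_mono: "near \<delta> v \<Longrightarrow> \<delta> \<le> \<delta>' \<Longrightarrow> near \<delta>' v"
  unfolding near_def by force

lemma eventually_Fl:
  "eventually P Fl \<longleftrightarrow> (\<exists>\<delta>>0. \<forall>t v v'. 0 < t \<longrightarrow> t < \<delta> \<longrightarrow> near \<delta> v \<longrightarrow> near \<delta> v' \<longrightarrow> P (t, v, v'))"
  unfolding Fl_def
proof (subst eventually_INF_base)
  show "\<exists>x\<in>{0<..}. principal {(t, v, v'). 0 < t \<and> t < x \<and> near x v \<and> near x v'}
      \<le> inf (principal {(t, v, v'). 0 < t \<and> t < a \<and> near a v \<and> near a v'})
          (principal {(t, v, v'). 0 < t \<and> t < b \<and> near b v \<and> near b v'})"
    if "a \<in> {0<..}" "b \<in> {0<..}" for a b :: real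
    using that by (intro bexI[of _ "min a b"]) (auto intro: near_mono)
qed (auto simp: eventually_principal)

lemma eventually_Fl_True [simp]: "\<forall>\<^sub>F (t, v, v') in Fl. True"
  by (simp add: case_prod_unfold)

lemma nrm_nonneg [simp]: "0 \<le> nrm h"
  unfolding nrm_def by (simp add: sum_nonneg)

lemma nrm_ge: "i \<in> S \<Longrightarrow> cmod (h i) \<le> nrm h"
  unfolding nrm_def using finS by (intro member_le_sum) auto

text \<open>Strict differentiability at t = 0+, v = \<open>v0\<close>, uniformly in a parameter z
  from \<open>Z\<close> (later a circle of integration), with limit value \<open>g0\<close> and
  derivative \<open>L\<close>. In t only convergence is demanded, because t enters through the
  fractional powers \<open>kap\<close>. The first clause gives uniform bounds for the product and
  quotient rules.\<close>

definition sd :: "complex set \<Rightarrow> (complex \<Rightarrow> real \<Rightarrow> ('a \<Rightarrow> complex) \<Rightarrow> complex) \<Rightarrow>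
    (complex \<Rightarrow> complex) \<Rightarrow> (complex \<Rightarrow> ('a \<Rightarrow> complex) \<Rightarrow> complex) \<Rightarrow> bool" where
  "sd Z g g0 L \<longleftrightarrow>
     (\<exists>C\<ge>0. \<forall>z\<in>Z. cmod (g0 z) \<le> C \<and> (\<forall>h. cmod (L z h) \<le> C * nrm h)) \<and>
     (\<forall>\<epsilon>>0. \<forall>\<^sub>F (t, v, v') in Fl. \<forall>z\<in>Z. cmod (g z t v - g0 z) \<le> \<epsilon> \<and> cmod (g z t v' - g0 z) \<le> \<epsilon>) \<and>
     (\<forall>\<epsilon>>0. \<forall>\<^sub>F (t, v, v') in Fl. \<forall>z\<in>Z.
        cmod (g z t v - g z t v' - L z (\<lambda>i. v i - v' i)) \<le> \<epsilon> * nrm (\<lambda>i. v i - v' i))"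

lemma sdI:
  assumes "C \<ge> 0" "\<And>z. z \<in> Z \<Longrightarrow> cmod (g0 z) \<le> C" "\<And>z h. z \<in> Z \<Longrightarrow> cmod (L z h) \<le> C * nrm h"
    and "\<And>\<epsilon>. \<epsilon> > 0 \<Longrightarrow> \<forall>\<^sub>F (t, v, v') in Fl. \<forall>z\<in>Z. cmod (g z t v - g0 z) \<le> \<epsilon> \<and> cmod (g z t v' - g0 z) \<le> \<epsilon>"
    and "\<And>\<epsilon>. \<epsilon> > 0 \<Longrightarrow> \<forall>\<^sub>F (t, v, v') in Fl. \<forall>z\<in>Z.
        cmod (g z t v - g z t v' - L z (\<lambda>i. v i - v' i)) \<le> \<epsilon> * nrm (\<lambda>i. v i - v' i)"
  shows "sd Z g g0 L"
  unfolding sd_def using assms by blast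

lemma sd_bound:
  assumes "sd Z g g0 L"
  obtains C where "C > 0" "\<And>z. z \<in> Z \<Longrightarrow> cmod (g0 z) \<le> C" "\<And>z h. z \<in> Z \<Longrightarrow> cmod (L z h) \<le> C * nrm h"
proof -
  obtain C where C: "C \<ge> 0" "\<And>z. z \<in> Z \<Longrightarrow> cmod (g0 z) \<le> C" "\<And>z h. z \<in> Z \<Longrightarrow> cmod (L z h) \<le> C * nrm h"
    using assms unfolding sd_def by blast
  have "cmod (L z h) \<le> (C + 1) * nrm h" if "z \<in> Z" for z h
    using C(3)[OF that, of h] nrm_nonneg[of h] unfolding distrib_right by linarith
  moreover have "cmod (g0 z) \<le> C + 1" if "z \<in> Z" for z using C(2)[OF that] by simp
  ultimately show ?thesis using that[of "C + 1"] C(1) by auto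
qed

lemma sd_value:
  "sd Z g g0 L \<Longrightarrow> \<epsilon> > 0 \<Longrightarrow>
    \<forall>\<^sub>F (t, v, v') in Fl. \<forall>z\<in>Z. cmod (g z t v - g0 z) \<le> \<epsilon> \<and> cmod (g z t v' - g0 z) \<le> \<epsilon>"
  unfolding sd_def by blast

lemma sd_strict:
  "sd Z g g0 L \<Longrightarrow> \<epsilon> > 0 \<Longrightarrow> \<forall>\<^sub>F (t, v, v') in Fl. \<forall>z\<in>Z.
        cmod (g z t v - g z t v' - L z (\<lambda>i. v i - v' i)) \<le> \<epsilon> * nrm (\<lambda>i. v i - v' i)"
  unfolding sd_def by blast

lemma sd_cong:
  assumes "sd Z g g0 L" "\<And>z t v. z \<in> Z \<Longrightarrow> g' z t v = g z t v"
    "\<And>z. z \<in> Z \<Longrightarrow> g0' z = g0 z" "\<And>z h. z \<in> Z \<Longrightarrow> L' z h = L z h"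
  shows "sd Z g' g0' L'"
  using assms unfolding sd_def by (simp cong: ball_cong)

lemma sd_const:
  assumes "(\<kappa> \<longlongrightarrow> k0) (at_right (0::real))"
  shows "sd Z (\<lambda>z t v. \<kappa> t) (\<lambda>z. k0) (\<lambda>z h. 0)"
proof (rule sdI[of "cmod k0"])
  fix \<epsilon> :: real assume "\<epsilon> > 0"
  then have "\<forall>\<^sub>F t in at_right 0. dist (\<kappa> t) k0 < \<epsilon>" using assms by (rule tendstoD[rotated])
  then obtain b where b: "b > 0" "\<And>t. 0 < t \<Longrightarrow> t < b \<Longrightarrow> dist (\<kappa> t) k0 < \<epsilon>"
    by (auto simp: eventually_at_right_field)
  show "\<forall>\<^sub>F (t, v, v') in Fl. \<forall>z\<in>Z. cmod (\<kappa> t - k0) \<le> \<epsilon> \<and> cmod (\<kappa> t - k0) \<le> \<epsilon>"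
    unfolding eventually_Fl using b by (intro exI[of _ b]) (auto simp: dist_norm less_imp_le)
qed (auto simp: case_prod_unfold)

lemma sd_zconst:
  assumes "bounded (c ` Z)"
  shows "sd Z (\<lambda>z t v. c z) c (\<lambda>z h. 0)"
proof -
  obtain C where "C > 0" "\<And>z. z \<in> Z \<Longrightarrow> cmod (c z) \<le> C"
    using assms by (auto simp: bounded_pos)
  then show ?thesis by (intro sdI[of C]) (auto simp: case_prod_unfold)
qed

lemma sd_proj:
  assumes "i \<in> S"
  shows "sd Z (\<lambda>z t v. v i) (\<lambda>z. v0 i) (\<lambda>z h. h i)"
proof (rule sdI[of "cmod (v0 i) + 1"])
  fix \<epsilon> :: real assume "\<epsilon> > 0"
  then show "\<forall>\<^sub>F (t, v, v') in Fl. \<forall>z\<in>Z. cmod (v i - v0 i) \<le> \<epsilon> \<and> cmod (v' i - v0 i) \<le> \<epsilon>"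
    unfolding eventually_Fl near_def using assms by (intro exI[of _ \<epsilon>]) (auto intro: less_imp_le)
next
  fix h
  show "cmod (h i) \<le> (cmod (v0 i) + 1) * nrm h"
    using nrm_ge[OF assms, of h] mult_nonneg_nonneg[OF norm_ge_zero nrm_nonneg, of "v0 i" h]
    unfolding distrib_right by linarith
qed auto

lemma sd_add:
  assumes f: "sd Z f f0 L" and g: "sd Z g g0 M"
  shows "sd Z (\<lambda>z t v. f z t v + g z t v) (\<lambda>z. f0 z + g0 z) (\<lambda>z h. L z h + M z h)"
proof -
  obtain C where C: "C > 0" "\<And>z. z \<in> Z \<Longrightarrow> cmod (f0 z) \<le> C" "\<And>z h. z \<in> Z \<Longrightarrow> cmod (L z h) \<le> C * nrm h"
    using sd_bound[OF f] by metis
  obtain D where D: "D > 0" "\<And>z. z \<in> Z \<Longrightarrow> cmod (g0 z) \<le> D" "\<And>z h. z \<in> Z \<Longrightarrow> cmod (M z h) \<le> D * nrm h"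
    using sd_bound[OF g] by metis
  show ?thesis
  proof (rule sdI[of "C + D"])
    show "cmod (f0 z + g0 z) \<le> C + D" if "z \<in> Z" for z
      using C(2)[OF that] D(2)[OF that] norm_triangle_ineq[of "f0 z" "g0 z"] by linarith
    show "cmod (L z h + M z h) \<le> (C + D) * nrm h" if "z \<in> Z" for z h
      using C(3)[OF that, of h] D(3)[OF that, of h] norm_triangle_ineq[of "L z h" "M z h"]
      unfolding distrib_right by linarith
  next
    fix \<epsilon> :: real assume e: "\<epsilon> > 0"
    then have e2: "\<epsilon> / 2 > 0" by simp
    show "\<forall>\<^sub>F (t, v, v') in Fl. \<forall>z\<in>Z. cmod (f z t v + g z t v - (f0 z + g0 z)) \<le> \<epsilon>
       \<and> cmod (f z t v' + g z t v' - (f0 z + g0 z)) \<le> \<epsilon>"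
      using sd_value[OF f e2] sd_value[OF g e2]
    proof eventually_elim
      case (elim x)
      obtain t v v' where x: "x = (t, v, v')" by (cases x)
      have "cmod (f z t v + g z t v - (f0 z + g0 z)) \<le> \<epsilon>" if
        "cmod (f z t v - f0 z) \<le> \<epsilon>/2" "cmod (g z t v - g0 z) \<le> \<epsilon>/2" for z t v
        using that norm_triangle_ineq[of "f z t v - f0 z" "g z t v - g0 z"] by (simp add: algebra_simps)
      then show ?case using elim by (simp add: x)
    qed
    show "\<forall>\<^sub>F (t, v, v') in Fl. \<forall>z\<in>Z. cmod (f z t v + g z t v - (f z t v' + g z t v')
         - (L z (\<lambda>i. v i - v' i) + M z (\<lambda>i. v i - v' i))) \<le> \<epsilon> * nrm (\<lambda>i. v i - v' i)"
      using sd_strict[OF f e2] sd_strict[OF g e2]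
    proof eventually_elim
      case (elim x)
      obtain t v v' where x: "x = (t, v, v')" by (cases x)
      let ?h = "\<lambda>i. v i - v' i"
      have "cmod (f z t v + g z t v - (f z t v' + g z t v') - (L z ?h + M z ?h)) \<le> \<epsilon> * nrm ?h" if "z \<in> Z" for z
      proof -
        have "cmod (f z t v - f z t v' - L z ?h) \<le> \<epsilon>/2 * nrm ?h" "cmod (g z t v - g z t v' - M z ?h) \<le> \<epsilon>/2 * nrm ?h"
          using elim that by (simp_all add: x)
        then show ?thesis
          using norm_triangle_ineq[of "f z t v - f z t v' - L z ?h" "g z t v - g z t v' - M z ?h"]
          by (simp add: algebra_simps)
      qed
      then show ?case by (simp add: x)
    qed
  qed (use C D in auto)
qed

lemma sd_mult:
  assumes f: "sd Z f f0 L" and g: "sd Z g g0 M"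
  shows "sd Z (\<lambda>z t v. f z t v * g z t v) (\<lambda>z. f0 z * g0 z) (\<lambda>z h. f0 z * M z h + g0 z * L z h)"
proof -
  obtain C where C: "C > 0" "\<And>z. z \<in> Z \<Longrightarrow> cmod (f0 z) \<le> C" "\<And>z h. z \<in> Z \<Longrightarrow> cmod (L z h) \<le> C * nrm h"
    using sd_bound[OF f] by metis
  obtain D where D: "D > 0" "\<And>z. z \<in> Z \<Longrightarrow> cmod (g0 z) \<le> D" "\<And>z h. z \<in> Z \<Longrightarrow> cmod (M z h) \<le> D * nrm h"
    using sd_bound[OF g] by metis
  show ?thesis
  proof (rule sdI[of "C * D + C * D"])
    show "cmod (f0 z * g0 z) \<le> C * D + C * D" if "z \<in> Z" for z
      using mult_mono[OF C(2)[OF that] D(2)[OF that]] C(1) D(1)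
      by (simp add: norm_mult) (smt (verit) mult_pos_pos)
    show "cmod (f0 z * M z h + g0 z * L z h) \<le> (C * D + C * D) * nrm h" if "z \<in> Z" for z h
    proof -
      have "cmod (f0 z * M z h) \<le> C * (D * nrm h)" "cmod (g0 z * L z h) \<le> D * (C * nrm h)"
        unfolding norm_mult using C D that by (auto intro!: mult_mono)
      then show ?thesis using norm_triangle_ineq[of "f0 z * M z h" "g0 z * L z h"]
        by (simp add: algebra_simps)
    qed
  next
    fix \<epsilon> :: real assume e: "\<epsilon> > 0"
    \<comment> \<open>The bound 1 keeps the factors within \<open>C + 1\<close> and
      \<open>D + 1\<close>; the factor 2(C + D + 1) collects the four error terms of the telescoped
      product.\<close>
    define \<epsilon>' where "\<epsilon>' = min 1 (\<epsilon> / (2 * (C + D + 1)))"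
    have e': "\<epsilon>' > 0" "\<epsilon>' \<le> 1" using e C(1) D(1) by (auto simp: \<epsilon>'_def)
    have "\<epsilon>' \<le> \<epsilon> / (2 * (C + D + 1))" by (simp add: \<epsilon>'_def)
    then have ee: "\<epsilon>' * (2 * (C + D + 1)) \<le> \<epsilon>" using C(1) D(1) by (simp add: pos_le_divide_eq)
    have val: "cmod (a * b - a0 * b0) \<le> \<epsilon>" if
        "cmod (a - a0) \<le> \<epsilon>'" "cmod (b - b0) \<le> \<epsilon>'" "cmod a0 \<le> C" "cmod b0 \<le> D" for a b a0 b0
    proof -
      have "a * b - a0 * b0 = (a - a0) * (b - b0) + a0 * (b - b0) + (a - a0) * b0"
        by (simp add: algebra_simps)
      then have "cmod (a * b - a0 * b0) \<le> cmod (a - a0) * cmod (b - b0) + cmod a0 * cmod (b - b0) + cmod (a - a0) * cmod b0"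
        by (metis (no_types, lifting) norm_triangle_le norm_mult add_mono order_refl)
      also have "\<dots> \<le> 1 * \<epsilon>' + C * \<epsilon>' + \<epsilon>' * D"
        using that e' C D by (intro add_mono mult_mono) auto
      also have "\<dots> \<le> \<epsilon>' * (2 * (C + D + 1))" using e' C(1) D(1) by (simp add: algebra_simps)
      finally show ?thesis using ee by simp
    qed
    show "\<forall>\<^sub>F (t, v, v') in Fl. \<forall>z\<in>Z. cmod (f z t v * g z t v - f0 z * g0 z) \<le> \<epsilon>
       \<and> cmod (f z t v' * g z t v' - f0 z * g0 z) \<le> \<epsilon>"
      using sd_value[OF f e'(1)] sd_value[OF g e'(1)]
      by eventually_elim (use val C(2) D(2) in auto)
    show "\<forall>\<^sub>F (t, v, v') in Fl. \<forall>z\<in>Z. cmod (f z t v * g z t v - f z t v' * g z t v'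
         - (f0 z * M z (\<lambda>i. v i - v' i) + g0 z * L z (\<lambda>i. v i - v' i))) \<le> \<epsilon> * nrm (\<lambda>i. v i - v' i)"
      using sd_strict[OF f e'(1)] sd_strict[OF g e'(1)] sd_value[OF f e'(1)] sd_value[OF g e'(1)]
    proof eventually_elim
      case (elim x)
      obtain t v v' where x: "x = (t, v, v')" by (cases x)
      let ?h = "\<lambda>i. v i - v' i"
      have "cmod (f z t v * g z t v - f z t v' * g z t v' - (f0 z * M z ?h + g0 z * L z ?h)) \<le> \<epsilon> * nrm ?h"
        if z: "z \<in> Z" for z
      proof -
        define l m where "l = L z ?h" and "m = M z ?h"
        have 1: "cmod (f z t v - f z t v' - l) \<le> \<epsilon>' * nrm ?h" "cmod (g z t v - g z t v' - m) \<le> \<epsilon>' * nrm ?h"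
          "cmod (f z t v - f0 z) \<le> \<epsilon>'" "cmod (g z t v' - g0 z) \<le> \<epsilon>'"
          using elim z by (auto simp: x l_def m_def)
        have 2: "cmod l \<le> C * nrm ?h" "cmod m \<le> D * nrm ?h" "cmod (f0 z) \<le> C" "cmod (g0 z) \<le> D"
          using C D z by (auto simp: l_def m_def)
        have 3: "cmod (f z t v) \<le> C + 1" "cmod (g z t v') \<le> D + 1"
          using 1(3,4) 2(3,4) e'(2) norm_triangle_ineq2[of "f z t v" "f0 z"] norm_triangle_ineq2[of "g z t v'" "g0 z"]
          by linarith+
        have "f z t v * g z t v - f z t v' * g z t v' - (f0 z * m + g0 z * l)
          = f z t v * (g z t v - g z t v' - m) + (f z t v - f0 z) * m
            + (g z t v' * (f z t v - f z t v' - l) + (g z t v' - g0 z) * l)"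
          by (simp add: algebra_simps)
        then have "cmod (f z t v * g z t v - f z t v' * g z t v' - (f0 z * m + g0 z * l))
          \<le> (cmod (f z t v) * cmod (g z t v - g z t v' - m) + cmod (f z t v - f0 z) * cmod m)
            + (cmod (g z t v') * cmod (f z t v - f z t v' - l) + cmod (g z t v' - g0 z) * cmod l)"
          by (metis (no_types, lifting) norm_triangle_le norm_mult add_mono order_refl)
        also have "\<dots> \<le> ((C + 1) * (\<epsilon>' * nrm ?h) + \<epsilon>' * (D * nrm ?h)) + ((D + 1) * (\<epsilon>' * nrm ?h) + \<epsilon>' * (C * nrm ?h))"
          using 1 2 3 e' C(1) D(1) by (intro add_mono mult_mono) auto
        also have "\<dots> = \<epsilon>' * (2 * (C + D + 1)) * nrm ?h" by (simp add: algebra_simps)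
        also have "\<dots> \<le> \<epsilon> * nrm ?h" using ee by (intro mult_right_mono) auto
        finally show ?thesis by (simp add: l_def m_def)
      qed
      then show ?case by (simp add: x)
    qed
  qed (use C D in auto)
qed

lemma sd_inverse:
  assumes g: "sd Z g g0 M" and c: "c > 0" "\<And>z. z \<in> Z \<Longrightarrow> c \<le> cmod (g0 z)"
  shows "sd Z (\<lambda>z t v. inverse (g z t v)) (\<lambda>z. inverse (g0 z)) (\<lambda>z h. - (inverse (g0 z))\<^sup>2 * M z h)"
proof -
  obtain D where D: "D > 0" "\<And>z. z \<in> Z \<Longrightarrow> cmod (g0 z) \<le> D" "\<And>z h. z \<in> Z \<Longrightarrow> cmod (M z h) \<le> D * nrm h"
    using sd_bound[OF g] by metis
  have inv0: "cmod (inverse (g0 z)) \<le> 1 / c" if "z \<in> Z" for z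
    using frac_le[of 1 1 c "cmod (g0 z)"] c(2)[OF that] c(1) by (simp add: norm_divide inverse_eq_divide)
  have close: "cmod (inverse a - inverse (g0 z)) \<le> 2 / c\<^sup>2 * \<epsilon> \<and> cmod (inverse a) \<le> 2 / c"
    if z: "z \<in> Z" and "cmod (a - g0 z) \<le> \<epsilon>" "\<epsilon> \<le> c / 2" for z a \<epsilon>
  proof -
    have a: "cmod a \<ge> c / 2" using that c(2)[OF z] norm_triangle_ineq2[of "g0 z" a]
      by (simp add: norm_minus_commute)
    have nz: "a \<noteq> 0" "g0 z \<noteq> 0" using a c(1) c(2)[OF z] by auto
    have ia: "cmod (inverse a) \<le> 2 / c" using frac_le[of 1 1 "c / 2" "cmod a"] a c(1) by (simp add: norm_divide inverse_eq_divide)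
    have "inverse a - inverse (g0 z) = inverse a * inverse (g0 z) * (g0 z - a)"
      using nz by (simp add: field_simps)
    then have "cmod (inverse a - inverse (g0 z)) = cmod (inverse a) * cmod (inverse (g0 z)) * cmod (a - g0 z)"
      by (simp add: norm_mult norm_minus_commute)
    also have "\<dots> \<le> (2 / c) * (1 / c) * \<epsilon>"
      using ia inv0[OF z] that c(1) by (intro mult_mono) auto
    finally show ?thesis using ia by (simp add: power2_eq_square)
  qed
  show ?thesis
  proof (rule sdI[of "1 / c + (1 / c)\<^sup>2 * D"])
    show "cmod (inverse (g0 z)) \<le> 1 / c + (1 / c)\<^sup>2 * D" if "z \<in> Z" for z
      using inv0[OF that] D(1) c(1) by (simp add: add_increasing2)
    show "cmod (- (inverse (g0 z))\<^sup>2 * M z h) \<le> (1 / c + (1 / c)\<^sup>2 * D) * nrm h" if "z \<in> Z" for z h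
    proof -
      have "cmod (- (inverse (g0 z))\<^sup>2 * M z h) \<le> (1 / c)\<^sup>2 * (D * nrm h)"
        unfolding norm_mult norm_minus_cancel norm_power
        using inv0[OF that] D(3)[OF that] by (intro mult_mono power_mono) auto
      then show ?thesis using c(1) nrm_nonneg[of h] by (simp add: distrib_right add_increasing)
    qed
  next
    fix \<epsilon> :: real assume e: "\<epsilon> > 0"
    define \<epsilon>1 where "\<epsilon>1 = min (c / 2) (\<epsilon> / (2 / c\<^sup>2))"
    have e1: "\<epsilon>1 > 0" "\<epsilon>1 \<le> c / 2" using e c(1) by (auto simp: \<epsilon>1_def)
    have "\<epsilon>1 \<le> \<epsilon> / (2 / c\<^sup>2)" by (simp add: \<epsilon>1_def)
    then have e1': "2 / c\<^sup>2 * \<epsilon>1 \<le> \<epsilon>" using c(1) by (simp add: field_simps)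
    show "\<forall>\<^sub>F (t, v, v') in Fl. \<forall>z\<in>Z. cmod (inverse (g z t v) - inverse (g0 z)) \<le> \<epsilon>
       \<and> cmod (inverse (g z t v') - inverse (g0 z)) \<le> \<epsilon>"
      using sd_value[OF g e1(1)]
      by eventually_elim (use close[OF _ _ e1(2)] e1' in \<open>fastforce\<close>)
    \<comment> \<open>Both values of g stay at least c/2 in modulus, so 4/c^2 bounds the error from
      the increment of g, and 8D/c^3 the error from replacing the two reciprocals by the limiting
      one.\<close>
    define K where "K = 4 / c\<^sup>2 + 8 * D / c ^ 3"
    have K: "K > 0" using c(1) D(1) by (auto simp: K_def intro!: add_pos_pos)
    define \<epsilon>2 where "\<epsilon>2 = min (c / 2) (\<epsilon> / K)"
    have e2: "\<epsilon>2 > 0" using e c(1) K by (auto simp: \<epsilon>2_def)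
    have e2b: "\<epsilon>2 \<le> c / 2" unfolding \<epsilon>2_def by (rule min.cobounded1)
    have "\<epsilon>2 \<le> \<epsilon> / K" by (simp add: \<epsilon>2_def)
    then have e2': "K * \<epsilon>2 \<le> \<epsilon>" using K by (simp add: field_simps)
    show "\<forall>\<^sub>F (t, v, v') in Fl. \<forall>z\<in>Z. cmod (inverse (g z t v) - inverse (g z t v')
         - - (inverse (g0 z))\<^sup>2 * M z (\<lambda>i. v i - v' i)) \<le> \<epsilon> * nrm (\<lambda>i. v i - v' i)"
      using sd_strict[OF g e2] sd_value[OF g e2]
    proof eventually_elim
      case (elim x)
      obtain t v v' where x: "x = (t, v, v')" by (cases x)
      let ?h = "\<lambda>i. v i - v' i"
      have "cmod (inverse (g z t v) - inverse (g z t v') - - (inverse (g0 z))\<^sup>2 * M z ?h) \<le> \<epsilon> * nrm ?h"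
        if z: "z \<in> Z" for z
      proof -
        define m a a' i0 where "m = M z ?h" and "a = g z t v" and "a' = g z t v'" and "i0 = inverse (g0 z)"
        have 1: "cmod (a - a' - m) \<le> \<epsilon>2 * nrm ?h" "cmod (a - g0 z) \<le> \<epsilon>2" "cmod (a' - g0 z) \<le> \<epsilon>2"
          using elim z by (auto simp: x m_def a_def a'_def)
        have m: "cmod m \<le> D * nrm ?h" using D z by (auto simp: m_def)
        note ca = close[OF z 1(2) e2b, folded i0_def] close[OF z 1(3) e2b, folded i0_def]
        have nz: "a \<noteq> 0" "a' \<noteq> 0" 
          using 1 e2b c(1) c(2)[OF z] by auto
        have "inverse a - inverse a' - - i0\<^sup>2 * m
          = - (inverse a * inverse a' * (a - a' - m)) - (inverse a * (inverse a' - i0) + i0 * (inverse a - i0)) * m"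
          using nz by (simp add: field_simps power2_eq_square)
        then have "cmod (inverse a - inverse a' - - i0\<^sup>2 * m)
          \<le> cmod (inverse a) * cmod (inverse a') * cmod (a - a' - m)
           + (cmod (inverse a) * cmod (inverse a' - i0) + cmod i0 * cmod (inverse a - i0)) * cmod m"
          by (metis (no_types, lifting) norm_triangle_ineq norm_triangle_le_diff norm_minus_cancel norm_mult add_mono order_refl mult_right_mono norm_ge_zero)
        also have "\<dots> \<le> (2 / c) * (2 / c) * (\<epsilon>2 * nrm ?h) + ((2 / c) * (2 / c\<^sup>2 * \<epsilon>2) + (2 / c) * (2 / c\<^sup>2 * \<epsilon>2)) * (D * nrm ?h)"
        proof -
          have "cmod i0 \<le> 2 / c" using inv0[OF z] c(1) by (simp add: i0_def field_simps)
          then show ?thesis using 1 m ca c(1) e2 by (intro add_mono mult_mono) auto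
        qed
        also have "\<dots> = K * \<epsilon>2 * nrm ?h" using c(1) by (simp add: K_def field_simps power2_eq_square power3_eq_cube)
        also have "\<dots> \<le> \<epsilon> * nrm ?h" using e2' by (intro mult_right_mono) auto
        finally show ?thesis by (simp add: a_def a'_def i0_def m_def)
      qed
      then show ?case by (simp add: x)
    qed
  qed (use c D in auto)
qed

end

context strict_diff
begin

lemma sd_sum:
  assumes "finite A" "\<And>j. j \<in> A \<Longrightarrow> sd Z (g j) (g0 j) (M j)"
  shows "sd Z (\<lambda>z t v. \<Sum>j\<in>A. g j z t v) (\<lambda>z. \<Sum>j\<in>A. g0 j z) (\<lambda>z h. \<Sum>j\<in>A. M j z h)"
  using assms
proof (induction A rule: finite_induct)
  case empty
  then show ?case using sd_const[of "\<lambda>_. 0" 0 Z] by simp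
next
  case (insert a A)
  then show ?case using sd_add[of Z "g a" "g0 a" "M a"] by simp
qed

lemma sd_cmult:
  assumes "sd Z g g0 M"
  shows "sd Z (\<lambda>z t v. c * g z t v) (\<lambda>z. c * g0 z) (\<lambda>z h. c * M z h)"
  by (rule sd_cong[OF sd_mult[OF sd_const[OF tendsto_const[of c]] assms]]) auto

lemma sd_diff:
  assumes f: "sd Z f f0 L" and g: "sd Z g g0 M"
  shows "sd Z (\<lambda>z t v. f z t v - g z t v) (\<lambda>z. f0 z - g0 z) (\<lambda>z h. L z h - M z h)"
  by (rule sd_cong[OF sd_add[OF f sd_cmult[OF g, of "- 1"]]]) auto

text \<open>The derivative is kept in logarithmic form, since it is later recognised as a residue
  integrand.\<close>

lemma sd_prod_inverse:
  assumes "finite A" "\<And>j. j \<in> A \<Longrightarrow> sd Z (g j) (g0 j) (M j)"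
    and c: "c > 0" "\<And>z j. z \<in> Z \<Longrightarrow> j \<in> A \<Longrightarrow> c \<le> cmod (g0 j z)"
  shows "sd Z (\<lambda>z t v. \<Prod>j\<in>A. inverse (g j z t v)) (\<lambda>z. \<Prod>j\<in>A. inverse (g0 j z))
    (\<lambda>z h. - (\<Prod>j\<in>A. inverse (g0 j z)) * (\<Sum>j\<in>A. M j z h / g0 j z))"
  using assms(1,2,4)
proof (induction A rule: finite_induct)
  case empty
  then show ?case using sd_const[of "\<lambda>_. 1" 1 Z] by simp
next
  case (insert a A)
  have a: "sd Z (\<lambda>z t v. inverse (g a z t v)) (\<lambda>z. inverse (g0 a z)) (\<lambda>z h. - (inverse (g0 a z))\<^sup>2 * M a z h)"
    using insert.prems by (intro sd_inverse[OF _ c(1)]) auto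
  have A: "sd Z (\<lambda>z t v. \<Prod>j\<in>A. inverse (g j z t v)) (\<lambda>z. \<Prod>j\<in>A. inverse (g0 j z))
    (\<lambda>z h. - (\<Prod>j\<in>A. inverse (g0 j z)) * (\<Sum>j\<in>A. M j z h / g0 j z))"
    using insert by auto
  show ?case
    by (rule sd_cong[OF sd_mult[OF a A]])
      (use insert.hyps in \<open>auto simp: algebra_simps power2_eq_square divide_inverse\<close>)
qed

text \<open>Differentiation under the contour integral: uniformity on the circle times its length
  bounds the error.\<close>

lemma sd_integral:
  assumes g: "sd (sphere a r) g g0 L" and r: "r > 0"
    and int: "\<forall>\<^sub>F (t, v, v') in Fl. (\<lambda>z. g z t v) contour_integrable_on circlepath a r \<and>
                (\<lambda>z. g z t v') contour_integrable_on circlepath a r"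
    and int0: "g0 contour_integrable_on circlepath a r"
    and intL: "\<And>h. (\<lambda>z. L z h) contour_integrable_on circlepath a r"
  shows "sd Z (\<lambda>_ t v. contour_integral (circlepath a r) (\<lambda>z. g z t v))
           (\<lambda>_. contour_integral (circlepath a r) g0)
           (\<lambda>_ h. contour_integral (circlepath a r) (\<lambda>z. L z h))"
proof -
  have bound: "cmod (contour_integral (circlepath a r) f) \<le> B * (2 * pi * r)"
    if "f contour_integrable_on circlepath a r" "B \<ge> 0" "\<And>z. z \<in> sphere a r \<Longrightarrow> cmod (f z) \<le> B" for f B
    using has_contour_integral_bound_circlepath[OF has_contour_integral_integral[OF that(1)] that(2) r] that(3)
    by (auto simp: dist_norm norm_minus_commute)
  define R where "R = 2 * pi * r"
  have R: "R > 0" using r by (simp add: R_def)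
  obtain C where C: "C > 0" "\<And>z. z \<in> sphere a r \<Longrightarrow> cmod (g0 z) \<le> C"
     "\<And>z h. z \<in> sphere a r \<Longrightarrow> cmod (L z h) \<le> C * nrm h"
    using sd_bound[OF g] by metis
  show ?thesis
  proof (rule sdI[of "C * R"])
    show "cmod (contour_integral (circlepath a r) g0) \<le> C * R"
      unfolding R_def using C by (intro bound int0) auto
    show "cmod (contour_integral (circlepath a r) (\<lambda>z. L z h)) \<le> C * R * nrm h" for h
      using bound[OF intL, of "C * nrm h" h] C by (simp add: R_def mult_ac)
  next
    fix \<epsilon> :: real assume e: "\<epsilon> > 0"
    then have e': "\<epsilon> / R > 0" using R by simp
    show "\<forall>\<^sub>F (t, v, v') in Fl. \<forall>z\<in>Z.
       cmod (contour_integral (circlepath a r) (\<lambda>z. g z t v) - contour_integral (circlepath a r) g0) \<le> \<epsilon> \<and>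
       cmod (contour_integral (circlepath a r) (\<lambda>z. g z t v') - contour_integral (circlepath a r) g0) \<le> \<epsilon>"
      using sd_value[OF g e'] int
    proof eventually_elim
      case (elim x)
      obtain t v v' where x: "x = (t, v, v')" by (cases x)
      have *: "cmod (contour_integral (circlepath a r) (\<lambda>z. g z t v) - contour_integral (circlepath a r) g0) \<le> \<epsilon>"
        if "(\<lambda>z. g z t v) contour_integrable_on circlepath a r" "\<forall>z\<in>sphere a r. cmod (g z t v - g0 z) \<le> \<epsilon> / R" for v
      proof -
        have "cmod (contour_integral (circlepath a r) (\<lambda>z. g z t v - g0 z)) \<le> (\<epsilon> / R) * (2 * pi * r)"
          by (rule bound[OF contour_integrable_diff[OF that(1) int0]]) (use that(2) e' in auto)
        also have "\<dots> = \<epsilon>" unfolding R_def[symmetric] using R by simp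
        also have "contour_integral (circlepath a r) (\<lambda>z. g z t v - g0 z) =
            contour_integral (circlepath a r) (\<lambda>z. g z t v) - contour_integral (circlepath a r) g0"
          by (rule contour_integral_diff[OF that(1) int0])
        finally show ?thesis .
      qed
      then show ?case using elim by (simp add: x)
    qed
    show "\<forall>\<^sub>F (t, v, v') in Fl. \<forall>z\<in>Z.
       cmod (contour_integral (circlepath a r) (\<lambda>z. g z t v) - contour_integral (circlepath a r) (\<lambda>z. g z t v')
         - contour_integral (circlepath a r) (\<lambda>z. L z (\<lambda>i. v i - v' i))) \<le> \<epsilon> * nrm (\<lambda>i. v i - v' i)"
      using sd_strict[OF g e'] int
    proof eventually_elim
      case (elim x)
      obtain t v v' where x: "x = (t, v, v')" by (cases x)
      let ?h = "\<lambda>i. v i - v' i"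
      have i: "(\<lambda>z. g z t v) contour_integrable_on circlepath a r" "(\<lambda>z. g z t v') contour_integrable_on circlepath a r"
        using elim by (auto simp: x)
      have "cmod (contour_integral (circlepath a r) (\<lambda>z. g z t v - g z t v' - L z ?h)) \<le> (\<epsilon> / R * nrm ?h) * (2 * pi * r)"
        by (rule bound[OF contour_integrable_diff[OF contour_integrable_diff[OF i] intL]])
          (use elim(1) e' mult_nonneg_nonneg[OF less_imp_le[OF e'] nrm_nonneg] in \<open>auto simp: x\<close>)
      also have "\<dots> = \<epsilon> * nrm ?h" unfolding R_def[symmetric] using R by simp
      also have "contour_integral (circlepath a r) (\<lambda>z. g z t v - g z t v' - L z ?h) =
          contour_integral (circlepath a r) (\<lambda>z. g z t v) - contour_integral (circlepath a r) (\<lambda>z. g z t v')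
          - contour_integral (circlepath a r) (\<lambda>z. L z ?h)"
        by (simp only: contour_integral_diff[OF contour_integrable_diff[OF i] intL] contour_integral_diff[OF i])
      finally show ?case by (simp add: x)
    qed
  qed (use C R in auto)
qed

text \<open>Banach's fixed point theorem on a closed ball for \<open>nrm\<close>. The iterates form
  geometric series in each coordinate of \<open>S\<close>; values off \<open>S\<close> are not
  controlled, so the fixed point equation is asserted on \<open>S\<close> only.\<close>

lemma contraction_fixpoint:
  assumes dom: "\<And>v. nrm (\<lambda>i. v i - v0 i) \<le> \<sigma> \<Longrightarrow> nrm (\<lambda>i. T v i - v0 i) \<le> \<sigma>"
    and contr: "\<And>v v'. nrm (\<lambda>i. v i - v0 i) \<le> \<sigma> \<Longrightarrow> nrm (\<lambda>i. v' i - v0 i) \<le> \<sigma> \<Longrightarrow>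
       nrm (\<lambda>i. T v i - T v' i) \<le> nrm (\<lambda>i. v i - v' i) / 2"
    and \<sigma>: "\<sigma> \<ge> 0"
  obtains v where "nrm (\<lambda>i. v i - v0 i) \<le> \<sigma>" "\<And>i. i \<in> S \<Longrightarrow> T v i = v i"
proof -
  define X where "X n = (T ^^ n) v0" for n
  have X0: "X 0 = v0" and XS: "X (Suc n) = T (X n)" for n by (simp_all add: X_def)
  have inD: "nrm (\<lambda>i. X n i - v0 i) \<le> \<sigma>" for n
  proof (induction n)
    case 0
    then show ?case using \<sigma> by (simp add: X0 nrm_def)
  qed (use dom in \<open>simp add: XS\<close>)
  define K where "K = nrm (\<lambda>i. X 1 i - X 0 i)"
  have step: "nrm (\<lambda>i. X (Suc n) i - X n i) \<le> K * (1/2) ^ n" for n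
  proof (induction n)
    case (Suc n)
    have "nrm (\<lambda>i. X (Suc (Suc n)) i - X (Suc n) i) \<le> nrm (\<lambda>i. X (Suc n) i - X n i) / 2"
      using contr[OF inD[of "Suc n"] inD[of n]] by (simp add: XS)
    then show ?case using Suc by simp
  qed (simp add: K_def)
  define x where "x i = lim (\<lambda>n. X n i)" for i
  have "convergent (\<lambda>n. X n i)" if i: "i \<in> S" for i
  proof -
    have "summable (\<lambda>n. X (Suc n) i - X n i)"
    proof (rule summable_comparison_test[OF exI[of _ 0]])
      show "\<forall>n\<ge>0. cmod (X (Suc n) i - X n i) \<le> K * (1/2) ^ n"
        using order.trans[OF nrm_ge[OF i] step] by simp
      show "summable (\<lambda>n. K * (1/2) ^ n)" by (intro summable_mult summable_geometric) auto
    qed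
    then have "convergent (\<lambda>n. \<Sum>k<n. X (Suc k) i - X k i)"
      unfolding convergent_def by (intro exI, rule summable_LIMSEQ)
    then have "convergent (\<lambda>n. X n i - X 0 i)"
      by (subst (asm) sum_lessThan_telescope)
    from convergent_add[OF this convergent_const[of "X 0 i"]] show ?thesis by simp
  qed
  then have x: "(\<lambda>n. X n i) \<longlonglongrightarrow> x i" if "i \<in> S" for i
    unfolding x_def using that by (simp only: convergent_LIMSEQ_iff)
  have nrmlim: "(\<lambda>n. nrm (\<lambda>i. X n i - y i)) \<longlonglongrightarrow> nrm (\<lambda>i. x i - y i)" for y
    unfolding nrm_def by (intro tendsto_sum tendsto_norm tendsto_diff tendsto_const x)
  have xD: "nrm (\<lambda>i. x i - v0 i) \<le> \<sigma>"
    by (rule LIMSEQ_le_const2[OF nrmlim]) (use inD in auto)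
  have "T x i = x i" if i: "i \<in> S" for i
  proof -
    have "(\<lambda>n. nrm (\<lambda>i. X n i - x i) / 2) \<longlonglongrightarrow> 0"
      using tendsto_divide[OF nrmlim[of x] tendsto_const[of 2]] by (simp add: nrm_def)
    moreover have "\<forall>n. cmod (X (Suc n) i - T x i) \<le> nrm (\<lambda>i. X n i - x i) / 2"
      using order.trans[OF nrm_ge[OF i] contr[OF inD xD]] unfolding XS by simp
    ultimately have "(\<lambda>n. X (Suc n) i - T x i) \<longlonglongrightarrow> 0"
      by (rule Lim_null_comparison[OF always_eventually, rotated])
    then have "(\<lambda>n. X (Suc n) i) \<longlonglongrightarrow> T x i" by (simp add: LIM_zero_iff)
    moreover have "(\<lambda>n. X (Suc n) i) \<longlonglongrightarrow> x i" using x[OF i] by (rule LIMSEQ_Suc)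
    ultimately show ?thesis by (rule LIMSEQ_unique)
  qed
  then show ?thesis using that xD by blast
qed

text \<open>Newton's map with the inverse of the derivative frozen at the base point is a
  contraction. The admissible radius \<open>\<rho>0\<close> is fixed first and works for every
  smaller \<rho>; only the bound on t depends on \<rho>. This allows radii to be shrunk later to
  separate different limit points.\<close>

lemma implicit_solution:
  assumes sd: "\<And>i. i \<in> S \<Longrightarrow> sd {0} (\<lambda>z t v. \<Phi> i t v) (\<lambda>z. 0) (\<lambda>z h. L i h)"
    and lin: "\<And>i h. i \<in> S \<Longrightarrow> L i h = (\<Sum>j\<in>S. A i j * h j)"
    and inj: "\<And>h. (\<And>i. i \<in> S \<Longrightarrow> L i h = 0) \<Longrightarrow> (\<And>j. j \<in> S \<Longrightarrow> h j = 0)"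
  shows "\<exists>\<rho>0>0. \<forall>\<rho>. 0 < \<rho> \<longrightarrow> \<rho> \<le> \<rho>0 \<longrightarrow> (\<exists>\<delta>>0. \<forall>t. 0 < t \<longrightarrow> t < \<delta> \<longrightarrow>
     (\<exists>!v. v \<in> S \<rightarrow>\<^sub>E UNIV \<and> near \<rho> v \<and> (\<forall>i\<in>S. \<Phi> i t v = 0)))"
proof -
  obtain B where AB: "\<And>i k. i \<in> S \<Longrightarrow> k \<in> S \<Longrightarrow> (\<Sum>j\<in>S. A i j * B j k) = (if i = k then 1 else 0)"
    and BA: "\<And>i k. i \<in> S \<Longrightarrow> k \<in> S \<Longrightarrow> (\<Sum>j\<in>S. B i j * A j k) = (if i = k then 1 else 0)"
  proof (rule injective_system_inverse[OF finS, of A])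
    show "h j = 0" if "\<And>i. i \<in> S \<Longrightarrow> (\<Sum>j\<in>S. A i j * h j) = 0" "j \<in> S" for h j
      using inj[of h j] lin that by auto
  qed blast
  define C where "C = (\<Sum>i\<in>S. \<Sum>j\<in>S. cmod (B i j)) + 1"
  have C: "C \<ge> 1" by (simp add: C_def sum_nonneg)
  have Bnrm: "nrm (\<lambda>i. \<Sum>j\<in>S. B i j * y j) \<le> C * K" if "\<And>j. j \<in> S \<Longrightarrow> cmod (y j) \<le> K" "K \<ge> 0" for y K
  proof -
    have "nrm (\<lambda>i. \<Sum>j\<in>S. B i j * y j) \<le> (\<Sum>i\<in>S. \<Sum>j\<in>S. cmod (B i j) * K)"
      unfolding nrm_def
    proof (rule sum_mono)
      fix i assume "i \<in> S"
      have "cmod (\<Sum>j\<in>S. B i j * y j) \<le> (\<Sum>j\<in>S. cmod (B i j * y j))" by (rule norm_sum)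
      also have "\<dots> \<le> (\<Sum>j\<in>S. cmod (B i j) * K)"
        unfolding norm_mult using that by (intro sum_mono mult_left_mono) auto
      finally show "cmod (\<Sum>j\<in>S. B i j * y j) \<le> (\<Sum>j\<in>S. cmod (B i j) * K)" .
    qed
    also have "\<dots> = (C - 1) * K" by (simp add: C_def sum_distrib_right)
    also have "\<dots> \<le> C * K" using that by (intro mult_right_mono) auto
    finally show ?thesis .
  qed
  \<comment> \<open>The simplified Newton map v - B \<Phi>(t, v); its fixed points are the zeros of
    \<Phi> because A B = 1.\<close>
  define T where "T t v i = v i - (\<Sum>j\<in>S. B i j * \<Phi> j t v)" for t v i
  have BL: "(\<Sum>j\<in>S. B i j * L j h) = h i" if i: "i \<in> S" for i h
  proof -
    have "(\<Sum>j\<in>S. B i j * L j h) = (\<Sum>j\<in>S. \<Sum>k\<in>S. B i j * A j k * h k)"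
      by (intro sum.cong refl) (simp add: lin sum_distrib_left mult.assoc)
    also have "\<dots> = (\<Sum>k\<in>S. (\<Sum>j\<in>S. B i j * A j k) * h k)"
      by (subst sum.swap) (simp add: sum_distrib_right)
    also have "\<dots> = (\<Sum>k\<in>S. if i = k then h k else 0)"
      using BA i by (intro sum.cong) auto
    finally show ?thesis using i finS by simp
  qed
  have TT: "nrm (\<lambda>i. T t v i - T t v' i) \<le> C * K" if
     "\<And>j. j \<in> S \<Longrightarrow> cmod (\<Phi> j t v - \<Phi> j t v' - L j (\<lambda>i. v i - v' i)) \<le> K" "K \<ge> 0" for t v v' K
  proof -
    have "nrm (\<lambda>i. T t v i - T t v' i) = nrm (\<lambda>i. \<Sum>j\<in>S. B i j * - (\<Phi> j t v - \<Phi> j t v' - L j (\<lambda>i. v i - v' i)))"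
      unfolding nrm_def
    proof (intro sum.cong refl)
      fix i assume i: "i \<in> S"
      have "(\<Sum>j\<in>S. B i j * - (\<Phi> j t v - \<Phi> j t v' - L j (\<lambda>i. v i - v' i)))
        = (\<Sum>j\<in>S. B i j * L j (\<lambda>i. v i - v' i)) - (\<Sum>j\<in>S. B i j * \<Phi> j t v) + (\<Sum>j\<in>S. B i j * \<Phi> j t v')"
        by (simp add: algebra_simps sum.distrib sum_subtractf)
      also have "\<dots> = T t v i - T t v' i" by (simp add: BL[OF i] T_def)
      finally show "cmod (T t v i - T t v' i) = cmod (\<Sum>j\<in>S. B i j * - (\<Phi> j t v - \<Phi> j t v' - L j (\<lambda>i. v i - v' i)))"
        by simp
    qed
    also have "\<dots> \<le> C * K" using that by (intro Bnrm) (simp_all add: norm_minus_commute)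
    finally show ?thesis .
  qed
  have T0: "T t v i = v i \<longleftrightarrow> (\<Sum>j\<in>S. B i j * \<Phi> j t v) = 0" for t v i by (simp add: T_def)
  have zero: "\<forall>i\<in>S. \<Phi> i t v = 0" if "\<And>i. i \<in> S \<Longrightarrow> T t v i = v i" for t v
  proof
    fix i assume i: "i \<in> S"
    have "0 = (\<Sum>k\<in>S. A i k * (\<Sum>j\<in>S. B k j * \<Phi> j t v))" using that by (simp add: T0)
    also have "\<dots> = (\<Sum>j\<in>S. (\<Sum>k\<in>S. A i k * B k j) * \<Phi> j t v)"
      unfolding sum_distrib_left sum_distrib_right by (subst sum.swap) (simp add: mult.assoc)
    also have "\<dots> = (\<Sum>j\<in>S. if i = j then \<Phi> j t v else 0)" using AB i by (intro sum.cong) auto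
    finally show "\<Phi> i t v = 0" using i finS by simp
  qed
  have "\<forall>\<^sub>F (t, v, v') in Fl. \<forall>i\<in>S. cmod (\<Phi> i t v - \<Phi> i t v' - L i (\<lambda>i. v i - v' i)) \<le> 1 / (2 * C) * nrm (\<lambda>i. v i - v' i)"
    using sd_strict[OF sd, of _ "1 / (2 * C)"] C finS
    by (simp add: case_prod_unfold eventually_ball_finite)
  then obtain \<rho>0 where \<rho>0: "\<rho>0 > 0" and strict: "\<And>t v v' i. 0 < t \<Longrightarrow> t < \<rho>0 \<Longrightarrow> near \<rho>0 v \<Longrightarrow> near \<rho>0 v' \<Longrightarrow> i \<in> S \<Longrightarrow>
      cmod (\<Phi> i t v - \<Phi> i t v' - L i (\<lambda>i. v i - v' i)) \<le> 1 / (2 * C) * nrm (\<lambda>i. v i - v' i)"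
    unfolding eventually_Fl by auto
  \<comment> \<open>\<open>C\<close> bounds the inverse matrix, so the tolerance 1/(2C) yields the
    contraction factor 1/2. The radius does not yet depend on \<rho>.\<close>
  have contr: "nrm (\<lambda>i. T t v i - T t v' i) \<le> nrm (\<lambda>i. v i - v' i) / 2"
    if "0 < t" "t < \<rho>0" "near \<rho>0 v" "near \<rho>0 v'" for t v v'
  proof -
    have "nrm (\<lambda>i. T t v i - T t v' i) \<le> C * (1 / (2 * C) * nrm (\<lambda>i. v i - v' i))"
      using strict[OF that] C by (intro TT) auto
    also have "\<dots> = nrm (\<lambda>i. v i - v' i) / 2" using C by simp
    finally show ?thesis .
  qed
  have "\<exists>\<delta>>0. \<forall>t. 0 < t \<longrightarrow> t < \<delta> \<longrightarrow> (\<exists>!v. v \<in> S \<rightarrow>\<^sub>E UNIV \<and> near \<rho> v \<and> (\<forall>i\<in>S. \<Phi> i t v = 0))"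
    if \<rho>: "0 < \<rho>" "\<rho> \<le> \<rho>0" for \<rho>
  proof -
    \<comment> \<open>The closed \<open>nrm\<close>-ball of radius \<rho>/2 lies strictly inside the
      coordinatewise neighbourhood of radius \<rho>.\<close>
    define \<sigma> where "\<sigma> = \<rho> / 2"
    have \<sigma>: "0 < \<sigma>" "\<sigma> < \<rho>" using \<rho> by (auto simp: \<sigma>_def)
    have nearn: "near \<rho> v" if "nrm (\<lambda>i. v i - v0 i) \<le> \<sigma>" for v
      unfolding near_def using nrm_ge[of _ "\<lambda>i. v i - v0 i"] that \<sigma> by force
    have "\<forall>\<^sub>F (t, v, v') in Fl. \<forall>i\<in>S. cmod (\<Phi> i t v) \<le> \<sigma> / (2 * C)"
    proof -
      have "\<forall>\<^sub>F (t, v, v') in Fl. cmod (\<Phi> i t v) \<le> \<sigma> / (2 * C)" if "i \<in> S" for i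
        using sd_value[OF sd[OF that], of "\<sigma> / (2 * C)"] C \<sigma> by (auto simp: case_prod_unfold elim: eventually_mono)
      then show ?thesis using finS by (simp add: case_prod_unfold eventually_ball_finite)
    qed
    then obtain \<delta> where \<delta>: "\<delta> > 0" and small: "\<And>t v i. 0 < t \<Longrightarrow> t < \<delta> \<Longrightarrow> near \<delta> v \<Longrightarrow> i \<in> S \<Longrightarrow> cmod (\<Phi> i t v) \<le> \<sigma> / (2 * C)"
      unfolding eventually_Fl by auto
    have "\<exists>!v. v \<in> S \<rightarrow>\<^sub>E UNIV \<and> near \<rho> v \<and> (\<forall>i\<in>S. \<Phi> i t v = 0)"
      if t: "0 < t" "t < min \<delta> \<rho>0" for t
    proof -
      have nv0: "near \<epsilon> v0" if "\<epsilon> > 0" for \<epsilon> using that by (simp add: near_def)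
      have n0: "near \<rho>0 v" if "near \<rho> v" for v using near_mono[OF that \<rho>(2)] .
      obtain v where v: "nrm (\<lambda>i. v i - v0 i) \<le> \<sigma>" "\<And>i. i \<in> S \<Longrightarrow> T t v i = v i"
      proof (rule contraction_fixpoint[of \<sigma> "T t"])
        fix v assume v: "nrm (\<lambda>i. v i - v0 i) \<le> \<sigma>"
        have "nrm (\<lambda>i. T t v i - v0 i) \<le> nrm (\<lambda>i. T t v i - T t v0 i) + nrm (\<lambda>i. T t v0 i - v0 i)"
          unfolding nrm_def sum.distrib[symmetric]
        proof (rule sum_mono)
          fix i
          show "cmod (T t v i - v0 i) \<le> cmod (T t v i - T t v0 i) + cmod (T t v0 i - v0 i)"
            using norm_triangle_ineq[of "T t v i - T t v0 i" "T t v0 i - v0 i"] by simp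
        qed
        also have "nrm (\<lambda>i. T t v i - T t v0 i) \<le> \<sigma> / 2"
          using contr[of t v v0] t v n0[OF nearn[OF v]] nv0[OF \<rho>0] by simp
        also have "nrm (\<lambda>i. T t v0 i - v0 i) = nrm (\<lambda>i. \<Sum>j\<in>S. B i j * \<Phi> j t v0)"
          unfolding nrm_def T_def by (intro sum.cong) auto
        also have "\<dots> \<le> C * (\<sigma> / (2 * C))"
          using small[of t v0] t nv0[OF \<delta>] \<sigma> C by (intro Bnrm) auto
        also have "\<dots> = \<sigma> / 2" using C by simp
        finally show "nrm (\<lambda>i. T t v i - v0 i) \<le> \<sigma>" by simp
      next
        fix v v' assume "nrm (\<lambda>i. v i - v0 i) \<le> \<sigma>" "nrm (\<lambda>i. v' i - v0 i) \<le> \<sigma>"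
        then show "nrm (\<lambda>i. T t v i - T t v' i) \<le> nrm (\<lambda>i. v i - v' i) / 2"
          using t by (intro contr n0 nearn) auto
      qed (use \<sigma> in auto)
      \<comment> \<open>Uniqueness is stated among functions extended by \<open>undefined\<close>
        off \<open>S\<close>. The contraction estimate itself shows that changing v off
        \<open>S\<close> does not change T on \<open>S\<close>.\<close>
      define w where "w = restrict v S"
      have nw: "near \<rho> w" using nearn[OF v(1)] by (simp add: near_def w_def)
      have "nrm (\<lambda>i. T t w i - T t v i) \<le> nrm (\<lambda>i. w i - v i) / 2"
        using t nw nearn[OF v(1)] by (intro contr n0) auto
      also have "\<dots> = 0" by (simp add: nrm_def w_def)
      finally have "nrm (\<lambda>i. T t w i - T t v i) = 0" using nrm_nonneg[of "\<lambda>i. T t w i - T t v i"] by linarith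
      then have "T t w i = w i" if "i \<in> S" for i
        using nrm_ge[OF that, of "\<lambda>i. T t w i - T t v i"] v(2)[OF that] that by (simp add: w_def)
      then have "\<forall>i\<in>S. \<Phi> i t w = 0" by (rule zero)
      moreover have "v' = v''" if "v' \<in> S \<rightarrow>\<^sub>E UNIV" "near \<rho> v'" "\<forall>i\<in>S. \<Phi> i t v' = 0"
         "v'' \<in> S \<rightarrow>\<^sub>E UNIV" "near \<rho> v''" "\<forall>i\<in>S. \<Phi> i t v'' = 0" for v' v''
      proof (rule PiE_ext[OF that(1,4)])
        fix i assume i: "i \<in> S"
        have "nrm (\<lambda>i. T t v' i - T t v'' i) \<le> nrm (\<lambda>i. v' i - v'' i) / 2"
          using t that by (intro contr n0) auto
        moreover have "T t v' = v'" "T t v'' = v''" using that by (auto simp: T_def fun_eq_iff)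
        ultimately have "nrm (\<lambda>i. v' i - v'' i) \<le> 0" by simp
        then have "cmod (v' i - v'' i) \<le> 0" using nrm_ge[OF i, of "\<lambda>i. v' i - v'' i"] by linarith
        then show "v' i = v'' i" by simp
      qed
      ultimately show ?thesis using nw by (intro ex1I[of _ w]) (auto simp: w_def)
    qed
    then show ?thesis using \<delta> \<rho>0 by (intro exI[of _ "min \<delta> \<rho>0"]) auto
  qed
  then show ?thesis using \<rho>0 by blast
qed

end

section \<open>Lagrange interpolation and contour integrals around clusters\<close>

text \<open>The derivative at \<open>w i\<close> of the monic polynomial with roots
  \<open>w j\<close>; its inverse is the residue of the reciprocal polynomial there.\<close>

definition diffprod :: "'a set \<Rightarrow> ('a \<Rightarrow> complex) \<Rightarrow> 'a \<Rightarrow> complex" where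
  "diffprod S w i = (\<Prod>j\<in>S - {i}. w i - w j)"

lemma diffprod_nonzero: "finite S \<Longrightarrow> inj_on w S \<Longrightarrow> i \<in> S \<Longrightarrow> diffprod S w i \<noteq> 0"
  by (auto simp: diffprod_def inj_on_def)

lemma poly_eq_0_if_many_roots:
  fixes p :: "complex poly"
  assumes "finite S" "inj_on w S" "\<And>i. i \<in> S \<Longrightarrow> poly p (w i) = 0" "degree p < card S"
  shows "p = 0"
proof (rule ccontr)
  assume "p \<noteq> 0"
  then have "card (w ` S) \<le> degree p"
    using assms(3) by (intro order.trans[OF card_mono card_poly_roots_bound[of p]] poly_roots_finite) auto
  then show False using assms by (simp add: card_image)
qed

text \<open>Interpolation polynomial and q agree at \<open>card S\<close> points and both have
  smaller degree. Only q = 1 is used afterwards: it gives the partial fractions of the reciprocal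
  product.\<close>

lemma lagrange_sum_poly:
  fixes w :: "'a \<Rightarrow> complex"
  assumes fin: "finite S" and ne: "S \<noteq> {}" and inj: "inj_on w S"
    and that: "\<And>i. i \<in> S \<Longrightarrow> poly q (w i) = y i" "degree q < card S"
  shows "(\<Sum>i\<in>S. smult (y i * inverse (diffprod S w i)) (\<Prod>j\<in>S - {i}. [:- w j, 1:])) - q = 0"
proof (rule poly_eq_0_if_many_roots[OF fin inj])
  fix i assume i: "i \<in> S"
  have "poly (\<Sum>i\<in>S. smult (y i * inverse (diffprod S w i)) (\<Prod>j\<in>S - {i}. [:- w j, 1:])) (w i)
     = (\<Sum>k\<in>S. if k = i then y i else 0)"
    unfolding poly_sum
  proof (intro sum.cong refl)
    fix k assume k: "k \<in> S"
    show "poly (smult (y k * inverse (diffprod S w k)) (\<Prod>j\<in>S - {k}. [:- w j, 1:])) (w i) = (if k = i then y i else 0)"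
    proof (cases "k = i")
      case True
      then show ?thesis using diffprod_nonzero[OF fin inj i] by (simp add: poly_prod diffprod_def)
    next
      case False
      then have "(\<Prod>j\<in>S - {k}. w i - w j) = 0" using i fin by (auto intro!: prod_zero)
      then show ?thesis using False by (simp add: poly_prod)
    qed
  qed
  then show "poly ((\<Sum>i\<in>S. smult (y i * inverse (diffprod S w i)) (\<Prod>j\<in>S - {i}. [:- w j, 1:])) - q) (w i) = 0"
    using fin i that by simp
next
  have c: "card S > 0" using fin ne by (simp add: card_gt_0_iff)
  have "degree (\<Prod>j\<in>S - {i}. [:- w j, 1:]) < card S" if "i \<in> S" for i
    using that fin c by (subst degree_prod_eq_sum_degree) auto
  then show "degree ((\<Sum>i\<in>S. smult (y i * inverse (diffprod S w i)) (\<Prod>j\<in>S - {i}. [:- w j, 1:])) - q) < card S"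
    using c that(2) by (intro degree_diff_less degree_sum_less) (auto intro: le_less_trans[OF degree_smult_le])
qed

lemma prod_inverse_partial_fractions:
  assumes fin: "finite S" and ne: "S \<noteq> {}" and inj: "inj_on w S" and z: "z \<notin> w ` S"
  shows "(\<Prod>j\<in>S. inverse (z - w j)) = (\<Sum>i\<in>S. inverse (diffprod S w i) * inverse (z - w i))"
proof -
  have "poly ((\<Sum>i\<in>S. smult (1 * inverse (diffprod S w i)) (\<Prod>j\<in>S - {i}. [:- w j, 1:])) - 1) z = 0"
    by (subst lagrange_sum_poly[OF fin ne inj, where q = 1 and y = "\<lambda>_. 1"]) (use fin ne in \<open>auto simp: card_gt_0_iff\<close>)
  then have 1: "1 = (\<Sum>i\<in>S. inverse (diffprod S w i) * (\<Prod>j\<in>S - {i}. z - w j))"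
    by (simp add: poly_sum poly_prod)
  have nz: "z - w j \<noteq> 0" if "j \<in> S" for j using z that by auto
  have "(\<Prod>j\<in>S. inverse (z - w j)) = (\<Prod>j\<in>S. inverse (z - w j)) * 1" by simp
  also have "\<dots> = (\<Sum>i\<in>S. inverse (diffprod S w i) * inverse (z - w i))"
    unfolding 1 sum_distrib_left
  proof (intro sum.cong refl)
    fix i assume i: "i \<in> S"
    have "(\<Prod>j\<in>S - {i}. inverse (z - w j)) * (\<Prod>j\<in>S - {i}. z - w j) = 1"
      unfolding prod.distrib[symmetric] using nz by (intro prod.neutral) auto
    then show "(\<Prod>j\<in>S. inverse (z - w j)) * (inverse (diffprod S w i) * (\<Prod>j\<in>S - {i}. z - w j)) =
         inverse (diffprod S w i) * inverse (z - w i)"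
      by (subst prod.remove[OF fin i]) (simp add: mult_ac)
  qed
  finally show ?thesis .
qed

text \<open>The coefficient of degree \<open>card S - 1\<close> in the Lagrange formula for the
  constant 1; equivalently, the sum of all residues.\<close>

lemma sum_inverse_diffprod:
  assumes fin: "finite S" and c: "card S \<ge> 2" and inj: "inj_on w S"
  shows "(\<Sum>i\<in>S. inverse (diffprod S w i)) = 0"
proof -
  have ne: "S \<noteq> {}" using c by auto
  have "coeff ((\<Sum>i\<in>S. smult (1 * inverse (diffprod S w i)) (\<Prod>j\<in>S - {i}. [:- w j, 1:])) - 1) (card S - 1) = 0"
    by (subst lagrange_sum_poly[OF fin ne inj, where q = 1 and y = "\<lambda>_. 1"]) (use fin ne c in \<open>auto simp: card_gt_0_iff\<close>)
  moreover have "coeff (\<Prod>j\<in>S - {i}. [:- w j, 1:]) (card S - 1) = 1" if "i \<in> S" for i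
  proof -
    have "degree (\<Prod>j\<in>S - {i}. [:- w j, 1:]) = card S - 1"
      using that fin by (subst degree_prod_eq_sum_degree) auto
    moreover have "lead_coeff (\<Prod>j\<in>S - {i}. [:- w j, 1:]) = 1" by (simp add: lead_coeff_prod)
    ultimately show ?thesis by simp
  qed
  ultimately show ?thesis using c by (simp add: coeff_sum)
qed

lemma circle_integral_inverse:
  assumes "\<epsilon> > 0" "cmod (\<xi> - \<eta>) \<noteq> \<epsilon>"
  shows "((\<lambda>z. inverse (z - \<xi>)) has_contour_integral (if cmod (\<xi> - \<eta>) < \<epsilon> then 2 * of_real pi * \<i> else 0)) (circlepath \<eta> \<epsilon>)"
proof (cases "cmod (\<xi> - \<eta>) < \<epsilon>")
  case True
  then show ?thesis using Cauchy_integral_circlepath_simple[of "\<lambda>_. 1" \<eta> \<epsilon> \<xi>]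
    by (simp add: divide_inverse)
next
  case False
  have "((\<lambda>z. inverse (z - \<xi>)) has_contour_integral 0) (circlepath \<eta> \<epsilon>)"
  proof (rule Cauchy_theorem_disc_simple[of _ \<eta> "cmod (\<xi> - \<eta>)"])
    show "(\<lambda>z. inverse (z - \<xi>)) holomorphic_on ball \<eta> (cmod (\<xi> - \<eta>))"
      by (intro holomorphic_intros) (auto simp: dist_norm norm_minus_commute)
    show "path_image (circlepath \<eta> \<epsilon>) \<subseteq> ball \<eta> (cmod (\<xi> - \<eta>))"
      using assms False by (auto simp: dist_norm)
  qed auto
  then show ?thesis using False by simp
qed

text \<open>A circle that separates the points of \<open>J\<close> from the rest picks up just their
  residues. Individual terms blow up when points of \<open>J\<close> merge, the integral does
  not.\<close>

lemma cluster_integral: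
  assumes fin: "finite S" and inj: "inj_on w S" and e: "\<epsilon> > 0" and J: "J \<subseteq> S" "J \<noteq> {}"
    and ins: "\<And>i. i \<in> J \<Longrightarrow> cmod (w i - \<eta>) < \<epsilon>" and out: "\<And>i. i \<in> S - J \<Longrightarrow> cmod (w i - \<eta>) > \<epsilon>"
  shows "((\<lambda>z. \<Prod>j\<in>S. inverse (z - w j)) has_contour_integral
      (2 * of_real pi * \<i> * (\<Sum>i\<in>J. inverse (diffprod S w i)))) (circlepath \<eta> \<epsilon>)"
proof -
  have ne: "S \<noteq> {}" using J by auto
  have off: "cmod (w i - \<eta>) \<noteq> \<epsilon>" if "i \<in> S" for i using that ins[of i] out[of i] by (cases "i \<in> J") auto
  have "((\<lambda>z. \<Sum>i\<in>S. inverse (diffprod S w i) * inverse (z - w i)) has_contour_integral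
     (\<Sum>i\<in>S. inverse (diffprod S w i) * (if cmod (w i - \<eta>) < \<epsilon> then 2 * of_real pi * \<i> else 0))) (circlepath \<eta> \<epsilon>)"
    by (intro has_contour_integral_sum[OF fin] has_contour_integral_lmul circle_integral_inverse e off)
  moreover have "(\<Sum>i\<in>S. inverse (diffprod S w i) * (if cmod (w i - \<eta>) < \<epsilon> then 2 * of_real pi * \<i> else 0))
     = 2 * of_real pi * \<i> * (\<Sum>i\<in>J. inverse (diffprod S w i))"
  proof -
    have "(\<Sum>i\<in>S. inverse (diffprod S w i) * (if cmod (w i - \<eta>) < \<epsilon> then 2 * of_real pi * \<i> else 0))
      = (\<Sum>i\<in>J. 2 * of_real pi * \<i> * inverse (diffprod S w i))"
    proof (rule sum.mono_neutral_cong_right[OF fin J(1)])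
      show "\<forall>i\<in>S - J. inverse (diffprod S w i) * (if cmod (w i - \<eta>) < \<epsilon> then 2 * of_real pi * \<i> else 0) = 0"
        using out by (metis mult_zero_right not_less_iff_gr_or_eq)
    qed (use ins in auto)
    then show ?thesis by (simp add: sum_distrib_left)
  qed
  moreover have "(\<Sum>i\<in>S. inverse (diffprod S w i) * inverse (z - w i)) = (\<Prod>j\<in>S. inverse (z - w j))"
    if "z \<in> path_image (circlepath \<eta> \<epsilon>)" for z
  proof (rule prod_inverse_partial_fractions[OF fin ne inj, symmetric])
    show "z \<notin> w ` S" using that e off by (auto simp: dist_norm norm_minus_commute)
  qed
  ultimately show ?thesis by (metis (no_types, lifting) has_contour_integral_eq)
qed

lemma residue_circle:
  assumes fin: "finite A" and e: "\<epsilon> > 0" and A: "\<And>a. a \<in> A \<Longrightarrow> a = \<eta> \<or> cmod (a - \<eta>) > \<epsilon>"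
    and f: "f holomorphic_on - A"
  shows "(f has_contour_integral 2 * pi * \<i> * residue f \<eta>) (circlepath \<eta> \<epsilon>)"
proof (rule base_residue[of "- (A - {\<eta>})"])
  show "open (- (A - {\<eta>}))" by (intro open_Compl finite_imp_closed finite_Diff fin)
  show "f holomorphic_on - (A - {\<eta>}) - {\<eta>}" by (rule holomorphic_on_subset[OF f]) auto
  show "cball \<eta> \<epsilon> \<subseteq> - (A - {\<eta>})" using A by (force simp: dist_norm norm_minus_commute)
qed (use e in auto)

lemma uniform_limit_prod_inverse:
  fixes f :: "'a \<Rightarrow> 'n \<Rightarrow> 'z \<Rightarrow> complex"
  assumes "finite I" "\<And>j. j \<in> I \<Longrightarrow> uniform_limit Z (f j) (l j) F"
    and "\<And>j. j \<in> I \<Longrightarrow> \<exists>b>0. \<forall>z\<in>Z. b \<le> cmod (l j z)"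
  shows "uniform_limit Z (\<lambda>n z. \<Prod>j\<in>I. inverse (f j n z)) (\<lambda>z. \<Prod>j\<in>I. inverse (l j z)) F \<and>
     bounded ((\<lambda>z. \<Prod>j\<in>I. inverse (l j z)) ` Z)"
  using assms
proof (induction I rule: finite_induct)
  case empty
  have "bounded ((\<lambda>z. 1 :: complex) ` Z)" by (rule bounded_subset[of "{1}"]) auto
  then show ?case by (simp add: uniform_limit_const)
next
  case (insert a I)
  obtain b where b: "b > 0" "\<forall>z\<in>Z. b \<le> cmod (l a z)" using insert.prems by blast
  have 1: "uniform_limit Z (\<lambda>n z. inverse (f a n z)) (\<lambda>z. inverse (l a z)) F"
    using uniform_lim_inverse[OF insert.prems(1)[of a] _ b(1)] b(2) by (auto simp: o_def)
  have 2: "cmod (inverse (l a z)) \<le> inverse b" if "z \<in> Z" for z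
    using b that by (simp add: norm_inverse le_imp_inverse_le)
  then have 2: "bounded ((\<lambda>z. inverse (l a z)) ` Z)" unfolding bounded_iff by blast
  have 3: "uniform_limit Z (\<lambda>n z. \<Prod>j\<in>I. inverse (f j n z)) (\<lambda>z. \<Prod>j\<in>I. inverse (l j z)) F"
    "bounded ((\<lambda>z. \<Prod>j\<in>I. inverse (l j z)) ` Z)" using insert by auto
  have "bounded ((\<lambda>z. inverse (l a z) * (\<Prod>j\<in>I. inverse (l j z))) ` Z)"
  proof -
    obtain A B where A: "\<And>z. z \<in> Z \<Longrightarrow> cmod (inverse (l a z)) \<le> A" and B: "\<And>z. z \<in> Z \<Longrightarrow> cmod (\<Prod>j\<in>I. inverse (l j z)) \<le> B"
      using 2 3(2) unfolding bounded_iff by auto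
    have "cmod (inverse (l a z) * (\<Prod>j\<in>I. inverse (l j z))) \<le> A * B" if "z \<in> Z" for z
      unfolding norm_mult using A[OF that] B[OF that] by (intro mult_mono) (auto intro: order.trans[OF norm_ge_zero])
    then show ?thesis unfolding bounded_iff by blast
  qed
  then show ?case using insert.hyps uniform_lim_mult[OF 1 3(1) 2 3(2)] by simp
qed

lemma uniform_limit_affine:
  fixes b a w :: "'n \<Rightarrow> complex"
  assumes "((\<lambda>n. b n - w n) \<longlongrightarrow> l) F" "(a \<longlongrightarrow> a0) F" "bounded Z"
  shows "uniform_limit Z (\<lambda>n z. b n + a n * z - w n) (\<lambda>z. l + a0 * z) F"
proof -
  have "uniform_limit Z (\<lambda>n z. (b n - w n) + a n * z) (\<lambda>z. l + a0 * z) F"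
  proof (intro uniform_limit_add uniform_lim_mult)
    show "uniform_limit Z (\<lambda>n z. b n - w n) (\<lambda>z. l) F"
      using assms(1) by (auto simp: uniform_limit_iff tendsto_iff elim: eventually_mono)
    show "uniform_limit Z (\<lambda>n z. a n) (\<lambda>z. a0) F"
      using assms(2) by (auto simp: uniform_limit_iff tendsto_iff elim: eventually_mono)
    show "bounded ((\<lambda>z. a0) ` Z)" by (rule bounded_subset[of "{a0}"]) auto
    show "bounded ((\<lambda>z. z) ` Z)" using assms(3) by simp
  qed (rule uniform_limit_const)
  then show ?thesis by (simp add: algebra_simps)
qed

text \<open>In the coordinate z = b + a * zeta the points of \<open>I\<close> converge to \<xi> and
  the others leave every bounded region, so the rescaled integrand converges uniformly on a small
  circle around \<eta>. The limit of the integrals is a residue of the limiting product times the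
  constant contributed by the distant points. It is used with \<open>I = S\<close> and a scale
  tending to infinity, with \<open>I = S\<close> and scale 1, and with \<open>I\<close> a cluster
  and a scale tending to 0.\<close>

lemma cluster_scaling_limit:
  fixes w :: "nat \<Rightarrow> 'a \<Rightarrow> complex" and a :: "nat \<Rightarrow> real"
  assumes fin: "finite S" and I: "I \<subseteq> S" and inj: "\<And>n. inj_on (w n) S" and a: "\<And>n. a n > 0"
    and lim: "\<And>i. i \<in> I \<Longrightarrow> (\<lambda>n. (w n i - b n) / a n) \<longlonglongrightarrow> \<xi> i"
    and lim': "\<And>j. j \<in> S - I \<Longrightarrow> (\<lambda>n. w n j - b n) \<longlonglongrightarrow> \<omega> j" "\<And>j. j \<in> S - I \<Longrightarrow> \<omega> j \<noteq> 0"
    and a0: "S - I \<noteq> {} \<Longrightarrow> a \<longlonglongrightarrow> 0"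
    and \<eta>: "\<eta> \<in> \<xi> ` I"
  defines "J \<equiv> {i \<in> I. \<xi> i = \<eta>}"
  shows "(\<lambda>n. of_real (a n ^ (card I - 1)) * (\<Sum>i\<in>J. inverse (diffprod S (w n) i))) \<longlonglongrightarrow>
     (\<Prod>j\<in>S - I. inverse (- \<omega> j)) * residue (\<lambda>z. \<Prod>j\<in>I. inverse (z - \<xi> j)) \<eta>"
proof -
  have finI: "finite I" using fin I finite_subset by blast
  have J: "J \<subseteq> S" "J \<noteq> {}" using \<eta> I by (auto simp: J_def)
  \<comment> \<open>The radius is half the distance from \<eta> to the other limit points; the
    inserted 1 keeps the minimum defined when there are none.\<close>
  define D where "D = insert 1 ((\<lambda>i. cmod (\<xi> i - \<eta>)) ` (I - J))"
  have D: "finite D" "D \<noteq> {}" "\<And>x. x \<in> D \<Longrightarrow> x > 0" using finI by (auto simp: D_def J_def)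
  define \<epsilon> where "\<epsilon> = Min D / 2"
  have "Min D > 0" using D by simp
  then have e: "\<epsilon> > 0" and "Min D > \<epsilon>" by (auto simp: \<epsilon>_def)
  then have far: "cmod (\<xi> i - \<eta>) > \<epsilon>" if "i \<in> I - J" for i
    using Min_le[OF D(1), of "cmod (\<xi> i - \<eta>)"] that by (auto simp: D_def)
  define A where "A n = complex_of_real (a n)" for n
  have A: "A n \<noteq> 0" for n using a[of n] by (simp add: A_def)
  define \<xi>n where "\<xi>n n i = (w n i - b n) / A n" for n i
  have weq: "w n i = b n + A n * \<xi>n n i" for n i using A[of n] by (simp add: \<xi>n_def)
  have injn: "inj_on (\<xi>n n) S" for n
    using inj[of n] A[of n] by (auto simp: \<xi>n_def inj_on_def)
  define k where "k = card S - 1"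
  have dp: "diffprod S (w n) i = A n ^ k * diffprod S (\<xi>n n) i" if "i \<in> S" for n i
  proof -
    have "diffprod S (w n) i = (\<Prod>j\<in>S - {i}. A n * (\<xi>n n i - \<xi>n n j))"
      unfolding diffprod_def by (intro prod.cong refl) (simp add: weq right_diff_distrib)
    then show ?thesis using fin that by (simp add: prod.distrib diffprod_def k_def)
  qed
  have cS: "card S = Suc k" using fin J by (cases "card S") (auto simp: k_def)
  \<comment> \<open>The integrand in the rescaled coordinate, with the factors of the distant points
    left unscaled so that each factor has a finite nonzero limit on the circle.\<close>
  define f where "f n z = (\<Prod>j\<in>I. inverse (z - \<xi>n n j)) * (\<Prod>j\<in>S - I. inverse (b n + A n * z - w n j))" for n and z :: complex
  \<comment> \<open>Since \<open>card S\<close> is k + 1, the powers of \<open>A n\<close> amount to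
    the exponent - card(S - I); they are written with a spare factor to avoid subtraction in
    exponents.\<close>
  have feq: "f n z = A n ^ card I * (A n * (inverse (A n) ^ Suc (Suc k) * (\<Prod>j\<in>S. inverse (z - \<xi>n n j))))" for n z
  proof -
    have "(\<Prod>j\<in>S - I. inverse (b n + A n * z - w n j)) = (\<Prod>j\<in>S - I. inverse (A n) * inverse (z - \<xi>n n j))"
    proof (intro prod.cong refl)
      fix j
      have "b n + A n * z - w n j = A n * (z - \<xi>n n j)" by (simp add: weq algebra_simps)
      then show "inverse (b n + A n * z - w n j) = inverse (A n) * inverse (z - \<xi>n n j)" by simp
    qed
    also have "\<dots> = inverse (A n) ^ card (S - I) * (\<Prod>j\<in>S - I. inverse (z - \<xi>n n j))"
      by (simp add: prod.distrib)
    finally have "f n z = inverse (A n) ^ card (S - I) * ((\<Prod>j\<in>I. inverse (z - \<xi>n n j)) * (\<Prod>j\<in>S - I. inverse (z - \<xi>n n j)))"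
      by (simp add: f_def)
    also have "(\<Prod>j\<in>I. inverse (z - \<xi>n n j)) * (\<Prod>j\<in>S - I. inverse (z - \<xi>n n j)) = (\<Prod>j\<in>S. inverse (z - \<xi>n n j))"
      using prod.subset_diff[OF I fin, of "\<lambda>j. inverse (z - \<xi>n n j)"] by (simp add: mult.commute)
    also have "inverse (A n) ^ card (S - I) = A n ^ card I * (A n * inverse (A n) ^ Suc (Suc k))"
    proof -
      have "card S = card I + card (S - I)" using I fin finI by (simp add: card_Diff_subset card_mono)
      then have p: "inverse (A n) ^ Suc (Suc k) = inverse (A n) * (inverse (A n) ^ card I * inverse (A n) ^ card (S - I))"
        using cS by (simp add: power_add)
      have "A n ^ card I * (A n * inverse (A n) ^ Suc (Suc k))
         = (A n * inverse (A n)) * (A n ^ card I * inverse (A n) ^ card I) * inverse (A n) ^ card (S - I)"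
        unfolding p by (simp only: mult_ac)
      also have "A n ^ card I * inverse (A n) ^ card I = 1"
        unfolding power_mult_distrib[symmetric] using A[of n] by simp
      finally show ?thesis using A[of n] by simp
    qed
    finally show ?thesis by (simp add: mult.assoc)
  qed
  have tot: "A n ^ card I * (A n * inverse (A n) ^ Suc (Suc k)) * x = A n ^ (card I - 1) * (inverse (A n) ^ k * x)" for n x
  proof -
    have "card I > 0" using \<eta> finI by (auto simp: card_gt_0_iff)
    then obtain l where l: "card I = Suc l" by (cases "card I") auto
    have "A n ^ card I * (A n * inverse (A n) ^ Suc (Suc k)) * x
       = (A n * inverse (A n)) * (A n * inverse (A n)) * (A n ^ l * (inverse (A n) ^ k * x))"
      unfolding l power_Suc by (simp only: mult_ac)
    then show ?thesis using A[of n] by (simp add: l)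
  qed
  define g where "g z = (\<Prod>j\<in>I. inverse (z - \<xi> j)) * (\<Prod>j\<in>S - I. inverse (- \<omega> j))" for z
  have off: "\<exists>c>0. \<forall>z\<in>sphere \<eta> \<epsilon>. c \<le> cmod (z - \<xi> j)" if j: "j \<in> I" for j
  proof (cases "j \<in> J")
    case True
    then show ?thesis using e by (intro exI[of _ \<epsilon>]) (auto simp: J_def dist_norm norm_minus_commute)
  next
    case False
    have "cmod (\<xi> j - \<eta>) - \<epsilon> \<le> cmod (z - \<xi> j)" if "z \<in> sphere \<eta> \<epsilon>" for z
      using norm_triangle_ineq[of "\<xi> j - z" "z - \<eta>"] that by (simp add: dist_norm norm_minus_commute)
    then show ?thesis using far[of j] j False by (intro exI[of _ "cmod (\<xi> j - \<eta>) - \<epsilon>"]) auto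
  qed
  have ul: "uniform_limit (sphere \<eta> \<epsilon>) f g sequentially"
    unfolding f_def g_def
  proof (rule uniform_lim_mult)
    have 1: "uniform_limit (sphere \<eta> \<epsilon>) (\<lambda>n z. z - \<xi>n n j) (\<lambda>z. z - \<xi> j) sequentially" if "j \<in> I" for j
      using uniform_limit_affine[of "\<lambda>_. 0" "\<lambda>n. \<xi>n n j" "- \<xi> j" sequentially "\<lambda>_. 1" 1 "sphere \<eta> \<epsilon>"]
        lim[OF that] by (simp add: \<xi>n_def A_def tendsto_minus)
    have "uniform_limit (sphere \<eta> \<epsilon>) (\<lambda>n z. \<Prod>j\<in>I. inverse (z - \<xi>n n j)) (\<lambda>z. \<Prod>j\<in>I. inverse (z - \<xi> j)) sequentially \<and>
        bounded ((\<lambda>z. \<Prod>j\<in>I. inverse (z - \<xi> j)) ` sphere \<eta> \<epsilon>)"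
      by (rule uniform_limit_prod_inverse[OF finI]) (rule 1, assumption, rule off)
    then show "uniform_limit (sphere \<eta> \<epsilon>) (\<lambda>n z. \<Prod>j\<in>I. inverse (z - \<xi>n n j)) (\<lambda>z. \<Prod>j\<in>I. inverse (z - \<xi> j)) sequentially"
      "bounded ((\<lambda>z. \<Prod>j\<in>I. inverse (z - \<xi> j)) ` sphere \<eta> \<epsilon>)" by blast+
    have 2: "uniform_limit (sphere \<eta> \<epsilon>) (\<lambda>n z. b n + A n * z - w n j) (\<lambda>z. - \<omega> j) sequentially" if "j \<in> S - I" for j
    proof -
      have "(\<lambda>n. b n - w n j) \<longlonglongrightarrow> - \<omega> j" using tendsto_minus[OF lim'(1)[OF that]] by simp
      moreover have "A \<longlonglongrightarrow> 0"
        using a0 that tendsto_of_real[of a 0] by (auto simp: A_def[abs_def])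
      ultimately show ?thesis
        using uniform_limit_affine[of b "\<lambda>n. w n j" "- \<omega> j" sequentially A 0 "sphere \<eta> \<epsilon>"] by simp
    qed
    have "finite (S - I)" using fin by simp
    then have "uniform_limit (sphere \<eta> \<epsilon>) (\<lambda>n z. \<Prod>j\<in>S - I. inverse (b n + A n * z - w n j)) (\<lambda>z. \<Prod>j\<in>S - I. inverse (- \<omega> j)) sequentially \<and>
        bounded ((\<lambda>z. \<Prod>j\<in>S - I. inverse (- \<omega> j)) ` sphere \<eta> \<epsilon>)"
    proof (rule uniform_limit_prod_inverse)
      show "\<exists>b>0. \<forall>z\<in>sphere \<eta> \<epsilon>. b \<le> cmod (- \<omega> j)" if "j \<in> S - I" for j
        using lim'(2)[OF that] by (intro exI[of _ "cmod (\<omega> j)"]) auto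
    qed (rule 2)
    then show "uniform_limit (sphere \<eta> \<epsilon>) (\<lambda>n z. \<Prod>j\<in>S - I. inverse (b n + A n * z - w n j)) (\<lambda>z. \<Prod>j\<in>S - I. inverse (- \<omega> j)) sequentially"
      "bounded ((\<lambda>z. \<Prod>j\<in>S - I. inverse (- \<omega> j)) ` sphere \<eta> \<epsilon>)" by blast+
  qed
  have evJ: "\<forall>\<^sub>F n in sequentially. \<forall>i\<in>J. cmod (\<xi>n n i - \<eta>) < \<epsilon>"
  proof (intro eventually_ball_finite ballI)
    fix i assume "i \<in> J"
    then have "(\<lambda>n. \<xi>n n i) \<longlonglongrightarrow> \<eta>" using lim[of i] by (auto simp: J_def \<xi>n_def A_def)
    then show "\<forall>\<^sub>F n in sequentially. cmod (\<xi>n n i - \<eta>) < \<epsilon>"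
      using e by (auto simp: tendsto_iff dist_norm)
  qed (use finI J_def in auto)
  have evI: "\<forall>\<^sub>F n in sequentially. \<forall>i\<in>I - J. cmod (\<xi>n n i - \<eta>) > \<epsilon>"
  proof (intro eventually_ball_finite ballI)
    fix i assume i: "i \<in> I - J"
    then have "(\<lambda>n. cmod (\<xi>n n i - \<eta>)) \<longlonglongrightarrow> cmod (\<xi> i - \<eta>)"
      using lim[of i] by (auto intro!: tendsto_intros simp: \<xi>n_def A_def)
    then show "\<forall>\<^sub>F n in sequentially. cmod (\<xi>n n i - \<eta>) > \<epsilon>"
      using far[OF i] by (rule order_tendstoD)
  qed (use finI in auto)
  \<comment> \<open>A point outside \<open>I\<close> keeps a distance of about |\<omega>| from b, so
    after division by a -> 0 it lies far outside the circle.\<close>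
  have evS: "\<forall>\<^sub>F n in sequentially. \<forall>i\<in>S - I. cmod (\<xi>n n i - \<eta>) > \<epsilon>"
  proof (intro eventually_ball_finite ballI)
    fix i assume i: "i \<in> S - I"
    have "(\<lambda>n. cmod (w n i - b n) - a n * (cmod \<eta> + \<epsilon>)) \<longlonglongrightarrow> cmod (\<omega> i) - 0 * (cmod \<eta> + \<epsilon>)"
      using lim'(1)[OF i] a0 i by (intro tendsto_intros) auto
    moreover have "0 < cmod (\<omega> i) - 0 * (cmod \<eta> + \<epsilon>)" using lim'(2)[OF i] by simp
    ultimately have "\<forall>\<^sub>F n in sequentially. 0 < cmod (w n i - b n) - a n * (cmod \<eta> + \<epsilon>)"
      by (rule order_tendstoD)
    then show "\<forall>\<^sub>F n in sequentially. cmod (\<xi>n n i - \<eta>) > \<epsilon>"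
    proof eventually_elim
      case (elim n)
      have "cmod (A n) = a n" using a[of n] by (simp add: A_def)
      then have "cmod (\<xi>n n i) > cmod \<eta> + \<epsilon>"
        using elim a[of n] by (simp add: \<xi>n_def norm_divide pos_less_divide_eq mult.commute)
      then show ?case using norm_triangle_ineq2[of "\<xi>n n i" \<eta>] by linarith
    qed
  qed (use fin in auto)
  have evint: "\<forall>\<^sub>F n in sequentially. (f n has_contour_integral
     (2 * of_real pi * \<i> * (of_real (a n ^ (card I - 1)) * (\<Sum>i\<in>J. inverse (diffprod S (w n) i))))) (circlepath \<eta> \<epsilon>)"
    using evJ evI evS
  proof eventually_elim
    case (elim n)
    have "((\<lambda>z. \<Prod>j\<in>S. inverse (z - \<xi>n n j)) has_contour_integral
        (2 * of_real pi * \<i> * (\<Sum>i\<in>J. inverse (diffprod S (\<xi>n n) i)))) (circlepath \<eta> \<epsilon>)"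
      using elim by (intro cluster_integral[OF fin injn e J]) auto
    from has_contour_integral_lmul[OF this, of "A n ^ card I * (A n * inverse (A n) ^ Suc (Suc k))"]
    have "(f n has_contour_integral A n ^ card I * (A n * inverse (A n) ^ Suc (Suc k)) *
        (2 * of_real pi * \<i> * (\<Sum>i\<in>J. inverse (diffprod S (\<xi>n n) i)))) (circlepath \<eta> \<epsilon>)"
      unfolding feq[abs_def] by (simp only: mult.assoc)
    also have "A n ^ card I * (A n * inverse (A n) ^ Suc (Suc k)) *
        (2 * of_real pi * \<i> * (\<Sum>i\<in>J. inverse (diffprod S (\<xi>n n) i)))
      = 2 * of_real pi * \<i> * (of_real (a n ^ (card I - 1)) * (\<Sum>i\<in>J. inverse (diffprod S (w n) i)))"
    proof -
      have "(\<Sum>i\<in>J. inverse (diffprod S (w n) i)) = (\<Sum>i\<in>J. inverse (A n) ^ k * inverse (diffprod S (\<xi>n n) i))"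
        using J by (intro sum.cong refl, subst dp) (auto simp: power_inverse)
      then show ?thesis unfolding mult.left_commute[of _ "2 * of_real pi * \<i>"] tot by (simp add: sum_distrib_left mult_ac A_def)
    qed
    finally show ?case .
  qed
  have "\<forall>\<^sub>F n in sequentially. f n contour_integrable_on circlepath \<eta> \<epsilon>"
    using evint by eventually_elim (auto simp: contour_integrable_on_def)
  from contour_integral_uniform_limit_circlepath(2)[OF this ul _ e]
  have "(\<lambda>n. contour_integral (circlepath \<eta> \<epsilon>) (f n)) \<longlonglongrightarrow> contour_integral (circlepath \<eta> \<epsilon>) g" by simp
  then have "(\<lambda>n. 2 * of_real pi * \<i> * (of_real (a n ^ (card I - 1)) * (\<Sum>i\<in>J. inverse (diffprod S (w n) i))))
      \<longlonglongrightarrow> contour_integral (circlepath \<eta> \<epsilon>) g"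
    by (rule Lim_transform_eventually) (use evint in eventually_elim, simp add: contour_integral_unique)
  moreover have "(g has_contour_integral (\<Prod>j\<in>S - I. inverse (- \<omega> j)) *
     (2 * pi * \<i> * residue (\<lambda>z. \<Prod>j\<in>I. inverse (z - \<xi> j)) \<eta>)) (circlepath \<eta> \<epsilon>)"
  proof -
    have "((\<lambda>z. \<Prod>j\<in>I. inverse (z - \<xi> j)) has_contour_integral 2 * pi * \<i> * residue (\<lambda>z. \<Prod>j\<in>I. inverse (z - \<xi> j)) \<eta>) (circlepath \<eta> \<epsilon>)"
      by (rule residue_circle[of "\<xi> ` I"]) (use finI e far in \<open>auto intro!: holomorphic_intros simp: J_def\<close>)
    from has_contour_integral_rmul[OF this, of "\<Prod>j\<in>S - I. inverse (- \<omega> j)"]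
    show ?thesis by (simp add: g_def[abs_def] mult.commute)
  qed
  ultimately have "(\<lambda>n. 2 * of_real pi * \<i> * (of_real (a n ^ (card I - 1)) * (\<Sum>i\<in>J. inverse (diffprod S (w n) i))))
      \<longlonglongrightarrow> 2 * of_real pi * \<i> * ((\<Prod>j\<in>S - I. inverse (- \<omega> j)) * residue (\<lambda>z. \<Prod>j\<in>I. inverse (z - \<xi> j)) \<eta>)"
    by (simp add: contour_integral_unique mult_ac)
  then show ?thesis by (subst (asm) tendsto_mult_left_iff) auto
qed

section \<open>Subsequences and nonvanishing residues\<close>

lemma unbounded_subseq:
  fixes D :: "nat \<Rightarrow> real"
  assumes "\<nexists>C. \<forall>n. D n \<le> C"
  obtains \<phi> where "strict_mono \<phi>" "filterlim (\<lambda>n. D (\<phi> n)) at_top sequentially"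
proof -
  have ex: "\<exists>n>N. D n > k" for N :: nat and k :: real
  proof (rule ccontr)
    assume c: "\<not> (\<exists>n>N. D n > k)"
    have "D n \<le> max k (Max (D ` {..N}))" for n
    proof (cases "n \<le> N")
      case True
      then have "D n \<le> Max (D ` {..N})" by (intro Max_ge) auto
      then show ?thesis by simp
    next
      case False
      then have "D n \<le> k" using c by (meson not_le)
      then show ?thesis by simp
    qed
    then show False using assms by blast
  qed
  have "\<exists>\<phi>. \<forall>n. D (\<phi> n) > real n \<and> \<phi> (Suc n) > \<phi> n"
  proof (rule dependent_nat_choice)
    show "\<exists>x. D x > real 0" using ex[of 0 0] by auto
    show "\<exists>y. D y > real (Suc n) \<and> y > x" for x n using ex[of x "real (Suc n)"] by auto
  qed
  then obtain \<phi> where \<phi>: "\<And>n. D (\<phi> n) > real n" "\<And>n. \<phi> (Suc n) > \<phi> n" by blast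
  have "filterlim (\<lambda>n. D (\<phi> n)) at_top sequentially"
    by (rule filterlim_at_top_mono[OF filterlim_real_sequentially])
      (use \<phi>(1) less_imp_le in \<open>auto intro!: always_eventually\<close>)
  then show ?thesis by (rule that[rotated]) (simp add: strict_mono_Suc_iff \<phi>(2))
qed

lemma finite_bounded_subseq:
  fixes f :: "nat \<Rightarrow> 'a \<Rightarrow> complex"
  assumes "finite S" "\<And>i. i \<in> S \<Longrightarrow> \<exists>C. \<forall>n. cmod (f n i) \<le> C"
  shows "\<exists>\<phi> l. strict_mono \<phi> \<and> (\<forall>i\<in>S. (\<lambda>n. f (\<phi> n) i) \<longlonglongrightarrow> l i)"
  using assms
proof (induction S rule: finite_induct)
  case empty
  show ?case by (intro exI[of _ id]) (auto simp: strict_mono_def)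
next
  case (insert a S)
  then obtain \<phi> l where \<phi>: "strict_mono \<phi>" "\<forall>i\<in>S. (\<lambda>n. f (\<phi> n) i) \<longlonglongrightarrow> l i" by auto
  obtain C where "\<forall>n. cmod (f n a) \<le> C" using insert.prems by auto
  then have "bounded (range (\<lambda>n. f (\<phi> n) a))" by (auto simp: bounded_iff)
  then obtain la \<psi> where \<psi>: "strict_mono \<psi>" "((\<lambda>n. f (\<phi> n) a) \<circ> \<psi>) \<longlonglongrightarrow> la"
    by (blast dest: bounded_imp_convergent_subsequence)
  have "\<forall>i\<in>insert a S. (\<lambda>n. f ((\<phi> \<circ> \<psi>) n) i) \<longlonglongrightarrow> (l(a := la)) i"
  proof
    fix i assume i: "i \<in> insert a S"
    show "(\<lambda>n. f ((\<phi> \<circ> \<psi>) n) i) \<longlonglongrightarrow> (l(a := la)) i"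
    proof (cases "i = a")
      case True
      then show ?thesis using \<psi>(2) by (simp add: o_def)
    next
      case False
      then have "(\<lambda>n. f (\<phi> n) i) \<longlonglongrightarrow> l i" using i \<phi>(2) by auto
      from LIMSEQ_subseq_LIMSEQ[OF this \<psi>(1)] show ?thesis using False by (simp add: o_def)
    qed
  qed
  then show ?case using strict_mono_o[OF \<phi>(1) \<psi>(1)] by blast
qed

lemma tendsto_zero_if_mult_at_top:
  fixes X :: "nat \<Rightarrow> real" and Y :: "nat \<Rightarrow> complex"
  assumes "filterlim X at_top sequentially" "(\<lambda>n. of_real (X n) * Y n) \<longlonglongrightarrow> c"
  shows "Y \<longlonglongrightarrow> 0"
proof -
  have "(\<lambda>n. inverse (X n)) \<longlonglongrightarrow> 0"
    using assms(1) by (rule tendsto_inverse_0_at_top)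
  then have "(\<lambda>n. complex_of_real (inverse (X n))) \<longlonglongrightarrow> of_real 0" by (rule tendsto_of_real)
  from tendsto_mult[OF this assms(2)] have "(\<lambda>n. of_real (inverse (X n)) * (of_real (X n) * Y n)) \<longlonglongrightarrow> 0" by simp
  then show ?thesis
  proof (rule Lim_transform_eventually)
    have "\<forall>\<^sub>F n in sequentially. X n > 0" using assms(1) by (simp add: filterlim_at_top_dense)
    then show "\<forall>\<^sub>F n in sequentially. of_real (inverse (X n)) * (of_real (X n) * Y n) = Y n"
      by eventually_elim simp
  qed
qed

lemma prod_power_fibres:
  fixes \<xi> :: "'a \<Rightarrow> complex"
  assumes "finite I"
  shows "(\<Prod>u\<in>\<xi> ` I. (z - u) ^ card {i \<in> I. \<xi> i = u}) = (\<Prod>i\<in>I. z - \<xi> i)"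
proof -
  have "(\<Prod>i\<in>I. z - \<xi> i) = (\<Prod>u\<in>\<xi> ` I. \<Prod>i\<in>{i \<in> I. \<xi> i = u}. z - \<xi> i)"
    by (rule prod.group[OF assms finite_imageI[OF assms] order_refl, symmetric])
  also have "\<dots> = (\<Prod>u\<in>\<xi> ` I. (z - u) ^ card {i \<in> I. \<xi> i = u})"
  proof (intro prod.cong refl)
    fix u
    have "(\<Prod>i\<in>{i \<in> I. \<xi> i = u}. z - \<xi> i) = (\<Prod>i\<in>{i \<in> I. \<xi> i = u}. z - u)" by (intro prod.cong) auto
    then show "(\<Prod>i\<in>{i \<in> I. \<xi> i = u}. z - \<xi> i) = (z - u) ^ card {i \<in> I. \<xi> i = u}" by simp
  qed
  finally show ?thesis by simp
qed

lemma sum_card_fibres: "finite I \<Longrightarrow> (\<Sum>u\<in>\<xi> ` I. card {i \<in> I. \<xi> i = u}) = card I"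
  using sum.group[of I "\<xi> ` I" \<xi> "\<lambda>_. 1 :: nat"] by simp

text \<open>\<open>equal_residues\<close> with numerator 1: if all residues vanished there could be
  only one pole. Coinciding points are grouped into poles of higher order by counting
  fibres.\<close>

lemma exists_nonzero_residue:
  fixes \<xi> :: "'a \<Rightarrow> complex"
  assumes fin: "finite I" and c: "card (\<xi> ` I) \<ge> 2"
  shows "\<exists>\<eta>\<in>\<xi> ` I. residue (\<lambda>z. \<Prod>j\<in>I. inverse (z - \<xi> j)) \<eta> \<noteq> 0"
proof (rule ccontr)
  assume "\<not> ?thesis"
  then have z: "residue (\<lambda>z. \<Prod>j\<in>I. inverse (z - \<xi> j)) \<eta> = 0" if "\<eta> \<in> \<xi> ` I" for \<eta> using that by blast
  have "(1 :: complex poly) = 0 \<or> card (\<xi> ` I) \<le> degree (1 :: complex poly) + 1"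
  proof (rule equal_residues(2)[where \<eta> = id and e = "\<lambda>u. card {i \<in> I. \<xi> i = u}" and a = 0])
    show "1 \<le> card {i \<in> I. \<xi> i = u}" if "u \<in> \<xi> ` I" for u
    proof -
      have "{i \<in> I. \<xi> i = u} \<noteq> {}" using that by auto
      then have "card {i \<in> I. \<xi> i = u} \<noteq> 0" using fin by simp
      then show ?thesis by linarith
    qed
    show "degree (1 :: complex poly) + 2 \<le> (\<Sum>u\<in>\<xi> ` I. card {i \<in> I. \<xi> i = u})"
      using c card_image_le[OF fin, of \<xi>] by (simp add: sum_card_fibres[OF fin])
    show "residue (\<lambda>z. poly 1 z / (\<Prod>v\<in>\<xi> ` I. (z - id v) ^ card {i \<in> I. \<xi> i = v})) (id u) = 0"
      if "u \<in> \<xi> ` I" for u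
      using z[OF that] by (simp add: prod_power_fibres[OF fin] divide_inverse prod_inversef[symmetric] o_def)
  qed (use fin c in auto)
  then show False using c by simp
qed

section \<open>Solutions, zero-sum partitions and rescaled coordinates\<close>

text \<open>For \<open>m i = 1 / (lam i - 1)\<close> the equation says that the polynomial with
  roots \<open>z i\<close> has derivative \<open>lam i - 1\<close> at \<open>z i\<close>: these are
  recentered labelled fixed points. Extensionality makes the set countable by cardinality.\<close>

definition sols :: "'a set \<Rightarrow> ('a \<Rightarrow> complex) \<Rightarrow> ('a \<Rightarrow> complex) set" where
  "sols S m = {z \<in> S \<rightarrow>\<^sub>E UNIV. (\<Sum>i\<in>S. z i) = 0 \<and> (\<forall>i\<in>S. m i * diffprod S z i = 1)}"

definition zsp :: "'a set \<Rightarrow> ('a \<Rightarrow> complex) \<Rightarrow> 'a set set set" where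
  "zsp S m = {P. partition_on S P \<and> (\<forall>B\<in>P. (\<Sum>i\<in>B. m i) = 0)}"

definition blk :: "'a set set \<Rightarrow> 'a \<Rightarrow> 'a set" where
  "blk P i = (THE B. B \<in> P \<and> i \<in> B)"

definition avg :: "'a set \<Rightarrow> ('a \<Rightarrow> complex) \<Rightarrow> complex" where
  "avg B v = (\<Sum>i\<in>B. v i) / of_nat (card B)"

abbreviation cen :: "'a set set \<Rightarrow> ('a \<Rightarrow> complex) \<Rightarrow> 'a \<Rightarrow> complex" where
  "cen P v i \<equiv> avg (blk P i) v"

text \<open>The natural diameter of a cluster of s points: a difference product has s - 1 small
  factors inside the cluster, and together they must be of order t.\<close>

definition kap :: "nat \<Rightarrow> real \<Rightarrow> real" where
  "kap s t = t powr (1 / real (s - 1))"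

text \<open>From rescaled coordinates to actual points: block means are kept, and deviations from
  them shrink to the natural cluster size. \<open>vof\<close> is the inverse.\<close>

definition wof :: "'a set set \<Rightarrow> real \<Rightarrow> ('a \<Rightarrow> complex) \<Rightarrow> 'a \<Rightarrow> complex" where
  "wof P t v i = cen P v i + kap (card (blk P i)) t * (v i - cen P v i)"

definition vof :: "'a set set \<Rightarrow> real \<Rightarrow> ('a \<Rightarrow> complex) \<Rightarrow> 'a \<Rightarrow> complex" where
  "vof P t w i = cen P w i + (w i - cen P w i) / kap (card (blk P i)) t"

lemma kap_pos: "t > 0 \<Longrightarrow> kap s t > 0"
  by (simp add: kap_def)

lemma kap_power: "t > 0 \<Longrightarrow> s \<ge> 2 \<Longrightarrow> kap s t ^ (s - 1) = t"
  by (simp add: kap_def powr_power)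

lemma kap_tendsto:
  assumes "s \<ge> 2"
  shows "(kap s \<longlongrightarrow> 0) (at_right 0)"
proof -
  have "((\<lambda>t. t powr (1 / real (s - 1))) \<longlongrightarrow> 0 powr (1 / real (s - 1))) (at_right 0)"
    using assms by (intro tendsto_powr' tendsto_ident_at tendsto_const) (auto simp: eventually_at_filter)
  then show ?thesis by (simp add: kap_def[abs_def])
qed

lemma partition_blk:
  assumes "partition_on S P" "i \<in> S"
  shows "blk P i \<in> P" "i \<in> blk P i" "blk P i \<subseteq> S"
proof -
  have "\<exists>!B. B \<in> P \<and> i \<in> B"
  proof -
    obtain B where B: "B \<in> P" "i \<in> B" using assms by (auto simp: partition_on_def)
    have "C = B" if "C \<in> P" "i \<in> C" for C
      using assms(1) B that unfolding partition_on_def disjoint_def by blast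
    with B show ?thesis by blast
  qed
  from theI'[OF this] show "blk P i \<in> P" "i \<in> blk P i" by (auto simp: blk_def)
  then show "blk P i \<subseteq> S" using assms(1) by (auto simp: partition_on_def)
qed

lemma blk_eqI:
  assumes "partition_on S P" "B \<in> P" "i \<in> B"
  shows "blk P i = B"
proof -
  have i: "i \<in> S" using assms by (auto simp: partition_on_def)
  show ?thesis
    using assms partition_blk[OF assms(1) i] unfolding partition_on_def disjoint_def by blast
qed

lemma blk_eq: "partition_on S P \<Longrightarrow> i \<in> S \<Longrightarrow> j \<in> blk P i \<Longrightarrow> blk P j = blk P i"
  by (rule blk_eqI[OF _ partition_blk(1)])

lemma avg_const: "finite B \<Longrightarrow> B \<noteq> {} \<Longrightarrow> (\<And>i. i \<in> B \<Longrightarrow> v i = c) \<Longrightarrow> avg B v = c"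
  by (simp add: avg_def)

lemma sum_diff_avg: "finite B \<Longrightarrow> B \<noteq> {} \<Longrightarrow> (\<Sum>i\<in>B. v i - avg B v) = 0"
  by (simp add: avg_def sum_subtractf)

lemma tendsto_avg: "(\<And>i. i \<in> B \<Longrightarrow> ((\<lambda>n. v n i) \<longlongrightarrow> l i) F) \<Longrightarrow> ((\<lambda>n. avg B (v n)) \<longlongrightarrow> avg B l) F"
  unfolding avg_def divide_inverse by (intro tendsto_mult tendsto_sum tendsto_const) auto

lemma sum_partition_on:
  assumes "finite S" "partition_on S P"
  shows "(\<Sum>i\<in>S. f i) = (\<Sum>B\<in>P. \<Sum>i\<in>B. f i)"
proof -
  have "sum f (\<Union>P) = (sum \<circ> sum) f P"
    using assms by (intro sum.Union_disjoint) (auto simp: partition_on_def disjoint_def intro: finite_subset)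
  then show ?thesis using assms(2) by (simp add: partition_on_def)
qed

locale cluster_partition =
  fixes S :: "'a set" and P :: "'a set set"
  assumes finS: "finite S" and part: "partition_on S P"
    and big: "\<And>B. B \<in> P \<Longrightarrow> card B \<ge> 2"
begin

lemma finB: "i \<in> S \<Longrightarrow> finite (blk P i)" "i \<in> S \<Longrightarrow> blk P i \<noteq> {}"
proof -
  assume i: "i \<in> S"
  show "finite (blk P i)" by (rule finite_subset[OF partition_blk(3)[OF part i] finS])
next
  assume i: "i \<in> S"
  show "blk P i \<noteq> {}" using partition_blk(2)[OF part i] by auto
qed

lemma bigblk: "i \<in> S \<Longrightarrow> card (blk P i) \<ge> 2"
  by (rule big[OF partition_blk(1)[OF part]])

lemma blk_blk: "i \<in> S \<Longrightarrow> j \<in> blk P i \<Longrightarrow> blk P j = blk P i"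
  by (rule blk_eq[OF part])

lemma cen_wof: "i \<in> S \<Longrightarrow> cen P (wof P t v) i = cen P v i"
proof -
  assume i: "i \<in> S"
  have "(\<Sum>j\<in>blk P i. wof P t v j) = (\<Sum>j\<in>blk P i. cen P v i + kap (card (blk P i)) t * (v j - cen P v i))"
  proof (rule sum.cong[OF refl])
    fix j assume "j \<in> blk P i"
    then have "blk P j = blk P i" by (rule blk_blk[OF i])
    then show "wof P t v j = cen P v i + kap (card (blk P i)) t * (v j - cen P v i)" by (simp add: wof_def)
  qed
  also have "\<dots> = of_nat (card (blk P i)) * cen P v i"
    using sum_diff_avg[OF finB[OF i], of v] by (simp add: sum.distrib flip: sum_distrib_left)
  also have "\<dots> = (\<Sum>j\<in>blk P i. v j)" using finB[OF i] by (simp add: avg_def)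
  finally show ?thesis by (simp add: avg_def)
qed

lemma cen_vof: "i \<in> S \<Longrightarrow> cen P (vof P t w) i = cen P w i"
proof -
  assume i: "i \<in> S"
  have "(\<Sum>j\<in>blk P i. vof P t w j) = (\<Sum>j\<in>blk P i. cen P w i + (w j - cen P w i) / kap (card (blk P i)) t)"
  proof (rule sum.cong[OF refl])
    fix j assume "j \<in> blk P i"
    then have "blk P j = blk P i" by (rule blk_blk[OF i])
    then show "vof P t w j = cen P w i + (w j - cen P w i) / kap (card (blk P i)) t" by (simp add: vof_def)
  qed
  also have "\<dots> = of_nat (card (blk P i)) * cen P w i"
    using sum_diff_avg[OF finB[OF i], of w] by (simp add: sum.distrib flip: sum_divide_distrib)
  also have "\<dots> = (\<Sum>j\<in>blk P i. w j)" using finB[OF i] by (simp add: avg_def)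
  finally show ?thesis by (simp add: avg_def)
qed

lemma vof_wof: "t > 0 \<Longrightarrow> i \<in> S \<Longrightarrow> vof P t (wof P t v) i = v i"
  using kap_pos[of t "card (blk P i)"] by (simp add: vof_def cen_wof) (simp add: wof_def)

lemma wof_vof: "t > 0 \<Longrightarrow> i \<in> S \<Longrightarrow> wof P t (vof P t w) i = w i"
  using kap_pos[of t "card (blk P i)"] by (simp add: wof_def cen_vof) (simp add: vof_def)

lemma sum_cen: "(\<Sum>i\<in>S. cen P v i) = (\<Sum>i\<in>S. v i)"
proof -
  have "(\<Sum>i\<in>S. cen P v i) = (\<Sum>B\<in>P. \<Sum>i\<in>B. avg B v)"
    unfolding sum_partition_on[OF finS part]
  proof (rule sum.cong[OF refl], rule sum.cong[OF refl])
    fix B i assume "B \<in> P" "i \<in> B"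
    then show "cen P v i = avg B v" using blk_eqI[OF part] by simp
  qed
  also have "\<dots> = (\<Sum>B\<in>P. \<Sum>i\<in>B. v i)"
  proof (rule sum.cong[OF refl])
    fix B assume "B \<in> P"
    then show "(\<Sum>i\<in>B. avg B v) = (\<Sum>i\<in>B. v i)" using big[of B] by (auto simp: avg_def)
  qed
  finally show ?thesis by (simp add: sum_partition_on[OF finS part])
qed

lemma sum_wof: "(\<Sum>i\<in>S. wof P t v i) = (\<Sum>i\<in>S. v i)"
  using sum_cen[of "wof P t v"] sum_cen[of v] by (simp add: cen_wof)

lemma wof_diff:
  fixes v :: "'a \<Rightarrow> complex"
  shows "i \<in> S \<Longrightarrow> j \<in> blk P i \<Longrightarrow> wof P t v i - wof P t v j = kap (card (blk P i)) t * (v i - v j)"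
  using blk_blk[of i j] by (simp add: wof_def algebra_simps)

text \<open>The s - 1 differences within a block contribute the (s-1)-st power of
  \<open>kap\<close>, which is t. Dividing the equation by t therefore leaves an expression that is
  regular at t = 0.\<close>

lemma diffprod_wof:
  assumes "t > 0" "i \<in> S"
  shows "diffprod S (wof P t v) i = t * ((\<Prod>j\<in>blk P i - {i}. v i - v j) * (\<Prod>j\<in>S - blk P i. wof P t v i - wof P t v j))"
proof -
  note b = partition_blk[OF part assms(2)]
  have "S - {i} = (blk P i - {i}) \<union> (S - blk P i)" using b by auto
  then have "diffprod S (wof P t v) i = (\<Prod>j\<in>blk P i - {i}. wof P t v i - wof P t v j) * (\<Prod>j\<in>S - blk P i. wof P t v i - wof P t v j)"
    unfolding diffprod_def using finS finB[OF assms(2)] by (subst prod.union_disjoint[symmetric]) auto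
  also have "(\<Prod>j\<in>blk P i - {i}. wof P t v i - wof P t v j) = (\<Prod>j\<in>blk P i - {i}. kap (card (blk P i)) t * (v i - v j))"
    by (rule prod.cong[OF refl], rule wof_diff[OF assms(2)]) auto
  also have "\<dots> = of_real (kap (card (blk P i)) t ^ (card (blk P i) - 1)) * (\<Prod>j\<in>blk P i - {i}. v i - v j)"
    using b finB[OF assms(2)] by (simp add: prod.distrib)
  also have "kap (card (blk P i)) t ^ (card (blk P i) - 1) = t"
    by (rule kap_power[OF assms(1) bigblk[OF assms(2)]])
  finally show ?thesis by simp
qed

end

section \<open>Compactness of solutions along the deformation\<close>

text \<open>The setting for following solutions of m + t r as t -> 0+. The condition
  \<open>nonres\<close> prevents points from escaping to infinity in groups: such a group would have
  to be a subset on which both m and r sum to zero.\<close>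

locale perturbation =
  fixes S :: "'a set" and m r :: "'a \<Rightarrow> complex"
  assumes finS: "finite S" and card2: "card S \<ge> 2"
    and m0: "\<And>i. i \<in> S \<Longrightarrow> m i \<noteq> 0"
    and sm: "(\<Sum>i\<in>S. m i) = 0" and sr: "(\<Sum>i\<in>S. r i) = 0"
    and nonres: "\<And>J. J \<subset> S \<Longrightarrow> J \<noteq> {} \<Longrightarrow> (\<Sum>i\<in>J. m i) = 0 \<Longrightarrow> (\<Sum>i\<in>J. r i) \<noteq> 0"
begin

text \<open>Rescaled limit configurations: the block means of v are the cluster positions, and the
  deviations are the cluster shapes. The product equation is the original one divided by t, at t =
  0. The residue equation is the sum of the reciprocal equations over a block: there the m-terms
  cancel, so the next order in t becomes visible.\<close>

definition limits :: "('a set set \<times> ('a \<Rightarrow> complex)) set" where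
  "limits = {(P, v). P \<in> zsp S m \<and> v \<in> S \<rightarrow>\<^sub>E UNIV \<and> (\<Sum>i\<in>S. v i) = 0 \<and>
     (\<forall>i\<in>S. \<forall>j\<in>S. blk P i \<noteq> blk P j \<longrightarrow> cen P v i \<noteq> cen P v j) \<and>
     (\<forall>i\<in>S. m i * ((\<Prod>j\<in>blk P i - {i}. v i - v j) * (\<Prod>j\<in>S - blk P i. cen P v i - cen P v j)) = 1) \<and>
     (\<forall>i\<in>S. residue (\<lambda>z. \<Prod>j\<in>S. inverse (z - cen P v j)) (cen P v i) = (\<Sum>j\<in>blk P i. r j))}"

definition solution_seq :: "(nat \<Rightarrow> real) \<Rightarrow> (nat \<Rightarrow> 'a \<Rightarrow> complex) \<Rightarrow> bool" where
  "solution_seq t w \<longleftrightarrow> (\<forall>n. t n > 0) \<and> t \<longlonglongrightarrow> 0 \<and> (\<forall>n. (\<Sum>i\<in>S. w n i) = 0) \<and>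
     (\<forall>n. \<forall>i\<in>S. (m i + t n * r i) * diffprod S (w n) i = t n)"

lemma solution_seq_subseq:
  assumes "solution_seq t w" "strict_mono \<phi>"
  shows "solution_seq (\<lambda>n. t (\<phi> n)) (\<lambda>n. w (\<phi> n))"
  using assms LIMSEQ_subseq_LIMSEQ[of t 0 \<phi>] by (auto simp: solution_seq_def o_def)

context
  fixes t w assumes sq: "solution_seq t w"
begin

lemma seq_pos: "t n > 0" and seq_lim: "t \<longlonglongrightarrow> 0" and seq_sum: "(\<Sum>i\<in>S. w n i) = 0"
  and seq_eq: "i \<in> S \<Longrightarrow> (m i + t n * r i) * diffprod S (w n) i = t n"
  using sq by (auto simp: solution_seq_def)

lemma seq_inj: "inj_on (w n) S"
proof (rule inj_onI, rule ccontr)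
  fix i j assume ij: "i \<in> S" "j \<in> S" "w n i = w n j" "i \<noteq> j"
  then have "diffprod S (w n) i = 0" unfolding diffprod_def using finS by (intro prod_zero) auto
  then show False using seq_eq[OF ij(1), of n] seq_pos[of n] by simp
qed

lemma seq_inverse: "i \<in> S \<Longrightarrow> inverse (diffprod S (w n) i) = (m i + t n * r i) / t n"
  using seq_eq[of i n] seq_pos[of n] diffprod_nonzero[OF finS seq_inj, of i n] by (simp add: field_simps)

lemma seq_cluster_sum:
  assumes "J \<subseteq> S"
  shows "(\<Sum>i\<in>J. inverse (diffprod S (w n) i)) = ((\<Sum>i\<in>J. m i) + t n * (\<Sum>i\<in>J. r i)) / t n"
proof -
  have "(\<Sum>i\<in>J. inverse (diffprod S (w n) i)) = (\<Sum>i\<in>J. (m i + t n * r i) / t n)"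
    using assms by (intro sum.cong refl seq_inverse) auto
  then show ?thesis by (simp add: sum.distrib sum_distrib_left flip: sum_divide_distrib)
qed

lemma of_real_t_lim: "(\<lambda>n. complex_of_real (t n)) \<longlonglongrightarrow> 0"
  using tendsto_of_real[OF seq_lim] by simp

lemma perturbed_sum_lim: "(\<lambda>n. a + complex_of_real (t n) * b) \<longlonglongrightarrow> a"
  using tendsto_add[OF tendsto_const[of a] tendsto_mult[OF of_real_t_lim tendsto_const[of b]]] by simp

text \<open>Otherwise rescale by the total size D -> infinity. The limit has sum 0 and norm 1, so
  some level set J of it is proper, and \<open>cluster_scaling_limit\<close> shows that the cluster
  sum over J is annihilated.\<close>

lemma seq_bounded: "\<exists>C. \<forall>n. (\<Sum>i\<in>S. cmod (w n i)) \<le> C"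
proof (rule ccontr)
  assume "\<not> ?thesis"
  from unbounded_subseq[OF this] obtain \<phi> where \<phi>: "strict_mono \<phi>"
    and top: "filterlim (\<lambda>n. \<Sum>i\<in>S. cmod (w (\<phi> n) i)) at_top sequentially" by blast
  define D where "D n = (\<Sum>i\<in>S. cmod (w (\<phi> n) i))" for n
  have Dpos: "D n > 0" for n
  proof (rule ccontr)
    assume "\<not> D n > 0"
    moreover have "D n \<ge> 0" by (simp add: D_def sum_nonneg)
    ultimately have "D n = 0" by linarith
    then have z: "w (\<phi> n) i = 0" if "i \<in> S" for i
      using finS that unfolding D_def by (simp add: sum_nonneg_eq_0_iff)
    have "w (\<phi> n) ` S \<subseteq> {0}" using z by auto
    then have "card (w (\<phi> n) ` S) \<le> 1" using card_mono[of "{0}" "w (\<phi> n) ` S"] by simp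
    then show False using card2 card_image[OF seq_inj[of "\<phi> n"]] by simp
  qed
  define x where "x n i = w (\<phi> n) i / D n" for n i
  have xb: "\<exists>C. \<forall>n. cmod (x n i) \<le> C" if i: "i \<in> S" for i
  proof -
    have "cmod (x n i) \<le> 1" for n
    proof -
      have "cmod (w (\<phi> n) i) \<le> D n" unfolding D_def using i finS by (intro member_le_sum) auto
      then show ?thesis using Dpos[of n] by (simp add: x_def norm_divide)
    qed
    then show ?thesis by blast
  qed
  from finite_bounded_subseq[of S x, OF finS xb] obtain \<psi> \<xi> where \<psi>: "strict_mono \<psi>"
    and lim: "\<And>i. i \<in> S \<Longrightarrow> (\<lambda>n. x (\<psi> n) i) \<longlonglongrightarrow> \<xi> i" by blast
  have sx: "(\<Sum>i\<in>S. \<xi> i) = 0"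
  proof -
    have "(\<lambda>n. \<Sum>i\<in>S. x (\<psi> n) i) \<longlonglongrightarrow> (\<Sum>i\<in>S. \<xi> i)" by (intro tendsto_sum lim)
    moreover have "(\<Sum>i\<in>S. x (\<psi> n) i) = 0" for n
      using seq_sum[of "\<phi> (\<psi> n)"] by (simp add: x_def flip: sum_divide_distrib)
    ultimately show ?thesis by (simp add: LIMSEQ_const_iff)
  qed
  have nx: "(\<Sum>i\<in>S. cmod (\<xi> i)) = 1"
  proof -
    have "(\<lambda>n. \<Sum>i\<in>S. cmod (x (\<psi> n) i)) \<longlonglongrightarrow> (\<Sum>i\<in>S. cmod (\<xi> i))" by (intro tendsto_sum tendsto_norm lim)
    moreover have "(\<Sum>i\<in>S. cmod (x (\<psi> n) i)) = 1" for n
      using Dpos[of "\<psi> n"] by (simp add: x_def norm_divide flip: sum_divide_distrib) (simp add: D_def)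
    ultimately show ?thesis by (simp add: LIMSEQ_const_iff)
  qed
  obtain i0 where i0: "i0 \<in> S" using card2 by fastforce
  define \<eta> where "\<eta> = \<xi> i0"
  define J where "J = {i \<in> S. \<xi> i = \<eta>}"
  have JS: "J \<subset> S" "J \<noteq> {}"
  proof -
    show "J \<noteq> {}" using i0 by (auto simp: J_def \<eta>_def)
    have "J \<noteq> S"
    proof
      assume "J = S"
      then have c: "\<xi> i = \<eta>" if "i \<in> S" for i using that by (auto simp: J_def)
      then have "of_nat (card S) * \<eta> = 0" using sx by simp
      then have "\<eta> = 0" using card2 by auto
      then show False using nx c by simp
    qed
    then show "J \<subset> S" by (auto simp: J_def)
  qed
  define T where "T n = t (\<phi> (\<psi> n))" for n
  have Tpos: "T n > 0" for n by (simp add: T_def seq_pos)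
  have Tlim: "(\<lambda>n. complex_of_real (T n)) \<longlonglongrightarrow> 0"
    using LIMSEQ_subseq_LIMSEQ[OF LIMSEQ_subseq_LIMSEQ[OF of_real_t_lim \<phi>] \<psi>] by (simp add: T_def o_def)
  have "(\<lambda>n. of_real (D (\<psi> n) ^ (card S - 1)) * (\<Sum>i\<in>J. inverse (diffprod S (w (\<phi> (\<psi> n))) i))) \<longlonglongrightarrow>
     (\<Prod>j\<in>S - S. inverse (- 1)) * residue (\<lambda>z. \<Prod>j\<in>S. inverse (z - \<xi> j)) \<eta>"
    unfolding J_def
  proof (rule cluster_scaling_limit[OF finS order_refl, where b = "\<lambda>_. 0"])
    show "(\<lambda>n. (w (\<phi> (\<psi> n)) i - 0) / complex_of_real (D (\<psi> n))) \<longlonglongrightarrow> \<xi> i" if "i \<in> S" for i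
      using lim[OF that] by (simp add: x_def)
  qed (use Dpos seq_inj i0 in \<open>auto simp: \<eta>_def\<close>)
  then have lim1: "(\<lambda>n. of_real (D (\<psi> n) ^ (card S - 1)) * (((\<Sum>i\<in>J. m i) + T n * (\<Sum>i\<in>J. r i)) / T n))
      \<longlonglongrightarrow> residue (\<lambda>z. \<Prod>j\<in>S. inverse (z - \<xi> j)) \<eta>"
    using JS by (simp add: seq_cluster_sum T_def)
  \<comment> \<open>D^(d-1) times (sum_J m + T sum_J r)/T converges while D^(d-1) diverges. So the
    second factor tends to 0, which kills first sum_J m and then sum_J r, against
    \<open>nonres\<close>.\<close>
  have top2: "filterlim (\<lambda>n. D (\<psi> n) ^ (card S - 1)) at_top sequentially"
  proof -
    have "filterlim (\<lambda>n. D (\<psi> n)) at_top sequentially"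
      using filterlim_compose[OF top filterlim_subseq[OF \<psi>]] by (simp add: D_def)
    then show ?thesis using card2 by (intro filterlim_pow_at_top) auto
  qed
  from tendsto_zero_if_mult_at_top[OF top2 lim1]
  have z: "(\<lambda>n. ((\<Sum>i\<in>J. m i) + T n * (\<Sum>i\<in>J. r i)) / T n) \<longlonglongrightarrow> 0" .
  have "(\<lambda>n. T n * (((\<Sum>i\<in>J. m i) + T n * (\<Sum>i\<in>J. r i)) / T n)) \<longlonglongrightarrow> 0 * 0"
    by (intro tendsto_mult Tlim z)
  moreover have "(\<lambda>n. T n * (((\<Sum>i\<in>J. m i) + T n * (\<Sum>i\<in>J. r i)) / T n)) = (\<lambda>n. (\<Sum>i\<in>J. m i) + T n * (\<Sum>i\<in>J. r i))"
    using Tpos by (auto simp: fun_eq_iff less_imp_neq[symmetric])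
  moreover have "(\<lambda>n. (\<Sum>i\<in>J. m i) + T n * (\<Sum>i\<in>J. r i)) \<longlonglongrightarrow> (\<Sum>i\<in>J. m i) + (0 :: complex) * (\<Sum>i\<in>J. r i)"
    by (intro tendsto_intros Tlim)
  ultimately have mJ: "(\<Sum>i\<in>J. m i) = 0" by (simp add: LIMSEQ_unique)
  have "(\<lambda>n. ((\<Sum>i\<in>J. m i) + T n * (\<Sum>i\<in>J. r i)) / T n) = (\<lambda>n. \<Sum>i\<in>J. r i)"
    using Tpos mJ by (auto simp: fun_eq_iff less_imp_neq[symmetric])
  then have "(\<Sum>i\<in>J. r i) = 0" using z by (simp add: LIMSEQ_const_iff)
  then show False using nonres[OF JS mJ] by simp
qed

text \<open>\<open>cluster_scaling_limit\<close> at scale 1. The sum over a cluster, divided by t,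
  has a finite limit, so the m-part vanishes and the r-part is the residue.\<close>

lemma seq_limit_clusters:
  assumes l: "\<And>i. i \<in> S \<Longrightarrow> (\<lambda>n. w n i) \<longlonglongrightarrow> l i" and i0: "i0 \<in> S"
  defines "J \<equiv> {i \<in> S. l i = l i0}"
  shows "(\<Sum>i\<in>J. m i) = 0" "residue (\<lambda>z. \<Prod>j\<in>S. inverse (z - l j)) (l i0) = (\<Sum>i\<in>J. r i)"
proof -
  have JS: "J \<subseteq> S" by (auto simp: J_def)
  have "(\<lambda>n. of_real (1 ^ (card S - 1)) * (\<Sum>i\<in>J. inverse (diffprod S (w n) i))) \<longlonglongrightarrow>
     (\<Prod>j\<in>S - S. inverse (- 1)) * residue (\<lambda>z. \<Prod>j\<in>S. inverse (z - l j)) (l i0)"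
    unfolding J_def
    by (rule cluster_scaling_limit[OF finS order_refl, where b = "\<lambda>_. 0"]) (use l seq_inj i0 in auto)
  then have z: "(\<lambda>n. ((\<Sum>i\<in>J. m i) + t n * (\<Sum>i\<in>J. r i)) / t n)
      \<longlonglongrightarrow> residue (\<lambda>z. \<Prod>j\<in>S. inverse (z - l j)) (l i0)"
    using JS by (simp add: seq_cluster_sum)
  have "(\<lambda>n. t n * (((\<Sum>i\<in>J. m i) + t n * (\<Sum>i\<in>J. r i)) / t n)) \<longlonglongrightarrow> 0 * residue (\<lambda>z. \<Prod>j\<in>S. inverse (z - l j)) (l i0)"
    by (intro tendsto_mult of_real_t_lim z)
  moreover have "(\<lambda>n. t n * (((\<Sum>i\<in>J. m i) + t n * (\<Sum>i\<in>J. r i)) / t n)) = (\<lambda>n. (\<Sum>i\<in>J. m i) + t n * (\<Sum>i\<in>J. r i))"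
    using seq_pos by (auto simp: fun_eq_iff less_imp_neq[symmetric])
  ultimately show mJ: "(\<Sum>i\<in>J. m i) = 0"
    using perturbed_sum_lim[of "\<Sum>i\<in>J. m i" "\<Sum>i\<in>J. r i"] by (simp add: LIMSEQ_unique)
  have "(\<lambda>n. ((\<Sum>i\<in>J. m i) + t n * (\<Sum>i\<in>J. r i)) / t n) = (\<lambda>n. \<Sum>i\<in>J. r i)"
    using seq_pos mJ by (auto simp: fun_eq_iff less_imp_neq[symmetric])
  then show "residue (\<lambda>z. \<Prod>j\<in>S. inverse (z - l j)) (l i0) = (\<Sum>i\<in>J. r i)"
    using z by (simp add: LIMSEQ_const_iff)
qed

end

text \<open>If the deviations in a cluster were much larger than \<open>kap\<close>, rescaling by
  their actual size D would show a nonconstant limit shape, hence a subcluster with nonzero residue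
  by \<open>exists_nonzero_residue\<close>. The scaled sums over that subcluster must tend to this
  nonzero value, but they tend to 0.\<close>

lemma cluster_bounded:
  assumes sq: "solution_seq t w"
    and l: "\<And>i. i \<in> S \<Longrightarrow> (\<lambda>n. w n i) \<longlonglongrightarrow> l i" and i0: "i0 \<in> S"
  defines "B \<equiv> {i \<in> S. l i = l i0}"
  assumes cB: "card B \<ge> 2"
  shows "\<exists>C. \<forall>n. (\<Sum>i\<in>B. cmod ((w n i - avg B (w n)) / kap (card B) (t n))) \<le> C"
proof (rule ccontr)
  assume "\<not> ?thesis"
  from unbounded_subseq[OF this] obtain \<phi> where \<phi>: "strict_mono \<phi>"
    and top: "filterlim (\<lambda>n. \<Sum>i\<in>B. cmod ((w (\<phi> n) i - avg B (w (\<phi> n))) / kap (card B) (t (\<phi> n)))) at_top sequentially"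
    by blast
  note sq\<phi> = solution_seq_subseq[OF sq \<phi>]
  have finB: "finite B" and BS: "B \<subseteq> S" and Bne: "B \<noteq> {}" using finS i0 by (auto simp: B_def)
  define k where "k n = kap (card B) (t (\<phi> n))" for n
  have kpos: "k n > 0" for n using seq_pos[OF sq\<phi>, of n] by (simp add: k_def kap_pos)
  define b where "b n = avg B (w (\<phi> n))" for n
  define D where "D n = (\<Sum>i\<in>B. cmod (w (\<phi> n) i - b n))" for n
  define E where "E n = (\<Sum>i\<in>B. cmod ((w (\<phi> n) i - b n) / k n))" for n
  have E: "filterlim E at_top sequentially" using top by (simp add: E_def[abs_def] b_def k_def)
  have DE: "D n = k n * E n" for n
    using kpos[of n] by (simp add: D_def E_def norm_divide sum_distrib_left)
  have Dpos: "D n > 0" for n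
  proof (rule ccontr)
    assume "\<not> D n > 0"
    moreover have "D n \<ge> 0" by (simp add: D_def sum_nonneg)
    ultimately have "D n = 0" by linarith
    then have z: "w (\<phi> n) i = b n" if "i \<in> B" for i
      using finB that unfolding D_def by (simp add: sum_nonneg_eq_0_iff)
    have "w (\<phi> n) ` B \<subseteq> {b n}" using z by auto
    then have "card (w (\<phi> n) ` B) \<le> 1" using card_mono[of "{b n}" "w (\<phi> n) ` B"] by simp
    then show False using cB card_image[OF inj_on_subset[OF seq_inj[OF sq\<phi>, of n] BS]] by simp
  qed
  define x where "x n i = (w (\<phi> n) i - b n) / D n" for n i
  have xb: "\<exists>C. \<forall>n. cmod (x n i) \<le> C" if i: "i \<in> B" for i
  proof -
    have "cmod (x n i) \<le> 1" for n
    proof -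
      have "cmod (w (\<phi> n) i - b n) \<le> D n" unfolding D_def using i finB by (intro member_le_sum) auto
      then show ?thesis using Dpos[of n] by (simp add: x_def norm_divide)
    qed
    then show ?thesis by blast
  qed
  from finite_bounded_subseq[of B x, OF finB xb] obtain \<psi> \<xi> where \<psi>: "strict_mono \<psi>"
    and lim: "\<And>i. i \<in> B \<Longrightarrow> (\<lambda>n. x (\<psi> n) i) \<longlonglongrightarrow> \<xi> i" by blast
  note sq\<psi> = solution_seq_subseq[OF sq\<phi> \<psi>]
  have sx: "(\<Sum>i\<in>B. \<xi> i) = 0"
  proof -
    have "(\<lambda>n. \<Sum>i\<in>B. x (\<psi> n) i) \<longlonglongrightarrow> (\<Sum>i\<in>B. \<xi> i)" by (intro tendsto_sum lim)
    moreover have "(\<Sum>i\<in>B. x (\<psi> n) i) = 0" for n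
      using sum_diff_avg[OF finB Bne, of "w (\<phi> (\<psi> n))"] by (simp add: x_def b_def flip: sum_divide_distrib)
    ultimately show ?thesis by (simp add: LIMSEQ_const_iff)
  qed
  have nx: "(\<Sum>i\<in>B. cmod (\<xi> i)) = 1"
  proof -
    have "(\<lambda>n. \<Sum>i\<in>B. cmod (x (\<psi> n) i)) \<longlonglongrightarrow> (\<Sum>i\<in>B. cmod (\<xi> i))" by (intro tendsto_sum tendsto_norm lim)
    moreover have "(\<Sum>i\<in>B. cmod (x (\<psi> n) i)) = 1" for n
      using Dpos[of "\<psi> n"] by (simp add: x_def norm_divide flip: sum_divide_distrib) (simp add: D_def)
    ultimately show ?thesis by (simp add: LIMSEQ_const_iff)
  qed
  have "card (\<xi> ` B) \<ge> 2"
  proof (rule ccontr)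
    assume "\<not> card (\<xi> ` B) \<ge> 2"
    then have c1: "card (\<xi> ` B) \<le> Suc 0" by linarith
    have "\<forall>a\<in>\<xi> ` B. \<forall>b\<in>\<xi> ` B. a = b"
      by (rule iffD1[OF card_le_Suc0_iff_eq[OF finite_imageI[OF finB]] c1])
    moreover have "i0 \<in> B" using i0 by (simp add: B_def)
    ultimately have c: "\<xi> i = \<xi> i0" if "i \<in> B" for i
      by (meson imageI that)
    have "(\<Sum>i\<in>B. \<xi> i) = (\<Sum>i\<in>B. \<xi> i0)" by (rule sum.cong[OF refl c])
    then have "of_nat (card B) * \<xi> i0 = 0" using sx by simp
    then have "\<xi> i0 = 0" using cB by auto
    moreover have "(\<Sum>i\<in>B. cmod (\<xi> i)) = (\<Sum>i\<in>B. cmod (\<xi> i0))"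
      by (rule sum.cong[OF refl], rule arg_cong[of _ _ cmod], rule c)
    ultimately show False using nx by simp
  qed
  from exists_nonzero_residue[OF finB this] obtain \<eta> where \<eta>: "\<eta> \<in> \<xi> ` B"
    "residue (\<lambda>z. \<Prod>j\<in>B. inverse (z - \<xi> j)) \<eta> \<noteq> 0" by blast
  define J where "J = {i \<in> B. \<xi> i = \<eta>}"
  have JS: "J \<subseteq> S" using BS by (auto simp: J_def)
  define T where "T n = t (\<phi> (\<psi> n))" for n
  have Tpos: "T n > 0" for n using seq_pos[OF sq\<psi>] by (simp add: T_def)
  have blim: "(\<lambda>n. b (\<psi> n)) \<longlonglongrightarrow> l i0"
  proof -
    have "(\<lambda>n. avg B (w n)) \<longlonglongrightarrow> avg B l" using BS by (intro tendsto_avg l) auto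
    also have "avg B l = l i0" using finB Bne by (intro avg_const) (auto simp: B_def)
    finally have "(\<lambda>n. avg B (w n)) \<longlonglongrightarrow> l i0" .
    from LIMSEQ_subseq_LIMSEQ[OF LIMSEQ_subseq_LIMSEQ[OF this \<phi>] \<psi>] show ?thesis by (simp add: b_def o_def)
  qed
  have wlim: "(\<lambda>n. w (\<phi> (\<psi> n)) i) \<longlonglongrightarrow> l i" if "i \<in> S" for i
    using LIMSEQ_subseq_LIMSEQ[OF LIMSEQ_subseq_LIMSEQ[OF l[OF that] \<phi>] \<psi>] by (simp add: o_def)
  have D0: "(\<lambda>n. D (\<psi> n)) \<longlonglongrightarrow> 0"
  proof -
    have "(\<lambda>n. D (\<psi> n)) \<longlonglongrightarrow> (\<Sum>i\<in>B. cmod (l i - l i0))"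
      unfolding D_def using BS by (intro tendsto_intros wlim blim) auto
    also have "(\<Sum>i\<in>B. cmod (l i - l i0)) = 0" by (auto simp: B_def)
    finally show ?thesis .
  qed
  define c where "c = (\<Prod>j\<in>S - B. inverse (- (l j - l i0)))"
  have c0: "c \<noteq> 0" unfolding c_def using finS by (auto simp: B_def)
  have "(\<lambda>n. of_real (D (\<psi> n) ^ (card B - 1)) * (\<Sum>i\<in>J. inverse (diffprod S (w (\<phi> (\<psi> n))) i))) \<longlonglongrightarrow>
     c * residue (\<lambda>z. \<Prod>j\<in>B. inverse (z - \<xi> j)) \<eta>"
    unfolding J_def c_def
  proof (rule cluster_scaling_limit[OF finS BS, where b = "\<lambda>n. b (\<psi> n)"])
    show "(\<lambda>n. (w (\<phi> (\<psi> n)) i - b (\<psi> n)) / complex_of_real (D (\<psi> n))) \<longlonglongrightarrow> \<xi> i" if "i \<in> B" for i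
      using lim[OF that] by (simp add: x_def)
    show "(\<lambda>n. w (\<phi> (\<psi> n)) j - b (\<psi> n)) \<longlonglongrightarrow> l j - l i0" if "j \<in> S - B" for j
      using that by (intro tendsto_diff wlim blim) auto
    show "l j - l i0 \<noteq> 0" if "j \<in> S - B" for j using that by (auto simp: B_def)
  qed (use Dpos seq_inj[OF sq\<psi>] \<eta> D0 in auto)
  then have lim1: "(\<lambda>n. of_real (D (\<psi> n) ^ (card B - 1)) * (((\<Sum>i\<in>J. m i) + T n * (\<Sum>i\<in>J. r i)) / T n))
      \<longlonglongrightarrow> c * residue (\<lambda>z. \<Prod>j\<in>B. inverse (z - \<xi> j)) \<eta>"
    using seq_cluster_sum[OF sq\<psi> JS] by (simp add: T_def)
  \<comment> \<open>D = \<open>kap\<close> * E and the relevant power of \<open>kap\<close> is t; so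
    the scaled sum is E^(s-1) times (sum_J m + T sum_J r), with E -> infinity.\<close>
  have ET: "D (\<psi> n) ^ (card B - 1) = T n * E (\<psi> n) ^ (card B - 1)" for n
    unfolding DE power_mult_distrib k_def T_def using kap_power[OF seq_pos[OF sq\<psi>] cB] by simp
  have top2: "filterlim (\<lambda>n. E (\<psi> n) ^ (card B - 1)) at_top sequentially"
  proof -
    have "filterlim (\<lambda>n. E (\<psi> n)) at_top sequentially"
      using filterlim_compose[OF E filterlim_subseq[OF \<psi>]] .
    then show ?thesis using cB by (intro filterlim_pow_at_top) auto
  qed
  have "of_real (D (\<psi> n) ^ (card B - 1)) * (((\<Sum>i\<in>J. m i) + T n * (\<Sum>i\<in>J. r i)) / T n)
     = of_real (E (\<psi> n) ^ (card B - 1)) * ((\<Sum>i\<in>J. m i) + T n * (\<Sum>i\<in>J. r i))" for n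
    unfolding ET using Tpos[of n] by simp
  then have "(\<lambda>n. of_real (E (\<psi> n) ^ (card B - 1)) * ((\<Sum>i\<in>J. m i) + T n * (\<Sum>i\<in>J. r i)))
      \<longlonglongrightarrow> c * residue (\<lambda>z. \<Prod>j\<in>B. inverse (z - \<xi> j)) \<eta>" using lim1 by simp
  from tendsto_zero_if_mult_at_top[OF top2 this]
  have "(\<lambda>n. (\<Sum>i\<in>J. m i) + T n * (\<Sum>i\<in>J. r i)) \<longlonglongrightarrow> 0" .
  moreover have "(\<lambda>n. (\<Sum>i\<in>J. m i) + T n * (\<Sum>i\<in>J. r i)) \<longlonglongrightarrow> (\<Sum>i\<in>J. m i)"
    using perturbed_sum_lim[OF sq\<psi>] by (simp add: T_def)
  ultimately have mJ: "(\<Sum>i\<in>J. m i) = 0" by (simp add: LIMSEQ_unique)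
  \<comment> \<open>With sum_J m = 0 the same sequence equals D^(s-1) times sum_J r. The cluster
    collapses, so D -> 0, and the exponent is positive.\<close>
  have "(\<lambda>n. of_real (D (\<psi> n) ^ (card B - 1)) * (\<Sum>i\<in>J. r i)) \<longlonglongrightarrow> of_real (0 ^ (card B - 1)) * (\<Sum>i\<in>J. r i)"
    by (intro tendsto_intros D0)
  moreover have "((\<Sum>i\<in>J. m i) + T n * (\<Sum>i\<in>J. r i)) / T n = (\<Sum>i\<in>J. r i)" for n
    using mJ Tpos[of n] by simp
  ultimately have "c * residue (\<lambda>z. \<Prod>j\<in>B. inverse (z - \<xi> j)) \<eta> = of_real (0 ^ (card B - 1)) * (\<Sum>i\<in>J. r i)"
    using lim1 by (simp add: LIMSEQ_unique)
  moreover have "(0 :: real) ^ (card B - 1) = 0" using cB by simp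
  ultimately have "c * residue (\<lambda>z. \<Prod>j\<in>B. inverse (z - \<xi> j)) \<eta> = 0" by (simp only: of_real_0 mult_zero_left)
  then show False using c0 \<eta>(2) by simp
qed

text \<open>Extract a limit of the points, read off the clusters, then extract a limit of the
  rescaled deviations, which are bounded by \<open>cluster_bounded\<close>. The equations of
  \<open>limits\<close> follow by continuity and by \<open>seq_limit_clusters\<close>.\<close>

lemma solution_seq_converges:
  assumes sq0: "solution_seq t w"
  shows "\<exists>P v \<phi>. (P, v) \<in> limits \<and> strict_mono \<phi> \<and> (\<forall>i\<in>S. (\<lambda>n. vof P (t (\<phi> n)) (w (\<phi> n)) i) \<longlonglongrightarrow> v i)"
proof -
  obtain C where C: "\<And>n. (\<Sum>i\<in>S. cmod (w n i)) \<le> C" using seq_bounded[OF sq0] by blast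
  have wb: "\<exists>C. \<forall>n. cmod (w n i) \<le> C" if "i \<in> S" for i
  proof (intro exI allI)
    fix n
    have "cmod (w n i) \<le> (\<Sum>i\<in>S. cmod (w n i))" using finS that by (intro member_le_sum) auto
    then show "cmod (w n i) \<le> C" using C[of n] by linarith
  qed
  from finite_bounded_subseq[of S w, OF finS wb] obtain \<phi> l where \<phi>: "strict_mono \<phi>"
    and l: "\<And>i. i \<in> S \<Longrightarrow> (\<lambda>n. w (\<phi> n) i) \<longlonglongrightarrow> l i" by blast
  note sq = solution_seq_subseq[OF sq0 \<phi>]
  \<comment> \<open>The clusters are the groups of indices with the same limit point.\<close>
  define P where "P = (\<lambda>u. {i \<in> S. l i = u}) ` (l ` S)"
  have part: "partition_on S P" by (auto simp: partition_on_def P_def disjoint_def)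
  have blk: "blk P i = {j \<in> S. l j = l i}" if "i \<in> S" for i
    using that by (intro blk_eqI[OF part]) (auto simp: P_def)
  have zB: "(\<Sum>i\<in>B. m i) = 0" if "B \<in> P" for B
    using seq_limit_clusters(1)[OF sq l] that by (auto simp: P_def)
  have big: "card B \<ge> 2" if B: "B \<in> P" for B
  proof (rule ccontr)
    assume "\<not> card B \<ge> 2"
    moreover have "B \<noteq> {}" "B \<subseteq> S" using B part by (auto simp: partition_on_def)
    moreover have "finite B" by (rule finite_subset[OF \<open>B \<subseteq> S\<close> finS])
    moreover have "card B > 0" using \<open>B \<noteq> {}\<close> \<open>finite B\<close> by (simp add: card_gt_0_iff)
    ultimately have "card B = 1" by linarith
    then obtain i where "B = {i}" by (auto simp: card_1_singleton_iff)
    then show False using zB[OF B] m0 \<open>B \<subseteq> S\<close> by auto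
  qed
  interpret cluster_partition S P by unfold_locales (use finS part big in auto)
  define u where "u n = vof P (t (\<phi> n)) (w (\<phi> n))" for n
  have cenlim: "(\<lambda>n. cen P (w (\<phi> n)) i) \<longlonglongrightarrow> l i" if i: "i \<in> S" for i
  proof -
    have "(\<lambda>n. cen P (w (\<phi> n)) i) \<longlonglongrightarrow> cen P l i" using partition_blk[OF part i] by (intro tendsto_avg l) auto
    also have "cen P l i = l i" using finB[OF i] by (intro avg_const) (auto simp: blk[OF i])
    finally show ?thesis .
  qed
  have "\<exists>C. \<forall>n. cmod (u n i) \<le> C" if i: "i \<in> S" for i
  proof -
    have "card {j \<in> S. l j = l i} \<ge> 2" using bigblk[OF i] blk[OF i] by simp
    from cluster_bounded[OF sq l i this] obtain C1 where C1:
      "\<And>n. (\<Sum>j\<in>blk P i. cmod ((w (\<phi> n) j - avg (blk P i) (w (\<phi> n))) / kap (card (blk P i)) (t (\<phi> n)))) \<le> C1"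
      unfolding blk[OF i] by blast
    have "convergent (\<lambda>n. cen P (w (\<phi> n)) i)" using cenlim[OF i] by (auto simp: convergent_def)
    then obtain C2 where C2: "\<And>n. cmod (cen P (w (\<phi> n)) i) \<le> C2"
      using convergent_imp_Bseq by (metis BseqE)
    have "cmod (u n i) \<le> C2 + C1" for n
    proof -
      have "cmod ((w (\<phi> n) i - avg (blk P i) (w (\<phi> n))) / kap (card (blk P i)) (t (\<phi> n))) \<le> C1"
        using partition_blk[OF part i] finB[OF i] by (intro order.trans[OF member_le_sum C1]) auto
      then show ?thesis unfolding u_def vof_def using C2[of n] by (intro order.trans[OF norm_triangle_ineq add_mono]) auto
    qed
    then show ?thesis by blast
  qed
  from finite_bounded_subseq[of S u, OF finS this] obtain \<psi> v0 where \<psi>: "strict_mono \<psi>"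
    and v0: "\<And>i. i \<in> S \<Longrightarrow> (\<lambda>n. u (\<psi> n) i) \<longlonglongrightarrow> v0 i" by blast
  define v where "v = restrict v0 S"
  have v: "(\<lambda>n. u (\<psi> n) i) \<longlonglongrightarrow> v i" if "i \<in> S" for i using v0[OF that] that by (simp add: v_def)
  note sq2 = solution_seq_subseq[OF sq \<psi>]
  have wl: "(\<lambda>n. w (\<phi> (\<psi> n)) i) \<longlonglongrightarrow> l i" if "i \<in> S" for i
    using LIMSEQ_subseq_LIMSEQ[OF l[OF that] \<psi>] by (simp add: o_def)
  have wu: "wof P (t (\<phi> (\<psi> n))) (u (\<psi> n)) i = w (\<phi> (\<psi> n)) i" if "i \<in> S" for n i
    using wof_vof[OF seq_pos[OF sq2] that] by (simp add: u_def)
  have su: "(\<Sum>i\<in>S. u (\<psi> n) i) = 0" for n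
  proof -
    have "(\<Sum>i\<in>S. u (\<psi> n) i) = (\<Sum>i\<in>S. wof P (t (\<phi> (\<psi> n))) (u (\<psi> n)) i)" by (simp add: sum_wof)
    also have "\<dots> = (\<Sum>i\<in>S. w (\<phi> (\<psi> n)) i)" by (intro sum.cong refl wu)
    finally show ?thesis using seq_sum[OF sq2] by simp
  qed
  have L1: "(\<Sum>i\<in>S. v i) = 0"
  proof -
    have "(\<lambda>n. \<Sum>i\<in>S. u (\<psi> n) i) \<longlonglongrightarrow> (\<Sum>i\<in>S. v i)" by (intro tendsto_sum v)
    then show ?thesis by (simp add: su LIMSEQ_const_iff)
  qed
  have cv: "cen P v i = l i" if i: "i \<in> S" for i
  proof -
    have "(\<lambda>n. cen P (u (\<psi> n)) i) \<longlonglongrightarrow> cen P v i" using partition_blk[OF part i] by (intro tendsto_avg v) auto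
    moreover have "(\<lambda>n. cen P (u (\<psi> n)) i) = (\<lambda>n. cen P (w (\<phi> (\<psi> n))) i)" by (simp add: u_def cen_vof[OF i])
    moreover have "(\<lambda>n. cen P (w (\<phi> (\<psi> n))) i) \<longlonglongrightarrow> l i"
      using LIMSEQ_subseq_LIMSEQ[OF cenlim[OF i] \<psi>] by (simp add: o_def)
    ultimately show ?thesis by (simp add: LIMSEQ_unique)
  qed
  have "P \<in> zsp S m" using part zB by (simp add: zsp_def)
  moreover have "v \<in> S \<rightarrow>\<^sub>E UNIV" by (simp add: v_def)
  moreover have "cen P v i \<noteq> cen P v j" if "i \<in> S" "j \<in> S" "blk P i \<noteq> blk P j" for i j
  proof -
    have "l i \<noteq> l j" using that(3) blk[OF that(1)] blk[OF that(2)] by auto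
    then show ?thesis by (simp add: cv that)
  qed
  moreover have "m i * ((\<Prod>j\<in>blk P i - {i}. v i - v j) * (\<Prod>j\<in>S - blk P i. cen P v i - cen P v j)) = 1" if i: "i \<in> S" for i
  proof -
    have bS: "j \<in> S" if "j \<in> blk P i" for j using that partition_blk[OF part i] by auto
    \<comment> \<open>The factor t has been cancelled by means of \<open>diffprod_wof\<close>, and
      in this form every factor converges.\<close>
    have "(m i + t (\<phi> (\<psi> n)) * r i) * ((\<Prod>j\<in>blk P i - {i}. u (\<psi> n) i - u (\<psi> n) j) *
        (\<Prod>j\<in>S - blk P i. w (\<phi> (\<psi> n)) i - w (\<phi> (\<psi> n)) j)) = 1" for n
    proof -
      have "diffprod S (w (\<phi> (\<psi> n))) i = diffprod S (wof P (t (\<phi> (\<psi> n))) (u (\<psi> n))) i"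
        unfolding diffprod_def using i by (intro prod.cong refl) (simp add: wu)
      also have "\<dots> = t (\<phi> (\<psi> n)) * ((\<Prod>j\<in>blk P i - {i}. u (\<psi> n) i - u (\<psi> n) j) *
          (\<Prod>j\<in>S - blk P i. wof P (t (\<phi> (\<psi> n))) (u (\<psi> n)) i - wof P (t (\<phi> (\<psi> n))) (u (\<psi> n)) j))"
        by (rule diffprod_wof[OF seq_pos[OF sq2] i])
      also have "(\<Prod>j\<in>S - blk P i. wof P (t (\<phi> (\<psi> n))) (u (\<psi> n)) i - wof P (t (\<phi> (\<psi> n))) (u (\<psi> n)) j)
          = (\<Prod>j\<in>S - blk P i. w (\<phi> (\<psi> n)) i - w (\<phi> (\<psi> n)) j)"
        using i by (intro prod.cong refl) (simp add: wu)
      finally show ?thesis using seq_eq[OF sq2 i, of n] seq_pos[OF sq2, of n] by simp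
    qed
    moreover have "(\<lambda>n. (m i + t (\<phi> (\<psi> n)) * r i) * ((\<Prod>j\<in>blk P i - {i}. u (\<psi> n) i - u (\<psi> n) j) *
        (\<Prod>j\<in>S - blk P i. w (\<phi> (\<psi> n)) i - w (\<phi> (\<psi> n)) j)))
       \<longlonglongrightarrow> m i * ((\<Prod>j\<in>blk P i - {i}. v i - v j) * (\<Prod>j\<in>S - blk P i. l i - l j))"
      using i bS by (intro tendsto_mult tendsto_prod tendsto_diff v wl perturbed_sum_lim[OF sq2]) auto
    ultimately have "m i * ((\<Prod>j\<in>blk P i - {i}. v i - v j) * (\<Prod>j\<in>S - blk P i. l i - l j)) = 1"
      by (simp add: LIMSEQ_const_iff)
    moreover have "(\<Prod>j\<in>S - blk P i. cen P v i - cen P v j) = (\<Prod>j\<in>S - blk P i. l i - l j)"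
      using i by (intro prod.cong refl) (simp add: cv)
    ultimately show ?thesis by simp
  qed
  moreover have "residue (\<lambda>z. \<Prod>j\<in>S. inverse (z - cen P v j)) (cen P v i) = (\<Sum>j\<in>blk P i. r j)" if i: "i \<in> S" for i
  proof -
    have "(\<lambda>z. \<Prod>j\<in>S. inverse (z - cen P v j)) = (\<lambda>z. \<Prod>j\<in>S. inverse (z - l j))"
      by (intro ext prod.cong refl) (simp add: cv)
    then show ?thesis unfolding cv[OF i] using seq_limit_clusters(2)[OF sq l i] by (simp add: blk[OF i])
  qed
  ultimately have "(P, v) \<in> limits" unfolding limits_def using L1 by blast
  moreover have "strict_mono (\<lambda>n. \<phi> (\<psi> n))" using strict_mono_o[OF \<phi> \<psi>] by (simp add: o_def)
  ultimately show ?thesis using v unfolding u_def by blast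
qed

end

section \<open>Infinitesimal rigidity of poles with given residues\<close>

text \<open>The function is the derivative of the product of the (z - eta_v)^(-s_v) when the poles
  move with velocities g. So the lemma says that the only motion changing all residues by the same
  amount is a translation, which the weighted sum excludes. Over the common denominator the
  numerator has degree at most \<open>card U - 1\<close>, the borderline case of
  \<open>equal_residues\<close>.\<close>

lemma equal_residues_log_derivative:
  fixes \<eta> :: "'a \<Rightarrow> complex" and g :: "'a \<Rightarrow> complex"
  assumes fin: "finite U" and ne: "U \<noteq> {}" and inj: "inj_on \<eta> U" and s: "\<And>u. u \<in> U \<Longrightarrow> s u \<ge> (1::nat)"
    and res: "\<And>u. u \<in> U \<Longrightarrow> residue (\<lambda>z. (\<Sum>v\<in>U. of_nat (s v) * g v * inverse (z - \<eta> v)) *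
        (\<Prod>v\<in>U. inverse (z - \<eta> v) ^ s v)) (\<eta> u) = a"
  shows "a = 0" "(\<Sum>u\<in>U. of_nat (s u) * g u) = 0 \<Longrightarrow> u \<in> U \<Longrightarrow> g u = 0"
proof -
  define X where "X = (\<Sum>u\<in>U. smult (of_nat (s u) * g u) (\<Prod>v\<in>U - {u}. [:- \<eta> v, 1:]))"
  have cU: "card U \<ge> 1" using fin ne by (simp add: Suc_leI card_gt_0_iff)
  have degp: "degree (\<Prod>v\<in>U - {u}. [:- \<eta> v, 1:]) = card U - 1" if "u \<in> U" for u
    using that fin by (subst degree_prod_eq_sum_degree) auto
  have degX: "degree X \<le> card U - 1"
    unfolding X_def by (intro degree_sum_le order.trans[OF degree_smult_le]) (use fin degp in auto)
  have eq: "poly X z / (\<Prod>v\<in>U. (z - \<eta> v) ^ (s v + 1)) =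
     (\<Sum>v\<in>U. of_nat (s v) * g v * inverse (z - \<eta> v)) * (\<Prod>v\<in>U. inverse (z - \<eta> v) ^ s v)"
    if z: "z \<notin> \<eta> ` U" for z
  proof -
    have nz: "z - \<eta> v \<noteq> 0" if "v \<in> U" for v using z that by auto
    have "poly X z = (\<Sum>v\<in>U. of_nat (s v) * g v * inverse (z - \<eta> v)) * (\<Prod>v\<in>U. z - \<eta> v)"
      unfolding X_def poly_sum sum_distrib_right
    proof (rule sum.cong[OF refl])
      fix u assume u: "u \<in> U"
      show "poly (smult (of_nat (s u) * g u) (\<Prod>v\<in>U - {u}. [:- \<eta> v, 1:])) z =
         of_nat (s u) * g u * inverse (z - \<eta> u) * (\<Prod>v\<in>U. z - \<eta> v)"
        using nz[OF u] by (subst prod.remove[OF fin u]) (simp add: poly_prod)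
    qed
    moreover have "(\<Prod>v\<in>U. (z - \<eta> v) ^ (s v + 1)) = (\<Prod>v\<in>U. z - \<eta> v) * (\<Prod>v\<in>U. (z - \<eta> v) ^ s v)"
      by (simp add: prod.distrib)
    moreover have "(\<Prod>v\<in>U. z - \<eta> v) \<noteq> 0" using nz fin by auto
    moreover have "(\<Prod>v\<in>U. inverse (z - \<eta> v) ^ s v) = inverse (\<Prod>v\<in>U. (z - \<eta> v) ^ s v)"
      by (simp add: power_inverse prod_inversef[symmetric] o_def)
    ultimately show ?thesis by (simp add: divide_inverse)
  qed
  have sumS: "(\<Sum>u\<in>U. s u + 1) \<ge> 2 * card U"
    using sum_mono[of U "\<lambda>_. 2" "\<lambda>u. s u + 1"] s by simp
  have res': "residue (\<lambda>z. poly X z / (\<Prod>v\<in>U. (z - \<eta> v) ^ (s v + 1))) (\<eta> u) = a" if u: "u \<in> U" for u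
  proof -
    have "residue (\<lambda>z. poly X z / (\<Prod>v\<in>U. (z - \<eta> v) ^ (s v + 1))) (\<eta> u) =
        residue (\<lambda>z. (\<Sum>v\<in>U. of_nat (s v) * g v * inverse (z - \<eta> v)) *
        (\<Prod>v\<in>U. inverse (z - \<eta> v) ^ s v)) (\<eta> u)"
    proof (rule residue_cong)
      have "eventually (\<lambda>z. z \<in> - (\<eta> ` (U - {u}))) (nhds (\<eta> u))"
      proof (rule eventually_nhds_in_open)
        show "open (- (\<eta> ` (U - {u})))" using fin by (intro open_Compl finite_imp_closed) auto
        show "\<eta> u \<in> - (\<eta> ` (U - {u}))" using inj u by (auto simp: inj_on_def)
      qed
      then have "\<forall>\<^sub>F z in at (\<eta> u). z \<notin> \<eta> ` U"
        unfolding eventually_at_filter by eventually_elim auto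
      then show "\<forall>\<^sub>F z in at (\<eta> u). poly X z / (\<Prod>v\<in>U. (z - \<eta> v) ^ (s v + 1)) =
          (\<Sum>v\<in>U. of_nat (s v) * g v * inverse (z - \<eta> v)) * (\<Prod>v\<in>U. inverse (z - \<eta> v) ^ s v)"
        by eventually_elim (rule eq)
    qed simp
    then show ?thesis using res[OF u] by simp
  qed
  \<comment> \<open>All exponents \<open>s u + 1\<close> are at least 2, so the denominator has
    degree at least 2 * card U, enough for the required decay.\<close>
  have deg: "degree X + 2 \<le> (\<Sum>u\<in>U. s u + 1)" using degX sumS cU by linarith
  note er = equal_residues[OF fin ne inj _ deg res']
  show "a = 0" by (rule er(1)) auto
  have X: "X = 0 \<or> card U \<le> degree X + 1" by (rule er(2)) auto
  assume z: "(\<Sum>u\<in>U. of_nat (s u) * g u) = 0" and u: "u \<in> U"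
  have "coeff X (card U - 1) = 0"
  proof -
    have "coeff X (card U - 1) = (\<Sum>u\<in>U. of_nat (s u) * g u)"
      unfolding X_def coeff_sum
    proof (rule sum.cong[OF refl])
      fix v assume v: "v \<in> U"
      have "coeff (\<Prod>v\<in>U - {v}. [:- \<eta> v, 1:]) (card U - 1) = lead_coeff (\<Prod>v\<in>U - {v}. [:- \<eta> v, 1:])"
        by (simp only: degp[OF v])
      then show "coeff (smult (of_nat (s v) * g v) (\<Prod>v\<in>U - {v}. [:- \<eta> v, 1:])) (card U - 1) = of_nat (s v) * g v"
        by (simp add: lead_coeff_prod)
    qed
    then show ?thesis using z by simp
  qed
  \<comment> \<open>A nonzero X would have degree exactly \<open>card U - 1\<close>, but its
    coefficient there is the vanishing weighted sum of g.\<close>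
  moreover have "degree X = card U - 1" if "X \<noteq> 0" using X that degX cU by linarith
  ultimately have "X = 0" by (metis leading_coeff_0_iff)
  then have "0 = poly X (\<eta> u)" by simp
  also have "\<dots> = (\<Sum>v\<in>U. if v = u then of_nat (s u) * g u * (\<Prod>v\<in>U - {u}. \<eta> u - \<eta> v) else 0)"
    unfolding X_def poly_sum
  proof (rule sum.cong[OF refl])
    fix v assume v: "v \<in> U"
    show "poly (smult (of_nat (s v) * g v) (\<Prod>v\<in>U - {v}. [:- \<eta> v, 1:])) (\<eta> u) =
        (if v = u then of_nat (s u) * g u * (\<Prod>v\<in>U - {u}. \<eta> u - \<eta> v) else 0)"
    proof (cases "v = u")
      case False
      then have "(\<Prod>v\<in>U - {v}. \<eta> u - \<eta> v) = 0" using u fin by (intro prod_zero) auto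
      then show ?thesis using False by (simp add: poly_prod)
    qed (simp add: poly_prod)
  qed
  also have "\<dots> = of_nat (s u) * g u * (\<Prod>v\<in>U - {u}. \<eta> u - \<eta> v)" using fin u by simp
  finally show "g u = 0" using s[OF u] inj u fin by (auto simp: inj_on_def)
qed

lemma has_field_derivative_prod_inverse:
  assumes "finite A" "\<And>j. j \<in> A \<Longrightarrow> z \<noteq> v j"
  shows "((\<lambda>z. \<Prod>j\<in>A. inverse (z - v j)) has_field_derivative
    - (\<Prod>j\<in>A. inverse (z - v j)) * (\<Sum>j\<in>A. inverse (z - v j))) (at z)"
  using assms
proof (induction A rule: finite_induct)
  case (insert a A)
  have "((\<lambda>z. inverse (z - v a)) has_field_derivative - (inverse (z - v a) * inverse (z - v a))) (at z)"
    using insert.prems by (auto intro!: derivative_eq_intros)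
  from DERIV_mult[OF this insert.IH] insert.prems insert.hyps show ?case
    by (simp add: algebra_simps)
qed auto

text \<open>The pole at \<open>v i\<close> is double, so the residue is the derivative of the
  holomorphic numerator \<open>N\<close>. The product rule combines the terms in h i and h j into
  differences.\<close>

lemma residue_log_derivative_simple:
  fixes v h :: "'a \<Rightarrow> complex"
  assumes fin: "finite B" and inj: "inj_on v B" and i: "i \<in> B"
  shows "residue (\<lambda>z. (\<Sum>j\<in>B. h j * inverse (z - v j)) * (\<Prod>j\<in>B. inverse (z - v j))) (v i)
    = - (\<Prod>j\<in>B - {i}. inverse (v i - v j)) * (\<Sum>j\<in>B - {i}. (h i - h j) * inverse (v i - v j))"
proof -
  define A where "A = B - {i}"
  have finA: "finite A" using fin by (simp add: A_def)
  define s where "s = - (v ` A)"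
  have s: "open s" "v i \<in> s" using finA inj i by (auto simp: s_def A_def inj_on_def intro!: open_Compl finite_imp_closed)
  define p where "p z = (\<Prod>j\<in>A. inverse (z - v j))" for z
  define q where "q z = (\<Sum>j\<in>A. h j * inverse (z - v j))" for z
  define N where "N z = (h i + q z * (z - v i)) * p z" for z
  have nz: "v i \<noteq> v j" if "j \<in> A" for j using that inj i by (auto simp: A_def inj_on_def)
  have eq: "(\<Sum>j\<in>B. h j * inverse (z - v j)) * (\<Prod>j\<in>B. inverse (z - v j)) = N z / (z - v i) ^ Suc 1" if "z \<noteq> v i" for z
  proof -
    have "(\<Sum>j\<in>B. h j * inverse (z - v j)) = h i * inverse (z - v i) + q z"
      unfolding q_def A_def by (rule sum.remove[OF fin i])
    moreover have "(\<Prod>j\<in>B. inverse (z - v j)) = inverse (z - v i) * p z"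
      unfolding p_def A_def by (rule prod.remove[OF fin i])
    moreover have "(h i * inverse y + q z) * (inverse y * p z) = (h i + q z * y) * p z / y ^ Suc 1" if "y \<noteq> 0" for y
      using that by (simp add: field_simps power2_eq_square)
    ultimately show ?thesis using that by (simp add: N_def)
  qed
  have "residue (\<lambda>z. (\<Sum>j\<in>B. h j * inverse (z - v j)) * (\<Prod>j\<in>B. inverse (z - v j))) (v i)
      = residue (\<lambda>z. N z / (z - v i) ^ Suc 1) (v i)"
  proof (rule residue_cong)
    show "\<forall>\<^sub>F z in at (v i). (\<Sum>j\<in>B. h j * inverse (z - v j)) * (\<Prod>j\<in>B. inverse (z - v j)) = N z / (z - v i) ^ Suc 1"
      unfolding eventually_at_filter by (rule always_eventually) (use eq in blast)
  qed simp
  also have "\<dots> = (deriv ^^ 1) N (v i) / fact 1"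
  proof (rule residue_holomorphic_over_power[OF s])
    show "N holomorphic_on s" unfolding N_def p_def q_def s_def by (intro holomorphic_intros) auto
  qed
  also have "\<dots> = deriv N (v i)" by simp
  also have "\<dots> = q (v i) * p (v i) + h i * (- p (v i) * (\<Sum>j\<in>A. inverse (v i - v j)))"
  proof (rule DERIV_imp_deriv)
    have dp: "(p has_field_derivative (- p (v i) * (\<Sum>j\<in>A. inverse (v i - v j)))) (at (v i))"
      unfolding p_def using nz by (intro has_field_derivative_prod_inverse finA) auto
    have "q holomorphic_on s" unfolding q_def s_def by (intro holomorphic_intros) auto
    then obtain q' where q': "(q has_field_derivative q') (at (v i))"
      using s holomorphic_derivI by blast
    have dq: "((\<lambda>z. h i + q z * (z - v i)) has_field_derivative q (v i)) (at (v i))"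
      using q' by (auto intro!: derivative_eq_intros)
    from DERIV_mult[OF dq dp] show "(N has_field_derivative q (v i) * p (v i) + h i * (- p (v i) * (\<Sum>j\<in>A. inverse (v i - v j)))) (at (v i))"
      by (simp add: N_def[abs_def] mult.commute)
  qed
  also have "\<dots> = - p (v i) * (\<Sum>j\<in>A. (h i - h j) * inverse (v i - v j))"
    unfolding q_def by (simp add: left_diff_distrib sum_subtractf right_diff_distrib sum_distrib_left sum_distrib_right mult_ac sum_negf)
  finally show ?thesis by (simp add: p_def A_def)
qed

lemma linear_as_sum:
  fixes L :: "('a \<Rightarrow> complex) \<Rightarrow> complex"
  assumes fin: "finite S" and add: "\<And>h k. L (\<lambda>i. h i + k i) = L h + L k"
    and scale: "\<And>c h. L (\<lambda>i. c * h i) = c * L h"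
    and cong: "\<And>h k. (\<And>i. i \<in> S \<Longrightarrow> h i = k i) \<Longrightarrow> L h = L k"
  shows "L h = (\<Sum>j\<in>S. L (\<lambda>i. if i = j then 1 else 0) * h j)"
proof -
  have "L (\<lambda>i. \<Sum>j\<in>T. h j * (if i = j then 1 else 0)) = (\<Sum>j\<in>T. L (\<lambda>i. if i = j then 1 else 0) * h j)"
    if "finite T" for T
    using that
  proof (induction T rule: finite_induct)
    case empty
    show ?case using scale[of 0 "\<lambda>_. 0"] by simp
  next
    case (insert a T)
    have "L (\<lambda>i. \<Sum>j\<in>insert a T. h j * (if i = j then 1 else 0))
      = L (\<lambda>i. h a * (if i = a then 1 else 0) + (\<Sum>j\<in>T. h j * (if i = j then 1 else 0)))"
      using insert.hyps by simp
    then show ?case using insert by (simp only: add scale) (simp add: mult.commute)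
  qed
  from this[OF fin] have "L (\<lambda>i. \<Sum>j\<in>S. h j * (if i = j then 1 else 0)) = (\<Sum>j\<in>S. L (\<lambda>i. if i = j then 1 else 0) * h j)" .
  moreover have "L h = L (\<lambda>i. \<Sum>j\<in>S. h j * (if i = j then 1 else 0))"
  proof (rule cong)
    fix i assume "i \<in> S"
    then show "h i = (\<Sum>j\<in>S. h j * (if i = j then 1 else 0))"
      using fin by (simp add: if_distrib[of "\<lambda>x. _ * x"] cong: if_cong)
  qed
  ultimately show ?thesis by simp
qed

lemma avg_add: "avg B (\<lambda>i. h i + k i) = avg B h + avg B k"
  by (simp add: avg_def sum.distrib add_divide_distrib)

lemma avg_cmult: "avg B (\<lambda>i. c * h i) = c * avg B h"
  by (simp add: avg_def flip: sum_distrib_left)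

lemma avg_cong: "(\<And>i. i \<in> B \<Longrightarrow> h i = k i) \<Longrightarrow> avg B h = avg B k"
  by (simp add: avg_def)

context strict_diff
begin

lemma sd_avg:
  assumes "B \<subseteq> S" "\<And>j. j \<in> B \<Longrightarrow> sd Z (g j) (g0 j) (M j)"
  shows "sd Z (\<lambda>z t v. avg B (\<lambda>j. g j z t v)) (\<lambda>z. avg B (\<lambda>j. g0 j z)) (\<lambda>z h. avg B (\<lambda>j. M j z h))"
proof -
  have "finite B" by (rule finite_subset[OF assms(1) finS])
  from sd_cmult[OF sd_sum[OF this assms(2)], where c = "inverse (of_nat (card B))"] show ?thesis
    by (rule sd_cong) (auto simp: avg_def divide_inverse mult.commute)
qed

lemma sd_prod_inverse_point:
  assumes A: "finite A" "\<And>j. j \<in> A \<Longrightarrow> sd {0} (g j) (g0 j) (M j)" "\<And>j. j \<in> A \<Longrightarrow> g0 j 0 \<noteq> 0"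
  shows "sd {0} (\<lambda>z t v. \<Prod>j\<in>A. inverse (g j z t v)) (\<lambda>z. \<Prod>j\<in>A. inverse (g0 j z))
    (\<lambda>z h. - (\<Prod>j\<in>A. inverse (g0 j z)) * (\<Sum>j\<in>A. M j z h / g0 j z))"
proof -
  define c where "c = Min (insert 1 ((\<lambda>j. cmod (g0 j 0)) ` A))"
  have c: "c > 0" unfolding c_def using A(1,3) by (subst Min_gr_iff) auto
  have "c \<le> cmod (g0 j 0)" if "j \<in> A" for j unfolding c_def using A(1) that by (intro Min_le) auto
  then show ?thesis using A(1,2) c by (intro sd_prod_inverse[of A _ g g0 M c]) auto
qed

end

section \<open>The regularised system around a limit point\<close>

locale limit_point = perturbation S m r for S :: "'a set" and m r :: "'a \<Rightarrow> complex" +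
  fixes P :: "'a set set" and v0 :: "'a \<Rightarrow> complex"
  assumes lim: "(P, v0) \<in> limits"
begin

lemma PS: "partition_on S P" and mB: "B \<in> P \<Longrightarrow> (\<Sum>i\<in>B. m i) = 0"
  and v0ext: "v0 \<in> S \<rightarrow>\<^sub>E UNIV" and sv0: "(\<Sum>i\<in>S. v0 i) = 0"
  and cen_ne: "i \<in> S \<Longrightarrow> j \<in> S \<Longrightarrow> blk P i \<noteq> blk P j \<Longrightarrow> cen P v0 i \<noteq> cen P v0 j"
  and eq0: "i \<in> S \<Longrightarrow> m i * ((\<Prod>j\<in>blk P i - {i}. v0 i - v0 j) * (\<Prod>j\<in>S - blk P i. cen P v0 i - cen P v0 j)) = 1"
  and res0: "i \<in> S \<Longrightarrow> residue (\<lambda>z. \<Prod>j\<in>S. inverse (z - cen P v0 j)) (cen P v0 i) = (\<Sum>j\<in>blk P i. r j)"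
  using lim by (auto simp: limits_def zsp_def)

lemma Pbig: "B \<in> P \<Longrightarrow> card B \<ge> 2"
proof (rule ccontr)
  assume B: "B \<in> P" and "\<not> card B \<ge> 2"
  moreover have "B \<noteq> {}" "B \<subseteq> S" using B PS by (auto simp: partition_on_def)
  moreover have "finite B" by (rule finite_subset[OF \<open>B \<subseteq> S\<close> finS])
  moreover have "card B > 0" using \<open>B \<noteq> {}\<close> \<open>finite B\<close> by (simp add: card_gt_0_iff)
  ultimately have "card B = 1" by linarith
  then obtain i where "B = {i}" by (auto simp: card_1_singleton_iff)
  then show False using mB[OF B] m0 \<open>B \<subseteq> S\<close> by auto
qed

sublocale cluster_partition S P
  by unfold_locales (use finS PS Pbig in auto)

sublocale sl: strict_diff S v0
  by unfold_locales (rule finS)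

lemma cen_in_blk: "i \<in> S \<Longrightarrow> k \<in> blk P i \<Longrightarrow> cen P h k = cen P h i"
  by (simp only: blk_blk)

lemma blk_sub: "i \<in> S \<Longrightarrow> j \<in> blk P i \<Longrightarrow> j \<in> S"
  using partition_blk(3)[OF PS] by blast

lemma cen_eq_iff: "i \<in> S \<Longrightarrow> j \<in> S \<Longrightarrow> cen P v0 i = cen P v0 j \<longleftrightarrow> j \<in> blk P i"
  using cen_ne[of i j] partition_blk(2)[OF PS, of j] cen_in_blk[of i j v0] by metis

lemma v0_ne: "i \<in> S \<Longrightarrow> j \<in> blk P i - {i} \<Longrightarrow> v0 i \<noteq> v0 j"
proof
  assume i: "i \<in> S" "j \<in> blk P i - {i}" "v0 i = v0 j"
  then have "(\<Prod>j\<in>blk P i - {i}. v0 i - v0 j) = 0" using finB[OF i(1)] by (intro prod_zero) auto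
  then show False using eq0[OF i(1)] by simp
qed

lemma v0_inj: "i \<in> S \<Longrightarrow> inj_on v0 (blk P i)"
proof (rule inj_onI, rule ccontr)
  fix j k assume i: "i \<in> S" and jk: "j \<in> blk P i" "k \<in> blk P i" "v0 j = v0 k" "j \<noteq> k"
  then have "k \<in> blk P j - {j}" using blk_blk[OF i jk(1)] by simp
  then show False using v0_ne[OF blk_sub[OF i jk(1)]] jk by blast
qed

text \<open>Half the least distance between different cluster centers, so a circle of this radius
  around one center keeps at least this distance from all of them. The inserted 1 covers the case of
  a single cluster.\<close>

definition separation :: real where
  "separation = Min (insert 1 ((\<lambda>(i, j). cmod (cen P v0 i - cen P v0 j)) ` {(i, j) \<in> S \<times> S. cen P v0 i \<noteq> cen P v0 j})) / 2"

lemma separation_pos: "separation > 0"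
  and separation_le: "i \<in> S \<Longrightarrow> j \<in> S \<Longrightarrow> cen P v0 i \<noteq> cen P v0 j \<Longrightarrow> 2 * separation \<le> cmod (cen P v0 i - cen P v0 j)"
proof -
  let ?D = "insert 1 ((\<lambda>(i, j). cmod (cen P v0 i - cen P v0 j)) ` {(i, j) \<in> S \<times> S. cen P v0 i \<noteq> cen P v0 j})"
  have "finite {(i, j) \<in> S \<times> S. cen P v0 i \<noteq> cen P v0 j}"
    by (rule finite_subset[of _ "S \<times> S"]) (use finS in auto)
  then have fin: "finite ?D" by blast
  have "0 < Min ?D" using fin by (subst Min_gr_iff) auto
  then show "separation > 0" by (simp add: separation_def)
  assume "i \<in> S" "j \<in> S" "cen P v0 i \<noteq> cen P v0 j"
  then have "Min ?D \<le> cmod (cen P v0 i - cen P v0 j)" by (intro Min_le fin) auto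
  then show "2 * separation \<le> cmod (cen P v0 i - cen P v0 j)" by (simp add: separation_def)
qed

text \<open>For t > 0 this is t / \<open>diffprod\<close> of the actual points, in a form free of
  division by powers of t.\<close>

definition yval :: "'a \<Rightarrow> real \<Rightarrow> ('a \<Rightarrow> complex) \<Rightarrow> complex" where
  "yval i t v = (\<Prod>j\<in>blk P i - {i}. inverse (v i - v j)) * (\<Prod>j\<in>S - blk P i. inverse (wof P t v i - wof P t v j))"

text \<open>The sum of 1 / \<open>diffprod\<close> over a block, written as a contour integral
  because the integral stays regular as t -> 0 although the single summands blow up.\<close>

definition rho :: "'a \<Rightarrow> real \<Rightarrow> ('a \<Rightarrow> complex) \<Rightarrow> complex" where
  "rho i t v = inverse (2 * pi * \<i>) * contour_integral (circlepath (cen P v0 i) separation) (\<lambda>z. \<Prod>j\<in>S. inverse (z - wof P t v j))"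

text \<open>Near t = 0 the equations \<open>yval i = m i + t r i\<close> only see m when summed over
  a block, so the system would be degenerate. It is replaced by the part with zero block sums
  (deviations from block averages) plus the block-constant part \<open>rho\<close> = sum of r, which
  is the block sum divided by t. The centering condition is added to the block-constant part and
  separates again because all residues sum to zero.\<close>

definition Phi :: "'a \<Rightarrow> real \<Rightarrow> ('a \<Rightarrow> complex) \<Rightarrow> complex" where
  "Phi i t v = (yval i t v - avg (blk P i) (\<lambda>k. yval k t v))
     - (m i + of_real t * (r i - avg (blk P i) r))
     + (rho i t v - (\<Sum>j\<in>blk P i. r j)) + (\<Sum>j\<in>S. v j)"

definition dy :: "'a \<Rightarrow> ('a \<Rightarrow> complex) \<Rightarrow> complex" where
  "dy i h = - m i * ((\<Sum>j\<in>blk P i - {i}. (h i - h j) * inverse (v0 i - v0 j)) +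
     (\<Sum>j\<in>S - blk P i. (cen P h i - cen P h j) * inverse (cen P v0 i - cen P v0 j)))"

text \<open>The change of the residue when each center moves with the block mean of h.\<close>

definition drho :: "'a \<Rightarrow> ('a \<Rightarrow> complex) \<Rightarrow> complex" where
  "drho i h = residue (\<lambda>z. (\<Sum>j\<in>S. cen P h j * inverse (z - cen P v0 j)) * (\<Prod>j\<in>S. inverse (z - cen P v0 j))) (cen P v0 i)"

definition dPhi :: "'a \<Rightarrow> ('a \<Rightarrow> complex) \<Rightarrow> complex" where
  "dPhi i h = dy i h - avg (blk P i) (\<lambda>k. dy k h) + drho i h + (\<Sum>j\<in>S. h j)"

lemma prod_m: "i \<in> S \<Longrightarrow> (\<Prod>j\<in>blk P i - {i}. inverse (v0 i - v0 j)) * (\<Prod>j\<in>S - blk P i. inverse (cen P v0 i - cen P v0 j)) = m i"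
proof -
  assume i: "i \<in> S"
  have "(\<Prod>j\<in>blk P i - {i}. inverse (v0 i - v0 j)) * (\<Prod>j\<in>S - blk P i. inverse (cen P v0 i - cen P v0 j))
    = inverse ((\<Prod>j\<in>blk P i - {i}. v0 i - v0 j) * (\<Prod>j\<in>S - blk P i. cen P v0 i - cen P v0 j))"
    by (simp add: prod_inversef[symmetric] o_def)
  then show ?thesis using inverse_unique[of "(\<Prod>j\<in>blk P i - {i}. v0 i - v0 j) * (\<Prod>j\<in>S - blk P i. cen P v0 i - cen P v0 j)" "m i"]
    eq0[OF i] by (simp add: mult.commute)
qed

lemma sd_cen: "j \<in> S \<Longrightarrow> sl.sd Z (\<lambda>z t v. cen P v j) (\<lambda>z. cen P v0 j) (\<lambda>z h. cen P h j)"
  using partition_blk(3)[OF PS] by (intro sl.sd_avg sl.sd_proj) auto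

lemma sd_wof: "j \<in> S \<Longrightarrow> sl.sd Z (\<lambda>z t v. wof P t v j) (\<lambda>z. cen P v0 j) (\<lambda>z h. cen P h j)"
proof -
  assume j: "j \<in> S"
  have "((\<lambda>t. complex_of_real (kap (card (blk P j)) t)) \<longlongrightarrow> of_real 0) (at_right 0)"
    by (intro tendsto_of_real kap_tendsto bigblk j)
  then have "((\<lambda>t. complex_of_real (kap (card (blk P j)) t)) \<longlongrightarrow> 0) (at_right 0)" by simp
  from sl.sd_add[OF sd_cen[OF j] sl.sd_mult[OF sl.sd_const[OF this] sl.sd_diff[OF sl.sd_proj[OF j] sd_cen[OF j]]]]
  show ?thesis by (rule sl.sd_cong) (auto simp: wof_def)
qed

lemma sd_yval: "i \<in> S \<Longrightarrow> sl.sd {0} (\<lambda>z t v. yval i t v) (\<lambda>z. m i) (\<lambda>z h. dy i h)"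
proof -
  assume i: "i \<in> S"
  have 1: "sl.sd {0} (\<lambda>z t v. \<Prod>j\<in>blk P i - {i}. inverse (v i - v j)) (\<lambda>z. \<Prod>j\<in>blk P i - {i}. inverse (v0 i - v0 j))
    (\<lambda>z h. - (\<Prod>j\<in>blk P i - {i}. inverse (v0 i - v0 j)) * (\<Sum>j\<in>blk P i - {i}. (h i - h j) / (v0 i - v0 j)))"
    using finB[OF i] blk_sub[OF i] v0_ne[OF i]
    by (intro sl.sd_prod_inverse_point sl.sd_diff sl.sd_proj i) auto
  have 2: "sl.sd {0} (\<lambda>z t v. \<Prod>j\<in>S - blk P i. inverse (wof P t v i - wof P t v j)) (\<lambda>z. \<Prod>j\<in>S - blk P i. inverse (cen P v0 i - cen P v0 j))
    (\<lambda>z h. - (\<Prod>j\<in>S - blk P i. inverse (cen P v0 i - cen P v0 j)) * (\<Sum>j\<in>S - blk P i. (cen P h i - cen P h j) / (cen P v0 i - cen P v0 j)))"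
    using cen_eq_iff[OF i] finS
    by (intro sl.sd_prod_inverse_point sl.sd_diff sd_wof i) auto
  show ?thesis
    by (rule sl.sd_cong[OF sl.sd_mult[OF 1 2]])
      (simp_all add: yval_def dy_def prod_m[OF i, symmetric] divide_inverse algebra_simps)
qed

lemma sphere_dist:
  assumes "i \<in> S" "j \<in> S" "z \<in> sphere (cen P v0 i) separation"
  shows "separation \<le> cmod (z - cen P v0 j)"
proof (cases "cen P v0 i = cen P v0 j")
  case True
  then show ?thesis using assms(3) by (simp add: dist_norm norm_minus_commute)
next
  case False
  have "cmod (cen P v0 i - cen P v0 j) \<le> cmod (cen P v0 i - z) + cmod (z - cen P v0 j)"
    using norm_triangle_ineq[of "cen P v0 i - z" "z - cen P v0 j"] by simp
  then show ?thesis using separation_le[OF assms(1,2) False] assms(3) by (simp add: dist_norm)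
qed

lemma wof_close: "\<forall>\<^sub>F (t, v, v') in sl.Fl. \<forall>j\<in>S. cmod (wof P t v j - cen P v0 j) \<le> separation / 2 \<and> cmod (wof P t v' j - cen P v0 j) \<le> separation / 2"
proof -
  have "\<forall>\<^sub>F (t, v, v') in sl.Fl. cmod (wof P t v j - cen P v0 j) \<le> separation / 2 \<and> cmod (wof P t v' j - cen P v0 j) \<le> separation / 2"
    if "j \<in> S" for j
    using sl.sd_value[OF sd_wof[OF that, of "{0}"], of "separation / 2"] separation_pos by (auto simp: case_prod_unfold)
  then show ?thesis using finS by (simp add: case_prod_unfold eventually_ball_finite)
qed

lemma sphere_off_wof:
  assumes "i \<in> S" "\<forall>j\<in>S. cmod (u j - cen P v0 j) \<le> separation / 2" "j \<in> S" "z \<in> sphere (cen P v0 i) separation"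
  shows "z \<noteq> u j"
  using sphere_dist[OF assms(1,3,4)] assms(2,3) separation_pos by force

lemma integrable_off:
  assumes "i \<in> S" "\<forall>j\<in>S. cmod (u j - cen P v0 j) \<le> separation / 2"
  shows "(\<lambda>z. \<Prod>j\<in>S. inverse (z - u j)) contour_integrable_on circlepath (cen P v0 i) separation"
proof (rule contour_integrable_continuous_circlepath)
  show "continuous_on (path_image (circlepath (cen P v0 i) separation)) (\<lambda>z. \<Prod>j\<in>S. inverse (z - u j))"
    using sphere_off_wof[OF assms] separation_pos
    by (intro continuous_on_prod continuous_on_inverse continuous_on_diff continuous_on_id continuous_on_const) auto
qed

lemma residue_integral:
  assumes i: "i \<in> S" and f: "f holomorphic_on - (cen P v0 ` S)"
  shows "(f has_contour_integral 2 * pi * \<i> * residue f (cen P v0 i)) (circlepath (cen P v0 i) separation)"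
proof (rule residue_circle[OF _ separation_pos _ f])
  show "a = cen P v0 i \<or> separation < cmod (a - cen P v0 i)" if "a \<in> cen P v0 ` S" for a
    using that separation_le[OF i] separation_pos by (fastforce simp: norm_minus_commute)
qed (use finS in auto)

text \<open>Differentiation under the integral sign: on the circle the denominators stay bounded
  away from zero. The resulting integrals over the limiting data are residues, and
  \<open>res0\<close> supplies the value at t = 0.\<close>

lemma sd_rho: "i \<in> S \<Longrightarrow> sl.sd {0} (\<lambda>z t v. rho i t v) (\<lambda>z. \<Sum>j\<in>blk P i. r j) (\<lambda>z h. drho i h)"
proof -
  assume i: "i \<in> S"
  let ?C = "sphere (cen P v0 i) separation"
  have g: "sl.sd ?C (\<lambda>z t v. \<Prod>j\<in>S. inverse (z - wof P t v j)) (\<lambda>z. \<Prod>j\<in>S. inverse (z - cen P v0 j))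
    (\<lambda>z h. - (\<Prod>j\<in>S. inverse (z - cen P v0 j)) * (\<Sum>j\<in>S. (0 - cen P h j) / (z - cen P v0 j)))"
  proof (rule sl.sd_prod_inverse[OF finS _ separation_pos])
    show "sl.sd ?C (\<lambda>z t v. z - wof P t v j) (\<lambda>z. z - cen P v0 j) (\<lambda>z h. 0 - cen P h j)" if "j \<in> S" for j
      by (intro sl.sd_diff sl.sd_zconst sd_wof that) simp
  qed (use sphere_dist[OF i] in auto)
  have g': "sl.sd ?C (\<lambda>z t v. \<Prod>j\<in>S. inverse (z - wof P t v j)) (\<lambda>z. \<Prod>j\<in>S. inverse (z - cen P v0 j))
    (\<lambda>z h. (\<Sum>j\<in>S. cen P h j * inverse (z - cen P v0 j)) * (\<Prod>j\<in>S. inverse (z - cen P v0 j)))"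
    by (rule sl.sd_cong[OF g]) (auto simp: divide_inverse sum_negf mult.commute)
  have hol: "(\<lambda>z. \<Prod>j\<in>S. inverse (z - cen P v0 j)) holomorphic_on - (cen P v0 ` S)"
    by (intro holomorphic_intros) auto
  have hol': "(\<lambda>z. (\<Sum>j\<in>S. cen P h j * inverse (z - cen P v0 j)) * (\<Prod>j\<in>S. inverse (z - cen P v0 j))) holomorphic_on - (cen P v0 ` S)" for h
    by (intro holomorphic_intros) auto
  note ri = residue_integral[OF i hol] and ri' = residue_integral[OF i hol']
  have I: "sl.sd {0} (\<lambda>_ t v. contour_integral (circlepath (cen P v0 i) separation) (\<lambda>z. \<Prod>j\<in>S. inverse (z - wof P t v j)))
    (\<lambda>_. contour_integral (circlepath (cen P v0 i) separation) (\<lambda>z. \<Prod>j\<in>S. inverse (z - cen P v0 j)))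
    (\<lambda>_ h. contour_integral (circlepath (cen P v0 i) separation) (\<lambda>z. (\<Sum>j\<in>S. cen P h j * inverse (z - cen P v0 j)) * (\<Prod>j\<in>S. inverse (z - cen P v0 j))))"
  proof (rule sl.sd_integral[OF g' separation_pos])
    show "\<forall>\<^sub>F (t, v, v') in sl.Fl. (\<lambda>z. \<Prod>j\<in>S. inverse (z - wof P t v j)) contour_integrable_on circlepath (cen P v0 i) separation \<and>
       (\<lambda>z. \<Prod>j\<in>S. inverse (z - wof P t v' j)) contour_integrable_on circlepath (cen P v0 i) separation"
      using wof_close by eventually_elim (auto intro!: integrable_off[OF i])
    show "(\<lambda>z. \<Prod>j\<in>S. inverse (z - cen P v0 j)) contour_integrable_on circlepath (cen P v0 i) separation"
      using ri unfolding contour_integrable_on_def by blast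
    show "(\<lambda>z. (\<Sum>j\<in>S. cen P h j * inverse (z - cen P v0 j)) * (\<Prod>j\<in>S. inverse (z - cen P v0 j))) contour_integrable_on circlepath (cen P v0 i) separation" for h
      using ri'[of h] unfolding contour_integrable_on_def by blast
  qed
  have cancel: "inverse (complex_of_real (2 * pi) * \<i>) * (complex_of_real (2 * pi) * \<i> * x) = x" for x
    by (subst mult.assoc[symmetric], subst left_inverse) auto
  show ?thesis
    by (rule sl.sd_cong[OF sl.sd_cmult[OF I, where c = "inverse (2 * pi * \<i>)"]])
      (simp_all only: rho_def drho_def contour_integral_unique[OF ri] contour_integral_unique[OF ri'] res0[OF i] cancel)
qed

lemma sd_Phi: "i \<in> S \<Longrightarrow> sl.sd {0} (\<lambda>z t v. Phi i t v) (\<lambda>z. 0) (\<lambda>z h. dPhi i h)"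
proof -
  assume i: "i \<in> S"
  have sub: "blk P i \<subseteq> S" by (rule partition_blk(3)[OF PS i])
  have y: "sl.sd {0} (\<lambda>z t v. yval i t v - avg (blk P i) (\<lambda>k. yval k t v)) (\<lambda>z. m i - avg (blk P i) m) (\<lambda>z h. dy i h - avg (blk P i) (\<lambda>k. dy k h))"
    by (rule sl.sd_diff[OF sd_yval[OF i] sl.sd_avg[OF sub sd_yval]]) (use sub in auto)
  have "((\<lambda>t. m i + complex_of_real t * (r i - avg (blk P i) r)) \<longlongrightarrow> m i + of_real 0 * (r i - avg (blk P i) r)) (at_right 0)"
    by (intro tendsto_intros)
  then have c: "sl.sd {0} (\<lambda>z t v. m i + complex_of_real t * (r i - avg (blk P i) r)) (\<lambda>z. m i) (\<lambda>z h. 0)"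
    by (intro sl.sd_const) simp
  have rr: "sl.sd {0} (\<lambda>z t v. rho i t v - (\<Sum>j\<in>blk P i. r j)) (\<lambda>z. (\<Sum>j\<in>blk P i. r j) - (\<Sum>j\<in>blk P i. r j)) (\<lambda>z h. drho i h - 0)"
    by (intro sl.sd_diff sd_rho i sl.sd_const tendsto_const)
  have s: "sl.sd {0} (\<lambda>z t v. \<Sum>j\<in>S. v j) (\<lambda>z. \<Sum>j\<in>S. v0 j) (\<lambda>z h. \<Sum>j\<in>S. h j)"
    by (intro sl.sd_sum finS sl.sd_proj)
  have "avg (blk P i) m = 0" using mB[OF partition_blk(1)[OF PS i]] by (simp add: avg_def)
  then show ?thesis
    by (intro sl.sd_cong[OF sl.sd_add[OF sl.sd_add[OF sl.sd_diff[OF y c] rr] s]])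
      (auto simp: Phi_def dPhi_def sv0)
qed

end

context limit_point
begin

text \<open>Equal centers are collected, so that the poles become distinct with multiplicities
  \<open>card B\<close>, as the rigidity lemma requires.\<close>

lemma log_derivative_by_blocks:
  "(\<Sum>j\<in>S. cen P h j * inverse (z - cen P v0 j)) * (\<Prod>j\<in>S. inverse (z - cen P v0 j))
   = (\<Sum>B\<in>P. of_nat (card B) * avg B h * inverse (z - avg B v0)) * (\<Prod>B\<in>P. inverse (z - avg B v0) ^ card B)"
proof -
  have "(\<Sum>j\<in>S. cen P h j * inverse (z - cen P v0 j)) = (\<Sum>B\<in>P. of_nat (card B) * avg B h * inverse (z - avg B v0))"
    unfolding sum_partition_on[OF finS PS]
  proof (rule sum.cong[OF refl])
    fix B assume B: "B \<in> P"
    have "(\<Sum>j\<in>B. cen P h j * inverse (z - cen P v0 j)) = (\<Sum>j\<in>B. avg B h * inverse (z - avg B v0))"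
      by (rule sum.cong[OF refl]) (simp only: blk_eqI[OF PS B])
    then show "(\<Sum>j\<in>B. cen P h j * inverse (z - cen P v0 j)) = of_nat (card B) * avg B h * inverse (z - avg B v0)" by simp
  qed
  moreover have "(\<Prod>j\<in>S. inverse (z - cen P v0 j)) = (\<Prod>B\<in>P. inverse (z - avg B v0) ^ card B)"
  proof -
    have "(\<Prod>j\<in>S. inverse (z - cen P v0 j)) = (prod \<circ> prod) (\<lambda>j. inverse (z - cen P v0 j)) P"
    proof -
      have "\<forall>B\<in>P. finite B" using Pbig by (metis card.infinite not_numeral_le_zero)
      moreover have "\<forall>A\<in>P. \<forall>B\<in>P. A \<noteq> B \<longrightarrow> A \<inter> B = {}" using partition_onD2[OF PS] by (simp add: disjoint_def)
      ultimately have "prod (\<lambda>j. inverse (z - cen P v0 j)) (\<Union>P) = (prod \<circ> prod) (\<lambda>j. inverse (z - cen P v0 j)) P"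
        by (rule prod.Union_disjoint)
      then show ?thesis by (simp add: partition_onD1[OF PS, symmetric])
    qed
    also have "\<dots> = (\<Prod>B\<in>P. inverse (z - avg B v0) ^ card B)"
      unfolding o_def
    proof (rule prod.cong[OF refl])
      fix B assume B: "B \<in> P"
      have "(\<Prod>j\<in>B. inverse (z - cen P v0 j)) = (\<Prod>j\<in>B. inverse (z - avg B v0))"
        by (rule prod.cong[OF refl]) (simp only: blk_eqI[OF PS B])
      then show "(\<Prod>j\<in>B. inverse (z - cen P v0 j)) = inverse (z - avg B v0) ^ card B" by simp
    qed
    finally show ?thesis .
  qed
  ultimately show ?thesis by simp
qed

lemma finP: "finite P"
  using PS finS by (metis finite_elements)

lemma block_rep: "B \<in> P \<Longrightarrow> \<exists>i\<in>S. blk P i = B"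
proof -
  assume B: "B \<in> P"
  have "B \<noteq> {}" using B partition_onD3[OF PS] by blast
  then obtain i where i: "i \<in> B" by blast
  then have "i \<in> S" using B PS by (auto simp: partition_on_def)
  then show ?thesis using blk_eqI[OF PS B i] by blast
qed

lemma inj_avg: "inj_on (\<lambda>B. avg B v0) P"
proof (rule inj_onI)
  fix B C assume B: "B \<in> P" and C: "C \<in> P" and eq: "avg B v0 = avg C v0"
  obtain i j where i: "i \<in> S" "blk P i = B" and j: "j \<in> S" "blk P j = C"
    using block_rep[OF B] block_rep[OF C] by blast
  then show "B = C" using cen_ne[OF i(1) j(1)] eq by auto
qed

lemma drho_injective:
  assumes a: "\<And>i. i \<in> S \<Longrightarrow> drho i h = a"
  shows "a = 0" "(\<Sum>i\<in>S. h i) = 0 \<Longrightarrow> i \<in> S \<Longrightarrow> cen P h i = 0"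
proof -
  have ne: "P \<noteq> {}" using PS card2 by (auto simp: partition_on_def)
  have s1: "1 \<le> card B" if "B \<in> P" for B using Pbig[OF that] by simp
  have res: "residue (\<lambda>z. (\<Sum>B\<in>P. of_nat (card B) * avg B h * inverse (z - avg B v0)) * (\<Prod>B\<in>P. inverse (z - avg B v0) ^ card B)) (avg B v0) = a"
    if B: "B \<in> P" for B
  proof -
    obtain i where i: "i \<in> S" "blk P i = B" using block_rep[OF B] by blast
    show ?thesis using a[OF i(1)] unfolding drho_def log_derivative_by_blocks i(2) .
  qed
  note er = equal_residues_log_derivative[OF finP ne inj_avg s1 res]
  show "a = 0" by (rule er(1))
  assume h: "(\<Sum>i\<in>S. h i) = 0" and i: "i \<in> S"
  have "(\<Sum>B\<in>P. of_nat (card B) * avg B h) = (\<Sum>B\<in>P. \<Sum>j\<in>B. h j)"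
  proof (rule sum.cong[OF refl])
    fix B assume "B \<in> P"
    then show "of_nat (card B) * avg B h = (\<Sum>j\<in>B. h j)" using Pbig[of B] by (auto simp: avg_def)
  qed
  also have "\<dots> = 0" using h by (simp add: sum_partition_on[OF finS PS])
  finally have zz: "(\<Sum>B\<in>P. of_nat (card B) * avg B h) = 0" .
  show "cen P h i = 0" by (rule er(2)[OF _ _ zz partition_blk(1)[OF PS i]])
qed

text \<open>Rigidity is applied twice. Block sums of the equations give equal residue changes for
  the centers, so the total sum of h and then all block means vanish. What remains in a block says
  that the points of the block, as simple poles, have equal residue changes, so h vanishes there
  too.\<close>

lemma dPhi_injective:
  assumes z: "\<And>i. i \<in> S \<Longrightarrow> dPhi i h = 0" and j: "j \<in> S"
  shows "h j = 0"
proof -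
  have drho_blk: "drho k h = drho i h" if "i \<in> S" "k \<in> blk P i" for i k
    unfolding drho_def by (simp only: cen_in_blk[OF that])
  \<comment> \<open>The deviation terms cancel in the sum over a block, and the other two terms are
    constant on it.\<close>
  have rho0: "drho i h = - (\<Sum>j\<in>S. h j)" if i: "i \<in> S" for i
  proof -
    have "0 = (\<Sum>k\<in>blk P i. dPhi k h)" using z blk_sub[OF i] by simp
    also have "\<dots> = (\<Sum>k\<in>blk P i. (dy k h - avg (blk P i) (\<lambda>k. dy k h)) + (drho i h + (\<Sum>j\<in>S. h j)))"
    proof (rule sum.cong[OF refl])
      fix k assume k: "k \<in> blk P i"
      show "dPhi k h = (dy k h - avg (blk P i) (\<lambda>k. dy k h)) + (drho i h + (\<Sum>j\<in>S. h j))"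
        unfolding dPhi_def drho_blk[OF i k] blk_blk[OF i k] by simp
    qed
    also have "\<dots> = of_nat (card (blk P i)) * (drho i h + (\<Sum>j\<in>S. h j))"
      unfolding sum.distrib using sum_diff_avg[OF finB[OF i], of "\<lambda>k. dy k h"] by (simp add: distrib_left)
    finally show ?thesis using bigblk[OF i] by (auto simp: eq_neg_iff_add_eq_0)
  qed
  have sh: "(\<Sum>j\<in>S. h j) = 0" using drho_injective(1)[OF rho0] by simp
  have cz: "cen P h i = 0" if "i \<in> S" for i using drho_injective(2)[OF rho0 sh that] .
  define B where "B = blk P j"
  have B: "B \<in> P" "j \<in> B" "B \<subseteq> S" "finite B" "B \<noteq> {}"
    using partition_blk[OF PS j] finB[OF j] by (auto simp: B_def)
  define K where "K = (\<Prod>k\<in>S - B. inverse (cen P v0 j - cen P v0 k))"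
  define \<beta> where "\<beta> = avg B (\<lambda>k. dy k h)"
  have K0: "K \<noteq> 0" using cen_eq_iff[OF j] finS by (auto simp: K_def B_def)
  have dyi: "dy i h = \<beta>" if i: "i \<in> B" for i
  proof -
    have iS: "i \<in> S" using i B by auto
    have bi: "blk P i = B" using blk_eqI[OF PS B(1) i] .
    have "dy i h - \<beta> + (drho i h + (\<Sum>j\<in>S. h j)) = 0" using z[OF iS] by (simp add: dPhi_def bi \<beta>_def add.assoc)
    then show ?thesis using rho0[OF iS] by simp
  qed
  \<comment> \<open>\<open>dy\<close> is constant on the block with value \<beta>; removing the
    factor \<open>K\<close>, common to the whole block, from \<open>m i\<close> leaves exactly the
    residue of the block's own log derivative.\<close>
  have "residue (\<lambda>z. (\<Sum>k\<in>B. of_nat 1 * h k * inverse (z - v0 k)) * (\<Prod>k\<in>B. inverse (z - v0 k) ^ 1)) (v0 i) = \<beta> / K"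
    if i: "i \<in> B" for i
  proof -
    have iS: "i \<in> S" using i B by auto
    have bi: "blk P i = B" using blk_eqI[OF PS B(1) i] .
    have ci: "cen P v0 i = cen P v0 j" using bi by (simp add: B_def)
    have "(\<Sum>k\<in>S - B. (cen P h i - cen P h k) * inverse (cen P v0 i - cen P v0 k)) = 0"
      using cz iS by (intro sum.neutral) auto
    then have "\<beta> = - m i * (\<Sum>k\<in>B - {i}. (h i - h k) * inverse (v0 i - v0 k))"
      using dyi[OF i] by (simp add: dy_def bi)
    also have "m i = (\<Prod>k\<in>B - {i}. inverse (v0 i - v0 k)) * K"
      using prod_m[OF iS] unfolding bi K_def by (simp add: B_def)
    finally show ?thesis
      using residue_log_derivative_simple[OF B(4) _ i, of v0 h] v0_inj[OF j] K0 by (simp add: B_def)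
  qed
  from equal_residues_log_derivative(2)[OF B(4,5) _ _ this, of j] v0_inj[OF j] cz[OF j] B(2,4,5)
  show ?thesis by (auto simp: avg_def B_def)
qed

lemma dPhi_linear: "i \<in> S \<Longrightarrow> dPhi i h = (\<Sum>j\<in>S. dPhi i (\<lambda>k. if k = j then 1 else 0) * h j)"
proof (rule linear_as_sum[OF finS])
  assume i: "i \<in> S"
  have bS: "k \<in> S" if "k \<in> blk P j" "j \<in> S" for k j using blk_sub that by blast
  have dyadd: "dy k (\<lambda>i. h i + g i) = dy k h + dy k g" for k h g
  proof -
    have "(\<Sum>j\<in>blk P k - {k}. (h k + g k - (h j + g j)) * inverse (v0 k - v0 j)) =
        (\<Sum>j\<in>blk P k - {k}. (h k - h j) * inverse (v0 k - v0 j)) + (\<Sum>j\<in>blk P k - {k}. (g k - g j) * inverse (v0 k - v0 j))"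
      unfolding sum.distrib[symmetric] by (rule sum.cong[OF refl]) (simp add: algebra_simps)
    moreover have "(\<Sum>j\<in>S - blk P k. (cen P (\<lambda>i. h i + g i) k - cen P (\<lambda>i. h i + g i) j) * inverse (cen P v0 k - cen P v0 j))
       = (\<Sum>j\<in>S - blk P k. (cen P h k - cen P h j) * inverse (cen P v0 k - cen P v0 j))
       + (\<Sum>j\<in>S - blk P k. (cen P g k - cen P g j) * inverse (cen P v0 k - cen P v0 j))"
      unfolding sum.distrib[symmetric] by (rule sum.cong[OF refl]) (simp add: algebra_simps avg_add)
    ultimately show ?thesis by (simp add: dy_def algebra_simps)
  qed
  have dymul: "dy k (\<lambda>i. c * h i) = c * dy k h" for k c h
  proof -
    have "(\<Sum>j\<in>blk P k - {k}. (c * h k - c * h j) * inverse (v0 k - v0 j)) = c * (\<Sum>j\<in>blk P k - {k}. (h k - h j) * inverse (v0 k - v0 j))"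
      unfolding sum_distrib_left by (rule sum.cong[OF refl]) (simp add: algebra_simps)
    moreover have "(\<Sum>j\<in>S - blk P k. (cen P (\<lambda>i. c * h i) k - cen P (\<lambda>i. c * h i) j) * inverse (cen P v0 k - cen P v0 j))
       = c * (\<Sum>j\<in>S - blk P k. (cen P h k - cen P h j) * inverse (cen P v0 k - cen P v0 j))"
      unfolding sum_distrib_left by (rule sum.cong[OF refl]) (simp add: algebra_simps avg_cmult)
    ultimately show ?thesis by (simp add: dy_def algebra_simps)
  qed
  have hol: "(\<lambda>z. (\<Sum>j\<in>S. cen P h j * inverse (z - cen P v0 j)) * (\<Prod>j\<in>S. inverse (z - cen P v0 j))) holomorphic_on
     (- (cen P v0 ` S - {cen P v0 i})) - {cen P v0 i}" for h
    by (intro holomorphic_intros) auto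
  have op: "open (- (cen P v0 ` S - {cen P v0 i}))" using finS by (intro open_Compl finite_imp_closed) auto
  have mem: "cen P v0 i \<in> - (cen P v0 ` S - {cen P v0 i})" by simp
  have radd: "drho i (\<lambda>i. h i + g i) = drho i h + drho i g" for h g
  proof -
    have "drho i h + drho i g = residue (\<lambda>z. (\<Sum>j\<in>S. cen P h j * inverse (z - cen P v0 j)) * (\<Prod>j\<in>S. inverse (z - cen P v0 j))
      + (\<Sum>j\<in>S. cen P g j * inverse (z - cen P v0 j)) * (\<Prod>j\<in>S. inverse (z - cen P v0 j))) (cen P v0 i)"
      unfolding drho_def by (rule residue_add[OF op mem hol hol, symmetric])
    then show ?thesis by (simp add: drho_def avg_add distrib_right sum.distrib)
  qed
  have rmul: "drho i (\<lambda>i. c * h i) = c * drho i h" for c h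
  proof -
    have "c * drho i h = residue (\<lambda>z. c * ((\<Sum>j\<in>S. cen P h j * inverse (z - cen P v0 j)) * (\<Prod>j\<in>S. inverse (z - cen P v0 j)))) (cen P v0 i)"
      unfolding drho_def by (rule residue_lmul[OF op mem hol, symmetric])
    then show ?thesis by (simp add: drho_def avg_cmult mult.assoc flip: sum_distrib_left)
  qed
  show "dPhi i (\<lambda>i. h i + g i) = dPhi i h + dPhi i g" for h g
    by (simp add: dPhi_def dyadd radd avg_add sum.distrib)
  show "dPhi i (\<lambda>i. c * h i) = c * dPhi i h" for c h
    by (simp add: dPhi_def dymul rmul avg_cmult algebra_simps flip: sum_distrib_left)
  show "dPhi i h = dPhi i g" if hg: "\<And>i. i \<in> S \<Longrightarrow> h i = g i" for h g
  proof -
    have c: "cen P h k = cen P g k" if "k \<in> S" for k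
      by (rule avg_cong) (use hg bS that in blast)
    have y: "dy k h = dy k g" if k: "k \<in> S" for k
    proof -
      have "(\<Sum>j\<in>blk P k - {k}. (h k - h j) * inverse (v0 k - v0 j)) = (\<Sum>j\<in>blk P k - {k}. (g k - g j) * inverse (v0 k - v0 j))"
        by (rule sum.cong[OF refl]) (use hg bS k in auto)
      moreover have "(\<Sum>j\<in>S - blk P k. (cen P h k - cen P h j) * inverse (cen P v0 k - cen P v0 j)) = (\<Sum>j\<in>S - blk P k. (cen P g k - cen P g j) * inverse (cen P v0 k - cen P v0 j))"
        by (rule sum.cong[OF refl]) (use c k in auto)
      ultimately show ?thesis by (simp add: dy_def)
    qed
    have "drho i h = drho i g"
    proof -
      have "(\<lambda>z. (\<Sum>j\<in>S. cen P h j * inverse (z - cen P v0 j))) = (\<lambda>z. (\<Sum>j\<in>S. cen P g j * inverse (z - cen P v0 j)))"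
        by (rule ext, rule sum.cong[OF refl]) (simp add: c)
      then show ?thesis unfolding drho_def by (simp only: fun_eq_iff)
    qed
    moreover have "avg (blk P i) (\<lambda>k. dy k h) = avg (blk P i) (\<lambda>k. dy k g)" by (rule avg_cong) (use y bS i in blast)
    moreover have "sum h S = sum g S" by (rule sum.cong[OF refl hg])
    ultimately show ?thesis by (simp add: dPhi_def y[OF i])
  qed
qed

text \<open>For t > 0 the regularised system is equivalent to the original one. The nontrivial
  direction recovers the centering condition and the block equations from their sum.\<close>

lemma Phi_zero_iff:
  assumes t: "t > 0"
    and close: "\<And>j. j \<in> S \<Longrightarrow> cmod (wof P t v j - cen P v0 j) \<le> separation / 2"
    and vne: "\<And>i j. i \<in> S \<Longrightarrow> j \<in> blk P i \<Longrightarrow> i \<noteq> j \<Longrightarrow> v i \<noteq> v j"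
  shows "(\<forall>i\<in>S. Phi i t v = 0) \<longleftrightarrow>
    (\<Sum>i\<in>S. wof P t v i) = 0 \<and> (\<forall>i\<in>S. (m i + t * r i) * diffprod S (wof P t v) i = t)"
proof -
  define w where "w = wof P t v"
  have apart: "cmod (w j - cen P v0 i) > separation" if "i \<in> S" "j \<in> S - blk P i" for i j
  proof -
    have "2 * separation \<le> cmod (cen P v0 i - cen P v0 j)" using separation_le[of i j] cen_eq_iff[of i j] that by auto
    also have "\<dots> \<le> cmod (w j - cen P v0 j) + cmod (w j - cen P v0 i)"
      using norm_triangle_ineq4[of "w j - cen P v0 j" "w j - cen P v0 i"] by simp
    finally show ?thesis using close[of j] that separation_pos by (auto simp: w_def)
  qed
  have near: "cmod (w j - cen P v0 i) < separation" if "i \<in> S" "j \<in> blk P i" for i j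
    using close[OF blk_sub[OF that]] separation_pos cen_in_blk[OF that, of v0] by (simp add: w_def)
  have inj: "inj_on w S"
  proof (rule inj_onI, rule ccontr)
    fix i j assume ij: "i \<in> S" "j \<in> S" "w i = w j" "i \<noteq> j"
    show False
    proof (cases "j \<in> blk P i")
      case True
      have "kap (card (blk P i)) t * (v i - v j) = 0" using wof_diff[OF ij(1) True, of t v] ij(3) by (simp add: w_def)
      then show False using vne[OF ij(1) True ij(4)] kap_pos[OF t, of "card (blk P i)"] by simp
    next
      case False
      then show False using apart[OF ij(1), of j] near[OF ij(1) partition_blk(2)[OF PS ij(1)]] ij by simp
    qed
  qed
  have y: "yval i t v = t * inverse (diffprod S w i)" if i: "i \<in> S" for i
  proof -
    have "diffprod S w i = t * ((\<Prod>j\<in>blk P i - {i}. v i - v j) * (\<Prod>j\<in>S - blk P i. w i - w j))"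
      unfolding w_def by (rule diffprod_wof[OF t i])
    moreover have "yval i t v = inverse ((\<Prod>j\<in>blk P i - {i}. v i - v j) * (\<Prod>j\<in>S - blk P i. w i - w j))"
      by (simp add: yval_def w_def prod_inversef[symmetric] o_def)
    ultimately show ?thesis using t by simp
  qed
  have rho: "rho i t v = (\<Sum>k\<in>blk P i. inverse (diffprod S w k))" if i: "i \<in> S" for i
  proof -
    have "((\<lambda>z. \<Prod>j\<in>S. inverse (z - w j)) has_contour_integral
        (2 * of_real pi * \<i> * (\<Sum>k\<in>blk P i. inverse (diffprod S w k)))) (circlepath (cen P v0 i) separation)"
      using partition_blk[OF PS i] near[OF i] apart[OF i]
      by (intro cluster_integral finS inj separation_pos) auto
    then have "rho i t v = inverse (2 * of_real pi * \<i>) * (2 * of_real pi * \<i> * (\<Sum>k\<in>blk P i. inverse (diffprod S w k)))"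
      unfolding rho_def w_def[symmetric] by (subst contour_integral_unique) (assumption, simp)
    also have "\<dots> = (\<Sum>k\<in>blk P i. inverse (diffprod S w k))"
      by (subst mult.assoc[symmetric], subst left_inverse) auto
    finally show ?thesis .
  qed
  have ysum: "(\<Sum>k\<in>blk P i. yval k t v) = t * rho i t v" if i: "i \<in> S" for i
  proof -
    have "(\<Sum>k\<in>blk P i. yval k t v) = (\<Sum>k\<in>blk P i. t * inverse (diffprod S w k))"
      by (rule sum.cong[OF refl], rule y, rule blk_sub[OF i])
    then show ?thesis by (simp add: rho[OF i] sum_distrib_left)
  qed
  have mz: "(\<Sum>k\<in>blk P i. m k) = 0" if "i \<in> S" for i using mB partition_blk(1)[OF PS that] .
  have sw: "(\<Sum>i\<in>S. w i) = (\<Sum>i\<in>S. v i)" by (simp add: w_def sum_wof)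
  have eqiff: "(m i + t * r i) * diffprod S w i = t \<longleftrightarrow> yval i t v = m i + t * r i" if i: "i \<in> S" for i
    using diffprod_nonzero[OF finS inj i] by (auto simp: y[OF i] field_simps)
  show ?thesis
    unfolding w_def[symmetric]
  proof
    assume z: "\<forall>i\<in>S. Phi i t v = 0"
    \<comment> \<open>Averaging \<Phi> over a block isolates the block-constant part.\<close>
    have rb: "rho i t v = (\<Sum>k\<in>blk P i. r k) - (\<Sum>j\<in>S. v j)" if i: "i \<in> S" for i
    proof -
      have rk: "rho k t v = rho i t v" if "k \<in> blk P i" for k
        unfolding rho_def by (simp only: cen_in_blk[OF i that])
      have "0 = (\<Sum>k\<in>blk P i. Phi k t v)" using z blk_sub[OF i] by simp
      also have "\<dots> = (\<Sum>k\<in>blk P i. (yval k t v - avg (blk P i) (\<lambda>k. yval k t v)) - (m k + of_real t * (r k - avg (blk P i) r))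
          + ((rho i t v - (\<Sum>j\<in>blk P i. r j)) + (\<Sum>j\<in>S. v j)))"
      proof (rule sum.cong[OF refl])
        fix k assume k: "k \<in> blk P i"
        show "Phi k t v = (yval k t v - avg (blk P i) (\<lambda>k. yval k t v)) - (m k + of_real t * (r k - avg (blk P i) r))
          + ((rho i t v - (\<Sum>j\<in>blk P i. r j)) + (\<Sum>j\<in>S. v j))"
          unfolding Phi_def blk_blk[OF i k] rk[OF k] by simp
      qed
      also have "\<dots> = of_nat (card (blk P i)) * ((rho i t v - (\<Sum>j\<in>blk P i. r j)) + (\<Sum>j\<in>S. v j))"
        unfolding sum.distrib sum_subtractf[of "\<lambda>k. yval k t v - avg (blk P i) (\<lambda>k. yval k t v)"]
          sum_distrib_left[symmetric] sum_diff_avg[OF finB[OF i]] mz[OF i] by (simp add: distrib_left)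
      finally have "rho i t v - (\<Sum>j\<in>blk P i. r j) + (\<Sum>j\<in>S. v j) = 0" using bigblk[OF i] by auto
      then show ?thesis by (simp add: algebra_simps)
    qed
    have Bsum: "(\<Sum>B\<in>P. f B) = (\<Sum>i\<in>S. f (blk P i) / of_nat (card (blk P i)))" for f :: "'a set \<Rightarrow> complex"
    proof -
      have "(\<Sum>i\<in>S. f (blk P i) / of_nat (card (blk P i))) = (\<Sum>B\<in>P. \<Sum>i\<in>B. f B / of_nat (card B))"
        unfolding sum_partition_on[OF finS PS]
      proof (rule sum.cong[OF refl], rule sum.cong[OF refl])
        fix B i assume "B \<in> P" "i \<in> B"
        then have "blk P i = B" by (rule blk_eqI[OF PS])
        then show "f (blk P i) / of_nat (card (blk P i)) = f B / of_nat (card B)" by simp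
      qed
      also have "\<dots> = (\<Sum>B\<in>P. f B)"
      proof (rule sum.cong[OF refl])
        fix B assume "B \<in> P"
        then show "(\<Sum>i\<in>B. f B / of_nat (card B)) = f B" using Pbig[of B] by auto
      qed
      finally show ?thesis by simp
    qed
    \<comment> \<open>All residues sum to zero and so do all r; adding the block equations leaves a
      multiple of the sum of v, which must vanish. \<open>Bsum\<close> converts sums over blocks
      into sums over points.\<close>
    have "0 = (\<Sum>i\<in>S. inverse (diffprod S w i))" using sum_inverse_diffprod[OF finS card2 inj] by simp
    also have "\<dots> = (\<Sum>B\<in>P. \<Sum>i\<in>B. inverse (diffprod S w i))" by (rule sum_partition_on[OF finS PS])
    also have "\<dots> = (\<Sum>i\<in>S. rho i t v / of_nat (card (blk P i)))"
      unfolding Bsum by (rule sum.cong[OF refl]) (simp add: rho)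
    also have "\<dots> = (\<Sum>i\<in>S. ((\<Sum>k\<in>blk P i. r k) - (\<Sum>j\<in>S. v j)) / of_nat (card (blk P i)))"
      by (rule sum.cong[OF refl]) (simp add: rb)
    also have "\<dots> = (\<Sum>B\<in>P. (\<Sum>k\<in>B. r k) - (\<Sum>j\<in>S. v j))" unfolding Bsum ..
    also have "\<dots> = - of_nat (card P) * (\<Sum>j\<in>S. v j)"
      using sum_partition_on[OF finS PS, of r] sr by (simp add: sum_subtractf)
    finally have "of_nat (card P) * (\<Sum>j\<in>S. v j) = 0" by simp
    moreover have "card P \<noteq> 0" using finP PS card2 by (auto simp: partition_on_def)
    ultimately have sv: "(\<Sum>j\<in>S. v j) = 0" by simp
    have "yval i t v = m i + t * r i" if i: "i \<in> S" for i
    proof -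
      have rb': "rho i t v = (\<Sum>k\<in>blk P i. r k)" using rb[OF i] sv by simp
      then have "avg (blk P i) (\<lambda>k. yval k t v) = t * avg (blk P i) r" by (simp add: avg_def ysum[OF i])
      then show ?thesis using z i rb' sv by (auto simp: Phi_def algebra_simps)
    qed
    then show "(\<Sum>i\<in>S. w i) = 0 \<and> (\<forall>i\<in>S. (m i + t * r i) * diffprod S w i = t)"
      using sv by (simp add: sw eqiff)
  next
    assume w: "(\<Sum>i\<in>S. w i) = 0 \<and> (\<forall>i\<in>S. (m i + t * r i) * diffprod S w i = t)"
    then have yy: "yval i t v = m i + t * r i" if "i \<in> S" for i using that eqiff by blast
    show "\<forall>i\<in>S. Phi i t v = 0"
    proof
      fix i assume i: "i \<in> S"
      have "t * rho i t v = (\<Sum>k\<in>blk P i. m k + t * r k)"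
        unfolding ysum[OF i, symmetric] by (rule sum.cong[OF refl], rule yy, rule blk_sub[OF i])
      also have "\<dots> = t * (\<Sum>k\<in>blk P i. r k)" by (simp add: sum.distrib mz[OF i] sum_distrib_left)
      finally have rb: "rho i t v = (\<Sum>k\<in>blk P i. r k)" using t by simp
      then have "avg (blk P i) (\<lambda>k. yval k t v) = t * avg (blk P i) r" by (simp add: avg_def ysum[OF i])
      then show "Phi i t v = 0" using w rb by (simp add: Phi_def yy[OF i] sw algebra_simps)
    qed
  qed
qed

end

section \<open>Correspondence between solutions and limits\<close>

lemma wof_restrict: "partition_on S P \<Longrightarrow> i \<in> S \<Longrightarrow> (\<And>j. j \<in> S \<Longrightarrow> v j = v' j) \<Longrightarrow> wof P t v i = wof P t v' i"
proof -
  assume a: "partition_on S P" "i \<in> S" "\<And>j. j \<in> S \<Longrightarrow> v j = v' j"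
  have "cen P v i = cen P v' i" by (rule avg_cong) (use a partition_blk(3)[OF a(1,2)] in blast)
  then show ?thesis using a(3)[OF a(2)] by (simp add: wof_def)
qed

lemma vof_restrict: "partition_on S P \<Longrightarrow> i \<in> S \<Longrightarrow> (\<And>j. j \<in> S \<Longrightarrow> w j = w' j) \<Longrightarrow> vof P t w i = vof P t w' i"
proof -
  assume a: "partition_on S P" "i \<in> S" "\<And>j. j \<in> S \<Longrightarrow> w j = w' j"
  have "cen P w i = cen P w' i" by (rule avg_cong) (use a partition_blk(3)[OF a(1,2)] in blast)
  then show ?thesis using a(3)[OF a(2)] by (simp add: vof_def)
qed

lemma diffprod_cong: "i \<in> S \<Longrightarrow> (\<And>j. j \<in> S \<Longrightarrow> w j = w' j) \<Longrightarrow> diffprod S w i = diffprod S w' i"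
  unfolding diffprod_def by (intro prod.cong) auto

lemma finite_common_radius:
  fixes Q :: "'b \<Rightarrow> real \<Rightarrow> bool"
  assumes "finite F" "\<And>l. l \<in> F \<Longrightarrow> \<exists>\<rho>>0. Q l \<rho>"
    and mono: "\<And>l \<rho> \<rho>'. Q l \<rho> \<Longrightarrow> 0 < \<rho>' \<Longrightarrow> \<rho>' \<le> \<rho> \<Longrightarrow> Q l \<rho>'"
  shows "\<exists>\<rho>>0. \<forall>l\<in>F. Q l \<rho>"
  using assms(1,2)
proof (induction F rule: finite_induct)
  case empty
  show ?case by (intro exI[of _ 1]) simp
next
  case (insert a F)
  obtain \<rho>1 where r1: "\<rho>1 > 0" "Q a \<rho>1" using insert.prems[of a] by blast
  obtain \<rho>2 where r2: "\<rho>2 > 0" "\<forall>l\<in>F. Q l \<rho>2" using insert by blast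
  have pos: "0 < min \<rho>1 \<rho>2" using r1 r2 by simp
  have "Q a (min \<rho>1 \<rho>2)" by (rule mono[OF r1(2) pos min.cobounded1])
  moreover have "Q l (min \<rho>1 \<rho>2)" if "l \<in> F" for l
    by (rule mono[OF bspec[OF r2(2) that] pos min.cobounded2])
  ultimately show ?case using pos by blast
qed

context perturbation
begin

definition sol_at :: "real \<Rightarrow> ('a \<Rightarrow> complex) set" where
  "sol_at t = {w \<in> S \<rightarrow>\<^sub>E UNIV. (\<Sum>i\<in>S. w i) = 0 \<and> (\<forall>i\<in>S. (m i + t * r i) * diffprod S w i = t)}"

definition near_limit :: "('a set set \<times> ('a \<Rightarrow> complex)) \<Rightarrow> real \<Rightarrow> real \<Rightarrow> ('a \<Rightarrow> complex) \<Rightarrow> bool" where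
  "near_limit l \<rho> t w \<longleftrightarrow> (\<forall>i\<in>S. cmod (vof (fst l) t w i - snd l i) < \<rho>)"

lemma near_limit_mono: "near_limit l \<rho> t w \<Longrightarrow> \<rho> \<le> \<rho>' \<Longrightarrow> near_limit l \<rho>' t w"
  unfolding near_limit_def by force

end

context limit_point
begin

lemma wof_close_eps:
  assumes "\<epsilon> > 0"
  shows "\<exists>\<delta>>0. \<forall>t v. 0 < t \<longrightarrow> t < \<delta> \<longrightarrow> sl.near \<delta> v \<longrightarrow> (\<forall>j\<in>S. cmod (wof P t v j - cen P v0 j) \<le> \<epsilon>)"
proof -
  have "\<forall>\<^sub>F (t, v, v') in sl.Fl. cmod (wof P t v j - cen P v0 j) \<le> \<epsilon>" if "j \<in> S" for j
    by (rule eventually_mono[OF sl.sd_value[OF sd_wof[OF that, of "{0}"] assms]]) auto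
  then have "\<forall>\<^sub>F (t, v, v') in sl.Fl. \<forall>j\<in>S. cmod (wof P t v j - cen P v0 j) \<le> \<epsilon>"
    using finS by (simp add: case_prod_unfold eventually_ball_finite)
  then show ?thesis unfolding sl.eventually_Fl by auto
qed

lemma blk_image: "blk P ` S = P"
proof
  show "blk P ` S \<subseteq> P" using partition_blk(1)[OF PS] by (rule image_subsetI)
  show "P \<subseteq> blk P ` S"
  proof
    fix B assume "B \<in> P"
    then obtain i where "i \<in> S" "blk P i = B" using block_rep by blast
    then show "B \<in> blk P ` S" by blast
  qed
qed

lemma near_v0_distinct:
  "\<exists>\<delta>>0. \<forall>v. sl.near \<delta> v \<longrightarrow> (\<forall>i\<in>S. \<forall>j\<in>blk P i. i \<noteq> j \<longrightarrow> v i \<noteq> v j)"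
proof -
  let ?D = "insert 1 ((\<lambda>(i, j). cmod (v0 i - v0 j)) ` {(i, j) \<in> S \<times> S. v0 i \<noteq> v0 j})"
  have "finite {(i, j) \<in> S \<times> S. v0 i \<noteq> v0 j}"
    by (rule finite_subset[of _ "S \<times> S"]) (use finS in auto)
  then have fin: "finite ?D" by blast
  define d where "d = Min ?D"
  have pos: "0 < d" unfolding d_def using fin by (subst Min_gr_iff) auto
  have le: "d \<le> cmod (v0 i - v0 j)" if "i \<in> S" "j \<in> S" "v0 i \<noteq> v0 j" for i j
    unfolding d_def using that by (intro Min_le fin) auto
  have "v i \<noteq> v j" if v: "sl.near (d / 2) v" and i: "i \<in> S" "j \<in> blk P i" "i \<noteq> j" for v i j
  proof
    assume eq: "v i = v j"
    have j: "j \<in> S" using blk_sub[OF i(1,2)] .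
    have "v0 i \<noteq> v0 j" using v0_ne[OF i(1), of j] i by blast
    then have "d \<le> cmod (v0 i - v0 j)" by (rule le[OF i(1) j])
    also have "v0 i - v0 j = (v j - v0 j) - (v i - v0 i)" using eq by simp
    also have "cmod \<dots> \<le> cmod (v j - v0 j) + cmod (v i - v0 i)" by (rule norm_triangle_ineq4)
    finally have "d \<le> cmod (v j - v0 j) + cmod (v i - v0 i)" .
    moreover have "cmod (v i - v0 i) < d / 2" "cmod (v j - v0 j) < d / 2" using v i(1) j unfolding sl.near_def by blast+
    ultimately show False by linarith
  qed
  then show ?thesis using pos half_gt_zero[OF pos] by blast
qed

text \<open>\<open>implicit_solution\<close> transported through the change of coordinates:
  \<open>wof\<close> and \<open>vof\<close> are inverse on \<open>S\<close>, and near the limit the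
  zeros of \<Phi> are the solutions.\<close>

lemma unique_solution_near:
  "\<exists>\<rho>0>0. \<forall>\<rho>. 0 < \<rho> \<longrightarrow> \<rho> \<le> \<rho>0 \<longrightarrow>
     (\<forall>\<^sub>F t in at_right 0. \<exists>!w. w \<in> sol_at t \<and> near_limit (P, v0) \<rho> t w)"
proof -
  have "\<exists>\<rho>0>0. \<forall>\<rho>. 0 < \<rho> \<longrightarrow> \<rho> \<le> \<rho>0 \<longrightarrow> (\<exists>\<delta>>0. \<forall>t. 0 < t \<longrightarrow> t < \<delta> \<longrightarrow>
     (\<exists>!v. v \<in> S \<rightarrow>\<^sub>E UNIV \<and> sl.near \<rho> v \<and> (\<forall>i\<in>S. Phi i t v = 0)))"
  proof (rule sl.implicit_solution[OF sd_Phi dPhi_linear])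
    show "h j = 0" if "\<And>i. i \<in> S \<Longrightarrow> dPhi i h = 0" "j \<in> S" for h j
      by (rule dPhi_injective[OF that])
  qed
  then obtain \<rho>1 where \<rho>1: "\<rho>1 > 0" and ex: "\<And>\<rho>. 0 < \<rho> \<Longrightarrow> \<rho> \<le> \<rho>1 \<Longrightarrow> \<exists>\<delta>>0. \<forall>t. 0 < t \<longrightarrow> t < \<delta> \<longrightarrow>
     (\<exists>!v. v \<in> S \<rightarrow>\<^sub>E UNIV \<and> sl.near \<rho> v \<and> (\<forall>i\<in>S. Phi i t v = 0))" by blast
  obtain \<delta>1 where \<delta>1: "\<delta>1 > 0" and close: "\<And>t v j. 0 < t \<Longrightarrow> t < \<delta>1 \<Longrightarrow> sl.near \<delta>1 v \<Longrightarrow> j \<in> S \<Longrightarrow>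
      cmod (wof P t v j - cen P v0 j) \<le> separation / 2"
    using wof_close_eps[of "separation / 2"] separation_pos by auto
  obtain \<delta>2 where \<delta>2: "\<delta>2 > 0" and dist: "\<And>v i j. sl.near \<delta>2 v \<Longrightarrow> i \<in> S \<Longrightarrow> j \<in> blk P i \<Longrightarrow> i \<noteq> j \<Longrightarrow> v i \<noteq> v j"
    using near_v0_distinct by blast
  \<comment> \<open>Three demands: uniqueness of the zero, points close enough to the centers for
    the contour argument, and distinct points within blocks.\<close>
  define \<rho>0 where "\<rho>0 = min \<rho>1 (min \<delta>1 \<delta>2)"
  have "\<forall>\<^sub>F t in at_right 0. \<exists>!w. w \<in> sol_at t \<and> near_limit (P, v0) \<rho> t w" if \<rho>: "0 < \<rho>" "\<rho> \<le> \<rho>0" for \<rho>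
  proof -
    obtain \<delta> where \<delta>: "\<delta> > 0" and uniq: "\<And>t. 0 < t \<Longrightarrow> t < \<delta> \<Longrightarrow>
       (\<exists>!v. v \<in> S \<rightarrow>\<^sub>E UNIV \<and> sl.near \<rho> v \<and> (\<forall>i\<in>S. Phi i t v = 0))"
      using ex[of \<rho>] \<rho> by (auto simp: \<rho>0_def)
    have "\<exists>!w. w \<in> sol_at t \<and> near_limit (P, v0) \<rho> t w" if t: "0 < t" "t < min \<delta> \<delta>1" for t
    proof -
      have iff: "(\<forall>i\<in>S. Phi i t v = 0) \<longleftrightarrow>
        (\<Sum>i\<in>S. wof P t v i) = 0 \<and> (\<forall>i\<in>S. (m i + t * r i) * diffprod S (wof P t v) i = t)" if "sl.near \<rho> v" for v
      proof (rule Phi_zero_iff[OF t(1)])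
        have "sl.near \<delta>1 v" "sl.near \<delta>2 v" using sl.near_mono[OF that] \<rho>(2) by (auto simp: \<rho>0_def)
        then show "cmod (wof P t v j - cen P v0 j) \<le> separation / 2" if "j \<in> S" for j
          using close[OF t(1)] t(2) that by simp
        show "v i \<noteq> v j" if "i \<in> S" "j \<in> blk P i" "i \<noteq> j" for i j
          by (rule dist[OF \<open>sl.near \<delta>2 v\<close> that])
      qed
      have "\<exists>!v. v \<in> S \<rightarrow>\<^sub>E UNIV \<and> sl.near \<rho> v \<and> (\<forall>i\<in>S. Phi i t v = 0)"
        by (rule uniq) (use t in auto)
      then obtain v where v0': "v \<in> S \<rightarrow>\<^sub>E UNIV \<and> sl.near \<rho> v \<and> (\<forall>i\<in>S. Phi i t v = 0)"
        and vu: "\<forall>v'. v' \<in> S \<rightarrow>\<^sub>E UNIV \<and> sl.near \<rho> v' \<and> (\<forall>i\<in>S. Phi i t v' = 0) \<longrightarrow> v' = v"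
        by (rule ex1E)
      have v: "v \<in> S \<rightarrow>\<^sub>E UNIV" "sl.near \<rho> v" "\<forall>i\<in>S. Phi i t v = 0" using v0' by blast+
      define w where "w = restrict (wof P t v) S"
      have wS: "w i = wof P t v i" if "i \<in> S" for i using that by (simp add: w_def)
      have vw: "vof P t w i = v i" if i: "i \<in> S" for i
        using vof_restrict[OF PS i, of w "wof P t v" t] wS vof_wof[OF t(1) i] by simp
      have "w \<in> sol_at t"
      proof -
        have "(\<Sum>i\<in>S. w i) = (\<Sum>i\<in>S. wof P t v i)" by (rule sum.cong[OF refl wS])
        moreover have "diffprod S w i = diffprod S (wof P t v) i" if "i \<in> S" for i by (rule diffprod_cong[OF that wS])
        moreover have "w \<in> S \<rightarrow>\<^sub>E UNIV" by (simp add: w_def)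
        ultimately show ?thesis using iffD1[OF iff[OF v(2)] v(3)] by (simp add: sol_at_def)
      qed
      moreover have "near_limit (P, v0) \<rho> t w" using v(2) by (simp add: near_limit_def sl.near_def vw)
      moreover have "w' = w" if w': "w' \<in> sol_at t" "near_limit (P, v0) \<rho> t w'" for w'
      proof -
        define v' where "v' = restrict (vof P t w') S"
        have vS: "v' i = vof P t w' i" if "i \<in> S" for i using that by (simp add: v'_def)
        have ww: "wof P t v' i = w' i" if i: "i \<in> S" for i
          using wof_restrict[OF PS i, of v' "vof P t w'" t] vS wof_vof[OF t(1) i] by simp
        have nv: "sl.near \<rho> v'" using w'(2) by (simp add: near_limit_def sl.near_def vS)
        have "(\<Sum>i\<in>S. wof P t v' i) = (\<Sum>i\<in>S. w' i)" by (rule sum.cong[OF refl ww])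
        moreover have "diffprod S (wof P t v') i = diffprod S w' i" if "i \<in> S" for i by (rule diffprod_cong[OF that ww])
        ultimately have "\<forall>i\<in>S. Phi i t v' = 0"
          using w'(1) by (intro iffD2[OF iff[OF nv]]) (simp add: sol_at_def)
        moreover have "v' \<in> S \<rightarrow>\<^sub>E UNIV" by (simp add: v'_def)
        ultimately have "v' = v" using vu nv by blast
        then have "w' i = w i" if "i \<in> S" for i using ww[OF that] wS[OF that] by simp
        moreover have "w' \<in> S \<rightarrow>\<^sub>E UNIV" "w \<in> S \<rightarrow>\<^sub>E UNIV" using w'(1) by (auto simp: sol_at_def w_def)
        ultimately show ?thesis using PiE_ext[of w' S "\<lambda>_. UNIV" w] by blast
      qed
      ultimately show ?thesis by blast
    qed
    moreover have "0 < min \<delta> \<delta>1" using \<delta> \<delta>1 by simp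
    ultimately show ?thesis unfolding eventually_at_right_field by blast
  qed
  moreover have "\<rho>0 > 0" using \<rho>1 \<delta>1 \<delta>2 by (simp add: \<rho>0_def)
  ultimately show ?thesis by blast
qed

lemma near_limit_close:
  assumes "\<epsilon> > 0"
  shows "\<exists>\<rho>>0. \<forall>\<^sub>F t in at_right 0. \<forall>w. near_limit (P, v0) \<rho> t w \<longrightarrow> (\<forall>j\<in>S. cmod (w j - cen P v0 j) \<le> \<epsilon>)"
proof -
  obtain \<delta> where \<delta>: "\<delta> > 0" and close: "\<And>t v j. 0 < t \<Longrightarrow> t < \<delta> \<Longrightarrow> sl.near \<delta> v \<Longrightarrow> j \<in> S \<Longrightarrow> cmod (wof P t v j - cen P v0 j) \<le> \<epsilon>"
    using wof_close_eps[OF assms] by blast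
  have "cmod (w j - cen P v0 j) \<le> \<epsilon>" if "0 < t" "t < \<delta>" "near_limit (P, v0) \<delta> t w" "j \<in> S" for t w j
    using close[OF that(1,2) _ that(4), of "vof P t w"] that(3) wof_vof[OF that(1,4), of w]
    by (simp add: near_limit_def sl.near_def)
  then show ?thesis using \<delta> unfolding eventually_at_right_field by (intro exI[of _ \<delta>]) blast
qed

end

context perturbation
begin

lemma limit_pointI: "l \<in> limits \<Longrightarrow> limit_point S m r (fst l) (snd l)"
  by unfold_locales simp

text \<open>If i and j share a block of P, the points w i and w j are both close to one center,
  whereas P' puts them close to two different centers.\<close>

lemma near_limit_separate_blocks:
  assumes l: "(P, v) \<in> limits" and l': "(P', v') \<in> limits" and i: "i \<in> S" and j: "j \<in> blk P i" "j \<notin> blk P' i"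
  shows "\<exists>\<rho>>0. \<forall>\<^sub>F t in at_right 0. \<forall>w. \<not> (near_limit (P, v) \<rho> t w \<and> near_limit (P', v') \<rho> t w)"
proof -
  interpret A: limit_point S m r P v using limit_pointI[OF l] by simp
  interpret B: limit_point S m r P' v' using limit_pointI[OF l'] by simp
  have jS: "j \<in> S" using A.blk_sub[OF i j(1)] .
  \<comment> \<open>Four errors of size \<epsilon> add up to less than the distance of the two
    centers.\<close>
  define \<epsilon> where "\<epsilon> = cmod (cen P' v' i - cen P' v' j) / 5"
  have e: "\<epsilon> > 0" using B.cen_eq_iff[OF i jS] j(2) by (simp add: \<epsilon>_def)
  obtain \<rho>1 where \<rho>1: "\<rho>1 > 0" "\<forall>\<^sub>F t in at_right 0. \<forall>w. near_limit (P, v) \<rho>1 t w \<longrightarrow> (\<forall>j\<in>S. cmod (w j - cen P v j) \<le> \<epsilon>)"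
    using A.near_limit_close[OF e] by blast
  obtain \<rho>2 where \<rho>2: "\<rho>2 > 0" "\<forall>\<^sub>F t in at_right 0. \<forall>w. near_limit (P', v') \<rho>2 t w \<longrightarrow> (\<forall>j\<in>S. cmod (w j - cen P' v' j) \<le> \<epsilon>)"
    using B.near_limit_close[OF e] by blast
  have "\<forall>\<^sub>F t in at_right 0. \<forall>w. \<not> (near_limit (P, v) (min \<rho>1 \<rho>2) t w \<and> near_limit (P', v') (min \<rho>1 \<rho>2) t w)"
    using \<rho>1(2) \<rho>2(2)
  proof eventually_elim
    case (elim t)
    show ?case
    proof (intro allI notI)
      fix w assume n: "near_limit (P, v) (min \<rho>1 \<rho>2) t w \<and> near_limit (P', v') (min \<rho>1 \<rho>2) t w"
      have "near_limit (P, v) \<rho>1 t w" "near_limit (P', v') \<rho>2 t w"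
        using n near_limit_mono[OF _ min.cobounded1] near_limit_mono[OF _ min.cobounded2] by blast+
      then have e1: "\<forall>k\<in>S. cmod (w k - cen P v k) \<le> \<epsilon>" and e2: "\<forall>k\<in>S. cmod (w k - cen P' v' k) \<le> \<epsilon>"
        using elim by blast+
      have 1: "cmod (w i - cen P v i) \<le> \<epsilon>" "cmod (w i - cen P' v' i) \<le> \<epsilon>" "cmod (w j - cen P' v' j) \<le> \<epsilon>"
        using e1 e2 i jS by blast+
      have 2: "cmod (w j - cen P v i) \<le> \<epsilon>"
        using bspec[OF e1 jS] by (simp only: A.cen_in_blk[OF i j(1)])
      have "cmod (cen P' v' i - cen P' v' j) = cmod ((w i - cen P v i) - (w j - cen P v i) - (w i - cen P' v' i) + (w j - cen P' v' j))"
        by (simp add: norm_minus_commute)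
      also have "\<dots> \<le> cmod (w i - cen P v i) + cmod (w j - cen P v i) + cmod (w i - cen P' v' i) + cmod (w j - cen P' v' j)"
      proof -
        have "cmod (a - b - c + d) \<le> cmod a + cmod b + cmod c + cmod d" for a b c d :: complex
          using norm_triangle_ineq[of "a - b - c" d] norm_triangle_ineq4[of "a - b" c] norm_triangle_ineq4[of a b] by linarith
        then show ?thesis .
      qed
      also have "\<dots> \<le> 4 * \<epsilon>" using 1 2 by linarith
      finally show False using e by (simp add: \<epsilon>_def)
    qed
  qed
  then show ?thesis using \<rho>1(1) \<rho>2(1) by (intro exI[of _ "min \<rho>1 \<rho>2"]) simp
qed

text \<open>With equal partitions the rescaled coordinates are the same, so different v are
  separated directly. Otherwise some index has different blocks, and one of the two blocks contains
  an element missing from the other.\<close>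

lemma near_limit_separate:
  assumes l: "l \<in> limits" and l': "l' \<in> limits" and ne: "l \<noteq> l'"
  shows "\<exists>\<rho>>0. \<forall>\<^sub>F t in at_right 0. \<forall>w. \<not> (near_limit l \<rho> t w \<and> near_limit l' \<rho> t w)"
proof -
  obtain P v where lP: "l = (P, v)" by (cases l)
  obtain P' v' where lP': "l' = (P', v')" by (cases l')
  interpret A: limit_point S m r P v using limit_pointI[OF l] lP by simp
  interpret B: limit_point S m r P' v' using limit_pointI[OF l'] lP' by simp
  show ?thesis
  proof (cases "P = P'")
    case True
    have "v \<noteq> v'" using True ne lP lP' by simp
    have "\<exists>i\<in>S. v i \<noteq> v' i"
    proof (rule ccontr)
      assume "\<not> (\<exists>i\<in>S. v i \<noteq> v' i)"
      then have "v i = v' i" if "i \<in> S" for i using that by blast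
      from PiE_ext[OF A.v0ext B.v0ext this] show False using \<open>v \<noteq> v'\<close> by simp
    qed
    then obtain i where i: "i \<in> S" "v i \<noteq> v' i" by blast
    define \<rho> where "\<rho> = cmod (v i - v' i) / 2"
    have "\<not> (near_limit l \<rho> t w \<and> near_limit l' \<rho> t w)" for t w
    proof
      assume "near_limit l \<rho> t w \<and> near_limit l' \<rho> t w"
      then have "cmod (vof P t w i - v i) < \<rho>" "cmod (vof P t w i - v' i) < \<rho>"
        using i True by (auto simp: near_limit_def lP lP')
      moreover have "cmod (v i - v' i) \<le> cmod (vof P t w i - v i) + cmod (vof P t w i - v' i)"
        using norm_triangle_ineq4[of "vof P t w i - v' i" "vof P t w i - v i"] by simp
      ultimately show False by (simp add: \<rho>_def)
    qed
    then show ?thesis using i by (intro exI[of _ \<rho>]) (simp add: \<rho>_def)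
  next
    case False
    have "\<exists>i\<in>S. blk P i \<noteq> blk P' i"
    proof (rule ccontr)
      assume "\<not> (\<exists>i\<in>S. blk P i \<noteq> blk P' i)"
      then have eq: "blk P i = blk P' i" if "i \<in> S" for i using that by simp
      have "P = blk P ` S" by (rule A.blk_image[symmetric])
      also have "\<dots> = blk P' ` S" by (rule image_cong[OF refl eq])
      also have "\<dots> = P'" by (rule B.blk_image)
      finally show False using False by simp
    qed
    then obtain i where i: "i \<in> S" and ne': "blk P i \<noteq> blk P' i" by (rule bexE)
    show ?thesis
    proof (cases "blk P i \<subseteq> blk P' i")
      case False
      then obtain j where j: "j \<in> blk P i" "j \<notin> blk P' i" by blast
      show ?thesis unfolding lP lP'
        by (rule near_limit_separate_blocks[OF l[unfolded lP] l'[unfolded lP'] i j])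
    next
      case True
      have "\<not> blk P' i \<subseteq> blk P i"
      proof
        assume "blk P' i \<subseteq> blk P i"
        from subset_antisym[OF True this] show False using ne' by contradiction
      qed
      then obtain j where j: "j \<in> blk P' i" "j \<notin> blk P i" by blast
      obtain \<rho> where \<rho>: "\<rho> > 0" "\<forall>\<^sub>F t in at_right 0. \<forall>w. \<not> (near_limit (P', v') \<rho> t w \<and> near_limit (P, v) \<rho> t w)"
        using near_limit_separate_blocks[OF l'[unfolded lP'] l[unfolded lP] i j] by blast
      have "\<forall>\<^sub>F t in at_right 0. \<forall>w. \<not> (near_limit (P, v) \<rho> t w \<and> near_limit (P', v') \<rho> t w)"
        using \<rho>(2) by (rule eventually_mono) blast
      with \<rho>(1) show ?thesis unfolding lP lP' by blast
    qed
  qed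
qed

lemma common_radius:
  assumes F: "finite F" "F \<subseteq> limits"
  obtains \<rho> where "\<rho> > 0" "\<forall>\<^sub>F t in at_right 0. \<forall>l\<in>F. \<exists>!w. w \<in> sol_at t \<and> near_limit l \<rho> t w"
    "\<forall>\<^sub>F t in at_right 0. \<forall>l\<in>F. \<forall>l'\<in>F. l \<noteq> l' \<longrightarrow> (\<forall>w. \<not> (near_limit l \<rho> t w \<and> near_limit l' \<rho> t w))"
proof -
  have "\<exists>\<rho>1>0. \<forall>\<rho>. 0 < \<rho> \<longrightarrow> \<rho> \<le> \<rho>1 \<longrightarrow> (\<forall>\<^sub>F t in at_right 0. \<exists>!w. w \<in> sol_at t \<and> near_limit l \<rho> t w)" if l: "l \<in> F" for l
  proof -
    interpret limit_point S m r "fst l" "snd l" by (rule limit_pointI) (use l F in blast)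
    show ?thesis using unique_solution_near by (simp only: prod.collapse)
  qed
  note ex1 = this
  \<comment> \<open>Unique existence is not monotone in the radius; quantifying over all smaller
    radii makes it so, which the minimum over finitely many limits needs.\<close>
  define Q1 where "Q1 l \<rho> \<longleftrightarrow> (\<forall>\<rho>'. 0 < \<rho>' \<longrightarrow> \<rho>' \<le> \<rho> \<longrightarrow> (\<forall>\<^sub>F t in at_right 0. \<exists>!w. w \<in> sol_at t \<and> near_limit l \<rho>' t w))" for l \<rho>
  have "\<exists>\<rho>>0. \<forall>l\<in>F. Q1 l \<rho>"
  proof (rule finite_common_radius[OF F(1)])
    show "\<exists>\<rho>>0. Q1 l \<rho>" if "l \<in> F" for l unfolding Q1_def by (rule ex1[OF that])
    show "Q1 l \<rho>'" if "Q1 l \<rho>" "0 < \<rho>'" "\<rho>' \<le> \<rho>" for l \<rho> \<rho>'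
      unfolding Q1_def
    proof (intro allI impI)
      fix \<rho>'' assume "0 < \<rho>''" "\<rho>'' \<le> \<rho>'"
      then show "\<forall>\<^sub>F t in at_right 0. \<exists>!w. w \<in> sol_at t \<and> near_limit l \<rho>'' t w"
        by (intro that(1)[unfolded Q1_def, rule_format] order.trans[OF _ that(3)])
    qed
  qed
  then obtain \<rho>1 where \<rho>1: "\<rho>1 > 0" "\<forall>l\<in>F. Q1 l \<rho>1" by blast
  define Q2 where "Q2 p \<rho> \<longleftrightarrow> (\<forall>\<^sub>F t in at_right 0. fst p \<noteq> snd p \<longrightarrow> (\<forall>w. \<not> (near_limit (fst p) \<rho> t w \<and> near_limit (snd p) \<rho> t w)))" for p \<rho>
  have "\<exists>\<rho>>0. \<forall>p\<in>F \<times> F. Q2 p \<rho>"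
  proof (rule finite_common_radius)
    show "finite (F \<times> F)" using F(1) by simp
    show "\<exists>\<rho>>0. Q2 p \<rho>" if p: "p \<in> F \<times> F" for p
    proof (cases "fst p = snd p")
      case True
      then show ?thesis unfolding Q2_def by (intro exI[of _ 1]) simp
    next
      case False
      have "fst p \<in> limits" "snd p \<in> limits" using p F by auto
      from near_limit_separate[OF this False] show ?thesis unfolding Q2_def by (simp only: False not_False_eq_True simp_thms)
    qed
    show "Q2 p \<rho>'" if q: "Q2 p \<rho>" and le: "0 < \<rho>'" "\<rho>' \<le> \<rho>" for p \<rho> \<rho>'
      using q unfolding Q2_def
    proof (rule eventually_mono)
      fix t assume a: "fst p \<noteq> snd p \<longrightarrow> (\<forall>w. \<not> (near_limit (fst p) \<rho> t w \<and> near_limit (snd p) \<rho> t w))"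
      show "fst p \<noteq> snd p \<longrightarrow> (\<forall>w. \<not> (near_limit (fst p) \<rho>' t w \<and> near_limit (snd p) \<rho>' t w))"
      proof (intro impI allI notI)
        fix w assume "fst p \<noteq> snd p" and n: "near_limit (fst p) \<rho>' t w \<and> near_limit (snd p) \<rho>' t w"
        have "near_limit (fst p) \<rho> t w" by (rule near_limit_mono[OF conjunct1[OF n] le(2)])
        moreover have "near_limit (snd p) \<rho> t w" by (rule near_limit_mono[OF conjunct2[OF n] le(2)])
        ultimately show False using a \<open>fst p \<noteq> snd p\<close> by simp
      qed
    qed
  qed
  then obtain \<rho>2 where \<rho>2: "\<rho>2 > 0" "\<forall>p\<in>F \<times> F. Q2 p \<rho>2" by blast
  define \<rho> where "\<rho> = min \<rho>1 \<rho>2"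
  have pos: "\<rho> > 0" using \<rho>1 \<rho>2 by (simp add: \<rho>_def)
  have "\<forall>\<^sub>F t in at_right 0. \<forall>l\<in>F. \<exists>!w. w \<in> sol_at t \<and> near_limit l \<rho> t w"
  proof (rule eventually_ball_finite[OF F(1)], rule ballI)
    fix l assume "l \<in> F"
    then have q: "Q1 l \<rho>1" using \<rho>1 by blast
    have le: "\<rho> \<le> \<rho>1" unfolding \<rho>_def by (rule min.cobounded1)
    show "\<forall>\<^sub>F t in at_right 0. \<exists>!w. w \<in> sol_at t \<and> near_limit l \<rho> t w"
      by (rule q[unfolded Q1_def, rule_format, OF pos le])
  qed
  moreover have "\<forall>\<^sub>F t in at_right 0. \<forall>l\<in>F. \<forall>l'\<in>F. l \<noteq> l' \<longrightarrow> (\<forall>w. \<not> (near_limit l \<rho> t w \<and> near_limit l' \<rho> t w))"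
  proof (rule eventually_ball_finite[OF F(1)], rule ballI, rule eventually_ball_finite[OF F(1)], rule ballI)
    fix l l' assume ll: "l \<in> F" "l' \<in> F"
    then have "Q2 (l, l') \<rho>2" using \<rho>2 by blast
    then have "\<forall>\<^sub>F t in at_right 0. l \<noteq> l' \<longrightarrow> (\<forall>w. \<not> (near_limit l \<rho>2 t w \<and> near_limit l' \<rho>2 t w))"
      unfolding Q2_def by simp
    then show "\<forall>\<^sub>F t in at_right 0. l \<noteq> l' \<longrightarrow> (\<forall>w. \<not> (near_limit l \<rho> t w \<and> near_limit l' \<rho> t w))"
    proof (rule eventually_mono)
      fix t assume a: "l \<noteq> l' \<longrightarrow> (\<forall>w. \<not> (near_limit l \<rho>2 t w \<and> near_limit l' \<rho>2 t w))"
      have mono: "near_limit k \<rho> t w \<Longrightarrow> near_limit k \<rho>2 t w" for k w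
        by (rule near_limit_mono, assumption, unfold \<rho>_def, rule min.cobounded2)
      show "l \<noteq> l' \<longrightarrow> (\<forall>w. \<not> (near_limit l \<rho> t w \<and> near_limit l' \<rho> t w))"
      proof (intro impI allI notI)
        fix w assume "l \<noteq> l'" "near_limit l \<rho> t w \<and> near_limit l' \<rho> t w"
        then show False using a mono[of l w] mono[of l' w] by simp
      qed
    qed
  qed
  ultimately show ?thesis by (rule that[OF pos])
qed

text \<open>Formulated for finite families of limits, since finiteness of \<open>limits\<close> is
  later deduced from this lower bound.\<close>

lemma solutions_at_least:
  assumes F: "finite F" "F \<subseteq> limits"
  shows "\<forall>\<^sub>F t in at_right 0. \<exists>G\<subseteq>sol_at t. finite G \<and> card G = card F"
proof -
  obtain \<rho> where \<rho>: "\<rho> > 0" "\<forall>\<^sub>F t in at_right 0. \<forall>l\<in>F. \<exists>!w. w \<in> sol_at t \<and> near_limit l \<rho> t w"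
    "\<forall>\<^sub>F t in at_right 0. \<forall>l\<in>F. \<forall>l'\<in>F. l \<noteq> l' \<longrightarrow> (\<forall>w. \<not> (near_limit l \<rho> t w \<and> near_limit l' \<rho> t w))"
    using common_radius[OF F] by blast
  show ?thesis using \<rho>(2,3)
  proof eventually_elim
    case (elim t)
    then have "\<forall>l\<in>F. \<exists>w. w \<in> sol_at t \<and> near_limit l \<rho> t w" by blast
    then obtain f where f: "\<forall>l\<in>F. f l \<in> sol_at t \<and> near_limit l \<rho> t (f l)"
      unfolding bchoice_iff by blast
    have "inj_on f F"
    proof (rule inj_onI, rule ccontr)
      fix l l' assume l: "l \<in> F" "l' \<in> F" "f l = f l'" "l \<noteq> l'"
      have "near_limit l \<rho> t (f l) \<and> near_limit l' \<rho> t (f l)" using f l by metis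
      then show False using elim(2) l by blast
    qed
    then show ?case using f F by (intro exI[of _ "f ` F"]) (auto simp: card_image)
  qed
qed

text \<open>A sequence of solutions staying away from all limits as t -> 0 would contradict
  \<open>solution_seq_converges\<close>.\<close>

lemma solutions_near_limits:
  assumes \<rho>: "\<rho> > 0"
  shows "\<forall>\<^sub>F t in at_right 0. \<forall>w\<in>sol_at t. \<exists>l\<in>limits. near_limit l \<rho> t w"
proof (rule ccontr)
  assume "\<not> ?thesis"
  then have ex: "\<exists>t. 0 < t \<and> t < b \<and> (\<exists>w\<in>sol_at t. \<forall>l\<in>limits. \<not> near_limit l \<rho> t w)" if "b > 0" for b
    using that unfolding eventually_at_right_field by auto
  have "\<forall>n. \<exists>t w. 0 < t \<and> t < inverse (real (Suc n)) \<and> w \<in> sol_at t \<and> (\<forall>l\<in>limits. \<not> near_limit l \<rho> t w)"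
  proof
    fix n
    have "0 < inverse (real (Suc n))" by simp
    from ex[OF this] show "\<exists>t w. 0 < t \<and> t < inverse (real (Suc n)) \<and> w \<in> sol_at t \<and> (\<forall>l\<in>limits. \<not> near_limit l \<rho> t w)"
      by blast
  qed
  then obtain t w where tw: "\<And>n. 0 < t n" "\<And>n. t n < inverse (real (Suc n))" "\<And>n. w n \<in> sol_at (t n)"
    "\<And>n l. l \<in> limits \<Longrightarrow> \<not> near_limit l \<rho> (t n) (w n)" by metis
  have "t \<longlonglongrightarrow> 0"
  proof (rule tendsto_sandwich[OF _ _ tendsto_const LIMSEQ_inverse_real_of_nat])
    show "\<forall>\<^sub>F n in sequentially. 0 \<le> t n" by (rule always_eventually) (use tw(1) less_imp_le in blast)
    show "\<forall>\<^sub>F n in sequentially. t n \<le> inverse (real (Suc n))"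
      by (rule always_eventually) (use tw(2) less_imp_le in blast)
  qed
  moreover have "w n \<in> sol_at (t n)" for n by (rule tw(3))
  ultimately have "solution_seq t w" using tw(1) by (simp add: solution_seq_def sol_at_def)
  from solution_seq_converges[OF this] obtain P v \<phi> where l: "(P, v) \<in> limits"
    and lim: "\<And>i. i \<in> S \<Longrightarrow> (\<lambda>n. vof P (t (\<phi> n)) (w (\<phi> n)) i) \<longlonglongrightarrow> v i" by blast
  have "\<forall>\<^sub>F n in sequentially. \<forall>i\<in>S. cmod (vof P (t (\<phi> n)) (w (\<phi> n)) i - v i) < \<rho>"
    using lim \<rho> finS by (intro eventually_ball_finite ballI) (auto simp: tendsto_iff dist_norm)
  then obtain n where "near_limit (P, v) \<rho> (t (\<phi> n)) (w (\<phi> n))"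
    unfolding near_limit_def eventually_sequentially by auto
  then show False using tw(4)[OF l] by blast
qed

text \<open>Each limit carries exactly one nearby solution, neighbourhoods of different limits share
  none, and every solution lies in some neighbourhood.\<close>

lemma solutions_count:
  assumes fin: "finite limits"
  shows "\<forall>\<^sub>F t in at_right 0. finite (sol_at t) \<and> card (sol_at t) = card limits"
proof -
  obtain \<rho> where \<rho>: "\<rho> > 0" "\<forall>\<^sub>F t in at_right 0. \<forall>l\<in>limits. \<exists>!w. w \<in> sol_at t \<and> near_limit l \<rho> t w"
    "\<forall>\<^sub>F t in at_right 0. \<forall>l\<in>limits. \<forall>l'\<in>limits. l \<noteq> l' \<longrightarrow> (\<forall>w. \<not> (near_limit l \<rho> t w \<and> near_limit l' \<rho> t w))"
    using common_radius[OF fin order_refl] by blast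
  show ?thesis using \<rho>(2,3) solutions_near_limits[OF \<rho>(1)]
  proof eventually_elim
    case (elim t)
    then have "\<forall>l\<in>limits. \<exists>w. w \<in> sol_at t \<and> near_limit l \<rho> t w" by blast
    then obtain f where f: "\<forall>l\<in>limits. f l \<in> sol_at t \<and> near_limit l \<rho> t (f l)"
      unfolding bchoice_iff by blast
    have inj: "inj_on f limits"
    proof (rule inj_onI, rule ccontr)
      fix l l' assume l: "l \<in> limits" "l' \<in> limits" "f l = f l'" "l \<noteq> l'"
      have "near_limit l \<rho> t (f l) \<and> near_limit l' \<rho> t (f l)" using f l by metis
      then show False using elim(2) l by blast
    qed
    have "sol_at t \<subseteq> f ` limits"
    proof
      fix w assume w: "w \<in> sol_at t"
      then obtain l where l: "l \<in> limits" "near_limit l \<rho> t w" using elim(3) by blast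
      then have "w = f l" using elim(1) f w by blast
      then show "w \<in> f ` limits" using l by blast
    qed
    then have "sol_at t = f ` limits" using f by blast
    then show ?case using inj fin by (simp add: card_image)
  qed
qed

end

section \<open>Counting limits: centers and shapes\<close>

lemma complex_root_ex:
  assumes "n \<noteq> 0"
  shows "\<exists>k. k ^ n = (c :: complex)"
proof -
  obtain w where "c = w ^ n" using exists_complex_root[OF assms] by blast
  then show ?thesis by blast
qed

text \<open>Centered configurations of distinct cluster centers with multiplicities s and prescribed
  residues \<rho>.\<close>

definition glob :: "'b set \<Rightarrow> ('b \<Rightarrow> nat) \<Rightarrow> ('b \<Rightarrow> complex) \<Rightarrow> ('b \<Rightarrow> complex) set" where
  "glob U s \<rho> = {\<eta> \<in> U \<rightarrow>\<^sub>E UNIV. inj_on \<eta> U \<and> (\<Sum>u\<in>U. of_nat (s u) * \<eta> u) = 0 \<and>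
     (\<forall>u\<in>U. residue (\<lambda>z. \<Prod>v\<in>U. inverse (z - \<eta> v) ^ s v) (\<eta> u) = \<rho> u)}"

lemma prod_partition_on:
  assumes "finite S" "partition_on S P"
  shows "(\<Prod>i\<in>S. f i) = (\<Prod>B\<in>P. \<Prod>i\<in>B. f i)"
proof -
  have "\<forall>A\<in>P. \<forall>B\<in>P. A \<noteq> B \<longrightarrow> A \<inter> B = {}" using partition_onD2[OF assms(2)] by (simp add: disjoint_def)
  moreover have "\<forall>B\<in>P. finite B"
  proof
    fix B assume "B \<in> P"
    then have "B \<subseteq> S" using partition_onD1[OF assms(2)] by auto
    then show "finite B" by (rule finite_subset[OF _ assms(1)])
  qed
  ultimately have "prod f (\<Union>P) = (prod \<circ> prod) f P" by (intro prod.Union_disjoint)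
  then show ?thesis by (simp add: partition_onD1[OF assms(2), symmetric])
qed

context perturbation
begin

lemma zsp_big:
  assumes P: "P \<in> zsp S m" and B: "B \<in> P"
  shows "card B \<ge> 2"
proof (rule ccontr)
  assume "\<not> card B \<ge> 2"
  moreover have PS: "partition_on S P" using P by (simp add: zsp_def)
  moreover have "B \<noteq> {}" using B partition_onD3[OF PS] by blast
  moreover have BS: "B \<subseteq> S" using B partition_onD1[OF PS] by blast
  moreover have "finite B" by (rule finite_subset[OF BS finS])
  moreover have "card B > 0" using \<open>B \<noteq> {}\<close> \<open>finite B\<close> by (simp add: card_gt_0_iff)
  ultimately have "card B = 1" by linarith
  then obtain i where i: "B = {i}" by (auto simp: card_1_singleton_iff)
  have "(\<Sum>i\<in>B. m i) = 0" using P B by (simp add: zsp_def)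
  then show False using i m0[of i] BS by simp
qed

text \<open>In the equation for a point of block B the factors from other blocks form a constant
  depending only on the centers. Scaling the deviations by a (#B - 1)-st root \<open>k B\<close> of
  that constant absorbs it and leaves the equation of \<open>sols B m\<close>.\<close>

lemma limits_iff:
  assumes P: "P \<in> zsp S m" and v: "v \<in> S \<rightarrow>\<^sub>E UNIV"
    and \<eta>: "\<eta> = (\<lambda>B\<in>P. avg B v)"
    and k0: "\<And>B. B \<in> P \<Longrightarrow> k B \<noteq> 0"
    and k: "\<And>B. B \<in> P \<Longrightarrow> inj_on \<eta> P \<Longrightarrow> k B ^ (card B - 1) = (\<Prod>j\<in>S - B. \<eta> B - \<eta> (blk P j))"
  shows "(P, v) \<in> limits \<longleftrightarrow> \<eta> \<in> glob P card (\<lambda>B. \<Sum>i\<in>B. r i) \<and>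
     (\<forall>B\<in>P. (\<lambda>i\<in>B. k B * (v i - avg B v)) \<in> sols B m)"
proof -
  have PS: "partition_on S P" using P by (simp add: zsp_def)
  interpret cluster_partition S P by unfold_locales (use finS PS zsp_big[OF P] in auto)
  have eB: "\<eta> B = avg B v" if "B \<in> P" for B using that by (simp add: \<eta>)
  have eblk: "\<eta> (blk P i) = cen P v i" if "i \<in> S" for i using eB partition_blk(1)[OF PS that] .
  have BS: "B \<subseteq> S" if "B \<in> P" for B using that partition_onD1[OF PS] by blast
  have injiff: "inj_on \<eta> P \<longleftrightarrow> (\<forall>i\<in>S. \<forall>j\<in>S. blk P i \<noteq> blk P j \<longrightarrow> cen P v i \<noteq> cen P v j)"
  proof
    assume inj: "inj_on \<eta> P"
    show "\<forall>i\<in>S. \<forall>j\<in>S. blk P i \<noteq> blk P j \<longrightarrow> cen P v i \<noteq> cen P v j"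
    proof (intro ballI impI notI)
      fix i j assume ij: "i \<in> S" "j \<in> S" "blk P i \<noteq> blk P j" "cen P v i = cen P v j"
      then have "\<eta> (blk P i) = \<eta> (blk P j)" by (simp add: eblk)
      then show False using inj_onD[OF inj] partition_blk(1)[OF PS] ij by blast
    qed
  next
    assume a: "\<forall>i\<in>S. \<forall>j\<in>S. blk P i \<noteq> blk P j \<longrightarrow> cen P v i \<noteq> cen P v j"
    show "inj_on \<eta> P"
    proof (rule inj_onI, rule ccontr)
      fix B C assume BC: "B \<in> P" "C \<in> P" "\<eta> B = \<eta> C" "B \<noteq> C"
      have "B \<noteq> {}" "C \<noteq> {}" using BC partition_onD3[OF PS] by auto
      then obtain i j where ij: "i \<in> B" "j \<in> C" by blast
      have bi: "blk P i = B" "blk P j = C" using blk_eqI[OF PS] BC ij by auto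
      have "i \<in> S" "j \<in> S" using BS BC ij by auto
      then show False using a bi BC(3,4) eB[OF BC(1)] eB[OF BC(2)] by auto
    qed
  qed
  have sumeq: "(\<Sum>B\<in>P. of_nat (card B) * \<eta> B) = (\<Sum>i\<in>S. v i)"
  proof -
    have "(\<Sum>B\<in>P. of_nat (card B) * \<eta> B) = (\<Sum>B\<in>P. \<Sum>i\<in>B. v i)"
    proof (rule sum.cong[OF refl])
      fix B assume B: "B \<in> P"
      then show "of_nat (card B) * \<eta> B = (\<Sum>i\<in>B. v i)" using big[OF B] by (auto simp: eB avg_def)
    qed
    then show ?thesis by (simp add: sum_partition_on[OF finS PS])
  qed
  have prodeq: "(\<Prod>j\<in>S. inverse (z - cen P v j)) = (\<Prod>B\<in>P. inverse (z - \<eta> B) ^ card B)" for z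
    unfolding prod_partition_on[OF finS PS]
  proof (rule prod.cong[OF refl])
    fix B assume B: "B \<in> P"
    have "(\<Prod>j\<in>B. inverse (z - cen P v j)) = (\<Prod>j\<in>B. inverse (z - \<eta> B))"
      by (rule prod.cong[OF refl]) (simp only: blk_eqI[OF PS B] eB[OF B])
    then show "(\<Prod>j\<in>B. inverse (z - cen P v j)) = inverse (z - \<eta> B) ^ card B" by simp
  qed
  have reseq: "(\<forall>i\<in>S. residue (\<lambda>z. \<Prod>j\<in>S. inverse (z - cen P v j)) (cen P v i) = (\<Sum>j\<in>blk P i. r j)) \<longleftrightarrow>
     (\<forall>B\<in>P. residue (\<lambda>z. \<Prod>C\<in>P. inverse (z - \<eta> C) ^ card C) (\<eta> B) = (\<Sum>j\<in>B. r j))"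
  proof
    assume a: "\<forall>i\<in>S. residue (\<lambda>z. \<Prod>j\<in>S. inverse (z - cen P v j)) (cen P v i) = (\<Sum>j\<in>blk P i. r j)"
    show "\<forall>B\<in>P. residue (\<lambda>z. \<Prod>C\<in>P. inverse (z - \<eta> C) ^ card C) (\<eta> B) = (\<Sum>j\<in>B. r j)"
    proof
      fix B assume B: "B \<in> P"
      then have "B \<noteq> {}" using partition_onD3[OF PS] by auto
      then obtain i where i: "i \<in> B" by blast
      have bi: "blk P i = B" using blk_eqI[OF PS B i] .
      have "i \<in> S" using BS B i by auto
      then have "residue (\<lambda>z. \<Prod>j\<in>S. inverse (z - cen P v j)) (cen P v i) = (\<Sum>j\<in>blk P i. r j)" using a by blast
      then show "residue (\<lambda>z. \<Prod>C\<in>P. inverse (z - \<eta> C) ^ card C) (\<eta> B) = (\<Sum>j\<in>B. r j)"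
        unfolding prodeq bi eB[OF B] .
    qed
  next
    assume a: "\<forall>B\<in>P. residue (\<lambda>z. \<Prod>C\<in>P. inverse (z - \<eta> C) ^ card C) (\<eta> B) = (\<Sum>j\<in>B. r j)"
    show "\<forall>i\<in>S. residue (\<lambda>z. \<Prod>j\<in>S. inverse (z - cen P v j)) (cen P v i) = (\<Sum>j\<in>blk P i. r j)"
    proof
      fix i assume i: "i \<in> S"
      show "residue (\<lambda>z. \<Prod>j\<in>S. inverse (z - cen P v j)) (cen P v i) = (\<Sum>j\<in>blk P i. r j)"
        using bspec[OF a partition_blk(1)[OF PS i]] unfolding prodeq eblk[OF i] .
    qed
  qed
  define x where "x B = (\<lambda>i\<in>B. k B * (v i - avg B v))" for B
  have xs: "(\<Sum>i\<in>B. x B i) = 0" if B: "B \<in> P" for B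
  proof -
    have "finite B" "B \<noteq> {}" using finite_subset[OF BS[OF B] finS] partition_onD3[OF PS] B by auto
    have "(\<Sum>i\<in>B. x B i) = (\<Sum>i\<in>B. k B * (v i - avg B v))" by (rule sum.cong[OF refl]) (simp add: x_def)
    also have "\<dots> = k B * (\<Sum>i\<in>B. v i - avg B v)" by (simp only: sum_distrib_left)
    finally show ?thesis using sum_diff_avg[OF \<open>finite B\<close> \<open>B \<noteq> {}\<close>, of v] by simp
  qed
  have dp: "diffprod B (x B) i = k B ^ (card B - 1) * (\<Prod>j\<in>B - {i}. v i - v j)" if B: "B \<in> P" and i: "i \<in> B" for B i
  proof -
    have "diffprod B (x B) i = (\<Prod>j\<in>B - {i}. k B * (v i - v j))"
      unfolding diffprod_def by (rule prod.cong[OF refl]) (use i in \<open>simp add: x_def algebra_simps\<close>)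
    then show ?thesis using i finite_subset[OF BS[OF B] finS] by (simp add: prod.distrib)
  qed
  have eqiff: "(\<forall>i\<in>S. m i * ((\<Prod>j\<in>blk P i - {i}. v i - v j) * (\<Prod>j\<in>S - blk P i. cen P v i - cen P v j)) = 1) \<longleftrightarrow>
     (\<forall>B\<in>P. x B \<in> sols B m)" if inj: "inj_on \<eta> P"
  proof -
    have one: "m i * ((\<Prod>j\<in>blk P i - {i}. v i - v j) * (\<Prod>j\<in>S - blk P i. cen P v i - cen P v j)) = m i * diffprod (blk P i) (x (blk P i)) i"
      if i: "i \<in> S" for i
    proof -
      note b = partition_blk[OF PS i]
      have "(\<Prod>j\<in>S - blk P i. \<eta> (blk P i) - \<eta> (blk P j)) = (\<Prod>j\<in>S - blk P i. cen P v i - cen P v j)"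
        by (rule prod.cong[OF refl]) (use i in \<open>simp add: eblk\<close>)
      then show ?thesis using dp[OF b(1,2)] k[OF b(1) inj] by simp
    qed
    show ?thesis
    proof
      assume a: "\<forall>i\<in>S. m i * ((\<Prod>j\<in>blk P i - {i}. v i - v j) * (\<Prod>j\<in>S - blk P i. cen P v i - cen P v j)) = 1"
      show "\<forall>B\<in>P. x B \<in> sols B m"
      proof
        fix B assume B: "B \<in> P"
        have "m i * diffprod B (x B) i = 1" if i: "i \<in> B" for i
        proof -
          have iS: "i \<in> S" using BS[OF B] i by auto
          have "m i * diffprod (blk P i) (x (blk P i)) i = 1" using trans[OF one[OF iS, symmetric] bspec[OF a iS]] .
          then show ?thesis by (simp only: blk_eqI[OF PS B i])
        qed
        then show "x B \<in> sols B m" using xs[OF B] by (simp add: sols_def x_def)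
      qed
    next
      assume a: "\<forall>B\<in>P. x B \<in> sols B m"
      show "\<forall>i\<in>S. m i * ((\<Prod>j\<in>blk P i - {i}. v i - v j) * (\<Prod>j\<in>S - blk P i. cen P v i - cen P v j)) = 1"
      proof
        fix i assume i: "i \<in> S"
        note b = partition_blk[OF PS i]
        show "m i * ((\<Prod>j\<in>blk P i - {i}. v i - v j) * (\<Prod>j\<in>S - blk P i. cen P v i - cen P v j)) = 1"
          unfolding one[OF i] using bspec[OF a b(1)] b(2) by (simp add: sols_def)
      qed
    qed
  qed
  have ext: "\<eta> \<in> P \<rightarrow>\<^sub>E UNIV" by (simp add: \<eta>)
  show ?thesis
  proof (cases "inj_on \<eta> P")
    case True
    show ?thesis
      unfolding limits_def glob_def x_def[symmetric] mem_Collect_eq prod.case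
      using P v ext True injiff[THEN iffD1, OF True] sumeq reseq eqiff[OF True] by (simp only: simp_thms) blast
  next
    case False
    then have "\<eta> \<notin> glob P card (\<lambda>B. \<Sum>i\<in>B. r i)" by (simp add: glob_def)
    moreover have "(P, v) \<notin> limits" using False injiff by (auto simp: limits_def)
    ultimately show ?thesis by simp
  qed
qed

text \<open>A limit is the same as a configuration of centers together with an independent shape for
  each block, once a root has been chosen for every configuration of centers.\<close>

lemma card_limits_fibre:
  assumes P: "P \<in> zsp S m"
  shows "card {v. (P, v) \<in> limits} = card (glob P card (\<lambda>B. \<Sum>i\<in>B. r i)) * (\<Prod>B\<in>P. card (sols B m))"
proof -
  have PS: "partition_on S P" using P by (simp add: zsp_def)
  interpret cluster_partition S P by unfold_locales (use finS PS zsp_big[OF P] in auto)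
  have finP: "finite P" using finite_elements[OF finS PS] .
  have BS: "B \<subseteq> S" if "B \<in> P" for B using that partition_onD1[OF PS] by blast
  define q where "q \<eta> B = (\<Prod>j\<in>S - B. \<eta> B - \<eta> (blk P j))" for \<eta> :: "'a set \<Rightarrow> complex" and B
  \<comment> \<open>The value 1 at q = 0 keeps the scaling factor invertible for every \<eta>, so
    \<open>F\<close> and \<open>G\<close> can be compared without case distinctions. For injective
    \<eta> the constant \<open>q\<close> is nonzero and the root is genuine.\<close>
  define \<kappa> where "\<kappa> \<eta> B = (if q \<eta> B = 0 then 1 else SOME k. k ^ (card B - 1) = q \<eta> B)" for \<eta> B
  have kap: "\<kappa> \<eta> B ^ (card B - 1) = q \<eta> B" if B: "B \<in> P" "q \<eta> B \<noteq> 0" for \<eta> B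
  proof -
    have "\<exists>k. k ^ (card B - 1) = q \<eta> B" by (rule complex_root_ex) (use big[OF B(1)] in simp)
    then have "(SOME k. k ^ (card B - 1) = q \<eta> B) ^ (card B - 1) = q \<eta> B" by (rule someI_ex)
    then show ?thesis unfolding \<kappa>_def if_not_P[OF B(2)] .
  qed
  have kap0: "\<kappa> \<eta> B \<noteq> 0" if "B \<in> P" for \<eta> B
  proof (cases "q \<eta> B = 0")
    case False
    then show ?thesis using kap[OF that False] big[OF that] by (auto simp: power_0_left)
  qed (simp add: \<kappa>_def)
  have q0: "q \<eta> B \<noteq> 0" if inj: "inj_on \<eta> P" and B: "B \<in> P" for \<eta> B
  proof -
    have "\<eta> B \<noteq> \<eta> (blk P j)" if j: "j \<in> S - B" for j
    proof
      assume "\<eta> B = \<eta> (blk P j)"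
      then have "B = blk P j" using inj_onD[OF inj] B partition_blk(1)[OF PS] j by blast
      then show False using partition_blk(2)[OF PS, of j] j by auto
    qed
    then show ?thesis using finS by (simp add: q_def)
  qed
  define E where "E v = (\<lambda>B\<in>P. avg B v)" for v
  define F where "F v = (E v, \<lambda>B\<in>P. \<lambda>i\<in>B. \<kappa> (E v) B * (v i - avg B v))" for v
  define G where "G p = (\<lambda>i\<in>S. fst p (blk P i) + snd p (blk P i) i / \<kappa> (fst p) (blk P i))" for p :: "('a set \<Rightarrow> complex) \<times> ('a set \<Rightarrow> 'a \<Rightarrow> complex)"
  let ?A = "{v. (P, v) \<in> limits}"
  let ?T = "glob P card (\<lambda>B. \<Sum>i\<in>B. r i) \<times> (\<Pi>\<^sub>E B\<in>P. sols B m)"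
  have iff: "(P, v) \<in> limits \<longleftrightarrow> F v \<in> ?T" if v: "v \<in> S \<rightarrow>\<^sub>E UNIV" for v
  proof -
    have "(P, v) \<in> limits \<longleftrightarrow> E v \<in> glob P card (\<lambda>B. \<Sum>i\<in>B. r i) \<and>
       (\<forall>B\<in>P. (\<lambda>i\<in>B. \<kappa> (E v) B * (v i - avg B v)) \<in> sols B m)"
    proof (rule limits_iff[OF P v])
      show "E v = (\<lambda>B\<in>P. avg B v)" by (simp add: E_def)
      show "\<kappa> (E v) B ^ (card B - 1) = (\<Prod>j\<in>S - B. E v B - E v (blk P j))" if "B \<in> P" "inj_on (E v) P" for B
        using kap[OF that(1) q0[OF that(2,1)]] by (simp add: q_def)
    qed (rule kap0)
    also have "\<dots> \<longleftrightarrow> F v \<in> ?T" by (simp add: F_def PiE_iff)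
    finally show ?thesis .
  qed
  have ext: "v \<in> S \<rightarrow>\<^sub>E UNIV" if "(P, v) \<in> limits" for v using that by (simp add: limits_def)
  have GF: "G (F v) = v" if v: "v \<in> ?A" for v
  proof (rule PiE_ext)
    show "G (F v) \<in> S \<rightarrow>\<^sub>E UNIV" by (simp add: G_def)
    show "v \<in> S \<rightarrow>\<^sub>E UNIV" using ext v by simp
    fix i assume i: "i \<in> S"
    note b = partition_blk[OF PS i]
    show "G (F v) i = v i"
      using i b kap0[OF b(1), of "E v"] by (simp add: G_def F_def) (simp add: E_def)
  qed
  have avgG: "avg B (G (\<eta>, x)) = \<eta> B" if \<eta>: "(\<eta>, x) \<in> ?T" and B: "B \<in> P" for \<eta> x B
  proof -
    have fB: "finite B" "B \<noteq> {}" using finite_subset[OF BS[OF B] finS] partition_onD3[OF PS] B by auto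
    have "x B \<in> sols B m" using \<eta> B by auto
    then have xs: "(\<Sum>i\<in>B. x B i) = 0" by (simp add: sols_def)
    have "(\<Sum>i\<in>B. G (\<eta>, x) i) = (\<Sum>i\<in>B. \<eta> B + x B i / \<kappa> \<eta> B)"
    proof (rule sum.cong[OF refl])
      fix i assume i: "i \<in> B"
      then show "G (\<eta>, x) i = \<eta> B + x B i / \<kappa> \<eta> B"
        using BS[OF B] blk_eqI[OF PS B i] by (auto simp: G_def)
    qed
    also have "\<dots> = of_nat (card B) * \<eta> B" by (simp add: sum.distrib xs flip: sum_divide_distrib)
    finally show ?thesis using fB by (simp add: avg_def)
  qed
  have FG: "F (G p) = p" if p: "p \<in> ?T" for p
  proof -
    obtain \<eta> x where px: "p = (\<eta>, x)" by (cases p)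
    have \<eta>x: "(\<eta>, x) \<in> ?T" using p px by simp
    have e1: "E (G (\<eta>, x)) = \<eta>"
    proof (rule PiE_ext)
      show "E (G (\<eta>, x)) \<in> P \<rightarrow>\<^sub>E UNIV" by (simp add: E_def)
      show "\<eta> \<in> P \<rightarrow>\<^sub>E UNIV" using \<eta>x by (simp add: glob_def)
      show "E (G (\<eta>, x)) B = \<eta> B" if "B \<in> P" for B using avgG[OF \<eta>x that] that by (simp add: E_def)
    qed
    have "(\<lambda>B\<in>P. \<lambda>i\<in>B. \<kappa> \<eta> B * (G (\<eta>, x) i - avg B (G (\<eta>, x)))) = x"
    proof (rule PiE_ext)
      show "(\<lambda>B\<in>P. \<lambda>i\<in>B. \<kappa> \<eta> B * (G (\<eta>, x) i - avg B (G (\<eta>, x)))) \<in> P \<rightarrow>\<^sub>E UNIV" by simp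
      show "x \<in> P \<rightarrow>\<^sub>E UNIV" using \<eta>x by (auto simp: PiE_iff)
      fix B assume B: "B \<in> P"
      have xB: "x B \<in> sols B m" using \<eta>x B by auto
      show "(\<lambda>B\<in>P. \<lambda>i\<in>B. \<kappa> \<eta> B * (G (\<eta>, x) i - avg B (G (\<eta>, x)))) B = x B"
      proof (rule PiE_ext)
        show "(\<lambda>B\<in>P. \<lambda>i\<in>B. \<kappa> \<eta> B * (G (\<eta>, x) i - avg B (G (\<eta>, x)))) B \<in> B \<rightarrow>\<^sub>E UNIV" using B by simp
        show "x B \<in> B \<rightarrow>\<^sub>E UNIV" using xB by (simp add: sols_def)
        fix i assume i: "i \<in> B"
        have "G (\<eta>, x) i = \<eta> B + x B i / \<kappa> \<eta> B"
          using BS[OF B] i blk_eqI[OF PS B i] by (auto simp: G_def)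
        then show "(\<lambda>B\<in>P. \<lambda>i\<in>B. \<kappa> \<eta> B * (G (\<eta>, x) i - avg B (G (\<eta>, x)))) B i = x B i"
          using B i avgG[OF \<eta>x B] kap0[OF B, of \<eta>] by simp
      qed
    qed
    then show ?thesis unfolding px F_def e1 by simp
  qed
  have "bij_betw F ?A ?T"
  proof (rule bij_betw_byWitness[where f' = G])
    show "\<forall>v\<in>?A. G (F v) = v" using GF by blast
    show "\<forall>p\<in>?T. F (G p) = p" using FG by blast
    show "F ` ?A \<subseteq> ?T" using iff ext by blast
    show "G ` ?T \<subseteq> ?A"
    proof
      fix v assume "v \<in> G ` ?T"
      then obtain p where p: "p \<in> ?T" "v = G p" by blast
      have "v \<in> S \<rightarrow>\<^sub>E UNIV" by (simp add: p(2) G_def)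
      moreover have "F v \<in> ?T" using FG[OF p(1)] p by simp
      ultimately show "v \<in> ?A" using iff by simp
    qed
  qed
  then have "card ?A = card ?T" by (rule bij_betw_same_card)
  also have "\<dots> = card (glob P card (\<lambda>B. \<Sum>i\<in>B. r i)) * (\<Prod>B\<in>P. card (sols B m))"
    by (simp add: card_cartesian_product card_PiE[OF finP])
  finally show ?thesis .
qed

lemma finite_zsp: "finite (zsp S m)"
  by (rule finite_subset[OF _ finitely_many_partition_on[OF finS]]) (auto simp: zsp_def)

lemma card_limits:
  assumes "finite limits"
  shows "card limits = (\<Sum>P\<in>zsp S m. card (glob P card (\<lambda>B. \<Sum>i\<in>B. r i)) * (\<Prod>B\<in>P. card (sols B m)))"
proof -
  have eq: "limits = (SIGMA P:zsp S m. {v. (P, v) \<in> limits})" by (auto simp: limits_def)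
  have "finite {v. (P, v) \<in> limits}" for P
    by (rule finite_subset[OF _ finite_imageI[OF assms, of snd]]) force
  then have "card (SIGMA P:zsp S m. {v. (P, v) \<in> limits}) = (\<Sum>P\<in>zsp S m. card {v. (P, v) \<in> limits})"
    using finite_zsp by (intro card_SigmaI) auto
  then show ?thesis unfolding eq[symmetric] by (simp add: card_limits_fibre)
qed

lemma sol_at_sols: "t > 0 \<Longrightarrow> sol_at t = sols S (\<lambda>i. (m i + t * r i) / t)"
  by (auto simp: sol_at_def sols_def field_simps)

end

section \<open>Explicit counts and nonexistence of solutions\<close>

text \<open>\<open>diffprod\<close> is homogeneous of degree \<open>card S - 1\<close>, so a factor
  c in m is undone by scaling z with a root of c.\<close>

lemma sols_scale_card:
  assumes fin: "finite S" and c2: "card S \<ge> 2" and c: "c \<noteq> 0"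
  shows "card (sols S (\<lambda>i. c * m i)) = card (sols S m)" "finite (sols S (\<lambda>i. c * m i)) = finite (sols S m)"
proof -
  define n where "n = card S - 1"
  have n0: "n \<noteq> 0" using c2 by (simp add: n_def)
  obtain k where k: "k ^ n = c" using complex_root_ex[OF n0] by blast
  have k0: "k \<noteq> 0" using k c n0 by (metis power_0_left)
  have dp: "diffprod S (\<lambda>i\<in>S. a * z i) i = a ^ n * diffprod S z i" if "i \<in> S" for a z i
  proof -
    have "diffprod S (\<lambda>i\<in>S. a * z i) i = (\<Prod>j\<in>S - {i}. a * (z i - z j))"
      unfolding diffprod_def by (rule prod.cong[OF refl]) (use that in \<open>simp add: algebra_simps\<close>)
    then show ?thesis using that fin by (simp add: prod.distrib diffprod_def n_def)
  qed
  have sm: "(\<Sum>i\<in>S. (\<lambda>i\<in>S. a * z i) i) = a * (\<Sum>i\<in>S. z i)" for a and z :: "'a \<Rightarrow> complex"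
    by (simp add: sum_distrib_left)
  have "bij_betw (\<lambda>z. \<lambda>i\<in>S. k * z i) (sols S (\<lambda>i. c * m i)) (sols S m)"
  proof (rule bij_betw_byWitness[where f' = "\<lambda>z. \<lambda>i\<in>S. inverse k * z i"])
    show "\<forall>z\<in>sols S (\<lambda>i. c * m i). (\<lambda>i\<in>S. inverse k * (\<lambda>i\<in>S. k * z i) i) = z"
      using k0 by (auto simp: sols_def fun_eq_iff PiE_def extensional_def)
    show "\<forall>z\<in>sols S m. (\<lambda>i\<in>S. k * (\<lambda>i\<in>S. inverse k * z i) i) = z"
      using k0 by (auto simp: sols_def fun_eq_iff PiE_def extensional_def)
    show "(\<lambda>z. \<lambda>i\<in>S. k * z i) ` sols S (\<lambda>i. c * m i) \<subseteq> sols S m"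
      using sm[of k] by (auto simp: sols_def dp k mult_ac)
    show "(\<lambda>z. \<lambda>i\<in>S. inverse k * z i) ` sols S m \<subseteq> sols S (\<lambda>i. c * m i)"
    proof
      fix y assume "y \<in> (\<lambda>z. \<lambda>i\<in>S. inverse k * z i) ` sols S m"
      then obtain z where z: "z \<in> sols S m" and y: "y = (\<lambda>i\<in>S. inverse k * z i)" by blast
      have "(\<Sum>i\<in>S. y i) = 0" using sm[of "inverse k" z] z by (simp only: y sols_def mem_Collect_eq mult_zero_right)
      moreover have "c * m i * diffprod S y i = 1" if i: "i \<in> S" for i
      proof -
        have "diffprod S y i = inverse c * diffprod S z i" unfolding y dp[OF i] power_inverse k ..
        then have "c * m i * diffprod S y i = m i * diffprod S z i" using c by simp
        also have "m i * diffprod S z i = 1" using z i by (simp add: sols_def)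
        finally show ?thesis .
      qed
      moreover have "y \<in> S \<rightarrow>\<^sub>E UNIV" by (simp add: y)
      ultimately show "y \<in> sols S (\<lambda>i. c * m i)" by (simp add: sols_def)
    qed
  qed
  then show "card (sols S (\<lambda>i. c * m i)) = card (sols S m)" "finite (sols S (\<lambda>i. c * m i)) = finite (sols S m)"
    by (rule bij_betw_same_card, rule bij_betw_finite)
qed

text \<open>Induction on A: the new element may go to any element of its colour, and the rest is a
  colour-preserving bijection onto the remainder.\<close>

lemma card_colour_bijections_aux:
  fixes f :: "'a \<Rightarrow> 'c" and g :: "'b \<Rightarrow> 'c"
  assumes "finite A" "finite B" "finite C" "f ` A \<subseteq> C" "\<And>c. card {a \<in> A. f a = c} = card {b \<in> B. g b = c}"
  shows "card {h \<in> A \<rightarrow>\<^sub>E B. bij_betw h A B \<and> (\<forall>a\<in>A. g (h a) = f a)} = (\<Prod>c\<in>C. fact (card {a \<in> A. f a = c}))"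
  using assms
proof (induction A arbitrary: B rule: finite_induct)
  case empty
  have "B = {}"
  proof (rule ccontr)
    assume "B \<noteq> {}"
    then obtain b where "b \<in> B" by blast
    then have "card {b' \<in> B. g b' = g b} \<noteq> 0" using empty.prems(1) by auto
    then show False using empty.prems(4)[of "g b"] by simp
  qed
  then have "{h \<in> {} \<rightarrow>\<^sub>E B. bij_betw h {} B \<and> (\<forall>a\<in>{}. g (h a) = f a)} = {\<lambda>x. undefined}"
    by (auto simp: bij_betw_def)
  then show ?case by simp
next
  case (insert a A)
  define X where "X = {h \<in> insert a A \<rightarrow>\<^sub>E B. bij_betw h (insert a A) B \<and> (\<forall>x\<in>insert a A. g (h x) = f x)}"
  \<comment> \<open>The possible images of the new element a.\<close>
  define D where "D = {b \<in> B. g b = f a}"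
  define Y where "Y b = {h \<in> A \<rightarrow>\<^sub>E B - {b}. bij_betw h A (B - {b}) \<and> (\<forall>x\<in>A. g (h x) = f x)}" for b
  have finD: "finite D" using insert.prems(1) by (simp add: D_def)
  have cA: "card {x \<in> insert a A. f x = c} = (if f a = c then Suc (card {x \<in> A. f x = c}) else card {x \<in> A. f x = c})" for c
  proof (cases "f a = c")
    case True
    then have "{x \<in> insert a A. f x = c} = insert a {x \<in> A. f x = c}" by auto
    then show ?thesis using True insert.hyps by simp
  next
    case False
    then have "{x \<in> insert a A. f x = c} = {x \<in> A. f x = c}" by auto
    then show ?thesis using False by simp
  qed
  have IH: "card (Y b) = (\<Prod>c\<in>C. fact (card {x \<in> A. f x = c}))" if b: "b \<in> D" for b
    unfolding Y_def
  proof (rule insert.IH)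
    show "finite (B - {b})" using insert.prems(1) by simp
    show "f ` A \<subseteq> C" using insert.prems(3) by blast
    show "card {x \<in> A. f x = c} = card {b' \<in> B - {b}. g b' = c}" for c
    proof (cases "f a = c")
      case True
      then have "{b' \<in> B - {b}. g b' = c} = {b' \<in> B. g b' = c} - {b}" by auto
      moreover have "b \<in> {b' \<in> B. g b' = c}" using b True by (auto simp: D_def)
      ultimately have "card {b' \<in> B - {b}. g b' = c} = card {b' \<in> B. g b' = c} - 1"
        using insert.prems(1) by simp
      then show ?thesis using insert.prems(4)[of c] cA[of c] True by simp
    next
      case False
      then have "{b' \<in> B - {b}. g b' = c} = {b' \<in> B. g b' = c}" using b by (auto simp: D_def)
      then show ?thesis using insert.prems(4)[of c] cA[of c] False by simp
    qed
  qed (rule insert.prems(2))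
  have bij: "bij_betw (\<lambda>h. (h a, restrict h A)) X (SIGMA b:D. Y b)"
  proof (rule bij_betw_byWitness[where f' = "\<lambda>(b, h). h(a := b)"])
    show "\<forall>h\<in>X. (case (h a, restrict h A) of (b, h) \<Rightarrow> h(a := b)) = h"
    proof
      fix h assume "h \<in> X"
      then have "h \<in> extensional (insert a A)" by (auto simp: X_def PiE_def)
      then show "(case (h a, restrict h A) of (b, h) \<Rightarrow> h(a := b)) = h"
        by (auto simp: fun_eq_iff extensional_def)
    qed
    show "\<forall>p\<in>(SIGMA b:D. Y b). ((case p of (b, h) \<Rightarrow> h(a := b)) a, restrict (case p of (b, h) \<Rightarrow> h(a := b)) A) = p"
    proof
      fix p assume "p \<in> (SIGMA b:D. Y b)"
      then obtain b h where p: "p = (b, h)" "h \<in> extensional A" by (auto simp: Y_def PiE_def)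
      have "restrict (h(a := b)) A = h" using p(2) insert.hyps(2) by (auto simp: fun_eq_iff extensional_def)
      then show "((case p of (b, h) \<Rightarrow> h(a := b)) a, restrict (case p of (b, h) \<Rightarrow> h(a := b)) A) = p" by (simp add: p)
    qed
    show "(\<lambda>h. (h a, restrict h A)) ` X \<subseteq> (SIGMA b:D. Y b)"
    proof
      fix p assume "p \<in> (\<lambda>h. (h a, restrict h A)) ` X"
      then obtain h where h: "h \<in> X" "p = (h a, restrict h A)" by blast
      have inj: "inj_on h (insert a A)" and im: "h ` insert a A = B" and gh: "\<forall>x\<in>insert a A. g (h x) = f x"
        using h(1) by (auto simp: X_def bij_betw_def)
      have "h a \<in> D" using im gh by (auto simp: D_def)
      moreover have imA: "h ` A = B - {h a}" using inj im insert.hyps(2) by (auto simp: inj_on_def)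
      moreover have "bij_betw (restrict h A) A (B - {h a})"
        using inj imA by (auto simp: bij_betw_def inj_on_def)
      ultimately show "p \<in> (SIGMA b:D. Y b)" using gh h(2) by (auto simp: Y_def)
    qed
    show "(\<lambda>(b, h). h(a := b)) ` (SIGMA b:D. Y b) \<subseteq> X"
    proof
      fix k assume "k \<in> (\<lambda>(b, h). h(a := b)) ` (SIGMA b:D. Y b)"
      then obtain b h where bh: "b \<in> D" "h \<in> Y b" "k = h(a := b)" by auto
      have hb: "bij_betw h A (B - {b})" "\<forall>x\<in>A. g (h x) = f x" "h \<in> A \<rightarrow>\<^sub>E B - {b}" using bh(2) by (auto simp: Y_def)
      have bB: "b \<in> B" "g b = f a" using bh(1) by (auto simp: D_def)
      have kA: "k x = h x" if "x \<in> A" for x using that bh(3) insert.hyps(2) by auto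
      have "bij_betw k (insert a A) (insert b (B - {b}))"
      proof -
        have "bij_betw k A (B - {b})" using hb(1) kA by (simp cong: bij_betw_cong)
        moreover have "bij_betw k {a} {b}" using bh(3) by (simp add: bij_betw_def)
        ultimately have "bij_betw k ({a} \<union> A) ({b} \<union> (B - {b}))" by (intro bij_betw_combine) auto
        then show ?thesis by simp
      qed
      moreover have "insert b (B - {b}) = B" using bB by auto
      moreover have "k \<in> insert a A \<rightarrow>\<^sub>E B" using hb(3) bB bh(3) by (auto simp: PiE_def extensional_def)
      moreover have "\<forall>x\<in>insert a A. g (k x) = f x" using hb(2) bB kA bh(3) by auto
      ultimately show "k \<in> X" by (simp add: X_def)
    qed
  qed
  have finY: "finite (Y b)" for b
    by (rule finite_subset[of _ "A \<rightarrow>\<^sub>E B - {b}"]) (use insert in \<open>auto simp: Y_def intro!: finite_PiE\<close>)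
  have "card X = card (SIGMA b:D. Y b)" by (rule bij_betw_same_card[OF bij])
  also have "\<dots> = (\<Sum>b\<in>D. card (Y b))" using finD finY by (intro card_SigmaI) auto
  also have "\<dots> = card D * (\<Prod>c\<in>C. fact (card {x \<in> A. f x = c}))" by (simp add: IH)
  also have "card D = Suc (card {x \<in> A. f x = f a})" using insert.prems(4)[of "f a"] cA[of "f a"] by (simp add: D_def)
  also have "Suc (card {x \<in> A. f x = f a}) * (\<Prod>c\<in>C. fact (card {x \<in> A. f x = c})) = (\<Prod>c\<in>C. fact (card {x \<in> insert a A. f x = c}))"
  proof -
    have fa: "f a \<in> C" using insert.prems(3) by blast
    have "(\<Prod>c\<in>C - {f a}. fact (card {x \<in> insert a A. f x = c}) :: nat) = (\<Prod>c\<in>C - {f a}. fact (card {x \<in> A. f x = c}))"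
      by (rule prod.cong[OF refl]) (use cA in auto)
    moreover have "card {x \<in> insert a A. f x = f a} = Suc (card {x \<in> A. f x = f a})" using cA by simp
    ultimately show ?thesis
      unfolding prod.remove[OF insert.prems(2) fa] by (simp only: fact_Suc of_nat_id mult.assoc)
  qed
  finally show ?case by (simp only: X_def)
qed

lemma card_bijections_ext:
  assumes "finite A" "finite B" "card A = card B"
  shows "card {h \<in> A \<rightarrow>\<^sub>E B. bij_betw h A B} = fact (card A)"
proof -
  have "card {h \<in> A \<rightarrow>\<^sub>E B. bij_betw h A B \<and> (\<forall>a\<in>A. () = ())} = (\<Prod>c\<in>{()}. fact (card {a \<in> A. () = c}))"
    by (rule card_colour_bijections_aux[OF assms(1,2)]) (use assms in auto)
  then show ?thesis by simp
qed

lemma sum_prod_remove_pderiv: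
  fixes a :: "'a \<Rightarrow> complex"
  shows "(\<Sum>i\<in>A. \<Prod>j\<in>A - {i}. [:- a j, 1:]) = pderiv (\<Prod>j\<in>A. [:- a j, 1:])"
  by (simp add: pderiv_prod pderiv_pCons)

lemma poly_pderiv_prod_root:
  fixes a :: "'a \<Rightarrow> complex"
  assumes "finite A" "i \<in> A"
  shows "poly (pderiv (\<Prod>j\<in>A. [:- a j, 1:])) (a i) = (\<Prod>j\<in>A - {i}. a i - a j)"
proof -
  have "poly (pderiv (\<Prod>j\<in>A. [:- a j, 1:])) (a i) = (\<Sum>k\<in>A. \<Prod>j\<in>A - {k}. a i - a j)"
    by (simp add: sum_prod_remove_pderiv[symmetric] poly_sum poly_prod)
  also have "\<dots> = (\<Sum>k\<in>A. if k = i then (\<Prod>j\<in>A - {i}. a i - a j) else 0)"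
  proof (rule sum.cong[OF refl])
    fix k assume "k \<in> A"
    show "(\<Prod>j\<in>A - {k}. a i - a j) = (if k = i then (\<Prod>j\<in>A - {i}. a i - a j) else 0)"
    proof (cases "k = i")
      case False
      then have "(\<Prod>j\<in>A - {k}. a i - a j) = 0" using assms by (intro prod_zero) auto
      then show ?thesis using False by simp
    qed simp
  qed
  finally show ?thesis using assms by simp
qed

lemma degree_linear_prod:
  fixes a :: "'a \<Rightarrow> complex"
  shows "degree (\<Prod>j\<in>A. [:- a j, 1:]) = card A" "lead_coeff (\<Prod>j\<in>A. [:- a j, 1:]) = 1"
proof -
  show "degree (\<Prod>j\<in>A. [:- a j, 1:]) = card A"
    by (subst degree_prod_eq_sum_degree) auto
  show "lead_coeff (\<Prod>j\<in>A. [:- a j, 1:]) = 1" by (simp add: lead_coeff_prod)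
qed

text \<open>Translate the special point to 0 and let A be the polynomial of the other n points. The
  equations become z A' - n A = 1, whose monic solution of degree n is z^n - 1/n. So the points are
  the n-th roots of 1/n in arbitrary order.\<close>

lemma card_sols_star:
  assumes fin: "finite S" and i0: "i0 \<in> S" and c2: "card S \<ge> 2" and \<gamma>: "\<gamma> \<noteq> 0"
    and m: "\<And>i. i \<in> S - {i0} \<Longrightarrow> m i = \<gamma>" and mi0: "m i0 = - \<gamma> * of_nat (card S - 1)"
  shows "card (sols S m) = fact (card S - 1)"
proof -
  define n where "n = card S - 1"
  have n: "n > 0" "card S = Suc n" using c2 by (auto simp: n_def)
  define m1 where "m1 i = (if i = i0 then - of_nat n else (1 :: complex))" for i
  have "sols S m = sols S (\<lambda>i. \<gamma> * m1 i)"
  proof -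
    have "m i = \<gamma> * m1 i" if "i \<in> S" for i using that m[of i] mi0 by (auto simp: m1_def n_def)
    then show ?thesis by (simp add: sols_def cong: ball_cong)
  qed
  then have red: "card (sols S m) = card (sols S m1)" using sols_scale_card(1)[OF fin c2 \<gamma>] by simp
  define Oo where "Oo = S - {i0}"
  have finO: "finite Oo" and cardO: "card Oo = n" using fin i0 n by (auto simp: Oo_def)
  define R where "R = {z :: complex. z ^ n = 1 / of_nat n}"
  have cR: "card R = n" unfolding R_def using n by (intro card_nth_roots) auto
  have finR: "finite R" using cR n by (intro card_ge_0_finite) simp
  have Xeq: "(\<Prod>j\<in>Oo. [:- a j, 1:]) = monom 1 n - [:1 / of_nat n:]"
    if "inj_on a Oo" "\<And>i. i \<in> Oo \<Longrightarrow> a i \<in> R" for a :: "'a \<Rightarrow> complex"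
  proof -
    have "(\<Prod>j\<in>Oo. [:- a j, 1:]) - (monom 1 n - [:1 / of_nat n:]) = 0"
    proof (rule poly_eq_0_if_many_roots[OF finO that(1)])
      fix i assume i: "i \<in> Oo"
      have "poly (\<Prod>j\<in>Oo. [:- a j, 1:]) (a i) = 0" using i finO by (auto simp: poly_prod intro!: prod_zero)
      then show "poly ((\<Prod>j\<in>Oo. [:- a j, 1:]) - (monom 1 n - [:1 / of_nat n:])) (a i) = 0"
        using that(2)[OF i] by (simp add: R_def poly_monom)
    next
      have "coeff ((\<Prod>j\<in>Oo. [:- a j, 1:]) - (monom 1 n - [:1 / of_nat n:])) k = 0" if k: "k \<ge> n" for k
      proof (cases "k = n")
        case True
        then show ?thesis using degree_linear_prod[of a Oo] cardO n by (simp add: coeff_pCons split: nat.split)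
      next
        case False
        then have "k > n" using k by simp
        then show ?thesis using degree_linear_prod(1)[of a Oo] cardO by (simp add: coeff_eq_0 coeff_pCons split: nat.split)
      qed
      then have "degree ((\<Prod>j\<in>Oo. [:- a j, 1:]) - (monom 1 n - [:1 / of_nat n:])) \<le> n - 1"
        using n by (intro degree_le) auto
      then show "degree ((\<Prod>j\<in>Oo. [:- a j, 1:]) - (monom 1 n - [:1 / of_nat n:])) < card Oo" using n cardO by simp
    qed
    then show ?thesis by simp
  qed
  have dO: "diffprod S z i = (z i - z i0) * (\<Prod>j\<in>Oo - {i}. (z i - z i0) - (z j - z i0))" if i: "i \<in> Oo" for z i
  proof -
    have "S - {i} = insert i0 (Oo - {i})" using i i0 by (auto simp: Oo_def)
    then show ?thesis using finO by (simp add: diffprod_def) (simp add: Oo_def)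
  qed
  have d0: "diffprod S z i0 = (\<Prod>j\<in>Oo. 0 - (z j - z i0))" for z by (simp add: diffprod_def Oo_def)
  let ?H = "{h \<in> Oo \<rightarrow>\<^sub>E R. bij_betw h Oo R}"
  define F where "F z = (\<lambda>i\<in>Oo. z i - z i0)" for z :: "'a \<Rightarrow> complex"
  define sh where "sh h = - (\<Sum>i\<in>Oo. h i) / of_nat (Suc n)" for h :: "'a \<Rightarrow> complex"
  define G where "G h = (\<lambda>i\<in>S. if i = i0 then sh h else h i + sh h)" for h :: "'a \<Rightarrow> complex"
  have sumS: "(\<Sum>i\<in>S. z i) = z i0 + (\<Sum>i\<in>Oo. z i)" for z :: "'a \<Rightarrow> complex"
    unfolding Oo_def by (rule sum.remove[OF fin i0])
  have "bij_betw F (sols S m1) ?H"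
  proof (rule bij_betw_byWitness[where f' = G])
    show "\<forall>z\<in>sols S m1. G (F z) = z"
    proof
      fix z assume z: "z \<in> sols S m1"
      have "(\<Sum>i\<in>Oo. F z i) = (\<Sum>i\<in>Oo. z i) - of_nat n * z i0" by (simp add: F_def sum_subtractf cardO)
      also have "\<dots> = - of_nat (Suc n) * z i0" using z sumS[of z] by (simp add: sols_def algebra_simps eq_neg_iff_add_eq_0)
      finally have s: "sh (F z) = z i0" by (simp add: sh_def del: of_nat_Suc)
      show "G (F z) = z"
      proof (rule PiE_ext)
        show "G (F z) \<in> S \<rightarrow>\<^sub>E UNIV" by (simp add: G_def)
        show "z \<in> S \<rightarrow>\<^sub>E UNIV" using z by (simp add: sols_def)
        show "G (F z) i = z i" if "i \<in> S" for i using that s by (simp add: G_def F_def Oo_def)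
      qed
    qed
    show "\<forall>h\<in>?H. F (G h) = h"
    proof
      fix h assume h: "h \<in> ?H"
      show "F (G h) = h"
      proof (rule PiE_ext)
        show "F (G h) \<in> Oo \<rightarrow>\<^sub>E UNIV" by (simp add: F_def)
        show "h \<in> Oo \<rightarrow>\<^sub>E UNIV" using h by (auto simp: PiE_def)
        show "F (G h) i = h i" if "i \<in> Oo" for i using that i0 by (simp add: G_def F_def Oo_def)
      qed
    qed
    show "F ` sols S m1 \<subseteq> ?H"
    proof
      fix h assume "h \<in> F ` sols S m1"
      then obtain z where z: "z \<in> sols S m1" "h = F z" by blast
      define a where "a i = z i - z i0" for i
      define A where "A = (\<Prod>j\<in>Oo. [:- a j, 1:])"
      have dA: "degree A = n" "lead_coeff A = 1" using degree_linear_prod[of a Oo] cardO by (simp_all add: A_def)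
      have eq: "m1 i * diffprod S z i = 1" if "i \<in> S" for i using z that by (simp add: sols_def)
      have inj: "inj_on a Oo"
      proof (rule inj_onI, rule ccontr)
        fix i j assume ij: "i \<in> Oo" "j \<in> Oo" "a i = a j" "i \<noteq> j"
        then have "(\<Prod>j\<in>Oo - {i}. (z i - z i0) - (z j - z i0)) = 0" using finO by (intro prod_zero) (auto simp: a_def)
        then show False using eq[of i] dO[OF ij(1), of z] ij(1) by (simp add: Oo_def)
      qed
      have r1: "a i * poly (pderiv A) (a i) = 1" if i: "i \<in> Oo" for i
        using eq[of i] dO[OF i, of z] i poly_pderiv_prod_root[OF finO i, of a]
        by (simp add: A_def a_def m1_def Oo_def)
      have r2: "of_nat n * poly A 0 = - 1"
        using eq[OF i0] d0[of z] by (simp add: A_def a_def m1_def poly_prod) (metis add.inverse_inverse)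
      \<comment> \<open>The top coefficients of z A' and n A cancel, so Q has degree below n; by the
        equations it vanishes at the n distinct points.\<close>
      define Q where "Q = [:0, 1:] * pderiv A - smult (of_nat n) A - 1"
      have cQ: "coeff Q k = (of_nat k - of_nat n) * coeff A k - (if k = 0 then 1 else 0)" for k
        by (cases k) (simp_all add: Q_def coeff_pderiv coeff_pCons algebra_simps)
      have "Q = 0"
      proof (rule poly_eq_0_if_many_roots[OF finO inj])
        fix i assume i: "i \<in> Oo"
        have "poly A (a i) = 0" using i finO by (auto simp: A_def poly_prod intro!: prod_zero)
        then show "poly Q (a i) = 0" using r1[OF i] by (simp add: Q_def)
      next
        have "coeff Q k = 0" if "k \<ge> n" for k
          using that dA n by (cases "k = n") (auto simp: cQ coeff_eq_0)
        then have "degree Q \<le> n - 1" using n by (intro degree_le) auto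
        then show "degree Q < card Oo" using n cardO by simp
      qed
      then have c0: "coeff A k = 0" if "0 < k" "k \<noteq> n" for k using cQ[of k] that by simp
      have "A = monom 1 n - [:1 / of_nat n:]"
      proof (rule poly_eqI)
        fix k
        consider "k = 0" | "k = n" | "0 < k" "k \<noteq> n" by blast
        then show "coeff A k = coeff (monom 1 n - [:1 / of_nat n:]) k"
        proof cases
          case 1
          have "poly A 0 = - (1 / of_nat n)" using r2 n by (simp add: field_simps eq_neg_iff_add_eq_0)
          then show ?thesis using 1 n by (simp add: poly_0_coeff_0)
        next
          case 2
          then show ?thesis using dA n by (simp add: coeff_pCons split: nat.split)
        next
          case 3
          then show ?thesis using c0 by (simp add: coeff_pCons split: nat.split)
        qed
      qed
      then have aR: "a i \<in> R" if i: "i \<in> Oo" for i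
      proof -
        assume eqA: "A = monom 1 n - [:1 / of_nat n:]"
        have "poly A (a i) = 0" using i finO by (auto simp: A_def poly_prod intro!: prod_zero)
        then show ?thesis unfolding eqA by (simp add: poly_monom R_def)
      qed
      have "a ` Oo = R"
        by (rule card_subset_eq[OF finR]) (use aR inj cardO cR in \<open>auto simp: card_image\<close>)
      then have "bij_betw h Oo R" using inj by (auto simp: bij_betw_def z(2) F_def a_def inj_on_def)
      moreover have "h \<in> Oo \<rightarrow>\<^sub>E R" using aR by (auto simp: z(2) F_def a_def)
      ultimately show "h \<in> ?H" by blast
    qed
    show "G ` ?H \<subseteq> sols S m1"
    proof
      fix z assume "z \<in> G ` ?H"
      then obtain h where h: "h \<in> Oo \<rightarrow>\<^sub>E R" "bij_betw h Oo R" "z = G h" by blast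
      have inj: "inj_on h Oo" using h(2) by (simp add: bij_betw_def)
      have hR: "h i ^ n = 1 / of_nat n" if "i \<in> Oo" for i using h(1) that by (auto simp: R_def)
      have zi: "z i - z i0 = h i" if "i \<in> Oo" for i using that i0 by (simp add: h(3) G_def Oo_def)
      have X: "(\<Prod>j\<in>Oo. [:- h j, 1:]) = monom 1 n - [:1 / of_nat n:]"
        by (rule Xeq[OF inj]) (use h(1) in auto)
      have "(\<Sum>i\<in>S. z i) = sh h + (\<Sum>i\<in>Oo. h i + sh h)"
      proof -
        have "(\<Sum>i\<in>Oo. z i) = (\<Sum>i\<in>Oo. h i + sh h)"
          by (rule sum.cong[OF refl]) (simp add: h(3) G_def Oo_def)
        moreover have "z i0 = sh h" using i0 by (simp add: h(3) G_def)
        ultimately show ?thesis by (simp add: sumS)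
      qed
      also have "\<dots> = 0"
      proof -
        have "sh h * of_nat (Suc n) = - (\<Sum>i\<in>Oo. h i)" by (simp add: sh_def del: of_nat_Suc)
        moreover have "sh h + (\<Sum>i\<in>Oo. h i + sh h) = sh h * of_nat (Suc n) + (\<Sum>i\<in>Oo. h i)"
          by (simp add: sum.distrib cardO algebra_simps)
        ultimately show ?thesis by (simp del: of_nat_Suc)
      qed
      finally have s0: "(\<Sum>i\<in>S. z i) = 0" .
      have "m1 i * diffprod S z i = 1" if i: "i \<in> S" for i
      proof (cases "i = i0")
        case True
        have "diffprod S z i0 = (\<Prod>j\<in>Oo. 0 - h j)" unfolding d0 by (rule prod.cong[OF refl]) (simp add: zi)
        also have "\<dots> = poly (\<Prod>j\<in>Oo. [:- h j, 1:]) 0" by (simp add: poly_prod)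
        also have "\<dots> = - (1 / of_nat n)" unfolding X using n by (simp add: poly_monom power_0_left)
        finally show ?thesis using True n by (simp add: m1_def)
      next
        case False
        then have iO: "i \<in> Oo" using i by (simp add: Oo_def)
        have "diffprod S z i = h i * (\<Prod>j\<in>Oo - {i}. h i - h j)"
          unfolding dO[OF iO] zi[OF iO] by (rule arg_cong[of _ _ "(*) (h i)"], rule prod.cong[OF refl]) (simp add: zi)
        also have "(\<Prod>j\<in>Oo - {i}. h i - h j) = poly (pderiv (\<Prod>j\<in>Oo. [:- h j, 1:])) (h i)"
          using poly_pderiv_prod_root[OF finO iO, of h] by simp
        also have "\<dots> = of_nat n * h i ^ (n - 1)" unfolding X by (simp add: pderiv_diff pderiv_monom pderiv_pCons poly_monom)
        also have "h i * (of_nat n * h i ^ (n - 1)) = of_nat n * h i ^ n" using n by (cases n) auto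
        also have "\<dots> = 1" using hR[OF iO] n by simp
        finally show ?thesis using False by (simp add: m1_def)
      qed
      then show "z \<in> sols S m1" using s0 by (simp add: sols_def h(3) G_def)
    qed
  qed
  then have "card (sols S m1) = card ?H" by (rule bij_betw_same_card)
  also have "\<dots> = fact n" using card_bijections_ext[OF finO finR] cardO cR by simp
  finally show ?thesis using red by (simp add: n_def)
qed

text \<open>The Lagrange identity for the constant 1 becomes, after multiplication by
  \<open>E1\<close>, a Wronskian identity between two monic polynomials of degree n. Their Wronskian
  has degree at least n - 1, but \<open>E1\<close> only has degree n - card T.\<close>

lemma sols_empty_if_two_negative:
  fixes m :: "'a \<Rightarrow> complex"
  assumes finO: "finite Oo" and finT: "finite T" and dis: "Oo \<inter> T = {}" and T2: "card T \<ge> 2"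
    and mO: "\<And>i. i \<in> Oo \<Longrightarrow> m i = 1" and mT: "\<And>b. b \<in> T \<Longrightarrow> m b = - of_nat (a b)" and a1: "\<And>b. b \<in> T \<Longrightarrow> a b \<ge> 1"
    and sa: "(\<Sum>b\<in>T. a b) = card Oo"
  shows "sols (Oo \<union> T) m = {}"
proof (rule ccontr)
  define S where "S = Oo \<union> T"
  assume "sols (Oo \<union> T) m \<noteq> {}"
  then obtain z where z: "z \<in> sols S m" by (auto simp: S_def)
  have finS: "finite S" using finO finT by (simp add: S_def)
  have Sne: "S \<noteq> {}" using T2 by (auto simp: S_def)
  have eq: "m i * diffprod S z i = 1" if "i \<in> S" for i using z that by (simp add: sols_def)
  have inj: "inj_on z S"
  proof (rule inj_onI, rule ccontr)
    fix i j assume ij: "i \<in> S" "j \<in> S" "z i = z j" "i \<noteq> j"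
    then have "diffprod S z i = 0" unfolding diffprod_def using finS by (intro prod_zero) auto
    then show False using eq[OF ij(1)] by simp
  qed
  have inv: "inverse (diffprod S z i) = m i" if "i \<in> S" for i
    using eq[OF that] by (metis inverse_unique mult.commute)
  define q where "q i = [:- z i, 1:]" for i
  have q0: "q i \<noteq> 0" for i by (simp add: q_def)
  define QA where "QA = (\<Prod>i\<in>Oo. q i)"
  define QT where "QT = (\<Prod>b\<in>T. q b)"
  define W where "W = (\<Sum>b\<in>T. smult (of_nat (a b)) (\<Prod>c\<in>T - {b}. q c))"
  have "(\<Sum>i\<in>S. smult (1 * inverse (diffprod S z i)) (\<Prod>j\<in>S - {i}. q j)) - 1 = 0"
    unfolding q_def by (rule lagrange_sum_poly[OF finS Sne inj]) (use finS Sne in \<open>auto simp: card_gt_0_iff\<close>)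
  moreover have "(\<Sum>i\<in>S. smult (1 * inverse (diffprod S z i)) (\<Prod>j\<in>S - {i}. q j)) = (\<Sum>i\<in>S. smult (m i) (\<Prod>j\<in>S - {i}. q j))"
    by (rule sum.cong[OF refl]) (simp add: inv)
  ultimately have lag: "(\<Sum>i\<in>S. smult (m i) (\<Prod>j\<in>S - {i}. q j)) = 1" by simp
  have "(\<Sum>i\<in>S. smult (m i) (\<Prod>j\<in>S - {i}. q j)) = (\<Sum>i\<in>Oo. smult (m i) (\<Prod>j\<in>S - {i}. q j)) + (\<Sum>i\<in>T. smult (m i) (\<Prod>j\<in>S - {i}. q j))"
    unfolding S_def by (rule sum.union_disjoint[OF finO finT dis])
  also have "(\<Sum>i\<in>Oo. smult (m i) (\<Prod>j\<in>S - {i}. q j)) = pderiv QA * QT"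
  proof -
    have "(\<Sum>i\<in>Oo. smult (m i) (\<Prod>j\<in>S - {i}. q j)) = (\<Sum>i\<in>Oo. (\<Prod>j\<in>Oo - {i}. q j) * QT)"
    proof (rule sum.cong[OF refl])
      fix i assume i: "i \<in> Oo"
      have "S - {i} = (Oo - {i}) \<union> T" using i dis by (auto simp: S_def)
      moreover have "(\<Prod>j\<in>(Oo - {i}) \<union> T. q j) = (\<Prod>j\<in>Oo - {i}. q j) * QT"
        unfolding QT_def using finO finT dis by (intro prod.union_disjoint) auto
      ultimately show "smult (m i) (\<Prod>j\<in>S - {i}. q j) = (\<Prod>j\<in>Oo - {i}. q j) * QT" by (simp add: mO[OF i])
    qed
    then show ?thesis unfolding QA_def q_def sum_prod_remove_pderiv[symmetric] by (simp only: sum_distrib_right)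
  qed
  also have "(\<Sum>b\<in>T. smult (m b) (\<Prod>j\<in>S - {b}. q j)) = - (QA * W)"
  proof -
    have "(\<Sum>b\<in>T. smult (m b) (\<Prod>j\<in>S - {b}. q j)) = (\<Sum>b\<in>T. - (QA * smult (of_nat (a b)) (\<Prod>c\<in>T - {b}. q c)))"
    proof (rule sum.cong[OF refl])
      fix b assume b: "b \<in> T"
      have "S - {b} = Oo \<union> (T - {b})" using b dis by (auto simp: S_def)
      moreover have "(\<Prod>j\<in>Oo \<union> (T - {b}). q j) = QA * (\<Prod>c\<in>T - {b}. q c)"
        unfolding QA_def using finO finT dis by (intro prod.union_disjoint) auto
      ultimately show "smult (m b) (\<Prod>j\<in>S - {b}. q j) = - (QA * smult (of_nat (a b)) (\<Prod>c\<in>T - {b}. q c))"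
        by (simp add: mT[OF b])
    qed
    then show ?thesis by (simp only: W_def sum_negf sum_distrib_left)
  qed
  finally have one: "pderiv QA * QT - QA * W = 1" using lag by simp
  \<comment> \<open>Multiplying by \<open>E1\<close> turns the part coming from \<open>T\<close>
    into the derivative of \<open>Bp\<close>, so \<open>pderiv QA * QT - QA * W = 1\<close> becomes
    a statement about a genuine Wronskian.\<close>
  define E1 where "E1 = (\<Prod>b\<in>T. q b ^ (a b - 1))"
  define Bp where "Bp = (\<Prod>b\<in>T. q b ^ a b)"
  have qa: "q b ^ a b = q b ^ (a b - 1) * q b" if "b \<in> T" for b
    using a1[OF that] by (cases "a b") (auto simp: mult.commute)
  have BE: "Bp = E1 * QT" unfolding Bp_def E1_def QT_def prod.distrib[symmetric] by (rule prod.cong[OF refl]) (rule qa)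
  have dB: "pderiv Bp = E1 * W"
  proof -
    have "pderiv Bp = (\<Sum>b\<in>T. (\<Prod>c\<in>T - {b}. q c ^ a c) * pderiv (q b ^ a b))" unfolding Bp_def by (rule pderiv_prod)
    also have "\<dots> = (\<Sum>b\<in>T. E1 * smult (of_nat (a b)) (\<Prod>c\<in>T - {b}. q c))"
    proof (rule sum.cong[OF refl])
      fix b assume b: "b \<in> T"
      obtain k where k: "a b = Suc k" using a1[OF b] by (cases "a b") auto
      have dq: "pderiv (q b) = 1" by (simp add: q_def pderiv_pCons)
      have pd: "pderiv (q b ^ a b) = smult (of_nat (a b)) (q b ^ (a b - 1))"
        unfolding k pderiv_power_Suc dq by simp
      have "(\<Prod>c\<in>T - {b}. q c ^ a c) = (\<Prod>c\<in>T - {b}. q c ^ (a c - 1)) * (\<Prod>c\<in>T - {b}. q c)"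
        unfolding prod.distrib[symmetric] by (rule prod.cong[OF refl], rule qa) simp
      moreover have "E1 = q b ^ (a b - 1) * (\<Prod>c\<in>T - {b}. q c ^ (a c - 1))"
        unfolding E1_def by (rule prod.remove[OF finT b])
      ultimately show "(\<Prod>c\<in>T - {b}. q c ^ a c) * pderiv (q b ^ a b) = E1 * smult (of_nat (a b)) (\<Prod>c\<in>T - {b}. q c)"
        unfolding pd by (simp add: mult_ac)
    qed
    finally show ?thesis by (simp only: W_def sum_distrib_left)
  qed
  have wr: "pderiv QA * Bp - QA * pderiv Bp = E1"
  proof -
    have "pderiv QA * Bp - QA * pderiv Bp = E1 * (pderiv QA * QT - QA * W)"
      unfolding BE[unfolded BE] dB by (simp add: BE algebra_simps)
    then show ?thesis by (simp add: one)
  qed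
  define n where "n = card Oo"
  have degA: "degree QA = n" "lead_coeff QA = 1" using degree_linear_prod[of z Oo] by (simp_all add: QA_def q_def n_def)
  have degB: "degree Bp = n" unfolding Bp_def n_def sa[symmetric]
    by (subst degree_prod_eq_sum_degree) (auto simp: q_def degree_power_eq)
  have lcB: "lead_coeff Bp = 1" unfolding Bp_def by (simp add: lead_coeff_prod lead_coeff_power q_def)
  have cTn: "card T \<le> n" using sum_mono[of T "\<lambda>_. 1" a] a1 sa by (simp add: n_def)
  have degE: "degree E1 = n - card T"
  proof -
    have "degree E1 = (\<Sum>b\<in>T. a b - 1)" unfolding E1_def
      by (subst degree_prod_eq_sum_degree) (auto simp: q_def degree_power_eq)
    also have "\<dots> = n - card T" using a1 sa by (subst sum_subtractf_nat) (auto simp: n_def)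
    finally show ?thesis .
  qed
  \<comment> \<open>Both polynomials are monic of degree n; subtracting \<open>QA\<close> does not
    change the Wronskian with \<open>QA\<close> but makes the degrees differ, so
    \<open>coeff_wronskian\<close> gives the exact degree.\<close>
  define D where "D = Bp - QA"
  have wrD: "pderiv QA * D - QA * pderiv D = E1"
    using wr by (simp add: D_def pderiv_diff algebra_simps)
  have E10: "E1 \<noteq> 0" unfolding E1_def using finT q0 by auto
  have D0: "D \<noteq> 0" using wrD E10 by auto
  have "degree D < n"
  proof -
    have "coeff D k = 0" if "k \<ge> n" for k
      using that degA degB lcB by (cases "k = n") (auto simp: D_def coeff_eq_0)
    then have "degree D \<le> n - 1" using T2 cTn by (intro degree_le) auto
    then show ?thesis using T2 cTn by simp
  qed
  then obtain l where l: "degree QA + degree D = Suc l" using degA T2 cTn by (cases "degree QA + degree D") auto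
  have "coeff (pderiv QA * D - QA * pderiv D) l \<noteq> 0"
  proof -
    have "QA \<noteq> 0" using degA(2) by auto
    from coeff_wronskian[OF this D0 l] show ?thesis using D0 degA \<open>degree D < n\<close> by simp
  qed
  then have "l \<le> degree E1" unfolding wrD by (rule le_degree)
  then show False using degE l degA T2 cTn by simp
qed

section \<open>Abel-Hurwitz identities and subset convolution\<close>

text \<open>An iterated finite difference with steps w a: each step lowers the degree, and there are
  more steps than the degree of p.\<close>

lemma alternating_subset_sum:
  fixes w :: "'a \<Rightarrow> real"
  assumes "finite Q" "degree p < card Q"
  shows "(\<Sum>A\<in>Pow Q. (-1) ^ card A * poly p (x + (\<Sum>a\<in>A. w a))) = 0"
  using assms
proof (induction Q arbitrary: p x rule: finite_induct)
  case (insert a Q)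
  define p' where "p' = p - pcompose p [:w a, 1:]"
  have inj: "inj_on (insert a) (Pow Q)" using insert.hyps(2) by (auto simp: inj_on_def)
  have "(\<Sum>A\<in>Pow (insert a Q). (-1) ^ card A * poly p (x + (\<Sum>a\<in>A. w a)))
     = (\<Sum>A\<in>Pow Q. (-1) ^ card A * poly p (x + (\<Sum>a\<in>A. w a)))
       + (\<Sum>A\<in>insert a ` Pow Q. (-1) ^ card A * poly p (x + (\<Sum>a\<in>A. w a)))"
    unfolding Pow_insert using insert.hyps by (intro sum.union_disjoint) auto
  also have "(\<Sum>A\<in>insert a ` Pow Q. (-1) ^ card A * poly p (x + (\<Sum>a\<in>A. w a)))
     = (\<Sum>A\<in>Pow Q. - ((-1) ^ card A * poly p (x + w a + (\<Sum>a\<in>A. w a))))"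
    unfolding sum.reindex[OF inj] o_def
  proof (rule sum.cong[OF refl])
    fix A assume "A \<in> Pow Q"
    then have "finite A" "a \<notin> A" using insert.hyps finite_subset by auto
    then show "(-1) ^ card (insert a A) * poly p (x + (\<Sum>a\<in>insert a A. w a)) =
        - ((-1) ^ card A * poly p (x + w a + (\<Sum>a\<in>A. w a)))" by (simp add: add.assoc)
  qed
  also have "(\<Sum>A\<in>Pow Q. (-1) ^ card A * poly p (x + (\<Sum>a\<in>A. w a))) + (\<Sum>A\<in>Pow Q. - ((-1) ^ card A * poly p (x + w a + (\<Sum>a\<in>A. w a))))
     = (\<Sum>A\<in>Pow Q. (-1) ^ card A * poly p' (x + (\<Sum>a\<in>A. w a)))"
    unfolding sum.distrib[symmetric]
    by (rule sum.cong[OF refl]) (simp add: p'_def poly_pcompose algebra_simps)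
  also have "\<dots> = 0"
  proof (cases "p' = 0")
    case False
    have dle: "degree p \<le> card Q" using insert.prems insert.hyps by simp
    have dc: "degree (pcompose p [:w a, 1:]) = degree p" by (simp add: degree_pcompose)
    have lc: "lead_coeff (pcompose p [:w a, 1:]) = lead_coeff p" by (subst lead_coeff_comp) auto
    have "degree p' < degree p"
    proof (rule ccontr)
      assume "\<not> degree p' < degree p"
      moreover have "degree p' \<le> degree p" unfolding p'_def using dc by (metis degree_diff_le order_refl)
      ultimately have "degree p' = degree p" by simp
      then have "lead_coeff p' = coeff p (degree p) - coeff (pcompose p [:w a, 1:]) (degree p)" by (simp add: p'_def)
      also have "\<dots> = 0" using lc dc by simp
      finally show False using False by simp
    qed
    then show ?thesis using dle by (intro insert.IH) simp
  qed simp
  finally show ?case .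
qed simp

text \<open>Hurwitz's multivariate form of the Abel polynomials. The value 1 at the empty set stands
  for the formal c * c^(-1).\<close>

definition hz :: "('a \<Rightarrow> real) \<Rightarrow> real \<Rightarrow> 'a set \<Rightarrow> real" where
  "hz w c A = (if A = {} then 1 else c * (c + (\<Sum>a\<in>A. w a)) ^ (card A - 1))"

lemma sum_swap_removed:
  fixes f :: "'a set \<Rightarrow> 'a \<Rightarrow> real"
  assumes "finite Q"
  shows "(\<Sum>A\<in>Pow Q. \<Sum>j\<in>Q - A. f A j) = (\<Sum>j\<in>Q. \<Sum>A\<in>Pow (Q - {j}). f A j)"
proof -
  have 1: "Q - A = {j \<in> Q. j \<notin> A}" for A by auto
  have 2: "Pow (Q - {j}) = {A \<in> Pow Q. j \<notin> A}" for j by auto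
  have "(\<Sum>A\<in>Pow Q. \<Sum>j\<in>{j \<in> Q. j \<notin> A}. f A j) = (\<Sum>j\<in>Q. \<Sum>A\<in>{A \<in> Pow Q. j \<notin> A}. f A j)"
    using assms by (intro sum.swap_restrict) auto
  moreover have "(\<Sum>A\<in>Pow Q. \<Sum>j\<in>Q - A. f A j) = (\<Sum>A\<in>Pow Q. \<Sum>j\<in>{j \<in> Q. j \<notin> A}. f A j)"
    by (rule sum.cong[OF refl]) (subst 1, rule refl)
  moreover have "(\<Sum>j\<in>Q. \<Sum>A\<in>Pow (Q - {j}). f A j) = (\<Sum>j\<in>Q. \<Sum>A\<in>{A \<in> Pow Q. j \<notin> A}. f A j)"
    by (rule sum.cong[OF refl]) (subst 2, rule refl)
  ultimately show ?thesis by simp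
qed

text \<open>Hurwitz's generalisation of Abel's binomial theorem. Both sides are functions of y with
  equal derivatives, by the identity for the sets with one element removed, and they agree at one
  value of y.\<close>

lemma hurwitz_identity:
  fixes w :: "'a \<Rightarrow> real"
  assumes "finite Q"
  shows "(\<Sum>A\<in>Pow Q. hz w x A * (y + (\<Sum>a\<in>Q - A. w a)) ^ card (Q - A)) = (x + y + (\<Sum>a\<in>Q. w a)) ^ card Q"
  using assms
proof (induction Q arbitrary: y rule: finite_psubset_induct)
  case (psubset Q)
  define W where "W A = (\<Sum>a\<in>A. w a)" for A
  have Wd: "W (Q - A) = W Q - W A" if "A \<subseteq> Q" for A
    using sum_diff[OF psubset.hyps that, of w] by (simp add: W_def)
  show ?case
  proof (cases "Q = {}")
    case True
    then show ?thesis by (simp add: hz_def)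
  next
    case False
    define q where "q = card Q"
    have q: "q \<ge> 1" using False psubset.hyps by (simp add: q_def Suc_leI card_gt_0_iff)
    \<comment> \<open>The difference of the two sides; it is shown to be constant in y.\<close>
    define F where "F y = (\<Sum>A\<in>Pow Q. hz w x A * (y + W (Q - A)) ^ card (Q - A)) - (x + y + W Q) ^ q" for y
    have cd: "card (Q - A) = q - card A" if "A \<subseteq> Q" for A
      using psubset.hyps that finite_subset[OF that] by (simp add: card_Diff_subset q_def)
    have "(F has_field_derivative 0) (at y)" for y
    proof -
      have "(F has_field_derivative (\<Sum>A\<in>Pow Q. hz w x A * (of_nat (card (Q - A)) * (y + W (Q - A)) ^ (card (Q - A) - 1)))
          - of_nat q * (x + y + W Q) ^ (q - 1)) (at y)"
        unfolding F_def by (auto intro!: derivative_eq_intros sum.cong)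
      moreover have "(\<Sum>A\<in>Pow Q. hz w x A * (of_nat (card (Q - A)) * (y + W (Q - A)) ^ (card (Q - A) - 1)))
         = of_nat q * (x + y + W Q) ^ (q - 1)"
      proof -
        have "(\<Sum>A\<in>Pow Q. hz w x A * (of_nat (card (Q - A)) * (y + W (Q - A)) ^ (card (Q - A) - 1)))
          = (\<Sum>A\<in>Pow Q. \<Sum>j\<in>Q - A. hz w x A * (y + w j + W (Q - {j} - A)) ^ card (Q - {j} - A))"
        proof (rule sum.cong[OF refl])
          fix A assume A: "A \<in> Pow Q"
          have "(\<Sum>j\<in>Q - A. hz w x A * (y + w j + W (Q - {j} - A)) ^ card (Q - {j} - A))
             = (\<Sum>j\<in>Q - A. hz w x A * (y + W (Q - A)) ^ (card (Q - A) - 1))"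
          proof (rule sum.cong[OF refl])
            fix j assume j: "j \<in> Q - A"
            have e: "Q - {j} - A = (Q - A) - {j}" by auto
            have "W (Q - A) = w j + W ((Q - A) - {j})" unfolding W_def
              by (rule sum.remove) (use psubset.hyps j in auto)
            moreover have "card ((Q - A) - {j}) = card (Q - A) - 1" using j psubset.hyps by simp
            ultimately show "hz w x A * (y + w j + W (Q - {j} - A)) ^ card (Q - {j} - A) = hz w x A * (y + W (Q - A)) ^ (card (Q - A) - 1)"
              unfolding e by (simp add: add.assoc)
          qed
          then show "hz w x A * (of_nat (card (Q - A)) * (y + W (Q - A)) ^ (card (Q - A) - 1)) =
             (\<Sum>j\<in>Q - A. hz w x A * (y + w j + W (Q - {j} - A)) ^ card (Q - {j} - A))" by simp
        qed
        also have "\<dots> = (\<Sum>j\<in>Q. \<Sum>A\<in>Pow (Q - {j}). hz w x A * (y + w j + W (Q - {j} - A)) ^ card (Q - {j} - A))"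
          by (rule sum_swap_removed[OF psubset.hyps])
        also have "\<dots> = (\<Sum>j\<in>Q. (x + y + W Q) ^ (q - 1))"
        proof (rule sum.cong[OF refl])
          fix j assume j: "j \<in> Q"
          have "(\<Sum>A\<in>Pow (Q - {j}). hz w x A * (y + w j + W (Q - {j} - A)) ^ card (Q - {j} - A))
             = (x + (y + w j) + (\<Sum>a\<in>Q - {j}. w a)) ^ card (Q - {j})"
            unfolding W_def by (rule psubset.IH) (use j in auto)
          moreover have "W Q = w j + (\<Sum>a\<in>Q - {j}. w a)" unfolding W_def by (rule sum.remove[OF psubset.hyps j])
          moreover have "card (Q - {j}) = q - 1" using j psubset.hyps by (simp add: q_def)
          ultimately show "(\<Sum>A\<in>Pow (Q - {j}). hz w x A * (y + w j + W (Q - {j} - A)) ^ card (Q - {j} - A)) = (x + y + W Q) ^ (q - 1)"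
            by (simp add: add.assoc)
        qed
        finally show ?thesis by (simp add: q_def)
      qed
      ultimately show ?thesis by simp
    qed
    then have const: "F y = F (- x - W Q)" for y by (rule DERIV_isconst_all[rule_format])
    \<comment> \<open>At this y the second base is the negative of x + W A, so both powers merge
      into the exponent q - 1 with an alternating sign. The result is a finite difference of order q
      of a polynomial of degree q - 1.\<close>
    have "F (- x - W Q) = 0"
    proof -
      have "(\<Sum>A\<in>Pow Q. hz w x A * (- x - W Q + W (Q - A)) ^ card (Q - A))
         = (\<Sum>A\<in>Pow Q. x * (-1) ^ q * ((-1) ^ card A * poly (monom 1 (q - 1)) (x + (\<Sum>a\<in>A. w a))))"
      proof (rule sum.cong[OF refl])
        fix A assume "A \<in> Pow Q"
        then have A: "A \<subseteq> Q" by simp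
        have cA: "card A \<le> q" using card_mono[OF psubset.hyps A] by (simp add: q_def)
        have base: "- x - W Q + W (Q - A) = (-1) * (x + W A)" using Wd[OF A] by simp
        have sg: "(-1 :: real) ^ (q - card A) = (-1) ^ q * (-1) ^ card A"
          using cA by (simp add: minus_one_power_iff)
        have "hz w x A * (x + W A) ^ (q - card A) = x * (x + W A) ^ (q - 1)"
        proof (cases "A = {}")
          case True
          then show ?thesis using q by (simp add: hz_def W_def) (metis Suc_diff_1 Suc_le_eq power_Suc One_nat_def)
        next
          case False
          then have "card A \<ge> 1" using finite_subset[OF A psubset.hyps] by (simp add: Suc_leI card_gt_0_iff)
          then have "q - 1 = (card A - 1) + (q - card A)" using cA by simp
          then show ?thesis using False by (simp add: hz_def W_def power_add mult.assoc)
        qed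
        then show "hz w x A * (- x - W Q + W (Q - A)) ^ card (Q - A) =
          x * (-1) ^ q * ((-1) ^ card A * poly (monom 1 (q - 1)) (x + (\<Sum>a\<in>A. w a)))"
          unfolding cd[OF A] base power_mult_distrib sg by (simp add: poly_monom W_def mult_ac)
      qed
      also have "\<dots> = x * (-1) ^ q * (\<Sum>A\<in>Pow Q. (-1) ^ card A * poly (monom 1 (q - 1)) (x + (\<Sum>a\<in>A. w a)))"
        by (simp only: sum_distrib_left)
      also have "\<dots> = 0"
        using q by (subst alternating_subset_sum[OF psubset.hyps]) (auto simp: degree_monom_eq q_def)
      finally show ?thesis using q by (simp add: F_def)
    qed
    then have "F y = 0" using const by simp
    then show ?thesis by (simp add: F_def W_def q_def)
  qed
qed

text \<open>These polynomials are of binomial type. Writing y as (y + W) - W reduces the claim to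
  \<open>hurwitz_identity\<close> for Q and for Q without one element.\<close>

lemma hurwitz_convolution:
  fixes w :: "'a \<Rightarrow> real"
  assumes fin: "finite Q"
  shows "(\<Sum>A\<in>Pow Q. hz w x A * hz w y (Q - A)) = hz w (x + y) Q"
proof (cases "Q = {}")
  case True
  then show ?thesis by (simp add: hz_def)
next
  case False
  define W where "W A = (\<Sum>a\<in>A. w a)" for A
  define q where "q = card Q"
  have q: "q \<ge> 1" using False fin by (simp add: q_def Suc_leI card_gt_0_iff)
  have hzB: "hz w y B = (y + W B) ^ card B - (\<Sum>j\<in>B. w j * (y + W B) ^ (card B - 1))" if B: "finite B" for B
  proof (cases "B = {}")
    case True
    then show ?thesis by (simp add: hz_def)
  next
    case False
    then obtain k where k: "card B = Suc k" using B by (metis card_0_eq not0_implies_Suc)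
    have "(\<Sum>j\<in>B. w j * (y + W B) ^ (card B - 1)) = W B * (y + W B) ^ k" by (simp add: W_def k sum_distrib_right)
    then show ?thesis using False by (simp add: hz_def k W_def[symmetric] algebra_simps)
  qed
  have "(\<Sum>A\<in>Pow Q. hz w x A * hz w y (Q - A)) =
    (\<Sum>A\<in>Pow Q. hz w x A * (y + W (Q - A)) ^ card (Q - A)) -
    (\<Sum>A\<in>Pow Q. \<Sum>j\<in>Q - A. w j * (hz w x A * (y + w j + W (Q - {j} - A)) ^ card (Q - {j} - A)))"
    unfolding sum_subtractf[symmetric]
  proof (rule sum.cong[OF refl])
    fix A assume "A \<in> Pow Q"
    have "(\<Sum>j\<in>Q - A. w j * (hz w x A * (y + w j + W (Q - {j} - A)) ^ card (Q - {j} - A)))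
       = (\<Sum>j\<in>Q - A. hz w x A * (w j * (y + W (Q - A)) ^ (card (Q - A) - 1)))"
    proof (rule sum.cong[OF refl])
      fix j assume j: "j \<in> Q - A"
      have e: "Q - {j} - A = (Q - A) - {j}" by auto
      have "W (Q - A) = w j + W ((Q - A) - {j})" unfolding W_def
        by (rule sum.remove) (use fin j in auto)
      moreover have "card ((Q - A) - {j}) = card (Q - A) - 1" using j fin by simp
      ultimately show "w j * (hz w x A * (y + w j + W (Q - {j} - A)) ^ card (Q - {j} - A)) =
          hz w x A * (w j * (y + W (Q - A)) ^ (card (Q - A) - 1))"
        unfolding e by (simp add: add.assoc)
    qed
    then show "hz w x A * hz w y (Q - A) = hz w x A * (y + W (Q - A)) ^ card (Q - A) -
        (\<Sum>j\<in>Q - A. w j * (hz w x A * (y + w j + W (Q - {j} - A)) ^ card (Q - {j} - A)))"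
      using hzB[of "Q - A"] fin by (simp add: right_diff_distrib sum_distrib_left)
  qed
  also have "(\<Sum>A\<in>Pow Q. hz w x A * (y + W (Q - A)) ^ card (Q - A)) = (x + y + W Q) ^ q"
    unfolding W_def q_def by (rule hurwitz_identity[OF fin])
  also have "(\<Sum>A\<in>Pow Q. \<Sum>j\<in>Q - A. w j * (hz w x A * (y + w j + W (Q - {j} - A)) ^ card (Q - {j} - A)))
     = (\<Sum>j\<in>Q. \<Sum>A\<in>Pow (Q - {j}). w j * (hz w x A * (y + w j + W (Q - {j} - A)) ^ card (Q - {j} - A)))"
    by (rule sum_swap_removed[OF fin])
  also have "\<dots> = (\<Sum>j\<in>Q. w j * (x + y + W Q) ^ (q - 1))"
  proof (rule sum.cong[OF refl])
    fix j assume j: "j \<in> Q"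
    have "(\<Sum>A\<in>Pow (Q - {j}). hz w x A * (y + w j + W (Q - {j} - A)) ^ card (Q - {j} - A))
       = (x + (y + w j) + (\<Sum>a\<in>Q - {j}. w a)) ^ card (Q - {j})"
      unfolding W_def by (rule hurwitz_identity) (use fin in simp)
    moreover have "W Q = w j + (\<Sum>a\<in>Q - {j}. w a)" unfolding W_def by (rule sum.remove[OF fin j])
    moreover have "card (Q - {j}) = q - 1" using j fin by (simp add: q_def)
    ultimately show "(\<Sum>A\<in>Pow (Q - {j}). w j * (hz w x A * (y + w j + W (Q - {j} - A)) ^ card (Q - {j} - A))) = w j * (x + y + W Q) ^ (q - 1)"
      by (simp add: add.assoc flip: sum_distrib_left)
  qed
  also have "\<dots> = W Q * (x + y + W Q) ^ (q - 1)" by (simp add: W_def sum_distrib_right)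
  also have "(x + y + W Q) ^ q - W Q * (x + y + W Q) ^ (q - 1) = (x + y) * (x + y + W Q) ^ (q - 1)"
    using q by (cases q) (auto simp: algebra_simps)
  finally show ?thesis using False by (simp add: hz_def W_def q_def)
qed

definition ffall :: "nat \<Rightarrow> nat \<Rightarrow> real" where
  "ffall c l = (\<Prod>k<l. real c - real k)"

lemma ffall_Suc: "ffall (Suc c) l = ffall c l + real l * ffall c (l - 1)"
proof (induction l)
  case (Suc l)
  have "ffall (Suc c) (Suc l) = ffall (Suc c) l * (real (Suc c) - real l)" by (simp add: ffall_def)
  also have "\<dots> = (ffall c l + real l * ffall c (l - 1)) * (real (Suc c) - real l)" by (simp only: Suc)
  also have "\<dots> = ffall c (Suc l) + real (Suc l) * ffall c l"
    by (cases l) (simp_all add: ffall_def algebra_simps)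
  finally show ?case by simp
qed (simp add: ffall_def)

definition parts :: "'a set \<Rightarrow> 'a set set set" where "parts S = {P. partition_on S P}"

lemma finite_parts: "finite S \<Longrightarrow> finite (parts S)"
  unfolding parts_def by (rule finitely_many_partition_on)

lemma parts_empty [simp]: "parts {} = {{}}"
  by (auto simp: parts_def partition_on_def)

lemma parts_finite_element: "finite S \<Longrightarrow> P \<in> parts S \<Longrightarrow> finite P"
  using finite_elements by (auto simp: parts_def)

text \<open>The c-th power of f under subset convolution, when f is 1 on the empty set: a family of
  c disjoint sets covering S is a partition into its nonempty members with distinct labels from c
  labels, and \<open>ffall\<close> counts the labellings.\<close>

definition block_sum :: "('a set \<Rightarrow> real) \<Rightarrow> nat \<Rightarrow> 'a set \<Rightarrow> real" where
  "block_sum f c S = (\<Sum>P\<in>parts S. ffall c (card P) * (\<Prod>B\<in>P. f B))"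

text \<open>With c = 1 and suitable g this is the numerator of the theorem, since block sizes add up
  to \<open>card S\<close>. The real parameter c turns out to be the exponent of a convolution
  power.\<close>

definition hz_sum :: "('a set \<Rightarrow> real) \<Rightarrow> real \<Rightarrow> 'a set \<Rightarrow> real" where
  "hz_sum g c S = (\<Sum>Q\<in>parts S. hz (\<lambda>J. - real (card J)) c Q * (\<Prod>J\<in>Q. g J))"

text \<open>\<open>ffall_Suc\<close> splits off the partitions in which the new label is given to
  one block T; the other summand is the case of an empty T.\<close>

lemma block_sum_Suc:
  assumes fin: "finite S" and f0: "f {} = 1"
  shows "block_sum f (Suc c) S = (\<Sum>T\<in>Pow S. f T * block_sum f c (S - T))"
proof -
  have "block_sum f (Suc c) S = (\<Sum>P\<in>parts S. ffall c (card P) * (\<Prod>B\<in>P. f B)) + (\<Sum>P\<in>parts S. real (card P) * ffall c (card P - 1) * (\<Prod>B\<in>P. f B))"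
    by (simp add: block_sum_def ffall_Suc distrib_right sum.distrib)
  also have "(\<Sum>P\<in>parts S. real (card P) * ffall c (card P - 1) * (\<Prod>B\<in>P. f B))
     = (\<Sum>P\<in>parts S. \<Sum>B\<in>P. f B * (ffall c (card (P - {B})) * (\<Prod>C\<in>P - {B}. f C)))"
  proof (rule sum.cong[OF refl])
    fix P assume P: "P \<in> parts S"
    have fP: "finite P" by (rule parts_finite_element[OF fin P])
    have "(\<Sum>B\<in>P. f B * (ffall c (card (P - {B})) * (\<Prod>C\<in>P - {B}. f C))) = (\<Sum>B\<in>P. ffall c (card P - 1) * (\<Prod>B\<in>P. f B))"
    proof (rule sum.cong[OF refl])
      fix B assume B: "B \<in> P"
      have "(\<Prod>B\<in>P. f B) = f B * (\<Prod>C\<in>P - {B}. f C)" by (rule prod.remove[OF fP B])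
      moreover have "card (P - {B}) = card P - 1" using fP B by simp
      ultimately show "f B * (ffall c (card (P - {B})) * (\<Prod>C\<in>P - {B}. f C)) = ffall c (card P - 1) * (\<Prod>B\<in>P. f B)" by simp
    qed
    then show "real (card P) * ffall c (card P - 1) * (\<Prod>B\<in>P. f B) = (\<Sum>B\<in>P. f B * (ffall c (card (P - {B})) * (\<Prod>C\<in>P - {B}. f C)))" by simp
  qed
  also have "\<dots> = (\<Sum>(P, B)\<in>(SIGMA P:parts S. P). f B * (ffall c (card (P - {B})) * (\<Prod>C\<in>P - {B}. f C)))"
    using finite_parts[OF fin] parts_finite_element[OF fin] by (subst sum.Sigma) auto
  also have "\<dots> = (\<Sum>(T, P')\<in>(SIGMA T:Pow S - {{}}. parts (S - T)). f T * (ffall c (card P') * (\<Prod>C\<in>P'. f C)))"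
  proof (rule sum.reindex_bij_witness[where i = "\<lambda>(T, P'). (insert T P', T)" and j = "\<lambda>(P, B). (B, P - {B})"])
    fix p assume "p \<in> (SIGMA P:parts S. P)"
    then obtain P B where p: "p = (P, B)" "partition_on S P" "B \<in> P" by (auto simp: parts_def)
    have disj: "C \<inter> B = {}" if "C \<in> P - {B}" for C
      using partition_onD2[OF p(2)] p(3) that by (auto simp: disjoint_def)
    have U: "\<Union>P = S" using partition_onD1[OF p(2)] by simp
    show "(case (case p of (P, B) \<Rightarrow> (B, P - {B})) of (T, P') \<Rightarrow> (insert T P', T)) = p" using p by auto
    have "partition_on (S - B) (P - {B})"
    proof (rule partition_onI)
      show "\<Union>(P - {B}) = S - B" using U p(3) disj by blast
      show "disjnt C D" if "C \<in> P - {B}" "D \<in> P - {B}" "C \<noteq> D" for C D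
        using partition_onD2[OF p(2)] that by (auto simp: disjoint_def disjnt_def)
    qed (use partition_onD3[OF p(2)] in auto)
    moreover have "B \<subseteq> S" "B \<noteq> {}" using U p(3) partition_onD3[OF p(2)] by auto
    ultimately show "(case p of (P, B) \<Rightarrow> (B, P - {B})) \<in> (SIGMA T:Pow S - {{}}. parts (S - T))" by (simp add: p(1) parts_def)
    show "(case (case p of (P, B) \<Rightarrow> (B, P - {B})) of (T, P') \<Rightarrow> f T * (ffall c (card P') * (\<Prod>C\<in>P'. f C))) =
        (case p of (P, B) \<Rightarrow> f B * (ffall c (card (P - {B})) * (\<Prod>C\<in>P - {B}. f C)))" by (simp add: p(1))
  next
    fix p assume "p \<in> (SIGMA T:Pow S - {{}}. parts (S - T))"
    then obtain T P' where p: "p = (T, P')" "T \<subseteq> S" "T \<noteq> {}" "partition_on (S - T) P'" by (auto simp: parts_def)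
    have U: "\<Union>P' = S - T" using partition_onD1[OF p(4)] by simp
    have TP: "T \<notin> P'" using U p(3) by blast
    show "(case (case p of (T, P') \<Rightarrow> (insert T P', T)) of (P, B) \<Rightarrow> (B, P - {B})) = p" using p TP by auto
    have "partition_on S (insert T P')"
    proof (rule partition_onI)
      show "\<Union>(insert T P') = S" using U p(2) by auto
      show "disjnt C D" if "C \<in> insert T P'" "D \<in> insert T P'" "C \<noteq> D" for C D
        using partition_onD2[OF p(4)] that U by (auto simp: disjoint_def disjnt_def)
    qed (use partition_onD3[OF p(4)] p(3) in auto)
    then show "(case p of (T, P') \<Rightarrow> (insert T P', T)) \<in> (SIGMA P:parts S. P)" by (simp add: p(1) parts_def)
  qed
  also have "\<dots> = (\<Sum>T\<in>Pow S - {{}}. f T * block_sum f c (S - T))"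
  proof -
    have "(\<Sum>(T, P')\<in>(SIGMA T:Pow S - {{}}. parts (S - T)). f T * (ffall c (card P') * (\<Prod>C\<in>P'. f C)))
      = (\<Sum>T\<in>Pow S - {{}}. \<Sum>P'\<in>parts (S - T). f T * (ffall c (card P') * (\<Prod>C\<in>P'. f C)))"
      using fin finite_parts by (subst sum.Sigma) auto
    then show ?thesis by (simp add: block_sum_def sum_distrib_left)
  qed
  also have "(\<Sum>P\<in>parts S. ffall c (card P) * (\<Prod>B\<in>P. f B)) = f {} * block_sum f c (S - {})"
    by (simp add: f0 block_sum_def)
  also have "f {} * block_sum f c (S - {}) + (\<Sum>T\<in>Pow S - {{}}. f T * block_sum f c (S - T)) = (\<Sum>T\<in>Pow S. f T * block_sum f c (S - T))"
    using sum.remove[of "Pow S" "{}" "\<lambda>T. f T * block_sum f c (S - T)"] fin by simp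
  finally show ?thesis .
qed

text \<open>Choosing a subfamily A of a partition of S amounts to choosing T = union of A together
  with partitions of T and of S - T. For a fixed partition the sum over A is
  \<open>hurwitz_convolution\<close> with weights - card J.\<close>

lemma hz_sum_convolution:
  assumes fin: "finite S"
  shows "hz_sum g (x + y) S = (\<Sum>T\<in>Pow S. hz_sum g x T * hz_sum g y (S - T))"
proof -
  define w where "w = (\<lambda>J :: 'a set. - real (card J))"
  have "hz_sum g (x + y) S = (\<Sum>Q\<in>parts S. \<Sum>A\<in>Pow Q. hz w x A * (\<Prod>J\<in>A. g J) * (hz w y (Q - A) * (\<Prod>J\<in>Q - A. g J)))"
    unfolding hz_sum_def w_def[symmetric]
  proof (rule sum.cong[OF refl])
    fix Q assume Q: "Q \<in> parts S"
    have fQ: "finite Q" by (rule parts_finite_element[OF fin Q])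
    have "(\<Sum>A\<in>Pow Q. hz w x A * (\<Prod>J\<in>A. g J) * (hz w y (Q - A) * (\<Prod>J\<in>Q - A. g J))) = (\<Sum>A\<in>Pow Q. hz w x A * hz w y (Q - A) * (\<Prod>J\<in>Q. g J))"
    proof (rule sum.cong[OF refl])
      fix A assume "A \<in> Pow Q"
      then have "(\<Prod>J\<in>Q. g J) = (\<Prod>J\<in>Q - A. g J) * (\<Prod>J\<in>A. g J)" using fQ by (intro prod.subset_diff) auto
      then show "hz w x A * (\<Prod>J\<in>A. g J) * (hz w y (Q - A) * (\<Prod>J\<in>Q - A. g J)) = hz w x A * hz w y (Q - A) * (\<Prod>J\<in>Q. g J)" by simp
    qed
    also have "\<dots> = hz w (x + y) Q * (\<Prod>J\<in>Q. g J)"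
      by (simp add: hurwitz_convolution[OF fQ] flip: sum_distrib_right)
    finally show "hz w (x + y) Q * (\<Prod>J\<in>Q. g J) = (\<Sum>A\<in>Pow Q. hz w x A * (\<Prod>J\<in>A. g J) * (hz w y (Q - A) * (\<Prod>J\<in>Q - A. g J)))" by simp
  qed
  also have "\<dots> = (\<Sum>(Q, A)\<in>(SIGMA Q:parts S. Pow Q). hz w x A * (\<Prod>J\<in>A. g J) * (hz w y (Q - A) * (\<Prod>J\<in>Q - A. g J)))"
    using finite_parts[OF fin] parts_finite_element[OF fin] by (subst sum.Sigma) auto
  also have "\<dots> = (\<Sum>(T, A, C)\<in>(SIGMA T:Pow S. parts T \<times> parts (S - T)). hz w x A * (\<Prod>J\<in>A. g J) * (hz w y C * (\<Prod>J\<in>C. g J)))"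
  proof (rule sum.reindex_bij_witness[where i = "\<lambda>(T, A, C). (A \<union> C, A)" and j = "\<lambda>(Q, A). (\<Union>A, A, Q - A)"])
    fix p assume "p \<in> (SIGMA Q:parts S. Pow Q)"
    then obtain Q A where p: "p = (Q, A)" "partition_on S Q" "A \<subseteq> Q" by (auto simp: parts_def)
    have U: "\<Union>Q = S" using partition_onD1[OF p(2)] by simp
    have dj: "C \<inter> D = {}" if "C \<in> Q" "D \<in> Q" "C \<noteq> D" for C D
      using partition_onD2[OF p(2)] that by (auto simp: disjoint_def)
    show "(case (case p of (Q, A) \<Rightarrow> (\<Union>A, A, Q - A)) of (T, A, C) \<Rightarrow> (A \<union> C, A)) = p" using p by auto
    have "partition_on (\<Union>A) A"
    proof (rule partition_onI)
      show "disjnt C D" if "C \<in> A" "D \<in> A" "C \<noteq> D" for C D using dj p(3) that by (auto simp: disjnt_def)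
    qed (use partition_onD3[OF p(2)] p(3) in auto)
    moreover have "partition_on (S - \<Union>A) (Q - A)"
    proof (rule partition_onI)
      show "\<Union>(Q - A) = S - \<Union>A"
      proof
        show "\<Union>(Q - A) \<subseteq> S - \<Union>A"
        proof
          fix y assume "y \<in> \<Union>(Q - A)"
          then obtain C where C: "C \<in> Q" "C \<notin> A" "y \<in> C" by blast
          have "y \<notin> D" if "D \<in> A" for D
          proof -
            have "C \<inter> D = {}" by (rule dj) (use C that p(3) in auto)
            then show ?thesis using C(3) by blast
          qed
          then show "y \<in> S - \<Union>A" using C U by blast
        qed
        show "S - \<Union>A \<subseteq> \<Union>(Q - A)" using U by blast
      qed
      show "disjnt C D" if "C \<in> Q - A" "D \<in> Q - A" "C \<noteq> D" for C D using dj that by (auto simp: disjnt_def)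
    qed (use partition_onD3[OF p(2)] in auto)
    moreover have "\<Union>A \<subseteq> S" using U p(3) by blast
    ultimately show "(case p of (Q, A) \<Rightarrow> (\<Union>A, A, Q - A)) \<in> (SIGMA T:Pow S. parts T \<times> parts (S - T))" by (simp add: p(1) parts_def)
    show "(case (case p of (Q, A) \<Rightarrow> (\<Union>A, A, Q - A)) of (T, A, C) \<Rightarrow> hz w x A * (\<Prod>J\<in>A. g J) * (hz w y C * (\<Prod>J\<in>C. g J))) =
      (case p of (Q, A) \<Rightarrow> hz w x A * (\<Prod>J\<in>A. g J) * (hz w y (Q - A) * (\<Prod>J\<in>Q - A. g J)))" by (simp add: p(1))
  next
    fix p assume "p \<in> (SIGMA T:Pow S. parts T \<times> parts (S - T))"
    then obtain T A C where p: "p = (T, A, C)" "T \<subseteq> S" "partition_on T A" "partition_on (S - T) C" by (auto simp: parts_def)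
    have U: "\<Union>A = T" "\<Union>C = S - T" using partition_onD1[OF p(3)] partition_onD1[OF p(4)] by simp_all
    have ne: "{} \<notin> A" "{} \<notin> C" using partition_onD3[OF p(3)] partition_onD3[OF p(4)] by simp_all
    have AC: "A \<inter> C = {}"
    proof (rule ccontr)
      assume "A \<inter> C \<noteq> {}"
      then obtain D where D: "D \<in> A" "D \<in> C" by blast
      then have "D \<subseteq> T" "D \<subseteq> S - T" using U by auto
      then have "D = {}" by blast
      then show False using ne D by simp
    qed
    then show "(case (case p of (T, A, C) \<Rightarrow> (A \<union> C, A)) of (Q, A) \<Rightarrow> (\<Union>A, A, Q - A)) = p" using p U by auto
    have "partition_on S (A \<union> C)"
    proof (rule partition_onI)
      show "\<Union>(A \<union> C) = S" using U p(2) by auto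
      show "disjnt D E" if DE: "D \<in> A \<union> C" "E \<in> A \<union> C" "D \<noteq> E" for D E
      proof -
        have AT: "X \<subseteq> T" if "X \<in> A" for X using U that by blast
        have CT: "X \<subseteq> S - T" if "X \<in> C" for X using U that by blast
        consider "D \<in> A" "E \<in> A" | "D \<in> C" "E \<in> C" | "D \<in> A" "E \<in> C" | "D \<in> C" "E \<in> A" using DE by blast
        then show ?thesis
        proof cases
          case 1 then show ?thesis using partition_onD2[OF p(3)] DE(3) by (simp add: disjoint_def disjnt_def)
        next
          case 2 then show ?thesis using partition_onD2[OF p(4)] DE(3) by (simp add: disjoint_def disjnt_def)
        next
          case 3 then show ?thesis using AT[of D] CT[of E] by (auto simp: disjnt_def)
        next
          case 4 then show ?thesis using AT[of E] CT[of D] by (auto simp: disjnt_def)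
        qed
      qed
    qed (use ne in auto)
    then show "(case p of (T, A, C) \<Rightarrow> (A \<union> C, A)) \<in> (SIGMA Q:parts S. Pow Q)" by (simp add: p(1) parts_def)
  qed
  also have "\<dots> = (\<Sum>T\<in>Pow S. \<Sum>(A, C)\<in>parts T \<times> parts (S - T). hz w x A * (\<Prod>J\<in>A. g J) * (hz w y C * (\<Prod>J\<in>C. g J)))"
  proof -
    have "finite (parts T \<times> parts (S - T))" if "T \<in> Pow S" for T
      using that fin finite_subset[of T S] by (intro finite_cartesian_product finite_parts) auto
    then show ?thesis using fin by (subst sum.Sigma) auto
  qed
  also have "\<dots> = (\<Sum>T\<in>Pow S. hz_sum g x T * hz_sum g y (S - T))"
    unfolding hz_sum_def w_def[symmetric] by (rule sum.cong[OF refl]) (simp add: sum_product sum.cartesian_product)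
  finally show ?thesis .
qed

text \<open>Both sides satisfy the same recursion in c, one by definition of powers, the other by
  \<open>hz_sum_convolution\<close>; at c = 0 only the empty partition contributes.\<close>

lemma block_sum_hz_sum:
  assumes "finite S"
  shows "block_sum (hz_sum g 1) c S = hz_sum g (real c) S"
  using assms
proof (induction c arbitrary: S)
  case 0
  have "ffall 0 (card P) = hz (\<lambda>J. - real (card J)) 0 P" if "P \<in> parts S" for P
  proof (cases "P = {}")
    case True
    then show ?thesis by (simp add: ffall_def hz_def)
  next
    case False
    then have "card P > 0" using parts_finite_element[OF 0 that] by (simp add: card_gt_0_iff)
    then have "ffall 0 (card P) = 0" unfolding ffall_def by (intro prod_zero) auto
    then show ?thesis using False by (simp add: hz_def)
  qed
  moreover have "(\<Prod>B\<in>P. hz_sum g 1 B) = (\<Prod>B\<in>P. g B)" if "P = {}" for P using that by simp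
  ultimately show ?case
    unfolding block_sum_def hz_sum_def[of g "real 0"]
    by (intro sum.cong refl) (auto simp: hz_def)
next
  case (Suc c)
  have h0: "hz_sum g 1 {} = 1" by (simp add: hz_sum_def hz_def)
  have "block_sum (hz_sum g 1) (Suc c) S = (\<Sum>T\<in>Pow S. hz_sum g 1 T * block_sum (hz_sum g 1) c (S - T))"
    by (rule block_sum_Suc[OF Suc.prems]) (rule h0)
  also have "\<dots> = (\<Sum>T\<in>Pow S. hz_sum g 1 T * hz_sum g (real c) (S - T))"
    using Suc by (intro sum.cong refl) simp
  also have "\<dots> = hz_sum g (1 + real c) S" by (rule hz_sum_convolution[OF Suc.prems, symmetric])
  finally show ?case by (simp add: add.commute)
qed

text \<open>At c = card S the base c minus the sum of block sizes is zero, so only the partition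
  with exponent zero, the one block S, survives.\<close>

lemma hz_sum_full:
  assumes fin: "finite S" and ne: "S \<noteq> {}"
  shows "hz_sum g (real (card S)) S = real (card S) * g S"
proof -
  define w where "w = (\<lambda>J :: 'a set. - real (card J))"
  have wQ: "(\<Sum>J\<in>Q. w J) = - real (card S)" if Q: "Q \<in> parts S" for Q
  proof -
    have "real (card S) = (\<Sum>i\<in>S. 1)" by simp
    also have "\<dots> = (\<Sum>J\<in>Q. \<Sum>i\<in>J. (1 :: real))"
    proof -
      have p: "partition_on S Q" using Q by (simp add: parts_def)
      have "\<forall>A\<in>Q. \<forall>B\<in>Q. A \<noteq> B \<longrightarrow> A \<inter> B = {}" using partition_onD2[OF p] by (simp add: disjoint_def)
      moreover have "\<forall>B\<in>Q. finite B"
      proof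
        fix B assume "B \<in> Q"
        then have "B \<subseteq> S" using partition_onD1[OF p] by auto
        then show "finite B" by (rule finite_subset[OF _ fin])
      qed
      ultimately have "sum (\<lambda>_. 1 :: real) (\<Union>Q) = (sum \<circ> sum) (\<lambda>_. 1) Q" by (intro sum.Union_disjoint)
      then show ?thesis by (simp add: partition_onD1[OF p, symmetric])
    qed
    finally show ?thesis by (simp add: w_def sum_negf)
  qed
  have "hz_sum g (real (card S)) S = (\<Sum>Q\<in>parts S. if Q = {S} then real (card S) * g S else 0)"
    unfolding hz_sum_def w_def[symmetric]
  proof (rule sum.cong[OF refl])
    fix Q assume Q: "Q \<in> parts S"
    have Qne: "Q \<noteq> {}" using Q ne by (auto simp: parts_def partition_on_def)
    have fQ: "finite Q" by (rule parts_finite_element[OF fin Q])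
    show "hz w (real (card S)) Q * (\<Prod>J\<in>Q. g J) = (if Q = {S} then real (card S) * g S else 0)"
    proof (cases "Q = {S}")
      case True
      then show ?thesis by (simp add: hz_def)
    next
      case False
      have "card Q \<noteq> 1"
      proof
        assume "card Q = 1"
        then obtain B where "Q = {B}" by (auto simp: card_1_singleton_iff)
        then show False using False Q by (auto simp: parts_def partition_on_def)
      qed
      moreover have "card Q > 0" using Qne fQ by (simp add: card_gt_0_iff)
      ultimately have "card Q - 1 > 0" by linarith
      then have "hz w (real (card S)) Q = 0" using Qne wQ[OF Q] by (simp add: hz_def)
      then show ?thesis using False by simp
    qed
  qed
  also have "\<dots> = real (card S) * g S"
  proof -
    have "{S} \<in> parts S" using ne by (auto simp: parts_def partition_on_def)
    then show ?thesis using finite_parts[OF fin] by simp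
  qed
  finally show ?thesis .
qed

section \<open>The nonresonant count and the partition relation\<close>

definition nonresonant :: "'a set \<Rightarrow> ('a \<Rightarrow> complex) \<Rightarrow> bool" where
  "nonresonant S m \<longleftrightarrow> (\<forall>J. J \<subset> S \<longrightarrow> J \<noteq> {} \<longrightarrow> (\<Sum>i\<in>J. m i) \<noteq> 0)"

lemma nonresonantD: "nonresonant S m \<Longrightarrow> J \<subset> S \<Longrightarrow> J \<noteq> {} \<Longrightarrow> (\<Sum>i\<in>J. m i) \<noteq> 0"
  unfolding nonresonant_def by blast

lemma nonresonant_nonzero:
  assumes "nonresonant S m" "card S \<ge> 2" "i \<in> S"
  shows "m i \<noteq> 0"
proof -
  have "{i} \<noteq> S" using assms(2) by auto
  then have "{i} \<subset> S" using assms(3) by blast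
  then show ?thesis using nonresonantD[OF assms(1), of "{i}"] by simp
qed

lemma zsp_nonresonant:
  assumes "nonresonant S m" "(\<Sum>i\<in>S. m i) = 0" "S \<noteq> {}"
  shows "zsp S m = {{S}}"
proof -
  have "P = {S}" if P: "P \<in> zsp S m" for P
  proof -
    have p: "partition_on S P" "\<And>B. B \<in> P \<Longrightarrow> (\<Sum>i\<in>B. m i) = 0" using P by (auto simp: zsp_def)
    have "B = S" if B: "B \<in> P" for B
    proof (rule ccontr)
      assume "B \<noteq> S"
      then have "B \<subset> S" "B \<noteq> {}" using p(1) B by (auto simp: partition_on_def)
      then show False using p(2)[OF B] nonresonantD[OF assms(1)] by simp
    qed
    moreover have "P \<noteq> {}" using p(1) assms(3) by (auto simp: partition_on_def)
    ultimately show ?thesis by blast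
  qed
  moreover have "{S} \<in> zsp S m" using assms(2,3) by (auto simp: zsp_def partition_on_def)
  ultimately show ?thesis by blast
qed

lemma residue_pole_power_eq_0: "n \<ge> 2 \<Longrightarrow> residue (\<lambda>z. inverse (z - a) ^ n) a = 0"
  using residue_inverse_power[of 1 a n] by (simp add: inverse_eq_divide power_divide)

text \<open>Centering puts the single cluster at 0, where a pole of order at least 2 has residue 0,
  as prescribed.\<close>

lemma glob_singleton:
  assumes "n \<ge> 2" "s U = n" "\<rho> U = 0"
  shows "card (glob {U} s \<rho>) = 1"
proof -
  have "glob {U} s \<rho> = {\<lambda>u\<in>{U}. 0}"
  proof
    show "glob {U} s \<rho> \<subseteq> {\<lambda>u\<in>{U}. 0}"
    proof
      fix \<eta> assume e: "\<eta> \<in> glob {U} s \<rho>"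
      then have "\<eta> U = 0" using assms by (auto simp: glob_def)
      then show "\<eta> \<in> {\<lambda>u\<in>{U}. 0}" using e by (auto simp: glob_def PiE_def extensional_def fun_eq_iff)
    qed
    show "{\<lambda>u\<in>{U}. 0} \<subseteq> glob {U} s \<rho>"
      using residue_pole_power_eq_0[OF assms(1), of 0] assms by (auto simp: glob_def)
  qed
  then show ?thesis by simp
qed

context perturbation
begin

lemma card_sol_at: "t > 0 \<Longrightarrow> card (sol_at t) = card (sols S (\<lambda>i. m i + of_real t * r i))"
  using sols_scale_card(1)[OF finS card2, of "1 / of_real t" "\<lambda>i. m i + of_real t * r i"] by (simp add: sol_at_sols)

lemma card_sols_near:
  assumes "finite limits"
  shows "\<forall>\<^sub>F t in at_right 0. card (sols S (\<lambda>i. m i + of_real t * r i)) = card limits"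
  using solutions_count[OF assms] eventually_at_right_less[of 0] by eventually_elim (simp add: card_sol_at)

text \<open>An infinite set of limits would produce more than N solutions for all small t. The
  condition N > 0 excludes that N is the conventional cardinality of an infinite set.\<close>

lemma card_limits_if_frequently:
  assumes N: "N > 0" and fr: "\<exists>\<^sub>F t in at_right 0. card (sols S (\<lambda>i. m i + of_real t * r i)) = N"
  shows "finite limits \<and> card limits = N"
proof -
  have fin: "finite limits"
  proof (rule ccontr)
    assume "infinite limits"
    then obtain F where F: "finite F" "card F = Suc N" "F \<subseteq> limits" using infinite_arbitrarily_large by blast
    have "\<forall>\<^sub>F t in at_right 0. card (sols S (\<lambda>i. m i + of_real t * r i)) \<noteq> N"
      using solutions_at_least[OF F(1,3)] eventually_at_right_less[of 0]
    proof eventually_elim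
      case (elim t)
      then obtain G where G: "G \<subseteq> sol_at t" "card G = Suc N" using F(2) by auto
      show ?case
      proof
        assume "card (sols S (\<lambda>i. m i + of_real t * r i)) = N"
        then have c: "card (sol_at t) = N" using card_sol_at elim(2) by simp
        then have "finite (sol_at t)" using N by (metis card.infinite less_irrefl)
        from card_mono[OF this G(1)] show False using c G(2) by simp
      qed
    qed
    then show False using fr by (simp add: frequently_def)
  qed
  from frequently_eventually_frequently[OF fr card_sols_near[OF fin]] have "card limits = N"
    by (auto dest: frequently_ex)
  then show ?thesis using fin by simp
qed

text \<open>Without proper zero-sum subsets the only cluster partition is the trivial one and its
  center is forced, so limits are just solutions for m.\<close>

lemma limits_nonresonant:
  assumes nr: "nonresonant S m"
  shows "limits = {{S}} \<times> {v. ({S}, v) \<in> limits}" "card {v. ({S}, v) \<in> limits} = card (sols S m)"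
proof -
  have S: "S \<noteq> {}" using card2 by auto
  have z: "zsp S m = {{S}}" by (rule zsp_nonresonant[OF nr sm S])
  then show "limits = {{S}} \<times> {v. ({S}, v) \<in> limits}" by (auto simp: limits_def)
  have "card (glob {S} card (\<lambda>B. \<Sum>i\<in>B. r i)) = 1" by (rule glob_singleton[OF card2]) (simp_all add: sr)
  then show "card {v. ({S}, v) \<in> limits} = card (sols S m)" using card_limits_fibre[of "{S}"] z by simp
qed

text \<open>Every centered solution for m itself is a one-block limit.\<close>

lemma finite_sols_if_finite_limits:
  assumes fin: "finite limits"
  shows "finite (sols S m)"
proof -
  have S: "S \<noteq> {}" using card2 by auto
  have P: "{S} \<in> zsp S m" using sm S by (auto simp: zsp_def partition_on_def)
  have "({S}, v) \<in> limits" if v: "v \<in> sols S m" for v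
  proof -
    have vE: "v \<in> S \<rightarrow>\<^sub>E UNIV" and v0: "(\<Sum>i\<in>S. v i) = 0" using v by (simp_all add: sols_def)
    have a0: "avg S v = 0" using v0 by (simp add: avg_def)
    define \<eta> where "\<eta> = (\<lambda>B\<in>{S}. avg B v)"
    have "({S}, v) \<in> limits \<longleftrightarrow> \<eta> \<in> glob {S} card (\<lambda>B. \<Sum>i\<in>B. r i) \<and>
        (\<forall>B\<in>{S}. (\<lambda>i\<in>B. 1 * (v i - avg B v)) \<in> sols B m)"
      by (rule limits_iff[OF P vE \<eta>_def]) simp_all
    moreover have "(\<lambda>i\<in>S. 1 * (v i - avg S v)) = v" using vE a0 by (auto simp: fun_eq_iff PiE_def extensional_def)
    moreover have "\<eta> \<in> glob {S} card (\<lambda>B. \<Sum>i\<in>B. r i)"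
      using residue_pole_power_eq_0[OF card2, of 0] a0 sr by (simp add: glob_def \<eta>_def)
    ultimately show ?thesis using v by simp
  qed
  then have "sols S m \<subseteq> snd ` limits" by force
  then show ?thesis by (rule finite_subset) (rule finite_imageI[OF fin])
qed

text \<open>Openness: at a nonresonant point a positive finite count persists in direction
  r.\<close>

lemma card_sols_nonresonant_near:
  assumes nr: "nonresonant S m" and N: "N > 0" and c: "card (sols S m) = N"
  shows "\<forall>\<^sub>F t in at_right 0. card (sols S (\<lambda>i. m i + of_real t * r i)) = N"
proof -
  have "finite {v. ({S}, v) \<in> limits}" using limits_nonresonant(2)[OF nr] c N by (metis card.infinite less_irrefl)
  then have fin: "finite limits" by (subst limits_nonresonant(1)[OF nr]) simp
  have "card limits = N"
    by (subst limits_nonresonant(1)[OF nr]) (simp add: card_cartesian_product limits_nonresonant(2)[OF nr] c)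
  then show ?thesis using card_sols_near[OF fin] by simp
qed

text \<open>Closedness: a count attained arbitrarily close by is attained at the nonresonant point
  as well.\<close>

lemma card_sols_nonresonant_limit:
  assumes nr: "nonresonant S m" and N: "N > 0"
    and fr: "\<exists>\<^sub>F t in at_right 0. card (sols S (\<lambda>i. m i + of_real t * r i)) = N"
  shows "card (sols S m) = N"
proof -
  have "card limits = card {v. ({S}, v) \<in> limits}"
    by (subst limits_nonresonant(1)[OF nr]) (simp add: card_cartesian_product)
  then show ?thesis using card_limits_if_frequently[OF N fr] limits_nonresonant(2)[OF nr] by simp
qed

end

lemma perturbation_nonresonant:
  assumes "finite S" "card S \<ge> 2" "nonresonant S m" "(\<Sum>i\<in>S. m i) = 0" "(\<Sum>i\<in>S. r i) = 0"
  shows "perturbation S m r"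
proof
  show "m i \<noteq> 0" if "i \<in> S" for i by (rule nonresonant_nonzero[OF assms(3,2) that])
  show "(\<Sum>i\<in>J. r i) \<noteq> 0" if "J \<subset> S" "J \<noteq> {}" "(\<Sum>i\<in>J. m i) = 0" for J
    using nonresonantD[OF assms(3) that(1,2)] that(3) by contradiction
qed (fact assms)+

text \<open>A connectedness argument on the segment, run from the end with known count down to m,
  with openness and closedness in the two directions.\<close>

lemma card_sols_path:
  fixes m e :: "'a \<Rightarrow> complex"
  defines "p \<equiv> \<lambda>s i. of_real (1 - s) * m i + of_real s * e i"
  assumes fin: "finite S" and c2: "card S \<ge> 2"
    and sm: "(\<Sum>i\<in>S. m i) = 0" and se: "(\<Sum>i\<in>S. e i) = 0"
    and nr: "\<And>s. 0 \<le> s \<Longrightarrow> s \<le> 1 \<Longrightarrow> nonresonant S (p s)"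
    and N: "N > 0" and end1: "card (sols S e) = N"
  shows "card (sols S m) = N"
proof -
  have sp: "(\<Sum>i\<in>S. p s i) = 0" for s by (simp add: p_def sum.distrib sm se flip: sum_distrib_left)
  have R: "perturbation S (p s) (\<lambda>i. e i - m i)" "perturbation S (p s) (\<lambda>i. m i - e i)" if "0 \<le> s" "s \<le> 1" for s
    by (rule perturbation_nonresonant[OF fin c2 nr sp]; use that in \<open>simp add: sum_subtractf sm se\<close>)+
  have pr: "(\<lambda>i. p s i + of_real t * (e i - m i)) = p (s + t)" for s t by (simp add: p_def fun_eq_iff algebra_simps)
  have pl: "(\<lambda>i. p s i + of_real t * (m i - e i)) = p (s - t)" for s t by (simp add: p_def fun_eq_iff algebra_simps)
  define A where "A = {s \<in> {0..1}. card (sols S (p s)) = N}"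
  have "p 1 = e" by (simp add: p_def fun_eq_iff)
  then have A1: "1 \<in> A" using end1 by (simp add: A_def)
  have bdd: "bdd_below A" by (rule bdd_belowI[of _ 0]) (simp add: A_def)
  \<comment> \<open>The infimum belongs to \<open>A\<close> by closedness from the right; if it were
    positive, openness to the left would give a smaller element.\<close>
  define s0 where "s0 = Inf A"
  have s01: "0 \<le> s0" "s0 \<le> 1"
  proof -
    have ne: "A \<noteq> {}" using A1 by blast
    have "0 \<le> x" if "x \<in> A" for x using that by (simp add: A_def)
    then show "0 \<le> s0" unfolding s0_def by (rule cInf_greatest[OF ne])
    show "s0 \<le> 1" unfolding s0_def by (rule cInf_lower[OF A1 bdd])
  qed
  have s0A: "card (sols S (p s0)) = N"
  proof (rule ccontr)
    assume n: "card (sols S (p s0)) \<noteq> N"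
    have "\<exists>\<^sub>F t in at_right 0. card (sols S (p (s0 + t))) = N"
      unfolding frequently_def eventually_at_right_field
    proof
      assume "\<exists>b>0. \<forall>y>0. y < b \<longrightarrow> card (sols S (p (s0 + y))) \<noteq> N"
      then obtain b where b: "b > 0" "\<And>y. y > 0 \<Longrightarrow> y < b \<Longrightarrow> card (sols S (p (s0 + y))) \<noteq> N" by blast
      have "Inf A < s0 + b" using b(1) by (simp add: s0_def)
      then obtain a where a: "a \<in> A" "a < s0 + b" using cInf_less_iff[of A "s0 + b"] A1 bdd by blast
      have "a \<noteq> s0" using a(1) n by (auto simp: A_def)
      moreover have "s0 \<le> a" unfolding s0_def by (rule cInf_lower[OF a(1) bdd])
      ultimately have "card (sols S (p (s0 + (a - s0)))) \<noteq> N" using a(2) by (intro b(2)) auto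
      then show False using a(1) by (simp add: A_def)
    qed
    then have "card (sols S (p s0)) = N"
      using perturbation.card_sols_nonresonant_limit[OF R(1)[OF s01] nr[OF s01] N] by (simp add: pr)
    then show False using n by simp
  qed
  have "s0 = 0"
  proof (rule ccontr)
    assume "s0 \<noteq> 0"
    then have pos: "0 < s0" using s01 by simp
    have "\<forall>\<^sub>F t in at_right 0. card (sols S (p (s0 - t))) = N"
      using perturbation.card_sols_nonresonant_near[OF R(2)[OF s01] nr[OF s01] N s0A] by (simp add: pl)
    then obtain b where b: "b > 0" "\<And>y. y > 0 \<Longrightarrow> y < b \<Longrightarrow> card (sols S (p (s0 - y))) = N"
      unfolding eventually_at_right_field by blast
    define y where "y = min b s0 / 2"
    have y: "y > 0" "y < b" "y < s0" using b(1) pos by (auto simp: y_def)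
    have "s0 - y \<in> A" using b(2)[OF y(1,2)] y s01 by (simp add: A_def)
    from cInf_lower[OF this bdd] show False using y(1) by (simp add: s0_def)
  qed
  then show ?thesis using s0A by (simp add: p_def)
qed

text \<open>A zero-sum vector without proper zero-sum subsets, for which
  \<open>card_sols_star\<close> gives the count. It also serves as a direction of perturbation valid
  for every m.\<close>

definition star :: "'a set \<Rightarrow> 'a \<Rightarrow> 'a \<Rightarrow> complex" where
  "star S i0 i = (if i = i0 then - of_nat (card S - 1) else 1)"

lemma sum_star_mem:
  assumes "finite J" "i0 \<in> J"
  shows "(\<Sum>i\<in>J. star S i0 i) = of_nat (card J) - 1 - of_nat (card S - 1)"
proof -
  have "(\<Sum>i\<in>J - {i0}. star S i0 i) = (\<Sum>i\<in>J - {i0}. 1)" by (rule sum.cong) (auto simp: star_def)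
  moreover have "(\<Sum>i\<in>J. star S i0 i) = star S i0 i0 + (\<Sum>i\<in>J - {i0}. star S i0 i)" by (rule sum.remove[OF assms])
  moreover have "card J = Suc (card (J - {i0}))" using assms by (metis card.remove)
  then have "(of_nat (card J) :: complex) = 1 + of_nat (card (J - {i0}))" by (metis of_nat_Suc)
  ultimately show ?thesis by (simp add: star_def)
qed

lemma sum_star_not_mem: "i0 \<notin> J \<Longrightarrow> (\<Sum>i\<in>J. star S i0 i) = of_nat (card J)"
  by (subst sum.cong[where h = "\<lambda>_. 1", OF refl]) (auto simp: star_def)

lemma sum_star:
  assumes "finite S" "i0 \<in> S"
  shows "(\<Sum>i\<in>S. star S i0 i) = 0"
proof -
  have "card S > 0" using assms by (auto simp: card_gt_0_iff)
  then show ?thesis using sum_star_mem[OF assms] by (simp add: of_nat_diff)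
qed

lemma nonresonant_star:
  assumes fin: "finite S" and i0: "i0 \<in> S"
  shows "nonresonant S (star S i0)"
  unfolding nonresonant_def
proof (intro allI impI)
  fix J assume J: "J \<subset> S" "J \<noteq> {}"
  have fJ: "finite J" using J(1) fin finite_subset by blast
  show "(\<Sum>i\<in>J. star S i0 i) \<noteq> 0"
  proof (cases "i0 \<in> J")
    case True
    have "card J < card S" by (rule psubset_card_mono[OF fin J(1)])
    then have "(of_nat (card J) :: complex) \<noteq> of_nat (card S)" by simp
    then show ?thesis using sum_star_mem[OF fJ True, of S] \<open>card J < card S\<close> by (simp add: of_nat_diff)
  next
    case False
    then show ?thesis using J(2) fJ by (simp add: sum_star_not_mem)
  qed
qed

lemma exists_generic_direction:
  fixes C :: "complex set"
  assumes "finite C" "0 \<notin> C"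
  shows "\<exists>\<gamma>. \<gamma> \<noteq> 0 \<and> (\<forall>c\<in>C. Im (\<gamma> * c) \<noteq> 0)"
proof -
  have "finite ((\<lambda>c. - Im c / Re c) ` C)" using assms(1) by simp
  \<comment> \<open>Each element of \<open>C\<close> excludes at most one slope x for the direction
    1 + i x.\<close>
  then obtain x where x: "x \<notin> (\<lambda>c. - Im c / Re c) ` C" using ex_new_if_finite[OF infinite_UNIV_char_0] by metis
  have "Im (Complex 1 x * c) \<noteq> 0" if "c \<in> C" for c
  proof
    assume z: "Im (Complex 1 x * c) = 0"
    have c0: "c \<noteq> 0" using that assms(2) by blast
    have q: "x * Re c = - Im c" using z by simp
    show False
    proof (cases "Re c = 0")
      case True
      then show ?thesis using q c0 by (simp add: complex_eq_iff)
    next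
      case False
      then have "x = - Im c / Re c" using q by (simp add: field_simps)
      then show ?thesis using x that by blast
    qed
  qed
  moreover have "Complex 1 x \<noteq> 0" by (simp add: complex_eq_iff)
  ultimately show ?thesis by blast
qed

text \<open>Join m to a complex multiple of \<open>star\<close> by a segment. A subset sum vanishes
  on the segment only if the ratio of the two end values is real and negative, which a generic
  complex multiple excludes for all subsets at once.\<close>

theorem card_sols_nonresonant:
  assumes fin: "finite S" and c2: "card S \<ge> 2" and nr: "nonresonant S m" and sm: "(\<Sum>i\<in>S. m i) = 0"
  shows "card (sols S m) = fact (card S - 1)"
proof -
  obtain i0 where i0: "i0 \<in> S" using c2 by fastforce
  define e where "e = star S i0"
  define \<J> where "\<J> = {J. J \<subset> S \<and> J \<noteq> {}}"
  have "finite \<J>" by (rule finite_subset[of _ "Pow S"]) (use fin in \<open>auto simp: \<J>_def\<close>)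
  moreover have m0: "(\<Sum>i\<in>J. m i) \<noteq> 0" if "J \<in> \<J>" for J using that nonresonantD[OF nr] by (simp add: \<J>_def)
  moreover have e0: "(\<Sum>i\<in>J. e i) \<noteq> 0" if "J \<in> \<J>" for J
    using that nonresonantD[OF nonresonant_star[OF fin i0]] by (simp add: \<J>_def e_def)
  ultimately have "finite ((\<lambda>J. (\<Sum>i\<in>J. e i) / (\<Sum>i\<in>J. m i)) ` \<J>)" "0 \<notin> (\<lambda>J. (\<Sum>i\<in>J. e i) / (\<Sum>i\<in>J. m i)) ` \<J>"
    by auto
  from exists_generic_direction[OF this] obtain \<gamma> where \<gamma>: "\<gamma> \<noteq> 0"
    "\<And>J. J \<in> \<J> \<Longrightarrow> Im (\<gamma> * ((\<Sum>i\<in>J. e i) / (\<Sum>i\<in>J. m i))) \<noteq> 0" by blast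
  show ?thesis
  proof (rule card_sols_path[OF fin c2 sm, of "\<lambda>i. \<gamma> * e i"])
    show "(\<Sum>i\<in>S. \<gamma> * e i) = 0" using sum_star[OF fin i0] by (simp add: e_def flip: sum_distrib_left)
    show "card (sols S (\<lambda>i. \<gamma> * e i)) = fact (card S - 1)"
      by (rule card_sols_star[OF fin i0 c2 \<gamma>(1)]) (simp_all add: e_def star_def)
    fix s :: real assume s: "0 \<le> s" "s \<le> 1"
    show "nonresonant S (\<lambda>i. of_real (1 - s) * m i + of_real s * (\<gamma> * e i))"
      unfolding nonresonant_def
    proof (intro allI impI notI)
      fix J assume J: "J \<subset> S" "J \<noteq> {}"
      then have JJ: "J \<in> \<J>" by (simp add: \<J>_def)
      assume "(\<Sum>i\<in>J. of_real (1 - s) * m i + of_real s * (\<gamma> * e i)) = 0"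
      then have z: "of_real (1 - s) * (\<Sum>i\<in>J. m i) + of_real s * (\<gamma> * (\<Sum>i\<in>J. e i)) = 0"
        by (simp add: sum.distrib sum_distrib_left)
      define c where "c = \<gamma> * ((\<Sum>i\<in>J. e i) / (\<Sum>i\<in>J. m i))"
      have "\<gamma> * (\<Sum>i\<in>J. e i) = c * (\<Sum>i\<in>J. m i)" using m0[OF JJ] by (simp add: c_def)
      with z have "(of_real (1 - s) + of_real s * c) * (\<Sum>i\<in>J. m i) = 0" by (simp add: algebra_simps)
      then have z2: "of_real (1 - s) + of_real s * c = 0" using m0[OF JJ] by simp
      then have "Im (of_real (1 - s) + of_real s * c) = 0" by (simp only: zero_complex.sel)
      then have "s * Im c = 0" by simp
      then have "s = 0" using \<gamma>(2)[OF JJ] by (simp add: c_def)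
      then show False using z2 by simp
    qed
  qed simp
qed

text \<open>Perturb m in direction \<open>star\<close>. For small t > 0 no proper subset sum
  vanishes, so there are (d-1)! solutions, and these are counted a second time by the limits at t =
  0. The freedom in the choice of i0 is used when the center counts are computed.\<close>

theorem zsp_relation:
  assumes fin: "finite S" and c2: "card S \<ge> 2" and m0: "\<And>i. i \<in> S \<Longrightarrow> m i \<noteq> 0" and sm: "(\<Sum>i\<in>S. m i) = 0" and i0: "i0 \<in> S"
  shows "fact (card S - 1) = (\<Sum>P\<in>zsp S m. card (glob P card (\<lambda>B. \<Sum>i\<in>B. star S i0 i)) * (\<Prod>B\<in>P. card (sols B m)))"
    "finite (sols S m)"
proof -
  interpret perturbation S m "star S i0"
  proof
    show "(\<Sum>i\<in>J. star S i0 i) \<noteq> 0" if "J \<subset> S" "J \<noteq> {}" for J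
      by (rule nonresonantD[OF nonresonant_star[OF fin i0] that])
    show "m i \<noteq> 0" if "i \<in> S" for i by (rule m0[OF that])
  qed (fact fin c2 sm sum_star[OF fin i0])+
  define \<J> where "\<J> = {J. J \<subset> S \<and> J \<noteq> {}}"
  have finJ: "finite \<J>" by (rule finite_subset[of _ "Pow S"]) (use fin in \<open>auto simp: \<J>_def\<close>)
  have "\<forall>\<^sub>F t in at_right 0. (\<Sum>i\<in>J. m i) + complex_of_real t * (\<Sum>i\<in>J. star S i0 i) \<noteq> 0" if "J \<in> \<J>" for J
  proof (cases "(\<Sum>i\<in>J. m i) = 0")
    case True
    have "(\<Sum>i\<in>J. star S i0 i) \<noteq> 0" using that nonresonantD[OF nonresonant_star[OF fin i0]] by (simp add: \<J>_def)
    then have "(\<Sum>i\<in>J. m i) + complex_of_real t * (\<Sum>i\<in>J. star S i0 i) \<noteq> 0" if "0 < t" for t using True that by simp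
    then show ?thesis by (rule eventually_mono[OF eventually_at_right_less])
  next
    case False
    have lim: "((\<lambda>t. (\<Sum>i\<in>J. m i) + complex_of_real t * (\<Sum>i\<in>J. star S i0 i)) \<longlongrightarrow> (\<Sum>i\<in>J. m i) + complex_of_real 0 * (\<Sum>i\<in>J. star S i0 i)) (at_right 0)"
      by (rule tendsto_add[OF tendsto_const tendsto_mult[OF tendsto_of_real[OF tendsto_ident_at] tendsto_const]])
    show ?thesis by (rule tendsto_imp_eventually_ne[OF lim]) (simp add: False)
  qed
  then have "\<forall>\<^sub>F t in at_right 0. \<forall>J\<in>\<J>. (\<Sum>i\<in>J. m i) + complex_of_real t * (\<Sum>i\<in>J. star S i0 i) \<noteq> 0"
    using finJ by (simp add: eventually_ball_finite_distrib)
  then have "\<forall>\<^sub>F t in at_right 0. card (sols S (\<lambda>i. m i + complex_of_real t * star S i0 i)) = fact (card S - 1)"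
  proof eventually_elim
    case (elim t)
    then have "nonresonant S (\<lambda>i. m i + complex_of_real t * star S i0 i)"
      by (simp add: nonresonant_def \<J>_def sum.distrib sum_distrib_left)
    moreover have "(\<Sum>i\<in>S. m i + complex_of_real t * star S i0 i) = 0"
      by (simp add: sum.distrib sm sr flip: sum_distrib_left)
    ultimately show ?case by (rule card_sols_nonresonant[OF fin c2])
  qed
  then have "\<exists>\<^sub>F t in at_right 0. card (sols S (\<lambda>i. m i + complex_of_real t * star S i0 i)) = fact (card S - 1)"
    by (intro eventually_frequently) simp_all
  from card_limits_if_frequently[OF _ this] have "finite limits" "card limits = fact (card S - 1)" by simp_all
  then show "fact (card S - 1) = (\<Sum>P\<in>zsp S m. card (glob P card (\<lambda>B. \<Sum>i\<in>B. star S i0 i)) * (\<Prod>B\<in>P. card (sols B m)))"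
    "finite (sols S m)" using card_limits finite_sols_if_finite_limits by simp_all
qed

section \<open>The number of center configurations\<close>

text \<open>The center problem depends only on multiplicities and prescribed residues, so it can be
  compared between different partitions through a common index set.\<close>

lemma glob_reindex:
  assumes bij: "bij_betw f T P" and s: "\<And>b. b \<in> T \<Longrightarrow> s (f b) = s' b" and \<rho>: "\<And>b. b \<in> T \<Longrightarrow> \<rho> (f b) = \<rho>' b"
  shows "card (glob P s \<rho>) = card (glob T s' \<rho>')"
proof -
  define F where "F \<eta> = (\<lambda>b\<in>T. \<eta> (f b))" for \<eta> :: "'b \<Rightarrow> complex"
  define G where "G \<zeta> = (\<lambda>B\<in>P. \<zeta> (inv_into T f B))" for \<zeta> :: "'a \<Rightarrow> complex"
  have inj: "inj_on f T" and im: "f ` T = P" using bij by (auto simp: bij_betw_def)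
  have Ff: "F \<eta> b = \<eta> (f b)" if "b \<in> T" for \<eta> b using that by (simp add: F_def)
  have key: "\<eta> \<in> glob P s \<rho> \<longleftrightarrow> F \<eta> \<in> glob T s' \<rho>'" if \<eta>: "\<eta> \<in> P \<rightarrow>\<^sub>E UNIV" for \<eta>
  proof -
    have "inj_on \<eta> P \<longleftrightarrow> inj_on (\<eta> \<circ> f) T" unfolding im[symmetric] by (rule comp_inj_on_iff[OF inj])
    also have "\<dots> \<longleftrightarrow> inj_on (F \<eta>) T" by (rule inj_on_cong) (simp add: Ff)
    finally have 1: "inj_on \<eta> P \<longleftrightarrow> inj_on (F \<eta>) T" .
    have "(\<Sum>u\<in>T. of_nat (s' u) * F \<eta> u) = (\<Sum>u\<in>T. of_nat (s (f u)) * \<eta> (f u))" by (rule sum.cong) (simp_all add: Ff s)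
    also have "\<dots> = (\<Sum>u\<in>P. of_nat (s u) * \<eta> u)" by (rule sum.reindex_bij_betw[OF bij])
    finally have 2: "(\<Sum>u\<in>T. of_nat (s' u) * F \<eta> u) = (\<Sum>u\<in>P. of_nat (s u) * \<eta> u)" .
    have "(\<Prod>v\<in>T. inverse (z - F \<eta> v) ^ s' v) = (\<Prod>v\<in>T. inverse (z - \<eta> (f v)) ^ s (f v))" for z
      by (rule prod.cong) (simp_all add: Ff s)
    then have 3: "(\<Prod>v\<in>T. inverse (z - F \<eta> v) ^ s' v) = (\<Prod>v\<in>P. inverse (z - \<eta> v) ^ s v)" for z
      using prod.reindex_bij_betw[OF bij, of "\<lambda>v. inverse (z - \<eta> v) ^ s v"] by simp
    have "(\<forall>u\<in>P. residue (\<lambda>z. \<Prod>v\<in>P. inverse (z - \<eta> v) ^ s v) (\<eta> u) = \<rho> u) \<longleftrightarrow>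
        (\<forall>b\<in>T. residue (\<lambda>z. \<Prod>v\<in>T. inverse (z - F \<eta> v) ^ s' v) (F \<eta> b) = \<rho>' b)"
      unfolding 3 by (subst im[symmetric]) (simp add: Ff \<rho>)
    then show ?thesis using 1 2 \<eta> by (simp add: glob_def F_def)
  qed
  have ext: "\<eta> \<in> A \<rightarrow>\<^sub>E UNIV" if "\<eta> \<in> glob A b c" for \<eta> and A :: "'z set" and b c using that by (simp add: glob_def)
  have GF: "G (F \<eta>) = \<eta>" if "\<eta> \<in> P \<rightarrow>\<^sub>E UNIV" for \<eta>
  proof
    fix B
    show "G (F \<eta>) B = \<eta> B"
    proof (cases "B \<in> P")
      case True
      then have "inv_into T f B \<in> T" "f (inv_into T f B) = B" using im by (auto intro: inv_into_into f_inv_into_f)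
      then show ?thesis using True by (simp add: G_def F_def)
    next
      case False
      then show ?thesis using that by (simp add: G_def PiE_arb[OF that])
    qed
  qed
  have FG: "F (G \<zeta>) = \<zeta>" if "\<zeta> \<in> T \<rightarrow>\<^sub>E UNIV" for \<zeta>
  proof
    fix b
    show "F (G \<zeta>) b = \<zeta> b"
    proof (cases "b \<in> T")
      case True
      then have "f b \<in> P" "inv_into T f (f b) = b" using im inj by (auto simp: inv_into_f_f)
      then show ?thesis using True by (simp add: G_def F_def)
    next
      case False
      then show ?thesis using that by (simp add: F_def PiE_arb[OF that])
    qed
  qed
  have Gext: "G \<zeta> \<in> P \<rightarrow>\<^sub>E UNIV" for \<zeta> by (simp add: G_def)
  have "bij_betw F (glob P s \<rho>) (glob T s' \<rho>')"
  proof (rule bij_betw_byWitness[where f' = G])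
    show "\<forall>\<eta>\<in>glob P s \<rho>. G (F \<eta>) = \<eta>" using GF ext by blast
    show "\<forall>\<zeta>\<in>glob T s' \<rho>'. F (G \<zeta>) = \<zeta>" using FG ext by blast
    show "F ` glob P s \<rho> \<subseteq> glob T s' \<rho>'" using key ext by blast
    show "G ` glob T s' \<rho>' \<subseteq> glob P s \<rho>"
    proof
      fix \<eta> assume "\<eta> \<in> G ` glob T s' \<rho>'"
      then obtain \<zeta> where z: "\<zeta> \<in> glob T s' \<rho>'" "\<eta> = G \<zeta>" by blast
      then show "\<eta> \<in> glob P s \<rho>" using key[OF Gext] FG[OF ext[OF z(1)]] by simp
    qed
  qed
  then show ?thesis by (rule bij_betw_same_card)
qed

text \<open>The multinomial coefficient: composing permutations of A with \<open>g0\<close> gives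
  every function with these fibre sizes, each equally often.\<close>

lemma card_functions_with_fibres:
  fixes g0 :: "'a \<Rightarrow> 'b"
  assumes fin: "finite A" "finite C" and g0: "\<And>i. i \<in> A \<Longrightarrow> g0 i \<in> C"
  shows "card {f \<in> A \<rightarrow>\<^sub>E C. \<forall>c\<in>C. card {i \<in> A. f i = c} = card {i \<in> A. g0 i = c}} *
    (\<Prod>c\<in>C. fact (card {i \<in> A. g0 i = c})) = fact (card A)"
proof -
  define F where "F = {f \<in> A \<rightarrow>\<^sub>E C. \<forall>c\<in>C. card {i \<in> A. f i = c} = card {i \<in> A. g0 i = c}}"
  define H where "H f = {h \<in> A \<rightarrow>\<^sub>E A. bij_betw h A A \<and> (\<forall>a\<in>A. g0 (h a) = f a)}" for f
  have finF: "finite F" by (rule finite_subset[OF _ finite_PiE[OF fin(1)]]) (use fin(2) in \<open>auto simp: F_def\<close>)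
  have finH: "finite (H f)" for f by (rule finite_subset[OF _ finite_PiE[OF fin(1)]]) (use fin(1) in \<open>auto simp: H_def\<close>)
  have cH: "card (H f) = (\<Prod>c\<in>C. fact (card {i \<in> A. g0 i = c}))" if f: "f \<in> F" for f
  proof -
    have fC: "f ` A \<subseteq> C" using f by (auto simp: F_def)
    have eq: "card {i \<in> A. f i = c} = card {i \<in> A. g0 i = c}" for c
    proof (cases "c \<in> C")
      case True
      then show ?thesis using f by (simp add: F_def)
    next
      case False
      then have "{i \<in> A. f i = c} = {}" "{i \<in> A. g0 i = c} = {}" using fC g0 by auto
      then show ?thesis by (simp only:)
    qed
    show ?thesis unfolding H_def using card_colour_bijections_aux[OF fin(1) fin(1) fin(2) fC eq] by (simp add: eq)
  qed
  have "{h \<in> A \<rightarrow>\<^sub>E A. bij_betw h A A} = (\<Union>f\<in>F. H f)"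
  proof
    show "(\<Union>f\<in>F. H f) \<subseteq> {h \<in> A \<rightarrow>\<^sub>E A. bij_betw h A A}" by (auto simp: H_def)
    show "{h \<in> A \<rightarrow>\<^sub>E A. bij_betw h A A} \<subseteq> (\<Union>f\<in>F. H f)"
    proof
      fix h assume "h \<in> {h \<in> A \<rightarrow>\<^sub>E A. bij_betw h A A}"
      then have h: "h \<in> A \<rightarrow>\<^sub>E A" "bij_betw h A A" by auto
      define f where "f = (\<lambda>a\<in>A. g0 (h a))"
      have "card {i \<in> A. f i = c} = card {i \<in> A. g0 i = c}" for c
        by (rule bij_betw_same_card[OF bij_betw_Collect[OF h(2)]]) (simp add: f_def)
      moreover have "f \<in> A \<rightarrow>\<^sub>E C" using h(1) g0 by (auto simp: f_def)
      ultimately have "f \<in> F" by (simp add: F_def)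
      moreover have "h \<in> H f" using h by (simp add: H_def f_def)
      ultimately show "h \<in> (\<Union>f\<in>F. H f)" by blast
    qed
  qed
  then have "fact (card A) = card (\<Union>f\<in>F. H f)" using card_bijections_ext[OF fin(1) fin(1) refl] by simp
  also have "\<dots> = (\<Sum>f\<in>F. card (H f))"
  proof (rule card_UN_disjoint[OF finF])
    show "\<forall>f\<in>F. finite (H f)" using finH by blast
    show "\<forall>f\<in>F. \<forall>f'\<in>F. f \<noteq> f' \<longrightarrow> H f \<inter> H f' = {}"
    proof (intro ballI impI)
      fix f f' assume f: "f \<in> F" "f' \<in> F" "f \<noteq> f'"
      show "H f \<inter> H f' = {}"
      proof (rule ccontr)
        assume "H f \<inter> H f' \<noteq> {}"
        then obtain h where h: "h \<in> H f" "h \<in> H f'" by blast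
        have "f a = f' a" if "a \<in> A" for a using h that by (simp add: H_def)
        then have "f = f'" using f(1,2) by (intro PiE_ext[of f A "\<lambda>_. C" f']) (auto simp: F_def)
        then show False using f(3) by simp
      qed
    qed
  qed
  also have "\<dots> = card F * (\<Prod>c\<in>C. fact (card {i \<in> A. g0 i = c}))" by (simp add: cH)
  finally show ?thesis by (simp add: F_def)
qed

text \<open>Choose m to be a star vector on each block of P0 and apply \<open>zsp_relation\<close>.
  Partitions with two special points in a block contribute nothing by
  \<open>sols_empty_if_two_negative\<close>. All others have the same block sizes and the same
  position of i0, hence the same center count and the same shape counts prod a_b!. They are in
  bijection with functions with fibre sizes a_b, so their number times prod a_b! is (d -
  #P0)!.\<close>

theorem card_glob_star:
  fixes S :: "'a set"
  assumes fin: "finite S" and c2: "card S \<ge> 2" and P0: "partition_on S P0" and big: "\<And>B. B \<in> P0 \<Longrightarrow> card B \<ge> 2" and i0: "i0 \<in> S"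
  shows "card (glob P0 card (\<lambda>B. \<Sum>i\<in>B. star S i0 i)) * fact (card S - card P0) = fact (card S - 1)"
proof -
  \<comment> \<open>One special point per block, with i0 special in its own block. Then the
    prescribed residue of a block is determined by its special point, for all contributing
    partitions.\<close>
  define t where "t B = (if i0 \<in> B then i0 else (SOME i. i \<in> B))" for B
  have B0: "B \<subseteq> S" "B \<noteq> {}" if "B \<in> P0" for B using P0 that by (auto simp: partition_on_def)
  have tB: "t B \<in> B" if "B \<in> P0" for B using B0(2)[OF that] by (simp add: t_def some_in_eq)
  have tblk: "blk P0 (t B) = B" if "B \<in> P0" for B by (rule blk_eqI[OF P0 that tB[OF that]])
  have inj_t: "inj_on t P0" by (metis inj_onI tblk)
  define T where "T = t ` P0"
  have TS: "T \<subseteq> S" using tB B0 by (auto simp: T_def)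
  have finT: "finite T" using finite_subset[OF TS fin] .
  have cardT: "card T = card P0" unfolding T_def by (rule card_image[OF inj_t])
  have i0T: "i0 \<in> T"
    unfolding T_def using partition_blk[OF P0 i0] by (intro image_eqI[of _ _ "blk P0 i0"]) (simp_all add: t_def)
  define Oo where "Oo = S - T"
  have finO: "finite Oo" using fin by (simp add: Oo_def)
  have cardO: "card Oo = card S - card P0" unfolding Oo_def cardT[symmetric] by (rule card_Diff_subset[OF finT TS])
  define a where "a b = card (blk P0 b) - 1" for b
  have a1: "a b \<ge> 1" if "b \<in> T" for b
  proof -
    have "2 \<le> card (blk P0 b)" by (rule big[OF partition_blk(1)[OF P0]]) (use that TS in blast)
    then show ?thesis by (simp add: a_def)
  qed
  \<comment> \<open>Value 1 at ordinary points and minus the number of ordinary points of its block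
    at each special point, so every block of \<open>P0\<close> sums to zero.\<close>
  define m where "m i = (if i \<in> T then - of_nat (a i) else (1 :: complex))" for i
  have sumB: "(\<Sum>i\<in>X. m i) = of_nat (card (X - T)) - of_nat (\<Sum>b\<in>X \<inter> T. a b)" if X: "finite X" for X
  proof -
    have "(\<Sum>i\<in>X. m i) = (\<Sum>i\<in>X - T. m i) + (\<Sum>i\<in>X \<inter> T. m i)"
      using X by (subst sum.union_disjoint[symmetric]) (auto intro!: sum.cong)
    moreover have "(\<Sum>i\<in>X - T. m i) = (\<Sum>i\<in>X - T. 1)" by (rule sum.cong) (auto simp: m_def)
    moreover have "(\<Sum>i\<in>X \<inter> T. m i) = (\<Sum>i\<in>X \<inter> T. - of_nat (a i))" by (rule sum.cong) (auto simp: m_def)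
    ultimately show ?thesis by (simp add: sum_negf)
  qed
  have sum1: "(\<Sum>i\<in>X. m i) = 0 \<longleftrightarrow> card X = Suc (a b)" if X: "finite X" "X \<inter> T = {b}" for X b
  proof -
    have "b \<in> X" "X - T = X - {b}" using X(2) by auto
    then have "card X = Suc (card (X - T))" using X(1) by (metis card.remove)
    moreover have "(\<Sum>i\<in>X. m i) = of_nat (card (X - T)) - of_nat (a b)" using sumB[OF X(1)] X(2) by simp
    ultimately show ?thesis by simp
  qed
  have finblk: "finite B" if "partition_on S P" "B \<in> P" for P B
    by (rule finite_subset[OF _ fin]) (use that in \<open>auto simp: partition_on_def\<close>)
  have P0T: "B \<inter> T = {t B}" if B: "B \<in> P0" for B
  proof -
    have "x = t B" if xB: "x \<in> B" and xT: "x \<in> T" for x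
    proof -
      obtain B' where B': "B' \<in> P0" "x = t B'" using xT by (auto simp: T_def)
      have "B' = blk P0 x" using tblk[OF B'(1)] B'(2) by simp
      also have "\<dots> = B" by (rule blk_eqI[OF P0 B xB])
      finally show ?thesis using B'(2) by simp
    qed
    moreover have "t B \<in> T" using B by (simp add: T_def)
    ultimately show ?thesis using tB[OF B] by blast
  qed
  have cP0: "card B = Suc (a (t B))" if "B \<in> P0" for B using big[OF that] by (simp add: a_def tblk[OF that])
  have zB: "(\<Sum>i\<in>B. m i) = 0" if "B \<in> P0" for B
    using sum1[OF finblk[OF P0 that] P0T[OF that]] cP0[OF that] by simp
  have P0z: "P0 \<in> zsp S m" using P0 zB by (simp add: zsp_def)
  have "(\<Sum>i\<in>S. m i) = (\<Sum>B\<in>P0. \<Sum>i\<in>B. m i)" by (rule sum_partition_on[OF fin P0])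
  then have sm: "(\<Sum>i\<in>S. m i) = 0" using zB by simp
  have m0: "m i \<noteq> 0" if "i \<in> S" for i using a1[of i] by (auto simp: m_def)
  define M where "M P = card (glob P card (\<lambda>B. \<Sum>i\<in>B. star S i0 i))" for P
  have rel: "fact (card S - 1) = (\<Sum>P\<in>zsp S m. M P * (\<Prod>B\<in>P. card (sols B m)))"
    unfolding M_def by (rule zsp_relation(1)[OF fin c2 m0 sm i0])
  \<comment> \<open>The partitions that contribute: each block has exactly one special point b, and
    the zero sum then forces its size to be \<open>a b + 1\<close>.\<close>
  define \<G> where "\<G> = {P \<in> zsp S m. \<forall>B\<in>P. \<exists>b. B \<inter> T = {b}}"
  have finz: "finite (zsp S m)"
    by (rule finite_subset[OF _ finitely_many_partition_on[OF fin]]) (auto simp: zsp_def)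
  have zero: "(\<Prod>B\<in>P. card (sols B m)) = 0" if P: "P \<in> zsp S m" "P \<notin> \<G>" for P
  proof -
    have p: "partition_on S P" using P(1) by (simp add: zsp_def)
    obtain B where B: "B \<in> P" "\<And>b. B \<inter> T \<noteq> {b}" using P by (auto simp: \<G>_def)
    have fB: "finite B" by (rule finblk[OF p B(1)])
    have s0: "(\<Sum>i\<in>B. m i) = 0" using P(1) B(1) by (simp add: zsp_def)
    then have cB: "(\<Sum>b\<in>B \<inter> T. a b) = card (B - T)" using sumB[OF fB] by (simp del: of_nat_sum)
    have "B \<inter> T \<noteq> {}"
    proof
      assume e: "B \<inter> T = {}"
      then have "card (B - T) = 0" using cB by simp
      then have "B = {}" using fB e by auto
      then show False using partition_onD3[OF p] B(1) by simp
    qed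
    then have "card (B \<inter> T) \<noteq> 0" using finT by simp
    moreover have "card (B \<inter> T) \<noteq> 1" using B(2) by (metis card_1_singletonE)
    ultimately have c: "card (B \<inter> T) \<ge> 2" by linarith
    have "sols ((B - T) \<union> (B \<inter> T)) m = {}"
      by (rule sols_empty_if_two_negative[where a = a, OF _ _ _ c _ _ _ cB]) (use fB finT a1 in \<open>auto simp: m_def\<close>)
    moreover have "(B - T) \<union> (B \<inter> T) = B" by blast
    ultimately have "card (sols B m) = 0" by simp
    then show ?thesis using B(1) finite_elements[OF fin p] by (intro prod_zero) auto
  qed
  \<comment> \<open>The sum of \<open>star\<close> over the block with special point b, computed
    from its size alone.\<close>
  define \<rho> where "\<rho> b = (if b = i0 then of_nat (Suc (a b)) - 1 - of_nat (card S - 1) else (of_nat (Suc (a b)) :: complex))" for b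
  have G: "bij_betw (blk P) T P" "\<And>b. b \<in> T \<Longrightarrow> blk P b \<inter> T = {b}" "\<And>b. b \<in> T \<Longrightarrow> card (blk P b) = Suc (a b)" if P: "P \<in> \<G>" for P
  proof -
    have p: "partition_on S P" using P by (simp add: \<G>_def zsp_def)
    have bT: "blk P b \<in> P" "b \<in> blk P b" if "b \<in> T" for b using partition_blk[OF p] that TS by auto
    show bb: "blk P b \<inter> T = {b}" if b: "b \<in> T" for b
    proof -
      obtain x where x: "blk P b \<inter> T = {x}" using P bT(1)[OF b] by (auto simp: \<G>_def)
      have "b \<in> {x}" unfolding x[symmetric] using bT(2)[OF b] b by blast
      then show ?thesis using x by simp
    qed
    show "card (blk P b) = Suc (a b)" if b: "b \<in> T" for b
    proof -
      have "(\<Sum>i\<in>blk P b. m i) = 0" using P bT(1)[OF b] by (simp add: \<G>_def zsp_def)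
      then show ?thesis using sum1[OF finblk[OF p bT(1)[OF b]] bb[OF b]] by simp
    qed
    have "inj_on (blk P) T" by (rule inj_onI) (use bb in blast)
    moreover have "blk P ` T = P"
    proof
      show "blk P ` T \<subseteq> P" using bT(1) by blast
      show "P \<subseteq> blk P ` T"
      proof
        fix B assume B: "B \<in> P"
        then obtain b where "B \<inter> T = {b}" using P by (auto simp: \<G>_def)
        then have b: "b \<in> B" "b \<in> T" by auto
        show "B \<in> blk P ` T" using blk_eqI[OF p B b(1)] b(2) by blast
      qed
    qed
    ultimately show "bij_betw (blk P) T P" by (simp add: bij_betw_def)
  qed
  have MG: "M P = card (glob T (\<lambda>b. Suc (a b)) \<rho>)" if P: "P \<in> \<G>" for P
    unfolding M_def
  proof (rule glob_reindex[OF G(1)[OF P]])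
    have p: "partition_on S P" using P by (simp add: \<G>_def zsp_def)
    fix b assume b: "b \<in> T"
    show c: "card (blk P b) = Suc (a b)" by (rule G(3)[OF P b])
    have fB: "finite (blk P b)" using c card.infinite by fastforce
    show "(\<Sum>i\<in>blk P b. star S i0 i) = \<rho> b"
    proof (cases "b = i0")
      case True
      have "i0 \<in> blk P b" using G(2)[OF P b] True by blast
      from sum_star_mem[OF fB this] show ?thesis using True c by (simp add: \<rho>_def)
    next
      case False
      then have "i0 \<notin> blk P b" using G(2)[OF P b] i0T by (metis IntI singletonD)
      from sum_star_not_mem[OF this] show ?thesis using False c by (simp add: \<rho>_def)
    qed
  qed
  have PG: "(\<Prod>B\<in>P. card (sols B m)) = (\<Prod>b\<in>T. fact (a b))" if P: "P \<in> \<G>" for P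
  proof -
    have "(\<Prod>B\<in>P. card (sols B m)) = (\<Prod>b\<in>T. card (sols (blk P b) m))"
      by (rule prod.reindex_bij_betw[OF G(1)[OF P], symmetric])
    also have "\<dots> = (\<Prod>b\<in>T. fact (a b))"
    proof (rule prod.cong[OF refl])
      fix b assume b: "b \<in> T"
      have c: "card (blk P b) = Suc (a b)" by (rule G(3)[OF P b])
      have "card (sols (blk P b) m) = fact (card (blk P b) - 1)"
      proof (rule card_sols_star[of _ b 1])
        show "finite (blk P b)" using c card.infinite by fastforce
        show "b \<in> blk P b" using G(2)[OF P b] by blast
        show "2 \<le> card (blk P b)" using c a1[OF b] by simp
        show "m b = - 1 * of_nat (card (blk P b) - 1)" using c b by (simp add: m_def)
        show "m i = 1" if "i \<in> blk P b - {b}" for i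
        proof -
          have "i \<notin> T" using that G(2)[OF P b] by blast
          then show ?thesis by (simp add: m_def)
        qed
      qed simp
      then show "card (sols (blk P b) m) = fact (a b)" using c by simp
    qed
    finally show ?thesis .
  qed
  have P0G: "P0 \<in> \<G>" using P0z P0T by (auto simp: \<G>_def)
  have "fact (card S - 1) = (\<Sum>P\<in>\<G>. M P * (\<Prod>B\<in>P. card (sols B m)))"
    unfolding rel by (rule sum.mono_neutral_right[OF finz]) (use zero in \<open>auto simp: \<G>_def\<close>)
  also have "\<dots> = (\<Sum>P\<in>\<G>. M P0 * (\<Prod>b\<in>T. fact (a b)))"
    by (rule sum.cong[OF refl]) (simp add: PG MG[OF P0G] MG)
  finally have main: "fact (card S - 1) = card \<G> * (M P0 * (\<Prod>b\<in>T. fact (a b)))" by simp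
  \<comment> \<open>A contributing partition is encoded by the map sending each ordinary point to
    the special point of its block; \<open>g0\<close> is this map for \<open>P0\<close>, so
    \<open>card_functions_with_fibres\<close> applies.\<close>
  define g0 where "g0 i = t (blk P0 i)" for i
  define F where "F = {f \<in> Oo \<rightarrow>\<^sub>E T. \<forall>c\<in>T. card {i \<in> Oo. f i = c} = card {i \<in> Oo. g0 i = c}}"
  have g0T: "g0 i \<in> T" if "i \<in> Oo" for i
    using partition_blk(1)[OF P0] that by (simp add: g0_def T_def Oo_def)
  have fib0: "card {i \<in> Oo. g0 i = c} = a c" if c: "c \<in> T" for c
  proof -
    have cS: "c \<in> S" using c TS by blast
    have bc: "blk P0 c \<inter> T = {c}" by (rule G(2)[OF P0G c])
    have tc: "t (blk P0 c) = c" using P0T[OF partition_blk(1)[OF P0 cS]] bc by simp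
    have "{i \<in> Oo. g0 i = c} = blk P0 c - {c}"
    proof (intro equalityI subsetI)
      fix i assume "i \<in> {i \<in> Oo. g0 i = c}"
      then have i: "i \<in> S" "i \<notin> T" "t (blk P0 i) = c" by (auto simp: Oo_def g0_def)
      have "blk P0 c = blk P0 i" using tblk[OF partition_blk(1)[OF P0 i(1)]] i(3) by simp
      then show "i \<in> blk P0 c - {c}" using partition_blk(2)[OF P0 i(1)] i(2) c by auto
    next
      fix i assume i: "i \<in> blk P0 c - {c}"
      then have "i \<in> S" using partition_blk(3)[OF P0 cS] by blast
      moreover have "i \<notin> T" using i bc by blast
      moreover have "blk P0 i = blk P0 c" by (rule blk_eq[OF P0 cS]) (use i in blast)
      ultimately show "i \<in> {i \<in> Oo. g0 i = c}" using tc by (simp add: Oo_def g0_def)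
    qed
    moreover have "c \<in> blk P0 c" using bc by blast
    ultimately show ?thesis by (simp add: a_def)
  qed
  \<comment> \<open>The partition belonging to such a map: every special point together with its
    fibre.\<close>
  define \<Psi> where "\<Psi> f = (\<lambda>b. insert b {i \<in> Oo. f i = b}) ` T" for f :: "'a \<Rightarrow> 'a"
  have fT: "f i \<in> T" if "f \<in> F" "i \<in> Oo" for f i using that by (auto simp: F_def)
  have "inj_on \<Psi> F"
  proof (rule inj_onI)
    fix f f' assume f: "f \<in> F" "f' \<in> F" and eq: "\<Psi> f = \<Psi> f'"
    have "f i = f' i" if i: "i \<in> Oo" for i
    proof -
      have "insert (f i) {j \<in> Oo. f j = f i} \<in> \<Psi> f" using fT[OF f(1) i] by (auto simp: \<Psi>_def)
      then obtain b where b: "b \<in> T" "insert (f i) {j \<in> Oo. f j = f i} = insert b {j \<in> Oo. f' j = b}"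
        unfolding eq by (auto simp: \<Psi>_def)
      have "f i \<in> insert b {j \<in> Oo. f' j = b}" using b(2) by blast
      then have "f i = b" using fT[OF f(1) i] by (auto simp: Oo_def)
      moreover have "i \<in> insert b {j \<in> Oo. f' j = b}" using b(2) i by blast
      then have "f' i = b" using i b(1) by (auto simp: Oo_def)
      ultimately show ?thesis by simp
    qed
    then show "f = f'" using f by (intro PiE_ext[of f Oo "\<lambda>_. T" f']) (auto simp: F_def)
  qed
  moreover have "\<Psi> ` F = \<G>"
  proof
    show "\<Psi> ` F \<subseteq> \<G>"
    proof
      fix P assume "P \<in> \<Psi> ` F"
      then obtain f where f: "f \<in> F" "P = \<Psi> f" by blast
      have bT: "insert b {i \<in> Oo. f i = b} \<inter> T = {b}" if "b \<in> T" for b using that by (auto simp: Oo_def)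
      have "partition_on S P"
      proof (rule partition_onI)
        show "\<Union>P = S" using fT[OF f(1)] TS by (auto simp: f(2) \<Psi>_def Oo_def)
        show "{} \<notin> P" by (auto simp: f(2) \<Psi>_def)
        show "disjnt B C" if "B \<in> P" "C \<in> P" "B \<noteq> C" for B C using that by (auto simp: f(2) \<Psi>_def disjnt_def Oo_def)
      qed
      moreover have "(\<Sum>i\<in>B. m i) = 0 \<and> (\<exists>b. B \<inter> T = {b})" if BP: "B \<in> P" for B
      proof -
        obtain b where b: "b \<in> T" "B = insert b {i \<in> Oo. f i = b}" using BP unfolding f(2) \<Psi>_def by blast
        have "card {i \<in> Oo. f i = b} = a b" using f(1) b(1) fib0[OF b(1)] by (simp add: F_def)
        moreover have "b \<notin> {i \<in> Oo. f i = b}" using b(1) by (simp add: Oo_def)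
        ultimately have "card B = Suc (a b)" using finO by (simp add: b(2))
        moreover have "finite B" using finO by (simp add: b(2))
        ultimately show ?thesis using sum1[of B b] bT[OF b(1)] b(2) by blast
      qed
      ultimately show "P \<in> \<G>" by (simp add: \<G>_def zsp_def)
    qed
    show "\<G> \<subseteq> \<Psi> ` F"
    proof
      fix P assume P: "P \<in> \<G>"
      have p: "partition_on S P" using P by (simp add: \<G>_def zsp_def)
      define f where "f = (\<lambda>i\<in>Oo. the_elem (blk P i \<inter> T))"
      have fi: "blk P i \<inter> T = {f i}" if i: "i \<in> Oo" for i
      proof -
        have "blk P i \<in> P" by (rule partition_blk(1)[OF p]) (use i in \<open>simp add: Oo_def\<close>)
        then obtain b where "blk P i \<inter> T = {b}" using P by (auto simp: \<G>_def)
        then show ?thesis using i by (simp add: f_def)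
      qed
      have ib: "insert b {i \<in> Oo. f i = b} = blk P b" if b: "b \<in> T" for b
      proof (intro equalityI subsetI)
        have bb: "blk P b \<inter> T = {b}" by (rule G(2)[OF P b])
        fix i assume i: "i \<in> insert b {i \<in> Oo. f i = b}"
        show "i \<in> blk P b"
        proof (cases "i = b")
          case True
          then show ?thesis using bb by blast
        next
          case False
          then have iO: "i \<in> Oo" "f i = b" using i by auto
          then have "b \<in> blk P i" using fi[OF iO(1)] by blast
          then have "blk P b = blk P i" using iO(1) by (intro blk_eq[OF p]) (simp_all add: Oo_def)
          then show ?thesis using partition_blk(2)[OF p, of i] iO(1) by (simp add: Oo_def)
        qed
      next
        have bb: "blk P b \<inter> T = {b}" by (rule G(2)[OF P b])
        have bS: "b \<in> S" using b TS by blast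
        fix i assume i: "i \<in> blk P b"
        show "i \<in> insert b {i \<in> Oo. f i = b}"
        proof (cases "i \<in> T")
          case True
          then show ?thesis using i bb by blast
        next
          case False
          then have iO: "i \<in> Oo" using partition_blk(3)[OF p bS] i by (auto simp: Oo_def)
          have "blk P i = blk P b" by (rule blk_eq[OF p bS i])
          then have "f i = b" using fi[OF iO] bb by simp
          then show ?thesis using iO by simp
        qed
      qed
      have "\<Psi> f = blk P ` T" unfolding \<Psi>_def by (rule image_cong[OF refl ib])
      then have "\<Psi> f = P" using G(1)[OF P] by (simp add: bij_betw_def)
      moreover have "f \<in> F"
      proof -
        have "f i \<in> T" if "i \<in> Oo" for i using fi[OF that] by blast
        then have "f \<in> Oo \<rightarrow>\<^sub>E T" by (simp add: f_def)
        moreover have "card {i \<in> Oo. f i = c} = a c" if c: "c \<in> T" for c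
        proof -
          have "c \<notin> {i \<in> Oo. f i = c}" using c by (simp add: Oo_def)
          then have "Suc (card {i \<in> Oo. f i = c}) = card (blk P c)" using finO by (simp flip: ib[OF c])
          then show ?thesis using G(3)[OF P c] by simp
        qed
        ultimately show ?thesis using fib0 by (simp add: F_def)
      qed
      ultimately show "P \<in> \<Psi> ` F" by blast
    qed
  qed
  ultimately have "card F = card \<G>" using bij_betw_same_card[of \<Psi> F \<G>] by (simp add: bij_betw_def)
  moreover have "card F * (\<Prod>c\<in>T. fact (card {i \<in> Oo. g0 i = c})) = fact (card Oo)"
    unfolding F_def by (rule card_functions_with_fibres[OF finO finT g0T])
  moreover have "(\<Prod>c\<in>T. fact (card {i \<in> Oo. g0 i = c})) = (\<Prod>c\<in>T. fact (a c) :: nat)"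
    by (rule prod.cong[OF refl]) (simp add: fib0)
  ultimately have "card \<G> * (\<Prod>b\<in>T. fact (a b)) = fact (card Oo)" by simp
  then show ?thesis using main by (simp add: M_def cardO mult_ac)
qed

section \<open>Solving the partition relation\<close>

lemma ffall_fact: "l \<le> c \<Longrightarrow> ffall c l * fact (c - l) = fact c"
proof (induction l)
  case (Suc l)
  have "fact (c - l) = (real c - real l) * (fact (c - Suc l) :: real)"
    using Suc.prems by (simp add: fact_reduce of_nat_diff)
  then show ?case using Suc by (simp add: ffall_def mult_ac)
qed (simp add: ffall_def)

text \<open>Extending the weight (#J - 1)! by zero lets sums over zero-sum partitions be written as
  sums over all partitions, so that the convolution identities apply.\<close>

definition zero_sum_fact :: "('a \<Rightarrow> complex) \<Rightarrow> 'a set \<Rightarrow> real" where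
  "zero_sum_fact m J = (if (\<Sum>i\<in>J. m i) = 0 then fact (card J - 1) else 0)"

lemma finite_zsp': "finite S \<Longrightarrow> finite (zsp S m)"
  by (rule finite_subset[OF _ finitely_many_partition_on]) (auto simp: zsp_def)

lemma hz_sum_zero_sum_fact:
  assumes fin: "finite S"
  shows "hz_sum (zero_sum_fact m) c S = (\<Sum>Q\<in>zsp S m. hz (\<lambda>J. - real (card J)) c Q * (\<Prod>J\<in>Q. fact (card J - 1)))"
proof -
  have "hz_sum (zero_sum_fact m) c S = (\<Sum>Q\<in>zsp S m. hz (\<lambda>J. - real (card J)) c Q * (\<Prod>J\<in>Q. zero_sum_fact m J))"
    unfolding hz_sum_def
  proof (rule sum.mono_neutral_right[OF finite_parts[OF fin]])
    show "zsp S m \<subseteq> parts S" by (auto simp: zsp_def parts_def)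
    show "\<forall>Q\<in>parts S - zsp S m. hz (\<lambda>J. - real (card J)) c Q * (\<Prod>J\<in>Q. zero_sum_fact m J) = 0"
    proof
      fix Q assume Q: "Q \<in> parts S - zsp S m"
      then obtain J where "J \<in> Q" "zero_sum_fact m J = 0" by (auto simp: zsp_def parts_def zero_sum_fact_def)
      moreover have "finite Q" using parts_finite_element[OF fin] Q by blast
      ultimately have "(\<Prod>J\<in>Q. zero_sum_fact m J) = 0" by (intro prod_zero) blast+
      then show "hz (\<lambda>J. - real (card J)) c Q * (\<Prod>J\<in>Q. zero_sum_fact m J) = 0" by simp
    qed
  qed
  also have "\<dots> = (\<Sum>Q\<in>zsp S m. hz (\<lambda>J. - real (card J)) c Q * (\<Prod>J\<in>Q. fact (card J - 1)))"
    by (rule sum.cong[OF refl], rule arg_cong2[where f = "(*)"], rule refl, rule prod.cong[OF refl])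
      (simp add: zsp_def zero_sum_fact_def)
  finally show ?thesis .
qed

lemma hz_sum_zero_sum_fact_eq_0:
  assumes fin: "finite B" and s: "(\<Sum>i\<in>B. m i) \<noteq> 0"
  shows "hz_sum (zero_sum_fact m) c B = 0"
proof -
  have "Q \<notin> zsp B m" for Q
  proof
    assume Q: "Q \<in> zsp B m"
    then have "(\<Sum>i\<in>B. m i) = (\<Sum>J\<in>Q. \<Sum>i\<in>J. m i)" by (intro sum_partition_on[OF fin]) (simp add: zsp_def)
    then show False using s Q by (simp add: zsp_def)
  qed
  then have "zsp B m = {}" by blast
  then show ?thesis by (simp add: hz_sum_zero_sum_fact[OF fin])
qed

text \<open>Strong induction on S. The counts and the closed formula satisfy the same relation, sum
  over P of falling factorial times product over blocks = d!. Except for P = {S}, all blocks are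
  proper subsets, where the two agree.\<close>

theorem card_sols:
  fixes m :: "'a \<Rightarrow> complex"
  assumes "finite S" "card S \<ge> 2" "\<And>i. i \<in> S \<Longrightarrow> m i \<noteq> 0" "(\<Sum>i\<in>S. m i) = 0"
  shows "real (card (sols S m)) = hz_sum (zero_sum_fact m) 1 S"
  using assms
proof (induction S rule: finite_psubset_induct)
  case (psubset S)
  note fin = psubset.hyps and c2 = psubset.prems(1) and m0 = psubset.prems(2) and sm = psubset.prems(3)
  define d where "d = card S"
  have d: "d \<ge> 2" using c2 by (simp add: d_def)
  obtain i0 where i0: "i0 \<in> S" using c2 by fastforce
  define M where "M P = card (glob P card (\<lambda>B. \<Sum>i\<in>B. star S i0 i))" for P
  define f where "f = hz_sum (zero_sum_fact m) 1"
  have finz: "finite (zsp S m)" by (rule finite_zsp'[OF fin])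
  have SS: "{S} \<in> zsp S m" using i0 sm by (auto simp: zsp_def partition_on_def)
  have zb: "B \<subseteq> S" "card B \<ge> 2" "(\<Sum>i\<in>B. m i) = 0" if P: "P \<in> zsp S m" and B: "B \<in> P" for P B
  proof -
    show BS: "B \<subseteq> S" and s: "(\<Sum>i\<in>B. m i) = 0" using P B by (auto simp: zsp_def partition_on_def)
    have "card B \<noteq> 0" using P B finite_subset[OF BS fin] by (auto simp: zsp_def partition_on_def)
    moreover have "card B \<noteq> 1"
    proof
      assume "card B = 1"
      then obtain x where "B = {x}" by (rule card_1_singletonE)
      then show False using s m0[of x] BS by simp
    qed
    ultimately show "card B \<ge> 2" by linarith
  qed
  \<comment> \<open>Multiplying the center count (d-1)!/(d - #P)! by d gives the falling
    factorial.\<close>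
  have dM: "real d * real (M P) = ffall d (card P)" if P: "P \<in> zsp S m" for P
  proof -
    have p: "partition_on S P" using P by (simp add: zsp_def)
    have "P \<subseteq> blk P ` S"
    proof
      fix B assume B: "B \<in> P"
      then obtain x where x: "x \<in> B" using partition_onD3[OF p] by (metis equals0I)
      have "blk P x = B" by (rule blk_eqI[OF p B x])
      then show "B \<in> blk P ` S" using x zb(1)[OF P B] by blast
    qed
    then have le: "card P \<le> d" unfolding d_def using surj_card_le[OF fin] by blast
    have "M P * fact (d - card P) = fact (d - 1)"
      unfolding M_def d_def by (rule card_glob_star[OF fin c2 p zb(2)[OF P] i0])
    then have "real (M P) * fact (d - card P) = fact (d - 1)" by (metis of_nat_fact of_nat_mult)
    then have "real d * real (M P) * fact (d - card P) = fact d" using d by (simp add: fact_reduce[of d] mult.assoc)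
    also have "\<dots> = ffall d (card P) * fact (d - card P)" by (rule ffall_fact[OF le, symmetric])
    finally show ?thesis by simp
  qed
  have rel: "fact (d - 1) = (\<Sum>P\<in>zsp S m. M P * (\<Prod>B\<in>P. card (sols B m)))"
    unfolding M_def d_def by (rule zsp_relation(1)[OF fin c2 m0 sm i0])
  have "(fact (d - 1) :: real) = real (fact (d - 1))" by simp
  also have "\<dots> = (\<Sum>P\<in>zsp S m. real (M P) * (\<Prod>B\<in>P. real (card (sols B m))))"
    unfolding rel by simp
  finally have "real d * fact (d - 1) = (\<Sum>P\<in>zsp S m. real d * (real (M P) * (\<Prod>B\<in>P. real (card (sols B m)))))"
    by (simp only: sum_distrib_left)
  also have "\<dots> = (\<Sum>P\<in>zsp S m. ffall d (card P) * (\<Prod>B\<in>P. real (card (sols B m))))"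
    by (rule sum.cong[OF refl]) (simp only: dM mult.assoc[symmetric])
  finally have "real d * fact (d - 1) = (\<Sum>P\<in>zsp S m. ffall d (card P) * (\<Prod>B\<in>P. real (card (sols B m))))" .
  \<comment> \<open>The closed formula as a d-th convolution power: at parameter d it collapses to d
    * (d-1)!.\<close>
  moreover have "real d * fact (d - 1) = (\<Sum>P\<in>zsp S m. ffall d (card P) * (\<Prod>B\<in>P. f B))"
  proof -
    have "real d * fact (d - 1) = hz_sum (zero_sum_fact m) (real d) S"
    proof -
      have "S \<noteq> {}" using i0 by blast
      from hz_sum_full[OF fin this, of "zero_sum_fact m"] show ?thesis
        by (simp add: zero_sum_fact_def sm d_def)
    qed
    also have "\<dots> = block_sum f d S" unfolding f_def by (rule block_sum_hz_sum[OF fin, symmetric])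
    also have "\<dots> = (\<Sum>P\<in>zsp S m. ffall d (card P) * (\<Prod>B\<in>P. f B))"
      unfolding block_sum_def
    proof (rule sum.mono_neutral_right[OF finite_parts[OF fin]])
      show "zsp S m \<subseteq> parts S" by (auto simp: zsp_def parts_def)
      show "\<forall>P\<in>parts S - zsp S m. ffall d (card P) * (\<Prod>B\<in>P. f B) = 0"
      proof
        fix P assume P: "P \<in> parts S - zsp S m"
        then obtain B where B: "B \<in> P" "(\<Sum>i\<in>B. m i) \<noteq> 0" by (auto simp: zsp_def parts_def)
        have "B \<subseteq> S" using P B(1) by (auto simp: parts_def partition_on_def)
        then have "f B = 0" unfolding f_def using B(2) fin by (intro hz_sum_zero_sum_fact_eq_0) (rule finite_subset)
        moreover have "finite P" using parts_finite_element[OF fin] P by blast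
        ultimately have "(\<Prod>B\<in>P. f B) = 0" using B(1) by (intro prod_zero) blast+
        then show "ffall d (card P) * (\<Prod>B\<in>P. f B) = 0" by simp
      qed
    qed
    finally show ?thesis .
  qed
  moreover have "(\<Prod>B\<in>P. real (card (sols B m))) = (\<Prod>B\<in>P. f B)" if P: "P \<in> zsp S m - {{S}}" for P
  proof (rule prod.cong[OF refl])
    fix B assume B: "B \<in> P"
    have Pz: "P \<in> zsp S m" and p: "partition_on S P" using P by (auto simp: zsp_def)
    have "B \<noteq> S"
    proof
      assume BS: "B = S"
      have "C = S" if C: "C \<in> P" for C
      proof -
        obtain x where x: "x \<in> C" using C partition_onD3[OF p] by (metis equals0I)
        then have "x \<in> S" using zb(1)[OF Pz C] by blast
        then show ?thesis using blk_eqI[OF p C x] blk_eqI[OF p B, of x] BS by simp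
      qed
      then have "P = {S}" using B BS by blast
      then show False using P by simp
    qed
    then have "B \<subset> S" using zb(1)[OF Pz B] by blast
    then show "real (card (sols B m)) = f B"
      unfolding f_def using zb[OF Pz B] m0 by (intro psubset.IH) auto
  qed
  \<comment> \<open>All terms but that of the one-block partition cancel; its coefficient
    \<open>ffall d 1\<close> is d, hence nonzero.\<close>
  ultimately have "ffall d (card {S}) * (\<Prod>B\<in>{S}. real (card (sols B m))) = ffall d (card {S}) * (\<Prod>B\<in>{S}. f B)"
    by (simp add: sum.remove[OF finz SS])
  then show ?case using d by (simp add: ffall_def f_def)
qed

section \<open>From solutions to polynomials\<close>

lemma MC_iff:
  assumes "d \<ge> 2"
  shows "f \<in> MC d \<longleftrightarrow> (\<forall>n>d. coeff f n = 0) \<and> coeff f d = 1 \<and> coeff f (d - 1) = 0"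
proof -
  have c: "coeff (monom 1 d + (\<Sum>k\<in>{0..d-2}. monom (a k) k)) n = (if n = d then 1 else if n \<le> d - 2 then a n else 0)"
    for a :: "nat \<Rightarrow> complex" and n
  proof -
    have "coeff (\<Sum>k\<in>{0..d-2}. monom (a k) k) n = (\<Sum>k\<in>{0..d-2}. if k = n then a k else 0)" by (simp add: coeff_sum)
    also have "\<dots> = (if n \<le> d - 2 then a n else 0)" by simp
    finally show ?thesis using assms by auto
  qed
  show ?thesis
  proof
    assume "f \<in> MC d"
    then obtain a where "f = monom 1 d + (\<Sum>k\<in>{0..d-2}. monom (a k) k)" by (auto simp: MC_def)
    then show "(\<forall>n>d. coeff f n = 0) \<and> coeff f d = 1 \<and> coeff f (d - 1) = 0" using assms by (simp only: c) auto
  next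
    assume f: "(\<forall>n>d. coeff f n = 0) \<and> coeff f d = 1 \<and> coeff f (d - 1) = 0"
    have "coeff f n = (if n = d then 1 else if n \<le> d - 2 then coeff f n else 0)" for n
    proof -
      consider "n > d" | "n = d" | "n = d - 1" | "n \<le> d - 2" by linarith
      then show ?thesis using f assms by cases auto
    qed
    then have "f = monom 1 d + (\<Sum>k\<in>{0..d-2}. monom (coeff f k) k)" by (intro poly_eqI) (simp only: c)
    then show "f \<in> MC d" by (auto simp: MC_def)
  qed
qed

text \<open>\<open>pCons 0\<close> shifts the index, so the coefficient that carries the sum of the
  roots is reached without subtraction and also makes sense for an empty product.\<close>

lemma coeff_linear_prod:
  fixes w :: "'a \<Rightarrow> complex"
  assumes "finite A"
  shows "degree (\<Prod>i\<in>A. [:- w i, 1:]) = card A" "coeff (\<Prod>i\<in>A. [:- w i, 1:]) (card A) = 1"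
    "coeff (pCons 0 (\<Prod>i\<in>A. [:- w i, 1:])) (card A) = - (\<Sum>i\<in>A. w i)"
proof -
  show deg: "degree (\<Prod>i\<in>A. [:- w i, 1:]) = card A" by (subst degree_prod_eq_sum_degree) auto
  have "lead_coeff (\<Prod>i\<in>A. [:- w i, 1:]) = 1" by (subst lead_coeff_prod) simp
  then show "coeff (\<Prod>i\<in>A. [:- w i, 1:]) (card A) = 1" by (simp add: deg)
  have "coeff (\<Prod>i\<in>A. [:- w i, 1:]) (card A) = 1 \<and> coeff (pCons 0 (\<Prod>i\<in>A. [:- w i, 1:])) (card A) = - (\<Sum>i\<in>A. w i)"
    using assms
  proof (induction A rule: finite_induct)
    case (insert a A)
    have "degree (\<Prod>i\<in>A. [:- w i, 1:]) = card A" by (subst degree_prod_eq_sum_degree) auto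
    then have "coeff (\<Prod>i\<in>A. [:- w i, 1:]) (Suc (card A)) = 0" by (simp add: coeff_eq_0)
    then show ?case using insert by (simp add: mult_pCons_left)
  qed simp
  then show "coeff (pCons 0 (\<Prod>i\<in>A. [:- w i, 1:])) (card A) = - (\<Sum>i\<in>A. w i)" by blast
qed

lemma proots_linear_prod:
  fixes w :: "'a \<Rightarrow> complex"
  assumes "finite A"
  shows "proots (\<Prod>i\<in>A. [:- w i, 1:]) = image_mset w (mset_set A)"
  using assms
proof (induction A rule: finite_induct)
  case (insert a A)
  have "(\<Prod>i\<in>A. [:- w i, 1:]) \<noteq> 0" using insert.hyps(1) by simp
  then have "proots ([:- w a, 1:] * (\<Prod>i\<in>A. [:- w i, 1:])) = proots [:- w a, 1:] + proots (\<Prod>i\<in>A. [:- w i, 1:])"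
    by (intro proots_mult) auto
  moreover have "proots [:- w a, 1:] = {#w a#}" using proots_linear_factor[of "- w a"] by simp
  ultimately show ?case using insert by simp
qed simp

lemma count_image_mset_set: "finite A \<Longrightarrow> count (image_mset f (mset_set A)) y = card {x \<in> A. f x = y}"
proof (induction A rule: finite_induct)
  case (insert a A)
  have "{x \<in> insert a A. f x = y} = (if f a = y then insert a {x \<in> A. f x = y} else {x \<in> A. f x = y})" by auto
  then show ?case using insert by auto
qed simp

lemma sols_inj_on:
  assumes "finite S" "z \<in> sols S m"
  shows "inj_on z S"
proof (rule inj_onI)
  fix i j assume ij: "i \<in> S" "j \<in> S" "z i = z j"
  show "i = j"
  proof (rule ccontr)
    assume "i \<noteq> j"
    then have "diffprod S z i = 0" unfolding diffprod_def using ij assms(1) by (intro prod_zero) auto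
    then show False using assms(2) ij(1) by (auto simp: sols_def)
  qed
qed

text \<open>The classes are the fibres of lam over its values, which is the form in which coloured
  bijections are counted.\<close>

lemma prod_KK:
  "(\<Prod>K\<in>KK d lam. fact (card K) :: nat) = (\<Prod>c\<in>lam ` {1..d}. fact (card {i \<in> {1..d}. lam i = c}))"
proof -
  define h where "h c = {i \<in> {1..d}. lam i = c}" for c
  have "KK d lam = h ` lam ` {1..d}"
  proof -
    have "KK d lam = (\<lambda>x. {(i, j). i \<in> {1..d} \<and> j \<in> {1..d} \<and> lam i = lam j} `` {x}) ` {1..d}"
      by (auto simp: KK_def quotient_def)
    also have "\<dots> = (\<lambda>x. h (lam x)) ` {1..d}" by (rule image_cong[OF refl]) (auto simp: h_def)
    finally show ?thesis by (simp add: image_image)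
  qed
  moreover have "inj_on h (lam ` {1..d})"
  proof (rule inj_onI)
    fix c c' assume c: "c \<in> lam ` {1..d}" and eq: "h c = h c'"
    obtain i where i: "i \<in> {1..d}" "c = lam i" using c by blast
    have "i \<in> h c" using i by (simp add: h_def)
    moreover from this have "i \<in> h c'" by (simp only: eq)
    ultimately show "c = c'" by (simp add: h_def)
  qed
  ultimately show ?thesis by (simp only: prod.reindex o_def flip: h_def)
qed

text \<open>Double counting: the map \<Phi> sends a labelled configuration to its polynomial, and
  its fibre over f consists of the bijections from indices to fixed points of f that match the
  derivative with lam.\<close>

theorem card_sols_fiber:
  fixes lam :: "nat \<Rightarrow> complex"
  assumes d: "d \<ge> 2" and V: "lam \<in> V d" and fin: "finite (sols {1..d} (\<lambda>i. 1 / (lam i - 1)))"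
  shows "finite (fiber d (mset_class d lam))"
    "card (sols {1..d} (\<lambda>i. 1 / (lam i - 1))) = card (fiber d (mset_class d lam)) * (\<Prod>K\<in>KK d lam. fact (card K))"
proof -
  define I where "I = {1..d}"
  define m where "m i = 1 / (lam i - 1)" for i
  have mabs: "m = (\<lambda>i. 1 / (lam i - 1))" by (simp add: m_def fun_eq_iff)
  define X :: "complex poly" where "X = [:0, 1:]"
  define \<sigma> :: complex where "\<sigma> = (if d = 2 then 1 / 2 else 0)"
  define Q where "Q w = (\<Prod>i\<in>I. [:- w i, 1:])" for w :: "nat \<Rightarrow> complex"
  define \<Phi> where "\<Phi> z = Q (\<lambda>i. z i + \<sigma>) + X" for z
  define Fb where "Fb = fiber d (mset_class d lam)"
  have finI: "finite I" and cI: "card I = d" by (simp_all add: I_def)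
  have l1: "lam i \<noteq> 1" if "i \<in> I" for i using V that by (auto simp: V_def I_def)
  have cX: "coeff X n = (if n = 1 then 1 else 0)" for n by (cases n) (auto simp: X_def coeff_pCons split: nat.split)
  have pX: "pderiv X = 1" by (simp add: X_def pderiv_pCons)
  have MCQ: "p + X \<in> MC d \<longleftrightarrow> (\<forall>n>d. coeff p n = 0) \<and> coeff p d = 1 \<and> coeff p (d - 1) = - of_nat d * \<sigma>" for p
    unfolding MC_iff[OF d] using d by (auto simp: cX \<sigma>_def add_eq_0_iff2)
  have pc: "coeff (pCons 0 q) d = coeff q (d - 1)" for q :: "complex poly" using d by (simp add: coeff_pCons split: nat.split)
  have Q1: "coeff (Q w) d = 1" "\<And>n. n > d \<Longrightarrow> coeff (Q w) n = 0" "coeff (Q w) (d - 1) = - (\<Sum>i\<in>I. w i)" for w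
    using coeff_linear_prod[OF finI, of w] pc[of "Q w"] by (auto simp: Q_def cI coeff_eq_0)
  have dQ: "poly (pderiv (Q w)) (w i) = diffprod I w i" if "i \<in> I" for w i
    using poly_pderiv_prod_root[OF finI that, of w] by (simp add: Q_def diffprod_def)
  have shift: "diffprod I (\<lambda>i. z i + \<sigma>) i = diffprod I z i" for z i by (simp add: diffprod_def)
  have solD: "diffprod I z i = lam i - 1" if "z \<in> sols I m" "i \<in> I" for z i
    using that l1[OF that(2)] by (auto simp: sols_def m_def field_simps)
  have multi: "poly (pderiv (\<Phi> z)) (z i + \<sigma>) = lam i" if z: "z \<in> sols I m" and i: "i \<in> I" for z i
    using dQ[OF i, of "\<lambda>i. z i + \<sigma>"] solD[OF z i] by (simp add: \<Phi>_def pderiv_add pX shift)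
  have in_fiber: "\<Phi> z \<in> Fb" if z: "z \<in> sols I m" for z
  proof -
    have "(\<Sum>i\<in>I. z i + \<sigma>) = of_nat d * \<sigma>" using z by (simp add: sols_def sum.distrib cI)
    then have "\<Phi> z \<in> MC d" unfolding \<Phi>_def MCQ by (simp add: Q1 del: One_nat_def)
    moreover have "fixed_points (\<Phi> z) = image_mset (\<lambda>i. z i + \<sigma>) (mset_set I)"
      using proots_linear_prod[OF finI, of "\<lambda>i. z i + \<sigma>"] by (simp add: fixed_points_def \<Phi>_def X_def Q_def)
    then have "Phi_hat (\<Phi> z) = image_mset (\<lambda>i. poly (pderiv (\<Phi> z)) (z i + \<sigma>)) (mset_set I)"
      by (simp add: Phi_hat_def image_mset.compositionality o_def)
    moreover have "\<dots> = image_mset lam (mset_set I)"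
      by (rule image_mset_cong) (simp add: finI multi[OF z])
    ultimately show ?thesis by (simp add: Fb_def fiber_def mset_class_def I_def)
  qed
  define N where "N = (\<Prod>c\<in>lam ` I. fact (card {i \<in> I. lam i = c}) :: nat)"
  \<comment> \<open>Labellings of the roots of f - z compatible with lam, counted by
    \<open>card_colour_bijections_aux\<close>. The multiset equation between derivatives and lam
    supplies equal colour classes.\<close>
  have fibre: "card {z \<in> sols I m. \<Phi> z = f} = N" if f: "f \<in> Fb" for f
  proof -
    define p where "p = f - X"
    have fp: "f = p + X" by (simp add: p_def)
    have "p + X \<in> MC d" using f by (simp add: Fb_def fiber_def fp)
    then have p: "\<And>n. n > d \<Longrightarrow> coeff p n = 0" "coeff p d = 1" "coeff p (d - 1) = - of_nat d * \<sigma>" using MCQ by auto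
    have p0: "p \<noteq> 0" using p(2) by auto
    have "degree p \<le> d" by (rule degree_le) (use p(1) in blast)
    moreover have "d \<le> degree p" by (rule le_degree) (simp add: p(2))
    ultimately have degp: "degree p = d" by simp
    define \<mu> where "\<mu> = poly (pderiv f)"
    have \<mu>p: "\<mu> x = poly (pderiv p) x + 1" for x by (simp add: \<mu>_def fp pderiv_add pX)
    have img: "image_mset \<mu> (proots p) = image_mset lam (mset_set I)"
      using f by (simp add: Fb_def fiber_def Phi_hat_def fixed_points_def mset_class_def I_def \<mu>_def p_def X_def)
    define R where "R = {x. poly p x = 0}"
    have finR: "finite R" unfolding R_def by (rule poly_roots_finite[OF p0])
    have \<mu>R: "\<mu> x \<in> lam ` I" if "x \<in> R" for x
    proof -
      have "x \<in># proots p" using that p0 by (simp add: R_def)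
      then have "\<mu> x \<in># image_mset \<mu> (proots p)" by simp
      then show ?thesis unfolding img using finI by auto
    qed
    \<comment> \<open>A multiple root of f - z would give derivative 1 at that fixed point, but no
      \<open>lam i\<close> equals 1. Hence the multiset of fixed points is a set with d
      elements.\<close>
    have simple: "order x p = 1" if x: "x \<in> R" for x
    proof -
      have "\<mu> x \<noteq> 1" using \<mu>R[OF x] l1 by auto
      then have n: "poly (pderiv p) x \<noteq> 0" by (simp add: \<mu>p)
      have "order x p = Suc (order x (pderiv p))" using x by (intro order_pderiv p0) (simp add: R_def)
      moreover have "order x (pderiv p) = 0" using n by (simp add: order_root)
      ultimately show ?thesis by simp
    qed
    have pr: "proots p = mset_set R"
    proof (rule multiset_eqI)
      fix x
      show "count (proots p) x = count (mset_set R) x"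
      proof (cases "x \<in> R")
        case True
        then show ?thesis using simple finR p0 by simp
      next
        case False
        then have "order x p = 0" using p0 by (simp add: R_def order_root)
        then show ?thesis using False finR p0 by simp
      qed
    qed
    have pprod: "p = (\<Prod>x\<in>R. [:- x, 1:])"
    proof -
      have "smult (lead_coeff p) (\<Prod>x\<in>#proots p. [:- x, 1:]) = p" by (rule complex_poly_decompose_multiset)
      then show ?thesis by (simp add: degp p(2) pr prod_unfold_prod_mset)
    qed
    have cR: "card R = d" using coeff_linear_prod(1)[OF finR, of "\<lambda>x. x"] degp by (simp flip: pprod)
    have sumR: "(\<Sum>x\<in>R. x) = of_nat d * \<sigma>"
      using coeff_linear_prod(3)[OF finR, of "\<lambda>x. x"] pc[of p] p(3) cR by (simp flip: pprod)
    define H where "H = {h \<in> I \<rightarrow>\<^sub>E R. bij_betw h I R \<and> (\<forall>i\<in>I. \<mu> (h i) = lam i)}"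
    have eqc: "card {i \<in> I. lam i = c} = card {x \<in> R. \<mu> x = c}" for c
      using arg_cong[OF img, of "\<lambda>M. count M c"] by (simp add: pr count_image_mset_set[OF finI] count_image_mset_set[OF finR])
    have cH: "card H = N"
      unfolding H_def N_def by (rule card_colour_bijections_aux[OF finI finR _ order_refl eqc]) (simp add: finI)
    have QR: "Q h = p" if h: "bij_betw h I R" for h
      unfolding Q_def using prod.reindex_bij_betw[OF h, of "\<lambda>x. [:- x, 1:]"] pprod by simp
    have Qcong: "Q w = Q w'" if "\<And>i. i \<in> I \<Longrightarrow> w i = w' i" for w w' unfolding Q_def by (rule prod.cong) (simp_all add: that)
    have "bij_betw (\<lambda>z. \<lambda>i\<in>I. z i + \<sigma>) {z \<in> sols I m. \<Phi> z = f} H"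
    proof (rule bij_betw_byWitness[where f' = "\<lambda>h. \<lambda>i\<in>I. h i - \<sigma>"])
      show "\<forall>z\<in>{z \<in> sols I m. \<Phi> z = f}. (\<lambda>i\<in>I. (\<lambda>i\<in>I. z i + \<sigma>) i - \<sigma>) = z"
        by (auto simp: sols_def fun_eq_iff PiE_def extensional_def)
      show "\<forall>h\<in>H. (\<lambda>i\<in>I. (\<lambda>i\<in>I. h i - \<sigma>) i + \<sigma>) = h"
        by (auto simp: H_def fun_eq_iff PiE_def extensional_def)
      show "(\<lambda>z. \<lambda>i\<in>I. z i + \<sigma>) ` {z \<in> sols I m. \<Phi> z = f} \<subseteq> H"
      proof
        fix h assume "h \<in> (\<lambda>z. \<lambda>i\<in>I. z i + \<sigma>) ` {z \<in> sols I m. \<Phi> z = f}"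
        then obtain z where z: "z \<in> sols I m" "\<Phi> z = f" and h: "h = (\<lambda>i\<in>I. z i + \<sigma>)" by blast
        have hi: "h i = z i + \<sigma>" if "i \<in> I" for i using that by (simp add: h)
        have "p = Q (\<lambda>i. z i + \<sigma>)" using z(2) by (simp add: \<Phi>_def p_def flip: z(2))
        also have "\<dots> = Q h" by (rule Qcong) (simp add: hi)
        finally have pQ: "p = Q h" .
        have R: "h ` I = R" unfolding R_def pQ using finI by (auto simp: Q_def poly_prod)
        have "inj_on h I" using sols_inj_on[OF finI z(1)] by (auto simp: inj_on_def hi)
        then have "bij_betw h I R" using R by (simp add: bij_betw_def)
        moreover have "\<mu> (h i) = lam i" if "i \<in> I" for i
          using multi[OF z(1) that] by (simp add: \<mu>_def z(2) hi[OF that])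
        moreover have "h \<in> I \<rightarrow>\<^sub>E R" using R by (auto simp: h)
        ultimately show "h \<in> H" by (simp add: H_def)
      qed
      show "(\<lambda>h. \<lambda>i\<in>I. h i - \<sigma>) ` H \<subseteq> {z \<in> sols I m. \<Phi> z = f}"
      proof
        fix z assume "z \<in> (\<lambda>h. \<lambda>i\<in>I. h i - \<sigma>) ` H"
        then obtain h where h: "h \<in> H" and z: "z = (\<lambda>i\<in>I. h i - \<sigma>)" by blast
        have bij: "bij_betw h I R" and \<mu>h: "\<And>i. i \<in> I \<Longrightarrow> \<mu> (h i) = lam i" using h by (auto simp: H_def)
        have zi: "z i + \<sigma> = h i" if "i \<in> I" for i using that by (simp add: z)
        have Qz: "Q (\<lambda>i. z i + \<sigma>) = p" using Qcong[of "\<lambda>i. z i + \<sigma>" h] zi QR[OF bij] by simp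
        have "(\<Sum>i\<in>I. z i + \<sigma>) = (\<Sum>i\<in>I. h i)" by (rule sum.cong) (simp_all add: zi)
        also have "\<dots> = (\<Sum>x\<in>R. x)" by (rule sum.reindex_bij_betw[OF bij])
        finally have s: "(\<Sum>i\<in>I. z i) = 0" by (simp add: sum.distrib cI sumR)
        have "m i * diffprod I z i = 1" if i: "i \<in> I" for i
        proof -
          have "diffprod I z i = poly (pderiv p) (h i)"
            using dQ[OF i, of "\<lambda>i. z i + \<sigma>"] by (simp add: shift Qz zi[OF i])
          also have "\<dots> = lam i - 1" using \<mu>h[OF i] by (simp add: \<mu>p algebra_simps)
          finally show ?thesis using l1[OF i] by (simp add: m_def)
        qed
        moreover have "z \<in> I \<rightarrow>\<^sub>E UNIV" by (simp add: z)
        ultimately have "z \<in> sols I m" using s by (simp add: sols_def)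
        then show "z \<in> {z \<in> sols I m. \<Phi> z = f}" by (simp add: \<Phi>_def Qz fp)
      qed
    qed
    then show ?thesis using cH by (simp add: bij_betw_same_card)
  qed
  have Npos: "N > 0" unfolding N_def by (intro prod_pos) simp
  have finsol: "finite (sols I m)" using fin unfolding I_def mabs .
  have "Fb \<subseteq> \<Phi> ` sols I m"
  proof
    fix f assume "f \<in> Fb"
    then have "card {z \<in> sols I m. \<Phi> z = f} > 0" using fibre Npos by simp
    then have "{z \<in> sols I m. \<Phi> z = f} \<noteq> {}" by (metis card.empty less_irrefl)
    then show "f \<in> \<Phi> ` sols I m" by blast
  qed
  then have finF: "finite Fb" by (rule finite_subset) (rule finite_imageI[OF finsol])
  then show "finite (fiber d (mset_class d lam))" by (simp add: Fb_def)
  \<comment> \<open>The solutions are grouped by their polynomial; every group has the same size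
    \<open>N\<close>.\<close>
  have "card (sols I m) = (\<Sum>f\<in>Fb. card {z \<in> sols I m. \<Phi> z = f})"
    using sum.group[OF finsol finF, of \<Phi> "\<lambda>_. 1 :: nat"] in_fiber by (simp add: image_subset_iff)
  also have "\<dots> = card Fb * N" by (simp add: fibre)
  finally show "card (sols {1..d} (\<lambda>i. 1 / (lam i - 1))) = card (fiber d (mset_class d lam)) * (\<Prod>K\<in>KK d lam. fact (card K))"
    unfolding prod_KK by (simp add: N_def I_def mabs Fb_def)
qed

text \<open>The weights differ only by a common sign, which does not affect vanishing sums.\<close>

lemma II'_eq_zsp:
  assumes "\<And>i. m i = 1 / (lam i - 1)"
  shows "II' d lam = zsp {1..d} m"
proof -
  have "m i = - (1 / (1 - lam i))" for i unfolding assms by (metis minus_diff_eq minus_divide_right)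
  then have "(\<Sum>i\<in>I. m i) = - (\<Sum>i\<in>I. 1 / (1 - lam i))" for I by (simp add: sum_negf)
  then have "(\<Sum>i\<in>I. m i) = 0 \<longleftrightarrow> (\<Sum>i\<in>I. 1 / (1 - lam i)) = 0" for I by (simp only: neg_equal_0_iff_equal)
  then show ?thesis by (simp only: II'_def zsp_def)
qed

theorem corollary3:
  fixes d :: nat and lam :: "nat \<Rightarrow> complex"
  assumes "d \<ge> 2" and "lam \<in> V d"
  shows "finite (fiber d (mset_class d lam)) \<and>
    real (card (fiber d (mset_class d lam))) =
      (\<Sum>P\<in>II' d lam. (- (real d - 1)) ^ (card P - 1) * (\<Prod>I\<in>P. fact (card I - 1)))
      / (\<Prod>K\<in>KK d lam. fact (card K))"
proof -
  define m where "m = (\<lambda>i. 1 / (lam i - 1))"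
  define S where "S = {1..d}"
  have fin: "finite S" and cS: "card S = d" and c2: "card S \<ge> 2" using assms(1) by (simp_all add: S_def)
  have II: "II' d lam = zsp S m" unfolding S_def by (rule II'_eq_zsp) (simp add: m_def)
  have m0: "m i \<noteq> 0" if "i \<in> S" for i using assms(2) that by (auto simp: V_def m_def S_def)
  have "{S} \<in> II' d lam" using assms by (auto simp: II'_def V_def S_def partition_on_def)
  then have sm: "(\<Sum>i\<in>S. m i) = 0" unfolding II by (simp add: zsp_def)
  have i0: "1 \<in> S" using assms(1) by (simp add: S_def)
  \<comment> \<open>Finiteness is obtained separately, since cardinality alone would be 0 for an
    infinite solution set.\<close>
  have finsol: "finite (sols S m)" by (rule zsp_relation(2)[OF fin c2 m0 sm i0])
  note F = card_sols_fiber[OF assms finsol[unfolded S_def m_def]]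
  have "real (card (sols S m)) = (\<Sum>P\<in>zsp S m. hz (\<lambda>J. - real (card J)) 1 P * (\<Prod>J\<in>P. fact (card J - 1)))"
    using card_sols[OF fin c2 m0 sm] hz_sum_zero_sum_fact[OF fin] by simp
  also have "\<dots> = (\<Sum>P\<in>zsp S m. (- (real d - 1)) ^ (card P - 1) * (\<Prod>I\<in>P. fact (card I - 1)))"
  proof (rule sum.cong[OF refl])
    fix P assume "P \<in> zsp S m"
    then have p: "partition_on S P" by (simp add: zsp_def)
    have "P \<noteq> {}" using p i0 by (auto simp: partition_on_def)
    \<comment> \<open>Block sizes add up to d, so the base 1 minus this sum is -(d - 1), independent
      of the partition.\<close>
    moreover have "(\<Sum>J\<in>P. real (card J)) = real d"
      using sum_partition_on[OF fin p, of "\<lambda>_. 1 :: real"] cS by simp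
    ultimately have "hz (\<lambda>J. - real (card J)) 1 P = (- (real d - 1)) ^ (card P - 1)" by (simp add: hz_def sum_negf)
    then show "hz (\<lambda>J. - real (card J)) 1 P * (\<Prod>J\<in>P. fact (card J - 1)) = (- (real d - 1)) ^ (card P - 1) * (\<Prod>I\<in>P. fact (card I - 1))"
      by simp
  qed
  finally have "real (card (sols S m)) = (\<Sum>P\<in>II' d lam. (- (real d - 1)) ^ (card P - 1) * (\<Prod>I\<in>P. fact (card I - 1)))"
    unfolding II .
  moreover have "real (card (sols S m)) = real (card (fiber d (mset_class d lam))) * (\<Prod>K\<in>KK d lam. fact (card K))"
    using F(2) by (simp add: S_def m_def)
  moreover have "(\<Prod>K\<in>KK d lam. fact (card K) :: real) > 0" by (intro prod_pos) simp
  ultimately show ?thesis using F(1) by (simp add: field_simps)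
qed

end
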